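(* Let $n,N\ge1$ be integers. Let $W\in\mathcal M(\mathbb{R}^{Nn})$ and suppose the restriction of $W$ to $(\mathbb{Z}^n)^N$ belongs to the class $\mathcal B_N((\mathbb{Z}^n)^N)$. Let $q_j,r\in(0,\infty]$ and $s_0,s_j\in[0,\infty)$, $j=1,\dots,N$, satisfy $\sum_{j=1}^N1/q_j=1/r$, $s_0=n/2$, and $s_j=n/\min(2,q_j)$; put $\boldsymbol s=(s_0,s_1,\dots,s_N)$. Then for every $\sigma\in S^W_{0,0}(\boldsymbol s,\min(1,r);\mathbb{R}^n,N)$ the multilinear pseudo-differential operator $T_\sigma$ is bounded from $(L^2,\ell^{q_1})(\mathbb{R}^n)\times\dots\times(L^2,\ell^{q_N})(\mathbb{R}^n)$ to $(L^2,\ell^r)(\mathbb{R}^n)$.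
   Context: Operators. For a bounded measurable function $\sigma=\sigma(x,\xi_1,\dots,\xi_N)$ on $(\mathbb{R}^n)^{N+1}$ and $f_1,\dots,f_N\in\mathcal S(\mathbb{R}^n)$ (Schwartz functions), $$T_\sigma(f_1,\dots,f_N)(x)=\frac1{(2\pi)^{Nn}}\int_{(\mathbb{R}^n)^N}e^{ix\cdot(\xi_1+\dots+\xi_N)}\sigma(x,\xi_1,\dots,\xi_N)\prod_{j=1}^N\widehat{f_j}(\xi_j)\,d\xi_1\cdots d\xi_N,$$ with $\widehat f(\xi)=\int e^{-ix\cdot\xi}f(x)\,dx$. "$T_\sigma$ is bounded from $X_1\times\dots\times X_N$ to $Y$" means that there is a constant $A$ with $\|T_\sigma(f_1,\dots,f_N)\|_Y\le A\prod_{j=1}^N\|f_j\|_{X_j}$ for all $f_j\in\mathcal S\cap X_j$. Amalgam spaces. With $Q=[-1/2,1/2)^n$ and $0<p,q\le\infty$, $\|f\|_{(L^p,\ell^q)}=\big\{\sum_{\nu\in\mathbb{Z}^n}\big(\int_Q|f(x+\nu)|^p\,dx\big)^{q/p}\big\}^{1/q}$ (usual modifications if $p$ or $q$ is $\infty$), and $(L^p,\ell^q)$ is the set of measurable $f$ on $\mathbb{R}^n$ with finite quasi-norm. Uniformly local $L^2$. $\|f\|_{L^2_{ul}(\mathbb{R}^d)}=\sup_{\nu\in\mathbb{Z}^d}\big(\int_{[-1/2,1/2)^d}|f(x+\nu)|^2\,dx\big)^{1/2}$. Class $\mathcal M(\mathbb{R}^d)$. The set of continuous functions $F:\mathbb{R}^d\to(0,\infty)$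 for which there are constants $C,M>0$ with $F(\xi+\eta)\le CF(\xi)\langle\eta\rangle^M$ for all $\xi,\eta\in\mathbb{R}^d$, where $\langle\eta\rangle=(1+|\eta|^2)^{1/2}$. Class $\mathcal B_N$. $\mathcal B_N((\mathbb{Z}^n)^N)$ is the set of nonnegative functions $V$ on $(\mathbb{Z}^n)^N$ for which there is $c\in(0,\infty)$ such that $$\sum_{\nu_1,\dots,\nu_N\in\mathbb{Z}^n}V(\nu_1,\dots,\nu_N)A_0(\nu_1+\dots+\nu_N)\prod_{j=1}^NA_j(\nu_j)\le c\prod_{j=0}^N\|A_j\|_{\ell^2(\mathbb{Z}^n)}$$ for all nonnegative functions $A_0,\dots,A_N$ on $\mathbb{Z}^n$. Besov-type symbol class. Take $\phi\in\mathcal S(\mathbb{R}^n)$ with $\phi(y)=1$ for $|y|\le1$ and $\operatorname{supp}\phi\subset\{|y|\le2\}$; put $\psi(y)=\phi(y)-\phi(2y)$, $\psi_0=\phi$, $\psi_k=\psi(\cdot/2^k)$ for $k\ge1$ (a Littlewood–Paley partition of unity, $\sum_{k\ge0}\psi_k=1$). For $\boldsymbol k=(k_0,\dots,k_N)\in(\mathbb{N}_0)^{N+1}$, $\boldsymbol s=(s_0,\dots,s_N)\in[0,\infty)^{N+1}$ and $\sigma\in L^\infty((\mathbb{R}^n)^{N+1})$, put $\boldsymbol s\cdot\boldsymbol k=\sum_{j=0}^Ns_jk_j$ and $$\Delta_{\boldsymbol k}\sigma=\psi_{k_0}(D_x)\psi_{k_1}(D_{\xi_1})\cdots\psi_{k_N}(D_{\xi_N})\sigma,$$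 where $m(D)f=\mathcal F^{-1}[m\,\mathcal Ff]$ is the Fourier multiplier operator acting in the indicated variable. For $t\in(0,\infty]$, $S^W_{0,0}(\boldsymbol s,t;\mathbb{R}^n,N)$ is the set of $\sigma\in L^\infty((\mathbb{R}^n)^{N+1})$ with $$\|\sigma\|_{S^W_{0,0}(\boldsymbol s,t;\mathbb{R}^n,N)}=\Big\{\sum_{\boldsymbol k\in(\mathbb{N}_0)^{N+1}}(2^{\boldsymbol s\cdot\boldsymbol k})^t\big\|W(\xi_1,\dots,\xi_N)^{-1}\Delta_{\boldsymbol k}\sigma(x,\xi_1,\dots,\xi_N)\big\|_{L^2_{ul}((\mathbb{R}^n)^{N+1})}^t\Big\}^{1/t}<\infty$$ (usual modification when $t=\infty$). Up to equivalence of quasi-norms this does not depend on the choice of $\phi$. *)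

theory Defs
  imports "HOL-Analysis.Analysis" "HOL-Probability.Essential_Supremum"
begin

text \<open>
  The space of \<open>N\<close>-tuples of points of \<open>n\<close>-space is \<open>(real^'n)^'N\<close>, with \<open>n = CARD('n)\<close> and
  \<open>N = CARD('N)\<close>; a symbol is a function on \<open>(real^'n) \<times> (real^'n)^'N\<close>. Both are Euclidean
  spaces whose norm is the usual Euclidean one, so notions on a general Euclidean space are
  defined once, over a type of class \<open>euclidean_space\<close>. Measurability is Lebesgue measurability.
\<close>

definition epowr :: "ennreal \<Rightarrow> real \<Rightarrow> ennreal" where
  "epowr x a = (if x = \<infinity> then \<infinity> else ennreal (enn2real x powr a))"  \<comment> \<open>intended for \<open>a > 0\<close>\<close>

definition Lp_norm :: "'a measure \<Rightarrow> ennreal \<Rightarrow> ('a \<Rightarrow> complex) \<Rightarrow> ennreal" where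
  "Lp_norm M p f =
     (if p = \<infinity> then esssup M (\<lambda>x. ennreal (norm (f x)))
      else epowr (\<integral>\<^sup>+ x. ennreal (norm (f x) powr enn2real p) \<partial>M) (1 / enn2real p))"

definition lq_norm :: "'i set \<Rightarrow> ennreal \<Rightarrow> ('i \<Rightarrow> ennreal) \<Rightarrow> ennreal" where
  "lq_norm I q a =
     (if q = \<infinity> then (SUP i\<in>I. a i)
      else epowr (\<Sum>\<^sub>\<infinity>i\<in>I. epowr (a i) (enn2real q)) (1 / enn2real q))"

definition int_lattice :: "'a::euclidean_space set" where
  "int_lattice = {\<nu>. \<forall>b\<in>Basis. \<nu> \<bullet> b \<in> \<int>}"

definition unit_cube :: "'a::euclidean_space set" where
  "unit_cube = {x. \<forall>b\<in>Basis. - 1 / 2 \<le> x \<bullet> b \<and> x \<bullet> b < 1 / 2}"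

definition amalgam_norm :: "ennreal \<Rightarrow> ennreal \<Rightarrow> ('a::euclidean_space \<Rightarrow> complex) \<Rightarrow> ennreal" where
  "amalgam_norm p q f =
     lq_norm int_lattice q (\<lambda>\<nu>. Lp_norm (restrict_space lebesgue unit_cube) p (\<lambda>x. f (x + \<nu>)))"

definition amalgam :: "ennreal \<Rightarrow> ennreal \<Rightarrow> ('a::euclidean_space \<Rightarrow> complex) set" where
  "amalgam p q = {f \<in> borel_measurable lebesgue. amalgam_norm p q f < \<infinity>}"

definition L2ul_norm :: "('a::euclidean_space \<Rightarrow> complex) \<Rightarrow> ennreal" where
  "L2ul_norm f =
     (SUP \<nu>\<in>int_lattice. Lp_norm (restrict_space lebesgue unit_cube) 2 (\<lambda>x. f (x + \<nu>)))"

definition L_infty :: "('a::euclidean_space \<Rightarrow> complex) set" where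
  "L_infty = {f \<in> borel_measurable lebesgue. \<exists>C. AE x in lebesgue. norm (f x) \<le> C}"

definition japanese_bracket :: "'a::euclidean_space \<Rightarrow> real" where
  "japanese_bracket \<eta> = sqrt (1 + (norm \<eta>)\<^sup>2)"

definition class_M :: "('a::euclidean_space \<Rightarrow> real) set" where
  "class_M = {F. continuous_on UNIV F \<and> (\<forall>\<xi>. 0 < F \<xi>) \<and>
     (\<exists>C>0. \<exists>M>0. \<forall>\<xi> \<eta>. F (\<xi> + \<eta>) \<le> C * F \<xi> * japanese_bracket \<eta> powr M)}"

text \<open>
  A function on an integer lattice is represented by a function on the surrounding Euclidean
  space, of which only the values at lattice points are used. The left-hand side and the
  \<open>\<ell>\<^sup>2\<close> norms of the \<open>A\<^sub>j\<close> are allowed to be infinite.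
\<close>

definition class_B :: "(real^'n^'N \<Rightarrow> real) set" where
  "class_B = {V. (\<forall>\<nu>\<in>int_lattice. 0 \<le> V \<nu>) \<and>
     (\<exists>c::real. 0 < c \<and>
       (\<forall>(A0 :: real^'n \<Rightarrow> real) (A :: 'N \<Rightarrow> real^'n \<Rightarrow> real).
          (\<forall>\<mu>\<in>int_lattice. 0 \<le> A0 \<mu> \<and> (\<forall>j. 0 \<le> A j \<mu>)) \<longrightarrow>
          (\<Sum>\<^sub>\<infinity>\<nu>\<in>int_lattice. ennreal (V \<nu> * A0 (\<Sum>j\<in>UNIV. \<nu> $ j) * (\<Prod>j\<in>UNIV. A j (\<nu> $ j))))
            \<le> ennreal c * lq_norm int_lattice 2 (\<lambda>\<mu>. ennreal (A0 \<mu>))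
                * (\<Prod>j\<in>UNIV. lq_norm int_lattice 2 (\<lambda>\<mu>. ennreal (A j \<mu>)))))}"

definition pderiv_dir :: "'a::euclidean_space \<Rightarrow> ('a \<Rightarrow> complex) \<Rightarrow> 'a \<Rightarrow> complex" where
  "pderiv_dir b f = (\<lambda>x. frechet_derivative f (at x) b)"

definition iter_pderiv :: "'a::euclidean_space list \<Rightarrow> ('a \<Rightarrow> complex) \<Rightarrow> 'a \<Rightarrow> complex" where
  "iter_pderiv bs f = foldr pderiv_dir bs f"

definition schwartz :: "('a::euclidean_space \<Rightarrow> complex) set" where
  "schwartz = {f. \<forall>bs\<in>lists Basis.
     (\<forall>x. iter_pderiv bs f differentiable (at x)) \<and>
     (\<forall>m::nat. \<exists>C. \<forall>x. norm x ^ m * norm (iter_pderiv bs f x) \<le> C)}"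

definition fourier :: "('a::euclidean_space \<Rightarrow> complex) \<Rightarrow> 'a \<Rightarrow> complex" where
  "fourier f \<xi> = (LINT x|lebesgue. cis (- (x \<bullet> \<xi>)) * f x)"

definition inv_fourier :: "('a::euclidean_space \<Rightarrow> complex) \<Rightarrow> 'a \<Rightarrow> complex" where
  "inv_fourier f x =
     1 / of_real ((2 * pi) ^ DIM('a)) * (LINT \<xi>|lebesgue. cis (x \<bullet> \<xi>) * f \<xi>)"

text \<open>
  A tempered distribution is represented by its action on test functions; only values at
  Schwartz functions are meaningful. The Fourier transform, its inverse and multiplication by
  a smooth function are defined by transposition, for the bilinear pairing.
\<close>

type_synonym 'a distr = "('a \<Rightarrow> complex) \<Rightarrow> complex"

definition distr_of :: "('a::euclidean_space \<Rightarrow> complex) \<Rightarrow> 'a distr" where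
  "distr_of f = (\<lambda>h. LINT x|lebesgue. f x * h x)"

definition fourier_distr :: "'a::euclidean_space distr \<Rightarrow> 'a distr" where
  "fourier_distr u = (\<lambda>h. u (fourier h))"

definition inv_fourier_distr :: "'a::euclidean_space distr \<Rightarrow> 'a distr" where
  "inv_fourier_distr u = (\<lambda>h. u (inv_fourier h))"

definition mult_distr :: "('a::euclidean_space \<Rightarrow> complex) \<Rightarrow> 'a distr \<Rightarrow> 'a distr" where
  "mult_distr m u = (\<lambda>h. u (\<lambda>x. m x * h x))"

text \<open>
  For a Schwartz function \<open>m\<close> and \<open>f\<close> in \<open>L\<^sup>\<infinity>\<close>, the distribution below is given by an \<open>L\<^sup>\<infinity>\<close>
  function, unique up to null sets.
\<close>

definition fourier_multiplier ::
  "('a::euclidean_space \<Rightarrow> complex) \<Rightarrow> ('a \<Rightarrow> complex) \<Rightarrow> 'a \<Rightarrow> complex" where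
  "fourier_multiplier m f =
     (SOME g. g \<in> L_infty \<and>
        (\<forall>h\<in>schwartz.
           distr_of g h = inv_fourier_distr (mult_distr m (fourier_distr (distr_of f))) h))"

definition lp_cutoff :: "('a::euclidean_space \<Rightarrow> complex) \<Rightarrow> bool" where
  "lp_cutoff \<phi> \<longleftrightarrow>
     \<phi> \<in> schwartz \<and> (\<forall>y. norm y \<le> 1 \<longrightarrow> \<phi> y = 1) \<and> closure {y. \<phi> y \<noteq> 0} \<subseteq> {y. norm y \<le> 2}"

definition lp_piece :: "('a::euclidean_space \<Rightarrow> complex) \<Rightarrow> nat \<Rightarrow> 'a \<Rightarrow> complex" where
  "lp_piece \<phi> k =
     (let \<psi> = (\<lambda>y. \<phi> y - \<phi> (2 *\<^sub>R y)) in if k = 0 then \<phi> else (\<lambda>y. \<psi> (y /\<^sub>R 2 ^ k)))"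

text \<open>
  The composition of the multiplier operators in the separate variables is the multiplier
  operator, in all variables jointly, of the product of their symbols.
\<close>

definition Delta :: "(real^'n \<Rightarrow> complex) \<Rightarrow> nat \<Rightarrow> ('N \<Rightarrow> nat) \<Rightarrow>
    ((real^'n) \<times> (real^'n^'N) \<Rightarrow> complex) \<Rightarrow> (real^'n) \<times> (real^'n^'N) \<Rightarrow> complex" where
  "Delta \<phi> k0 k =
     fourier_multiplier (\<lambda>(y, \<eta>). lp_piece \<phi> k0 y * (\<Prod>j\<in>UNIV. lp_piece \<phi> (k j) (\<eta> $ j)))"

definition symbol_norm :: "(real^'n \<Rightarrow> complex) \<Rightarrow> (real^'n^'N \<Rightarrow> real) \<Rightarrow> real \<Rightarrow> ('N \<Rightarrow> real) \<Rightarrow>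
    ennreal \<Rightarrow> ((real^'n) \<times> (real^'n^'N) \<Rightarrow> complex) \<Rightarrow> ennreal" where
  "symbol_norm \<phi> W s0 s t \<sigma> =
     lq_norm (UNIV :: (nat \<times> ('N \<Rightarrow> nat)) set) t
       (\<lambda>(k0, k). ennreal (2 powr (s0 * real k0 + (\<Sum>j\<in>UNIV. s j * real (k j)))) *
          L2ul_norm (\<lambda>(x, \<xi>). of_real (inverse (W \<xi>)) * Delta \<phi> k0 k \<sigma> (x, \<xi>)))"

definition symbol_class :: "(real^'n \<Rightarrow> complex) \<Rightarrow> (real^'n^'N \<Rightarrow> real) \<Rightarrow> real \<Rightarrow> ('N \<Rightarrow> real) \<Rightarrow>
    ennreal \<Rightarrow> ((real^'n) \<times> (real^'n^'N) \<Rightarrow> complex) set" where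
  "symbol_class \<phi> W s0 s t = {\<sigma> \<in> L_infty. symbol_norm \<phi> W s0 s t \<sigma> < \<infinity>}"

definition T_op :: "((real^'n) \<times> (real^'n^'N) \<Rightarrow> complex) \<Rightarrow>
    ('N \<Rightarrow> real^'n \<Rightarrow> complex) \<Rightarrow> real^'n \<Rightarrow> complex" where
  "T_op \<sigma> f x =
     1 / of_real ((2 * pi) ^ (CARD('N) * CARD('n))) *
     (LINT \<xi>|lebesgue. cis (x \<bullet> (\<Sum>j\<in>UNIV. \<xi> $ j)) * \<sigma> (x, \<xi>) * (\<Prod>j\<in>UNIV. fourier (f j) (\<xi> $ j)))"

definition bounded_on_amalgams :: "(('N::finite \<Rightarrow> 'a::euclidean_space \<Rightarrow> complex) \<Rightarrow> 'a \<Rightarrow> complex) \<Rightarrow>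
    ('N \<Rightarrow> ennreal) \<Rightarrow> ('N \<Rightarrow> ennreal) \<Rightarrow> ennreal \<Rightarrow> ennreal \<Rightarrow> bool" where
  "bounded_on_amalgams T p q p' q' \<longleftrightarrow>
     (\<exists>A::real. \<forall>f. (\<forall>j. f j \<in> schwartz \<inter> amalgam (p j) (q j)) \<longrightarrow>
        T f \<in> amalgam p' q' \<and>
        amalgam_norm p' q' (T f) \<le> ennreal A * (\<Prod>j\<in>UNIV. amalgam_norm (p j) (q j) (f j)))"

end

theory Submission
  imports Defs "HOL-Probability.Probability"
begin

text \<open>
  The piece \<open>u = Delta \<phi> k0 k \<sigma>\<close> is a convolution with an integrable kernel, and it is reproduced,
  \<open>u = K * u\<close>, by the kernel \<open>K\<close> that is the inverse Fourier transform of the dilated cutoffs at the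
  scales \<open>2 ^ (k0 + 1)\<close> and \<open>2 ^ (k j + 1)\<close>. Pair \<open>T_op u f\<close> with a function \<open>h\<close> supported in the cell
  of \<open>\<mu>\<close> and move \<open>K\<close> to the test function. In the frequency variables \<open>K\<close> then turns into the
  compactly supported factors \<open>\<phi> ((y - x) / 2 ^ (k j + 1))\<close>, so that \<open>f j\<close> may be replaced by its
  restriction to a ball of radius about \<open>2 ^ k j\<close> around \<open>\<mu>\<close>. Decomposing phase space into unit
  cells, using Cauchy--Schwarz on each cell and the class \<open>B\<close> inequality for the sum over the cells
  bounds the pairing by the uniformly local norm of \<open>u / W\<close>; the lattice sums of the two Fourier
  transforms that occur are controlled by a sampling inequality and Plancherel, and the kernel in
  \<open>x\<close> costs \<open>2 ^ (k0 n / 2)\<close>. Taking \<open>\<ell>\<^sup>r\<close> norms over \<open>\<mu>\<close>, Hoelder's inequality and the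
  \<open>min 1 r\<close>-triangle inequality finish the proof: an average over balls of radius \<open>2 ^ k j\<close> costs
  \<open>2 ^ (k j n / min 2 (q j))\<close> in the amalgam norm.
\<close>

section \<open>Lebesgue measure, lattice cells and a polynomial weight\<close>

text \<open>Two facts force the use of pairings. A symbol that is merely bounded is the limit of its
  Littlewood-Paley sums only weakly, against integrable functions; and
  \<open>fourier_multiplier\<close> selects its value by choice, so it is known only up to null sets
  and is replaced by a convolution with a bounded Borel representative. In the end \<open>h\<close>
  is the conjugate of the operator's own output on the cell, so the pairing is a squared norm and
  one factor cancels. The kernel scales are paid for in different ways. In \<open>x\<close> an L2
  norm of the dilated kernel enters, which grows like \<open>2 ^ (k0 n / 2)\<close>; in the
  frequencies only L1 norms enter, which are invariant under dilation, and their scale is felt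
  solely through the radius of the balls. The class B inequality reads one sequence at the sum of
  the lattice frequencies, whereas inside a cell the actual sum moves by a bounded amount. The
  factor carrying \<open>x\<close> is therefore bounded by a supremum over nearby frequencies, and
  the sampling inequality has to tolerate nodes that are perturbed arbitrarily within a fixed
  distance of the lattice.\<close>

lemma nn_integral_lborel_affine:
  fixes f :: "'a::euclidean_space \<Rightarrow> ennreal"
  assumes [measurable]: "f \<in> borel_measurable borel" and c: "c \<noteq> 0"
  shows "(\<integral>\<^sup>+x. f x \<partial>lborel) = ennreal (\<bar>c\<bar> ^ DIM('a)) * (\<integral>\<^sup>+x. f (t + c *\<^sub>R x) \<partial>lborel)"
  by (subst lborel_affine[OF c, of t])
     (simp add: nn_integral_density nn_integral_distr nn_integral_cmult)

lemma integrable_lborel_affine: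
  fixes f :: "'a::euclidean_space \<Rightarrow> 'b::{banach, second_countable_topology}"
  assumes f: "integrable lborel f"
  shows "c \<noteq> 0 \<Longrightarrow> integrable lborel (\<lambda>x. f (t + c *\<^sub>R x))"
  using f f[THEN borel_measurable_integrable] unfolding integrable_iff_bounded
  by (subst (asm) nn_integral_lborel_affine[where c=c and t=t]) (auto simp: ennreal_mult_less_top)

lemma integrable_lborel_affine_iff:
  fixes f :: "'a::euclidean_space \<Rightarrow> 'b::{banach, second_countable_topology}"
  shows "c \<noteq> 0 \<Longrightarrow> integrable lborel (\<lambda>x. f (t + c *\<^sub>R x)) \<longleftrightarrow> integrable lborel f"
  using integrable_lborel_affine[of f c t]
    integrable_lborel_affine[of "\<lambda>x. f (t + c *\<^sub>R x)" "1/c" "- (t /\<^sub>R c)"]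
  by (auto simp: algebra_simps divide_inverse)

lemma integral_lborel_affine:
  fixes f :: "'a::euclidean_space \<Rightarrow> 'b::{banach, second_countable_topology}"
  assumes c: "c \<noteq> 0"
  shows "(\<integral>x. f x \<partial>lborel) = \<bar>c\<bar> ^ DIM('a) *\<^sub>R (\<integral>x. f (t + c *\<^sub>R x) \<partial>lborel)"
proof cases
  assume f[measurable]: "integrable lborel f"
  then have [measurable]: "f \<in> borel_measurable borel" by auto
  show ?thesis
    using c f by (subst lborel_affine[OF c, of t]) (simp add: integral_density integral_distr)
next
  assume "\<not> integrable lborel f"
  with c show ?thesis
    by (simp add: integrable_lborel_affine_iff not_integrable_integral_eq)
qed

lemma nn_integral_lborel_shift:
  fixes f :: "'a::euclidean_space \<Rightarrow> ennreal"
  assumes [measurable]: "f \<in> borel_measurable borel"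
  shows "(\<integral>\<^sup>+x. f (x + t) \<partial>lborel) = (\<integral>\<^sup>+x. f x \<partial>lborel)"
  using nn_integral_lborel_affine[OF assms, of 1 t] by (simp add: add.commute)

lemma nn_integral_lborel_reflect:
  fixes f :: "'a::euclidean_space \<Rightarrow> ennreal"
  assumes [measurable]: "f \<in> borel_measurable borel"
  shows "(\<integral>\<^sup>+x. f (t - x) \<partial>lborel) = (\<integral>\<^sup>+x. f x \<partial>lborel)"
  using nn_integral_lborel_affine[OF assms, of "-1" t] by simp

lemma integrable_lborel_shift:
  fixes f :: "'a::euclidean_space \<Rightarrow> 'b::{banach, second_countable_topology}"
  shows "integrable lborel (\<lambda>x. f (x + t)) \<longleftrightarrow> integrable lborel f"
  using integrable_lborel_affine_iff[of 1 f t] by (simp add: add.commute)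

lemma integrable_lborel_reflect:
  fixes f :: "'a::euclidean_space \<Rightarrow> 'b::{banach, second_countable_topology}"
  shows "integrable lborel (\<lambda>x. f (t - x)) \<longleftrightarrow> integrable lborel f"
  using integrable_lborel_affine_iff[of "-1" f t] by simp

lemma integral_lborel_shift:
  fixes f :: "'a::euclidean_space \<Rightarrow> 'b::{banach, second_countable_topology}"
  shows "(\<integral>x. f (x + t) \<partial>lborel) = (\<integral>x. f x \<partial>lborel)"
  using integral_lborel_affine[of 1 f t] by (simp add: add.commute)

lemma integral_lborel_reflect:
  fixes f :: "'a::euclidean_space \<Rightarrow> 'b::{banach, second_countable_topology}"
  shows "(\<integral>x. f (t - x) \<partial>lborel) = (\<integral>x. f x \<partial>lborel)"
  using integral_lborel_affine[of "-1" f t] by simp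

section \<open>Lebesgue measure on tuples of points as a product measure\<close>

lemma prod_Basis_vec:
  fixes g :: "'a::euclidean_space ^ 'N::finite \<Rightarrow> 'c::comm_monoid_mult"
  shows "(\<Prod>b\<in>Basis. g b) = (\<Prod>i\<in>UNIV. \<Prod>b\<in>Basis. g (axis i b))"
proof -
  have "(\<Prod>b\<in>Basis. g b) = (\<Prod>(i,b)\<in>UNIV \<times> Basis. g (axis i b))"
  proof (rule prod.reindex_bij_betw[symmetric, where h="\<lambda>(i,b). axis i b", unfolded case_prod_unfold, THEN trans])
    show "bij_betw (\<lambda>p. axis (fst p) (snd p)) (UNIV \<times> Basis) (Basis :: ('a^'N) set)"
      unfolding bij_betw_def Basis_vec_def
      by (auto simp: inj_on_def axis_eq_axis image_iff nonzero_Basis)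
  qed (simp add: case_prod_unfold)
  then show ?thesis by (simp add: prod.cartesian_product)
qed

lemma vec_nth_borel_measurable [measurable]:
  "(\<lambda>x :: 'a::euclidean_space ^ 'N::finite. x $ i) \<in> borel_measurable borel"
  by (intro borel_measurable_continuous_onI continuous_intros)

lemma measurable_vec_lambda_PiM:
  "vec_lambda \<in> (\<Pi>\<^sub>M i\<in>(UNIV::'N::finite set). (lborel :: 'a::euclidean_space measure)) \<rightarrow>\<^sub>M borel"
proof (rule borel_measurable_euclidean_space[THEN iffD2], intro ballI)
  fix b :: "'a^'N" assume "b \<in> Basis"
  then obtain j c where b: "b = axis j c" by (auto simp: Basis_vec_def)
  show "(\<lambda>f. vec_lambda f \<bullet> b) \<in> borel_measurable (\<Pi>\<^sub>M i\<in>(UNIV::'N set). (lborel :: 'a measure))"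
    unfolding b inner_axis by simp
qed

text \<open>It suffices to compare the measures of boxes. The preimage of a box under
  \<open>vec_lambda\<close> is a product of component boxes, so both sides are the same double
  product of edge lengths. All factorizations of integrals over the \<open>N\<close> frequency
  variables rest on this identity.\<close>

lemma lborel_vec_eq:
  "(lborel :: ('a::euclidean_space ^ 'N::finite) measure) = distr (\<Pi>\<^sub>M i\<in>UNIV. lborel) borel vec_lambda"
proof (rule lborel_eqI)
  note measurable_vec_lambda_PiM[measurable]
  interpret finite_product_sigma_finite "\<lambda>_::'N. lborel :: 'a measure" UNIV
    by standard auto
  fix l u :: "'a^'N" assume le: "\<And>b. b \<in> Basis \<Longrightarrow> l \<bullet> b \<le> u \<bullet> b"
  have le': "l $ j \<bullet> b \<le> u $ j \<bullet> b" if "b \<in> Basis" for j b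
    using le[of "axis j b"] that by (auto simp: inner_axis Basis_vec_def)
  have "vec_lambda -` box l u \<inter> space (\<Pi>\<^sub>M i\<in>(UNIV::'N set). (lborel :: 'a measure)) =
     PiE UNIV (\<lambda>j. box (l $ j) (u $ j))"
    by (auto simp: box_def Basis_vec_def inner_axis space_PiM PiE_def Pi_def extensional_def)
  then have "emeasure (distr (\<Pi>\<^sub>M i\<in>UNIV. lborel) borel vec_lambda) (box l u) =
     (\<Prod>j\<in>UNIV. emeasure lborel (box (l $ j) (u $ j)))"
    by (simp add: emeasure_distr measure_times)
  also have "\<dots> = (\<Prod>j\<in>UNIV. ennreal (\<Prod>b\<in>Basis. (u $ j - l $ j) \<bullet> b))"
    using le' by (simp add: emeasure_lborel_box_eq)
  also have "\<dots> = ennreal (\<Prod>j\<in>UNIV. \<Prod>b\<in>Basis. (u $ j - l $ j) \<bullet> b)"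
    using le' by (intro prod_ennreal) (auto intro!: prod_nonneg simp: inner_diff_left)
  also have "\<dots> = (\<Prod>b\<in>Basis. (u - l) \<bullet> b)"
    by (simp add: prod_Basis_vec inner_axis)
  finally show "emeasure (distr (\<Pi>\<^sub>M i\<in>UNIV. lborel) borel vec_lambda) (box l u) =
     (\<Prod>b\<in>Basis. (u - l) \<bullet> b)" .
qed simp

lemma nn_integral_vec_prod:
  fixes f :: "'N::finite \<Rightarrow> 'a::euclidean_space \<Rightarrow> ennreal"
  assumes [measurable]: "\<And>i. f i \<in> borel_measurable borel"
  shows "(\<integral>\<^sup>+x. (\<Prod>i\<in>UNIV. f i (x $ i)) \<partial>lborel) = (\<Prod>i\<in>UNIV. \<integral>\<^sup>+x. f i x \<partial>lborel)"
proof -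
  note measurable_vec_lambda_PiM[measurable]
  interpret product_sigma_finite "\<lambda>_::'N. lborel :: 'a measure"
    by standard
  show ?thesis
    by (subst lborel_vec_eq) (simp add: nn_integral_distr product_nn_integral_prod)
qed

lemma integrable_vec_prod:
  fixes f :: "'N::finite \<Rightarrow> 'a::euclidean_space \<Rightarrow> 'b::{real_normed_field,banach,second_countable_topology}"
  assumes "\<And>i. integrable lborel (f i)"
  shows "integrable lborel (\<lambda>x. \<Prod>i\<in>UNIV. f i (x $ i))"
proof -
  note measurable_vec_lambda_PiM[measurable]
  have [measurable]: "f i \<in> borel_measurable borel" for i
    using assms[of i] by auto
  interpret product_sigma_finite "\<lambda>_::'N. lborel :: 'a measure"
    by standard
  show ?thesis
    by (subst lborel_vec_eq) (auto simp: integrable_distr_eq intro!: product_integrable_prod assms)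
qed

lemma integral_vec_prod:
  fixes f :: "'N::finite \<Rightarrow> 'a::euclidean_space \<Rightarrow> 'b::{real_normed_field,banach,second_countable_topology}"
  assumes "\<And>i. integrable lborel (f i)"
  shows "(\<integral>x. (\<Prod>i\<in>UNIV. f i (x $ i)) \<partial>lborel) = (\<Prod>i\<in>UNIV. \<integral>x. f i x \<partial>lborel)"
proof -
  note measurable_vec_lambda_PiM[measurable]
  have [measurable]: "f i \<in> borel_measurable borel" for i
    using assms[of i] by auto
  interpret product_sigma_finite "\<lambda>_::'N. lborel :: 'a measure"
    by standard
  show ?thesis
    by (subst lborel_vec_eq) (simp add: integral_distr product_integral_prod assms)
qed

section \<open>Unit cells around the points of the integer lattice\<close>

lemma unit_cube_borel [measurable]: "(unit_cube :: 'a::euclidean_space set) \<in> sets borel"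
  unfolding unit_cube_def by measurable

lemma norm_unit_cube_le:
  fixes x :: "'a::euclidean_space"
  assumes "x \<in> unit_cube" shows "norm x \<le> DIM('a)"
proof -
  have "norm x \<le> (\<Sum>b\<in>Basis. \<bar>x \<bullet> b\<bar>)" by (rule norm_le_l1)
  also have "\<dots> \<le> (\<Sum>b\<in>(Basis::'a set). 1)"
    using assms by (intro sum_mono) (fastforce simp: unit_cube_def)
  finally show ?thesis by simp
qed

lemma emeasure_unit_cube: "emeasure lborel (unit_cube :: 'a::euclidean_space set) = 1"
proof -
  have *: "indicator unit_cube x = (\<Prod>b\<in>Basis. indicator {-1/2..<1/2} (x \<bullet> b) :: ennreal)" for x :: 'a
    by (auto simp: indicator_def unit_cube_def)
  have "(\<integral>\<^sup>+x. indicator unit_cube x \<partial>(lborel :: 'a measure)) =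
      (\<Prod>b\<in>(Basis::'a set). \<integral>\<^sup>+x. indicator {-1/2..<1/2::real} x \<partial>lborel)"
    unfolding * by (rule nn_integral_lborel_prod) auto
  also have "\<dots> = 1" by simp
  finally show ?thesis by simp
qed

lemma int_lattice_add: "x \<in> int_lattice \<Longrightarrow> y \<in> int_lattice \<Longrightarrow> x + y \<in> int_lattice"
  and int_lattice_diff: "x \<in> int_lattice \<Longrightarrow> y \<in> int_lattice \<Longrightarrow> x - y \<in> int_lattice"
  and int_lattice_0: "0 \<in> int_lattice"
  by (auto simp: int_lattice_def inner_simps)

lemma int_lattice_sum: "(\<And>i. i \<in> I \<Longrightarrow> f i \<in> int_lattice) \<Longrightarrow> (\<Sum>i\<in>I. f i) \<in> int_lattice"
  by (induction I rule: infinite_finite_induct) (auto simp: int_lattice_0 int_lattice_add)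

lemma ex1_int_lattice_unit_cube:
  fixes x :: "'a::euclidean_space"
  shows "\<exists>!\<nu>. \<nu> \<in> int_lattice \<and> x - \<nu> \<in> unit_cube"
proof (rule ex1I)
  \<comment> \<open>Coordinates are rounded to the nearest integer with ties going up, the rounding
    that matches the half-open cube.\<close>
  let ?\<nu> = "\<Sum>b\<in>Basis. real_of_int \<lfloor>x \<bullet> b + 1/2\<rfloor> *\<^sub>R b"
  have *: "?\<nu> \<bullet> b = real_of_int \<lfloor>x \<bullet> b + 1/2\<rfloor>" if "b \<in> Basis" for b
    using that by simp
  show "?\<nu> \<in> int_lattice \<and> x - ?\<nu> \<in> unit_cube"
    unfolding int_lattice_def unit_cube_def mem_Collect_eq
    using * by (auto simp: inner_diff_left) linarith+
  fix \<nu> assume \<nu>: "\<nu> \<in> int_lattice \<and> x - \<nu> \<in> unit_cube"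
  show "\<nu> = ?\<nu>"
  proof (rule euclidean_eqI)
    fix b :: 'a assume b: "b \<in> Basis"
    with \<nu> obtain k where k: "\<nu> \<bullet> b = of_int k" by (auto simp: int_lattice_def Ints_def)
    have "- 1/2 \<le> x \<bullet> b - of_int k" "x \<bullet> b - of_int k < 1/2"
      using \<nu> b k by (auto simp: unit_cube_def inner_diff_left)
    then have "\<lfloor>x \<bullet> b + 1/2\<rfloor> = k" by linarith
    then show "\<nu> \<bullet> b = ?\<nu> \<bullet> b" using b k * by simp
  qed
qed

lemma countable_int_lattice: "countable (int_lattice :: 'a::euclidean_space set)"
proof -
  have "countable (PiE (Basis::'a set) (\<lambda>_. \<int> :: real set))"
    by (intro countable_PiE) (auto simp: Ints_def)
  then have "countable ((\<lambda>f. \<Sum>b\<in>Basis. f b *\<^sub>R b) ` PiE (Basis::'a set) (\<lambda>_. \<int> :: real set))"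
    by (rule countable_image)
  moreover have "x \<in> (\<lambda>f. \<Sum>b\<in>Basis. f b *\<^sub>R b) ` PiE (Basis::'a set) (\<lambda>_. \<int>)" if "x \<in> int_lattice" for x :: 'a
    using that by (intro image_eqI[where x="restrict (\<lambda>b. x \<bullet> b) Basis"])
      (auto simp: euclidean_representation int_lattice_def)
  ultimately show ?thesis by (meson countable_subset subsetI)
qed

text \<open>Every point lies in exactly one cell, so the cell indicators sum to 1 at each point.
  Tonelli for the counting measure and a translation of each cell to the origin do the rest.\<close>

lemma nn_integral_lattice_cells:
  fixes f :: "'a::euclidean_space \<Rightarrow> ennreal"
  assumes [measurable]: "f \<in> borel_measurable borel"
  shows "(\<integral>\<^sup>+x. f x \<partial>lborel) =
    (\<integral>\<^sup>+\<nu>. (\<integral>\<^sup>+x. f (x + \<nu>) * indicator unit_cube x \<partial>lborel) \<partial>count_space int_lattice)"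
proof -
  have *: "f x = (\<integral>\<^sup>+\<nu>. f x * indicator unit_cube (x - \<nu>) \<partial>count_space int_lattice)" for x
  proof -
    obtain \<nu> where \<nu>: "\<nu> \<in> int_lattice" "x - \<nu> \<in> unit_cube"
      "\<And>\<nu>'. \<nu>' \<in> int_lattice \<Longrightarrow> x - \<nu>' \<in> unit_cube \<Longrightarrow> \<nu>' = \<nu>"
      using ex1_int_lattice_unit_cube[of x] by blast
    have "(\<integral>\<^sup>+\<nu>. f x * indicator unit_cube (x - \<nu>) \<partial>count_space int_lattice) =
      (\<integral>\<^sup>+\<nu>'. f x * indicator {\<nu>} \<nu>' \<partial>count_space int_lattice)"
    proof (intro nn_integral_cong)
      fix \<nu>' assume "\<nu>' \<in> space (count_space (int_lattice :: 'a set))"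
      then have "x - \<nu>' \<in> unit_cube \<longleftrightarrow> \<nu>' = \<nu>" using \<nu>(2) \<nu>(3)[of \<nu>'] by auto
      then show "f x * indicator unit_cube (x - \<nu>') = f x * indicator {\<nu>} \<nu>'"
        by (simp add: indicator_def)
    qed
    also have "\<dots> = f x" using \<nu>(1) by (subst nn_integral_cmult_indicator) auto
    finally show ?thesis by simp
  qed
  have "(\<integral>\<^sup>+x. f x \<partial>lborel) = (\<integral>\<^sup>+x. (\<integral>\<^sup>+\<nu>. f x * indicator unit_cube (x - \<nu>) \<partial>count_space int_lattice) \<partial>lborel)"
    by (intro nn_integral_cong) (rule *)
  also have "\<dots> = (\<integral>\<^sup>+\<nu>. (\<integral>\<^sup>+x. f x * indicator unit_cube (x - \<nu>) \<partial>lborel) \<partial>count_space int_lattice)"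
    by (rule nn_integral_count_space_nn_integral[OF countable_int_lattice]) measurable
  also have "\<dots> = (\<integral>\<^sup>+\<nu>. (\<integral>\<^sup>+x. f (x + \<nu>) * indicator unit_cube x \<partial>lborel) \<partial>count_space int_lattice)"
  proof (rule nn_integral_cong)
    fix \<nu> :: 'a
    show "(\<integral>\<^sup>+x. f x * indicator unit_cube (x - \<nu>) \<partial>lborel) = (\<integral>\<^sup>+x. f (x + \<nu>) * indicator unit_cube x \<partial>lborel)"
      using nn_integral_lborel_shift[of "\<lambda>x. f x * indicator unit_cube (x - \<nu>)" \<nu>] by simp
  qed
  finally show ?thesis .
qed

section \<open>A polynomial weight whose lattice translates have uniformly bounded sums\<close>

text \<open>The exponent equals the dimension, so the weight decays like the norm to the power -2
  DIM: fast enough for integrals over the space and sums over the lattice. At the same time a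
  bounded shift changes it only by a bounded factor.\<close>

definition jw :: "'a::euclidean_space \<Rightarrow> real" where
  "jw x = inverse ((1 + (norm x)\<^sup>2) ^ DIM('a))"

lemma jw_pos: "0 < jw x"
  unfolding jw_def by (intro positive_imp_inverse_positive zero_less_power add_pos_nonneg) auto

lemma jw_nonneg: "0 \<le> jw x"
  using jw_pos[of x] by simp

lemma jw_le_1: "jw x \<le> 1"
  unfolding jw_def by (intro inverse_le_1_iff[THEN iffD2] disjI2 one_le_power) auto

lemma jw_measurable [measurable]: "jw \<in> borel_measurable borel"
  unfolding jw_def by measurable

lemma jw_minus: "jw (- x) = jw x" by (simp add: jw_def)

lemma peetre:
  fixes a b :: "'a::real_normed_vector"
  shows "1 + (norm (a + b))\<^sup>2 \<le> 2 * (1 + (norm a)\<^sup>2) * (1 + (norm b)\<^sup>2)"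
proof -
  have "(norm (a + b))\<^sup>2 \<le> (norm a + norm b)\<^sup>2" by (intro power_mono norm_triangle_ineq) auto
  also have "\<dots> \<le> 2 * (norm a)\<^sup>2 + 2 * (norm b)\<^sup>2"
    using zero_le_power2[of "norm a - norm b"] by (simp add: power2_eq_square algebra_simps)
  finally have "(norm (a + b))\<^sup>2 \<le> 2 * (norm a)\<^sup>2 + 2 * (norm b)\<^sup>2" .
  moreover have "0 \<le> (norm a)\<^sup>2 * (norm b)\<^sup>2" by simp
  ultimately show ?thesis unfolding distrib_left distrib_right mult_1_left mult_1_right mult.assoc by linarith
qed

text \<open>Peetre's inequality in the form in which the weight is used: moving the argument by at
  most \<rho> costs a constant. It lets a point of a cell and the lattice point of that cell replace
  each other.\<close>

lemma jw_peetre: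
  fixes a x :: "'a::euclidean_space"
  assumes "norm x \<le> \<rho>"
  shows "jw a \<le> (2 * (1 + \<rho>\<^sup>2)) ^ DIM('a) * jw (a + x)"
proof -
  have "1 + (norm (a + x))\<^sup>2 \<le> 2 * (1 + (norm a)\<^sup>2) * (1 + (norm x)\<^sup>2)" by (rule peetre)
  also have "\<dots> \<le> 2 * (1 + (norm a)\<^sup>2) * (1 + \<rho>\<^sup>2)"
    using assms by (intro mult_left_mono add_left_mono power_mono) auto
  finally have "(1 + (norm (a + x))\<^sup>2) ^ DIM('a) \<le> (2 * (1 + \<rho>\<^sup>2)) ^ DIM('a) * (1 + (norm a)\<^sup>2) ^ DIM('a)"
    unfolding power_mult_distrib[symmetric] by (intro power_mono) (auto simp: algebra_simps)
  moreover have "0 < 1 + (norm a)\<^sup>2" "0 < 1 + (norm (a+x))\<^sup>2" by (auto intro: add_pos_nonneg)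
  ultimately show ?thesis unfolding jw_def by (simp add: field_simps)
qed

lemma nn_integral_inverse_1_plus_square: "(\<integral>\<^sup>+x. ennreal (inverse (1 + x\<^sup>2)) \<partial>lborel) < \<infinity>" for x :: real
proof -
  have "set_integrable lborel (einterval (-\<infinity>) \<infinity>) (\<lambda>x::real. inverse (1 + x\<^sup>2))"
    using integrable_inverse_1_plus_square by (simp add: set_integrable_def)
  then have "integrable lborel (\<lambda>x::real. inverse (1 + x\<^sup>2))"
    by (simp add: set_integrable_def einterval_def)
  then show ?thesis by (simp add: integrable_iff_bounded)
qed

text \<open>A coordinate is at most the norm in absolute value. Distributing the DIM factors of the
  weight over the coordinates bounds it by a product of functions 1/(1 + t^2) of one
  variable.\<close>

lemma integrable_jw: "integrable lborel (jw :: 'a::euclidean_space \<Rightarrow> real)"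
proof (rule integrableI_bounded)
  have le: "jw x \<le> (\<Prod>b\<in>Basis. inverse (1 + (x \<bullet> b)\<^sup>2))" for x :: 'a
  proof -
    have "(\<Prod>b\<in>(Basis::'a set). inverse (1 + (norm x)\<^sup>2)) \<le> (\<Prod>b\<in>Basis. inverse (1 + (x \<bullet> b)\<^sup>2))"
    proof (intro prod_mono conjI le_imp_inverse_le add_left_mono)
      fix b :: 'a assume "b \<in> Basis"
      then have "\<bar>x \<bullet> b\<bar> \<le> norm x" by (rule Basis_le_norm)
      then show "(x \<bullet> b)\<^sup>2 \<le> (norm x)\<^sup>2" by (simp add: abs_le_square_iff[symmetric])
    qed (auto intro: add_pos_nonneg)
    then show ?thesis by (simp add: jw_def power_inverse)
  qed
  have "(\<integral>\<^sup>+x. ennreal (norm (jw x)) \<partial>(lborel::'a measure)) \<le>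
      (\<integral>\<^sup>+x. (\<Prod>b\<in>Basis. ennreal (inverse (1 + (x \<bullet> b)\<^sup>2))) \<partial>(lborel::'a measure))"
    using le by (intro nn_integral_mono) (auto simp: prod_ennreal jw_nonneg ennreal_leI)
  also have "\<dots> = (\<Prod>b\<in>(Basis::'a set). \<integral>\<^sup>+x. ennreal (inverse (1 + x\<^sup>2)) \<partial>lborel)"
    by (rule nn_integral_lborel_prod) auto
  also have "\<dots> < \<infinity>"
    using nn_integral_inverse_1_plus_square by (simp add: ennreal_prod_eq_top less_top[symmetric] power_eq_top_ennreal)
  finally show "(\<integral>\<^sup>+x. ennreal (norm (jw x)) \<partial>(lborel::'a measure)) < \<infinity>" .
qed auto

text \<open>On each cell the value at the lattice point is bounded by the weight at any point of the
  cell, so the sum is bounded by an integral. The integral is invariant under translation, whence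
  the uniformity in \<open>v\<close>.\<close>

lemma jw_lattice_sum:
  "\<exists>C>0. \<forall>v::'a::euclidean_space. (\<integral>\<^sup>+\<nu>. ennreal (jw (\<nu> - v)) \<partial>count_space int_lattice) \<le> ennreal C"
proof -
  define K where "K = (2 * (1 + (real DIM('a))\<^sup>2)) ^ DIM('a)"
  have K: "K > 0" unfolding K_def by (intro zero_less_power mult_pos_pos add_pos_nonneg) auto
  \<comment> \<open>The added 1 makes the constant positive once the integral is known to be
    nonnegative.\<close>
  have pos: "0 < (\<integral>x. jw x \<partial>(lborel::'a measure)) + 1"
    by (intro add_nonneg_pos integral_nonneg_AE) (auto simp: jw_nonneg)
  have "(\<integral>\<^sup>+\<nu>. ennreal (jw (\<nu> - v)) \<partial>count_space int_lattice) \<le> ennreal (K * ((\<integral>x. jw x \<partial>(lborel :: 'a measure)) + 1))" for v :: 'a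
  proof -
    have "(\<integral>\<^sup>+\<nu>. ennreal (jw (\<nu> - v)) \<partial>count_space int_lattice) =
        (\<integral>\<^sup>+\<nu>. (\<integral>\<^sup>+x. ennreal (jw (\<nu> - v)) * indicator unit_cube x \<partial>(lborel :: 'a measure)) \<partial>count_space int_lattice)"
      by (simp add: nn_integral_cmult_indicator emeasure_unit_cube)
    also have "\<dots> \<le> (\<integral>\<^sup>+\<nu>. (\<integral>\<^sup>+x. ennreal (K * jw (x + \<nu> - v)) * indicator unit_cube x \<partial>lborel) \<partial>count_space int_lattice)"
    proof (intro nn_integral_mono)
      fix \<nu> x :: 'a
      show "ennreal (jw (\<nu> - v)) * indicator unit_cube x \<le> ennreal (K * jw (x + \<nu> - v)) * indicator unit_cube x"
        using jw_peetre[OF norm_unit_cube_le, of x "\<nu> - v"]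
        by (auto simp: indicator_def K_def algebra_simps intro!: ennreal_leI)
    qed
    also have "\<dots> = (\<integral>\<^sup>+x. ennreal (K * jw (x - v)) \<partial>lborel)"
      by (rule nn_integral_lattice_cells[symmetric]) measurable
    also have "\<dots> = (\<integral>\<^sup>+x. ennreal (K * jw x) \<partial>(lborel :: 'a measure))"
      using nn_integral_lborel_shift[of "\<lambda>x. ennreal (K * jw x)" "-v"] by simp
    also have "\<dots> = ennreal (K * (\<integral>x. jw x \<partial>(lborel :: 'a measure)))"
      using K integrable_jw by (subst nn_integral_eq_integral) (auto simp: jw_nonneg)
    also have "\<dots> \<le> ennreal (K * ((\<integral>x. jw x \<partial>(lborel :: 'a measure)) + 1))"
      using K by (intro ennreal_leI) auto
    finally show ?thesis .
  qed
  then show ?thesis using K pos by (intro exI[of _ "K * ((\<integral>x. jw x \<partial>(lborel :: 'a measure)) + 1)"]) auto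
qed

text \<open>Volume comparison: the unit cells of the points of \<open>F\<close> are disjoint and lie
  in a cube of side 2 \<rho> + 2.\<close>

lemma card_lattice_ball:
  fixes F :: "'a::euclidean_space set"
  assumes F: "finite F" "F \<subseteq> int_lattice" "\<And>\<nu>. \<nu> \<in> F \<Longrightarrow> norm \<nu> \<le> \<rho>" and \<rho>: "0 \<le> \<rho>"
  shows "real (card F) \<le> (2 * \<rho> + 2) ^ DIM('a)"
proof -
  let ?B = "cbox (- ((\<rho> + 1) *\<^sub>R One)) ((\<rho> + 1) *\<^sub>R One) :: 'a set"
  have "ennreal (real (card F)) = (\<integral>\<^sup>+\<nu>. indicator F \<nu> \<partial>count_space int_lattice)"
    using F by (simp add: emeasure_count_space ennreal_of_nat_eq_real_of_nat)
  also have "\<dots> \<le> (\<integral>\<^sup>+\<nu>. (\<integral>\<^sup>+x. indicator ?B (x + \<nu>) * indicator unit_cube x \<partial>lborel) \<partial>count_space int_lattice)"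
  proof (intro nn_integral_mono)
    fix \<nu> :: 'a
    show "indicator F \<nu> \<le> (\<integral>\<^sup>+x. indicator ?B (x + \<nu>) * indicator unit_cube x \<partial>lborel)"
    proof (cases "\<nu> \<in> F")
      case True
      have "x + \<nu> \<in> ?B" if "x \<in> unit_cube" for x
      proof -
        have "\<bar>\<nu> \<bullet> b\<bar> \<le> \<rho>" "-1/2 \<le> x \<bullet> b" "x \<bullet> b < 1/2" if "b \<in> Basis" for b
          using F(3)[OF True] Basis_le_norm[OF that, of \<nu>] \<open>x \<in> unit_cube\<close> that by (auto simp: unit_cube_def)
        then show ?thesis by (fastforce simp: mem_box inner_simps)
      qed
      have "(\<integral>\<^sup>+x. indicator ?B (x + \<nu>) * indicator unit_cube x \<partial>lborel) = (\<integral>\<^sup>+x. indicator unit_cube x \<partial>(lborel::'a measure))"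
        using \<open>\<And>x. x \<in> unit_cube \<Longrightarrow> x + \<nu> \<in> ?B\<close> by (intro nn_integral_cong) (auto simp: indicator_def)
      also have "\<dots> = 1" by (simp add: emeasure_unit_cube)
      finally show ?thesis using True by simp
    qed simp
  qed
  also have "\<dots> = (\<integral>\<^sup>+x. indicator ?B x \<partial>lborel)"
    by (rule nn_integral_lattice_cells[symmetric]) auto
  also have "\<dots> = ennreal ((2 * \<rho> + 2) ^ DIM('a))"
    using \<rho> by (simp add: emeasure_lborel_cbox_eq inner_simps)
  finally show ?thesis using \<rho> by (simp add: ennreal_le_iff)
qed

section \<open>Fourier transforms of integrable functions\<close>

lemma fst_borel_measurable [measurable]:
  "(fst :: 'a::euclidean_space \<times> 'b::euclidean_space \<Rightarrow> 'a) \<in> borel_measurable borel"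
  by (intro borel_measurable_continuous_onI continuous_intros)

lemma snd_borel_measurable [measurable]:
  "(snd :: 'a::euclidean_space \<times> 'b::euclidean_space \<Rightarrow> 'b) \<in> borel_measurable borel"
  by (intro borel_measurable_continuous_onI continuous_intros)

lemma cis_inner_measurable [measurable]:
  assumes [measurable]: "f \<in> borel_measurable M"
  shows "(\<lambda>x. cis (f x)) \<in> borel_measurable M"
proof -
  have "cis \<in> borel_measurable borel"
    by (intro borel_measurable_continuous_onI continuous_intros)
  then show ?thesis using assms measurable_compose by blast
qed

section \<open>Fourier integrals of Gaussians, and Schur's test\<close>

lemma integral_Basis_prod:
  fixes f :: "'a::euclidean_space \<Rightarrow> real \<Rightarrow> 'b::{real_normed_field,banach,second_countable_topology}"
  assumes int: "\<And>b. b \<in> Basis \<Longrightarrow> integrable lborel (f b)"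
  shows "integrable lborel (\<lambda>x. \<Prod>b\<in>Basis. f b (x \<bullet> b))"
    and "(\<integral>x. (\<Prod>b\<in>Basis. f b (x \<bullet> b)) \<partial>lborel) = (\<Prod>b\<in>Basis. \<integral>x. f b x \<partial>lborel)"
proof -
  interpret product_sigma_finite "\<lambda>_::'a. lborel :: real measure" by standard
  have [measurable]: "f b \<in> borel_measurable borel" if "b \<in> Basis" for b
    using int[OF that] by auto
  have m: "(\<lambda>g. \<Sum>b\<in>Basis. g b *\<^sub>R b) \<in> Pi\<^sub>M (Basis::'a set) (\<lambda>_. lborel) \<rightarrow>\<^sub>M borel"
    by measurable
  have p: "(\<lambda>x. \<Prod>b\<in>Basis. f b (x \<bullet> b)) \<in> borel_measurable borel"
    by (intro borel_measurable_prod measurable_compose[OF _ \<open>\<And>b. b \<in> Basis \<Longrightarrow> f b \<in> _\<close>]) auto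
  show "integrable lborel (\<lambda>x. \<Prod>b\<in>Basis. f b (x \<bullet> b))"
    by (subst lborel_eq, subst integrable_distr_eq[OF m p])
       (auto intro!: product_integrable_prod int)
  show "(\<integral>x. (\<Prod>b\<in>Basis. f b (x \<bullet> b)) \<partial>lborel) = (\<Prod>b\<in>Basis. \<integral>x. f b x \<partial>lborel)"
    by (subst lborel_eq, subst integral_distr[OF m p])
       (auto simp: product_integral_prod int)
qed

text \<open>This is the characteristic function of the standard normal law, whose density is
  \<open>exp (- x^2 / 2) / sqrt (2 * pi)\<close>, freed of its normalization.\<close>

lemma integral_gauss_1d:
  fixes t :: real
  shows "integrable lborel (\<lambda>x::real. complex_of_real (exp (- x\<^sup>2 / 2)) * cis (x * t))"
    and "(\<integral>x. complex_of_real (exp (- x\<^sup>2 / 2)) * cis (x * t) \<partial>lborel) =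
           complex_of_real (sqrt (2 * pi) * exp (- t\<^sup>2 / 2))"
proof -
  have s: "exp (- x\<^sup>2 / 2) = sqrt (2 * pi) * std_normal_density x" for x :: real
    by (simp add: std_normal_density_def)
  have i: "integrable lborel (\<lambda>x::real. exp (- x\<^sup>2 / 2))"
    unfolding s by (intro integrable_mult_right integrable_normal_density) simp
  show int: "integrable lborel (\<lambda>x::real. complex_of_real (exp (- x\<^sup>2 / 2)) * cis (x * t))"
    by (rule Bochner_Integration.integrable_bound[OF i]) (auto simp: norm_mult)
  have "char std_normal_distribution t = (\<integral>x. std_normal_density x *\<^sub>R cis (x * t) \<partial>lborel)"
    unfolding char_def by (subst integral_density) (auto simp: cis_conv_exp mult_ac)
  then have *: "(\<integral>x. std_normal_density x *\<^sub>R cis (x * t) \<partial>lborel) = complex_of_real (exp (- t\<^sup>2 / 2))"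
    by (simp add: char_std_normal_distribution)
  have "(\<integral>x. complex_of_real (exp (- x\<^sup>2 / 2)) * cis (x * t) \<partial>lborel) =
     (\<integral>x. complex_of_real (sqrt (2 * pi)) * (std_normal_density x *\<^sub>R cis (x * t)) \<partial>lborel)"
    unfolding s by (simp add: scaleR_conv_of_real mult.assoc)
  also have "\<dots> = complex_of_real (sqrt (2 * pi)) * complex_of_real (exp (- t\<^sup>2 / 2))"
    by (subst integral_mult_right_zero) (simp add: *)
  finally show "(\<integral>x. complex_of_real (exp (- x\<^sup>2 / 2)) * cis (x * t) \<partial>lborel) =
           complex_of_real (sqrt (2 * pi) * exp (- t\<^sup>2 / 2))" by simp
qed

definition gauss :: "'a::euclidean_space \<Rightarrow> real" where
  "gauss x = exp (- (norm x)\<^sup>2 / 2)"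

lemma gauss_nonneg [simp]: "0 \<le> gauss x"
  and gauss_le_1: "gauss x \<le> 1" and gauss_minus [simp]: "gauss (- x) = gauss x"
  by (auto simp: gauss_def)

lemma gauss_measurable [measurable]: "gauss \<in> borel_measurable borel"
  unfolding gauss_def by measurable

lemma cis_sum: "finite A \<Longrightarrow> cis (\<Sum>i\<in>A. f i) = (\<Prod>i\<in>A. cis (f i))"
  by (induction A rule: finite_induct) (auto simp: cis_mult[symmetric])

text \<open>Gaussian and character both factor over the coordinates. With this normalization the
  Gaussian is its own Fourier transform up to a power of \<open>sqrt (2 * pi)\<close>.\<close>

lemma integral_gauss:
  fixes \<xi> :: "'a::euclidean_space"
  shows "integrable lborel (\<lambda>x. complex_of_real (gauss x) * cis (x \<bullet> \<xi>))"
    and "(\<integral>x. complex_of_real (gauss x) * cis (x \<bullet> \<xi>) \<partial>lborel) =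
           complex_of_real (sqrt (2 * pi) ^ DIM('a) * gauss \<xi>)"
proof -
  define f where "f b x = complex_of_real (exp (- x\<^sup>2 / 2)) * cis (x * (\<xi> \<bullet> b))" for b :: 'a and x
  have n: "gauss x = (\<Prod>b\<in>Basis. exp (- (x \<bullet> b)\<^sup>2 / 2))" for x :: 'a
  proof -
    have "(norm x)\<^sup>2 = (\<Sum>b\<in>Basis. (x \<bullet> b)\<^sup>2)"
      unfolding power2_norm_eq_inner euclidean_inner[of x x] by (simp add: power2_eq_square)
    then show ?thesis by (simp add: gauss_def exp_sum[symmetric] sum_negf sum_divide_distrib)
  qed
  have eq: "complex_of_real (gauss x) * cis (x \<bullet> \<xi>) = (\<Prod>b\<in>Basis. f b (x \<bullet> b))" for x
    unfolding f_def prod.distrib n euclidean_inner[of x \<xi>] by (simp add: cis_sum)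
  have int: "integrable lborel (f b)" for b unfolding f_def by (rule integral_gauss_1d)
  show "integrable lborel (\<lambda>x. complex_of_real (gauss x) * cis (x \<bullet> \<xi>))"
    unfolding eq by (rule integral_Basis_prod) (rule int)
  have "(\<integral>x. complex_of_real (gauss x) * cis (x \<bullet> \<xi>) \<partial>lborel) = (\<Prod>b\<in>Basis. \<integral>x. f b x \<partial>lborel)"
    unfolding eq by (rule integral_Basis_prod) (rule int)
  also have "\<dots> = (\<Prod>b\<in>Basis. complex_of_real (sqrt (2 * pi) * exp (- (\<xi> \<bullet> b)\<^sup>2 / 2)))"
    unfolding f_def by (simp only: integral_gauss_1d)
  also have "\<dots> = complex_of_real (sqrt (2 * pi) ^ DIM('a) * gauss \<xi>)"
    by (simp add: n prod.distrib)
  finally show "(\<integral>x. complex_of_real (gauss x) * cis (x \<bullet> \<xi>) \<partial>lborel) =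
           complex_of_real (sqrt (2 * pi) ^ DIM('a) * gauss \<xi>)" .
qed

lemma integrable_gauss: "integrable lborel (gauss :: 'a::euclidean_space \<Rightarrow> real)"
  by (rule Bochner_Integration.integrable_bound[OF integral_gauss(1)[of 0]]) auto

lemma integral_gauss_real:
  "(\<integral>x. gauss x \<partial>(lborel :: 'a::euclidean_space measure)) = sqrt (2 * pi) ^ DIM('a)"
proof -
  have "complex_of_real (\<integral>x. gauss (x::'a) \<partial>lborel) = (\<integral>x. complex_of_real (gauss (x::'a)) \<partial>lborel)"
    by (rule integral_complex_of_real[symmetric])
  also have "\<dots> = complex_of_real (sqrt (2 * pi) ^ DIM('a))"
    using integral_gauss(2)[of "0::'a"] by (simp add: gauss_def)
  finally show ?thesis by (simp only: of_real_eq_iff)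
qed

lemma integral_gauss_scaled:
  fixes \<xi> :: "'a::euclidean_space"
  assumes \<epsilon>: "0 < \<epsilon>"
  shows "integrable lborel (\<lambda>x. complex_of_real (gauss (\<epsilon> *\<^sub>R x)) * cis (x \<bullet> \<xi>))"
    and "(\<integral>x. complex_of_real (gauss (\<epsilon> *\<^sub>R x)) * cis (x \<bullet> \<xi>) \<partial>lborel) =
           complex_of_real ((sqrt (2 * pi) / \<epsilon>) ^ DIM('a) * gauss (\<xi> /\<^sub>R \<epsilon>))"
proof -
  let ?f = "\<lambda>x::'a. complex_of_real (gauss x) * cis (x \<bullet> (\<xi> /\<^sub>R \<epsilon>))"
  have eq: "complex_of_real (gauss (\<epsilon> *\<^sub>R x)) * cis (x \<bullet> \<xi>) = ?f (0 + \<epsilon> *\<^sub>R x)" for x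
    using \<epsilon> by (simp add: mult.assoc[symmetric])
  show "integrable lborel (\<lambda>x. complex_of_real (gauss (\<epsilon> *\<^sub>R x)) * cis (x \<bullet> \<xi>))"
    unfolding eq using \<epsilon> by (intro integrable_lborel_affine integral_gauss) auto
  have "complex_of_real (sqrt (2 * pi) ^ DIM('a) * gauss (\<xi> /\<^sub>R \<epsilon>)) =
      \<epsilon> ^ DIM('a) *\<^sub>R (\<integral>x. complex_of_real (gauss (\<epsilon> *\<^sub>R x)) * cis (x \<bullet> \<xi>) \<partial>lborel)"
    unfolding integral_gauss(2)[symmetric] eq using \<epsilon>
    by (subst integral_lborel_affine[of \<epsilon> _ 0]) (auto)
  then show "(\<integral>x. complex_of_real (gauss (\<epsilon> *\<^sub>R x)) * cis (x \<bullet> \<xi>) \<partial>lborel) =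
           complex_of_real ((sqrt (2 * pi) / \<epsilon>) ^ DIM('a) * gauss (\<xi> /\<^sub>R \<epsilon>))"
    using \<epsilon> by (simp add: scaleR_conv_of_real power_divide field_simps)
qed

lemma integrable_lborel_pair_mult:
  fixes f :: "'a::euclidean_space \<Rightarrow> 'c::{real_normed_field,banach,second_countable_topology}"
    and g :: "'b::euclidean_space \<Rightarrow> 'c"
  assumes f: "integrable lborel f" and g: "integrable lborel g"
  shows "integrable (lborel \<Otimes>\<^sub>M lborel) (\<lambda>(x, y). f x * g y)"
    and "integrable lborel (\<lambda>(x, y). f x * g y)"
proof -
  have [measurable]: "f \<in> borel_measurable borel" "g \<in> borel_measurable borel"
    using f g by auto
  show *: "integrable (lborel \<Otimes>\<^sub>M lborel) (\<lambda>(x, y). f x * g y)"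
    by (rule lborel_pair.Fubini_integrable) (auto simp: norm_mult intro!: f g)
  then show "integrable lborel (\<lambda>(x, y). f x * g y)" by (simp add: lborel_prod)
qed

lemma integral_lborel_pair_mult:
  fixes f :: "'a::euclidean_space \<Rightarrow> 'c::{real_normed_field,banach,second_countable_topology}"
    and g :: "'b::euclidean_space \<Rightarrow> 'c"
  assumes f: "integrable lborel f" and g: "integrable lborel g"
  shows "(\<integral>(x, y). f x * g y \<partial>lborel) = (\<integral>x. f x \<partial>lborel) * (\<integral>y. g y \<partial>lborel)"
  using lborel_pair.integral_fst'[OF integrable_lborel_pair_mult(1)[OF f g]]
  by (simp add: lborel_prod)

lemma cis_minus_inner_diff:
  "cis (- ((x - y) \<bullet> \<xi>)) = cis (- (x \<bullet> \<xi>)) * cnj (cis (- (y \<bullet> \<xi>)))"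
  by (simp add: cis_cnj cis_mult inner_diff_left)

lemma ennreal_two_mult_le_sum_squares: "2 * (a * b) \<le> a\<^sup>2 + (b::ennreal)\<^sup>2"
proof (cases "a = \<top> \<or> b = \<top>")
  case False
  then obtain x y where xy: "a = ennreal x" "b = ennreal y" "0 \<le> x" "0 \<le> y"
    by (metis ennreal_cases)
  have "2 * (x * y) \<le> x\<^sup>2 + y\<^sup>2" using sum_squares_bound[of x y] by simp
  then show ?thesis
    using xy by (auto simp: ennreal_power ennreal_mult[symmetric] simp flip: ennreal_plus ennreal_numeral intro!: ennreal_leI)
qed (auto simp: power2_eq_square ennreal_top_mult ennreal_mult_top)

text \<open>Schur's test, from 2 a b \<le> a^2 + b^2. Each of the two squares integrates to the same
  product, the second one after exchanging the variables and using that \<open>k\<close> is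
  even.\<close>

lemma schur_convolution:
  fixes u k :: "'a::euclidean_space \<Rightarrow> ennreal"
  assumes [measurable]: "u \<in> borel_measurable borel" "k \<in> borel_measurable borel"
    and even: "\<And>x. k (- x) = k x"
  shows "(\<integral>\<^sup>+x. \<integral>\<^sup>+y. u x * u y * k (x - y) \<partial>lborel \<partial>lborel) \<le> (\<integral>\<^sup>+x. (u x)\<^sup>2 \<partial>lborel) * (\<integral>\<^sup>+x. k x \<partial>lborel)"
    (is "?L \<le> ?R")
proof -
  have "(\<integral>\<^sup>+x. \<integral>\<^sup>+y. (u x)\<^sup>2 * k (x - y) \<partial>lborel \<partial>lborel) = (\<integral>\<^sup>+x. (u x)\<^sup>2 * (\<integral>\<^sup>+y. k (x - y) \<partial>lborel) \<partial>lborel)"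
    by (simp add: nn_integral_cmult)
  also have "\<dots> = ?R"
    by (simp add: nn_integral_lborel_reflect nn_integral_multc)
  finally have 1: "(\<integral>\<^sup>+x. \<integral>\<^sup>+y. (u x)\<^sup>2 * k (x - y) \<partial>lborel \<partial>lborel) = ?R" .
  have "(\<integral>\<^sup>+x. \<integral>\<^sup>+y. (u y)\<^sup>2 * k (x - y) \<partial>lborel \<partial>lborel) = (\<integral>\<^sup>+y. \<integral>\<^sup>+x. (u y)\<^sup>2 * k (x - y) \<partial>lborel \<partial>lborel)"
    by (rule lborel_pair.Fubini') measurable
  also have "\<dots> = ?R" unfolding 1[symmetric] using even[of "_ - _"] by (simp add: minus_diff_eq)
  finally have 2: "(\<integral>\<^sup>+x. \<integral>\<^sup>+y. (u y)\<^sup>2 * k (x - y) \<partial>lborel \<partial>lborel) = ?R" .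
  have "2 * ?L = (\<integral>\<^sup>+x. \<integral>\<^sup>+y. 2 * (u x * u y) * k (x - y) \<partial>lborel \<partial>lborel)"
    by (simp add: nn_integral_cmult[symmetric] mult.assoc)
  also have "\<dots> \<le> (\<integral>\<^sup>+x. \<integral>\<^sup>+y. (u x)\<^sup>2 * k (x - y) + (u y)\<^sup>2 * k (x - y) \<partial>lborel \<partial>lborel)"
    unfolding distrib_right[symmetric]
    by (intro nn_integral_mono mult_right_mono ennreal_two_mult_le_sum_squares) auto
  also have "\<dots> = 2 * ?R"
    by (simp add: nn_integral_add 1 2 mult_2)
  finally show ?thesis by (simp add: ennreal_mult_le_mult_iff)
qed

section \<open>Plancherel's inequality and Fourier inversion for integrable functions\<close>

lemma fourier_lborel:
  assumes "f \<in> borel_measurable borel"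
  shows "fourier f \<xi> = (\<integral>x. cis (- (x \<bullet> \<xi>)) * f x \<partial>lborel)"
  unfolding fourier_def using assms by (intro integral_completion) measurable

lemma inv_fourier_eq_fourier:
  fixes f :: "'a::euclidean_space \<Rightarrow> complex"
  shows "inv_fourier f x = fourier f (- x) / of_real ((2 * pi) ^ DIM('a))"
  by (simp add: inv_fourier_def fourier_def inner_commute)

lemma fourier_measurable [measurable]:
  assumes [measurable]: "f \<in> borel_measurable borel"
  shows "fourier f \<in> borel_measurable borel"
proof -
  have "(\<lambda>\<xi>. \<integral>x. cis (- (x \<bullet> \<xi>)) * f x \<partial>lborel) \<in> borel_measurable borel"
    by measurable
  then show ?thesis by (simp add: fourier_lborel[OF assms, abs_def])
qed

lemma inv_fourier_measurable [measurable]: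
  assumes [measurable]: "f \<in> borel_measurable borel"
  shows "inv_fourier f \<in> borel_measurable borel"
  unfolding inv_fourier_eq_fourier by measurable

lemma integrable_cis_mult:
  fixes f :: "'a::euclidean_space \<Rightarrow> complex"
  assumes f: "integrable lborel f" and [measurable]: "t \<in> borel_measurable borel"
  shows "integrable lborel (\<lambda>x. cis (t x) * f x)"
  by (rule Bochner_Integration.integrable_bound[OF f]) (use f in \<open>auto simp: norm_mult\<close>)

lemma norm_fourier_le:
  assumes f: "integrable lborel f"
  shows "norm (fourier f \<xi>) \<le> (\<integral>x. norm (f x) \<partial>lborel)"
proof -
  have [measurable]: "f \<in> borel_measurable borel" using f by auto
  have "norm (\<integral>x. cis (- (x \<bullet> \<xi>)) * f x \<partial>lborel) \<le> (\<integral>x. norm (cis (- (x \<bullet> \<xi>)) * f x) \<partial>lborel)"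
    by (rule integral_norm_bound)
  then show ?thesis by (simp add: fourier_lborel norm_mult)
qed

text \<open>The squared modulus of the transform is a double integral of
  \<open>f x * cnj (f y)\<close> against a character in \<open>x - y\<close>. The Gaussian makes the
  triple integral absolutely convergent, so the frequency may be integrated out; this produces a
  Gaussian kernel in \<open>x - y\<close>, to which Schur's test applies.\<close>

lemma plancherel_gauss:
  fixes f :: "'a::euclidean_space \<Rightarrow> complex"
  assumes f: "integrable lborel f" and \<epsilon>: "0 < \<epsilon>"
  shows "(\<integral>\<^sup>+\<xi>. ennreal ((norm (fourier f \<xi>))\<^sup>2 * gauss (\<epsilon> *\<^sub>R \<xi>)) \<partial>lborel) \<le>
     ennreal ((2 * pi) ^ DIM('a)) * (\<integral>\<^sup>+x. ennreal ((norm (f x))\<^sup>2) \<partial>lborel)"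
proof -
  have [measurable]: "f \<in> borel_measurable borel" using f by auto
  define g where "g p = f (fst p) * cnj (f (snd p))" for p
  have fc: "integrable lborel (\<lambda>x. cnj (f x))" using f by simp
  have g: "integrable lborel g"
    using integrable_lborel_pair_mult(2)[OF f fc] by (simp add: g_def[abs_def] case_prod_unfold)
  have [measurable]: "g \<in> borel_measurable borel" using g by auto
  have gs: "integrable lborel (\<lambda>\<xi>::'a. gauss (\<epsilon> *\<^sub>R \<xi>))"
    using integrable_lborel_affine[OF integrable_gauss, of \<epsilon> 0] \<epsilon> by simp
  define e where "e \<xi> p = cis (- ((fst p - snd p) \<bullet> \<xi>))" for \<xi> and p :: "'a \<times> 'a"
  have [measurable]: "(\<lambda>(x, y). e x y) \<in> borel_measurable (borel \<Otimes>\<^sub>M borel)"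
    unfolding e_def by measurable
  have sq: "complex_of_real ((norm (fourier f \<xi>))\<^sup>2) = (\<integral>p. e \<xi> p * g p \<partial>lborel)" for \<xi>
  proof -
    have i: "integrable lborel (\<lambda>x. cis (- (x \<bullet> \<xi>)) * f x)"
      by (rule integrable_cis_mult[OF f]) measurable
    then have ic: "integrable lborel (\<lambda>x. cnj (cis (- (x \<bullet> \<xi>)) * f x))"
      by (rule integrable_cnj)
    have "complex_of_real ((norm (fourier f \<xi>))\<^sup>2) = fourier f \<xi> * cnj (fourier f \<xi>)"
      by (rule complex_norm_square)
    also have "\<dots> = (\<integral>x. cis (- (x \<bullet> \<xi>)) * f x \<partial>lborel) * (\<integral>x. cnj (cis (- (x \<bullet> \<xi>)) * f x) \<partial>lborel)"
      by (simp only: fourier_lborel[OF \<open>f \<in> borel_measurable borel\<close>] integral_bounded_linear[OF bounded_linear_cnj i])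
    also have "\<dots> = (\<integral>(x, y). (cis (- (x \<bullet> \<xi>)) * f x) * cnj (cis (- (y \<bullet> \<xi>)) * f y) \<partial>lborel)"
      by (rule integral_lborel_pair_mult[symmetric, OF i ic])
    also have "\<dots> = (\<integral>p. e \<xi> p * g p \<partial>lborel)"
      unfolding case_prod_unfold e_def g_def
      by (intro Bochner_Integration.integral_cong refl)
         (simp only: cis_minus_inner_diff complex_cnj_mult mult_ac)
    finally show ?thesis .
  qed
  have int: "integrable (lborel \<Otimes>\<^sub>M lborel) (\<lambda>(\<xi>, p). complex_of_real (gauss (\<epsilon> *\<^sub>R \<xi>)) * (e \<xi> p * g p))"
  proof (rule Bochner_Integration.integrable_bound)
    have "integrable lborel (\<lambda>\<xi>::'a. complex_of_real (gauss (\<epsilon> *\<^sub>R \<xi>)))" using gs by simp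
    from integrable_lborel_pair_mult(1)[OF this g]
    show "integrable (lborel \<Otimes>\<^sub>M lborel) (\<lambda>(\<xi>::'a, p). complex_of_real (gauss (\<epsilon> *\<^sub>R \<xi>)) * g p)" .
    show "(\<lambda>(\<xi>, p). complex_of_real (gauss (\<epsilon> *\<^sub>R \<xi>)) * (e \<xi> p * g p)) \<in> borel_measurable (lborel \<Otimes>\<^sub>M lborel)"
      by measurable
  qed (auto simp: norm_mult e_def)
  have "(\<integral>\<xi>. complex_of_real ((norm (fourier f \<xi>))\<^sup>2 * gauss (\<epsilon> *\<^sub>R \<xi>)) \<partial>lborel) =
      (\<integral>\<xi>. (\<integral>p. complex_of_real (gauss (\<epsilon> *\<^sub>R \<xi>)) * (e \<xi> p * g p) \<partial>lborel) \<partial>lborel)"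
    by (intro Bochner_Integration.integral_cong refl)
       (simp add: sq integral_mult_right_zero mult.commute del: of_real_power)
  also have "\<dots> = (\<integral>p. (\<integral>\<xi>. complex_of_real (gauss (\<epsilon> *\<^sub>R \<xi>)) * (e \<xi> p * g p) \<partial>lborel) \<partial>lborel)"
    by (rule lborel_pair.Fubini_integral[OF int, symmetric])
  \<comment> \<open>The inner integral is the Fourier integral of a dilated Gaussian: again a
    Gaussian, of width \<epsilon>, in the difference of the two points.\<close>
  also have "\<dots> = (\<integral>p. complex_of_real ((sqrt (2 * pi) / \<epsilon>) ^ DIM('a) * gauss ((fst p - snd p) /\<^sub>R \<epsilon>)) * g p \<partial>lborel)"
  proof (intro Bochner_Integration.integral_cong refl)
    fix p :: "'a \<times> 'a"
    have "(\<integral>\<xi>. complex_of_real (gauss (\<epsilon> *\<^sub>R \<xi>)) * (e \<xi> p * g p) \<partial>lborel) =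
       (\<integral>\<xi>. (complex_of_real (gauss (\<epsilon> *\<^sub>R \<xi>)) * cis (\<xi> \<bullet> (- (fst p - snd p)))) * g p \<partial>lborel)"
      by (simp only: e_def mult.assoc inner_commute[of "fst p - snd p"] inner_minus_right)
    also have "\<dots> = complex_of_real ((sqrt (2 * pi) / \<epsilon>) ^ DIM('a) * gauss ((- (fst p - snd p)) /\<^sub>R \<epsilon>)) * g p"
      by (simp only: integral_mult_left_zero integral_gauss_scaled[OF \<epsilon>])
    also have "gauss ((- (fst p - snd p)) /\<^sub>R \<epsilon>) = gauss ((fst p - snd p) /\<^sub>R \<epsilon>)"
      by (simp add: gauss_def norm_minus_commute)
    finally show "(\<integral>\<xi>. complex_of_real (gauss (\<epsilon> *\<^sub>R \<xi>)) * (e \<xi> p * g p) \<partial>lborel) =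
       complex_of_real ((sqrt (2 * pi) / \<epsilon>) ^ DIM('a) * gauss ((fst p - snd p) /\<^sub>R \<epsilon>)) * g p" .
  qed
  finally have eq: "(\<integral>\<xi>. complex_of_real ((norm (fourier f \<xi>))\<^sup>2 * gauss (\<epsilon> *\<^sub>R \<xi>)) \<partial>lborel) =
    (\<integral>p. complex_of_real ((sqrt (2 * pi) / \<epsilon>) ^ DIM('a) * gauss ((fst p - snd p) /\<^sub>R \<epsilon>)) * g p \<partial>lborel)" .
  define c where "c = (sqrt (2 * pi) / \<epsilon>) ^ DIM('a)"
  have c: "0 \<le> c" using \<epsilon> by (simp add: c_def)
  have Fint: "integrable lborel (\<lambda>\<xi>. (norm (fourier f \<xi>))\<^sup>2 * gauss (\<epsilon> *\<^sub>R \<xi>))"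
  proof (rule Bochner_Integration.integrable_bound[OF integrable_mult_right[OF gs, of "(\<integral>x. norm (f x) \<partial>lborel)\<^sup>2"]])
    show "AE \<xi> in lborel. norm ((norm (fourier f \<xi>))\<^sup>2 * gauss (\<epsilon> *\<^sub>R \<xi>)) \<le> norm ((\<integral>x. norm (f x) \<partial>lborel)\<^sup>2 * gauss (\<epsilon> *\<^sub>R \<xi>))"
      by (intro AE_I2) (auto simp: abs_mult intro!: mult_right_mono power_mono norm_fourier_le f)
  qed measurable
  have "(\<integral>\<^sup>+\<xi>. ennreal ((norm (fourier f \<xi>))\<^sup>2 * gauss (\<epsilon> *\<^sub>R \<xi>)) \<partial>lborel) =
      ennreal (\<integral>\<xi>. (norm (fourier f \<xi>))\<^sup>2 * gauss (\<epsilon> *\<^sub>R \<xi>) \<partial>lborel)"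
    by (rule nn_integral_eq_integral[OF Fint]) auto
  also have "\<dots> \<le> ennreal (norm (complex_of_real (\<integral>\<xi>. (norm (fourier f \<xi>))\<^sup>2 * gauss (\<epsilon> *\<^sub>R \<xi>) \<partial>lborel)))"
    by (intro ennreal_leI) simp
  also have "\<dots> = ennreal (norm (\<integral>p. complex_of_real (c * gauss ((fst p - snd p) /\<^sub>R \<epsilon>)) * g p \<partial>lborel))"
    unfolding c_def eq[symmetric] integral_complex_of_real ..
  also have "\<dots> \<le> (\<integral>\<^sup>+p. ennreal (norm (complex_of_real (c * gauss ((fst p - snd p) /\<^sub>R \<epsilon>)) * g p)) \<partial>lborel)"
    by (rule integral_norm_bound_ennreal)
       (rule Bochner_Integration.integrable_bound[OF integrable_mult_right[OF g, of "of_real c"]],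
        measurable, auto simp: norm_mult c abs_mult gauss_le_1 intro!: mult_right_mono mult_left_le)
  also have "\<dots> = (\<integral>\<^sup>+x. \<integral>\<^sup>+y. ennreal (norm (f x)) * ennreal (norm (f y)) * ennreal (c * gauss ((x - y) /\<^sub>R \<epsilon>)) \<partial>lborel \<partial>lborel)"
    unfolding lborel_prod[symmetric]
    by (subst lborel.nn_integral_fst[symmetric]) (auto simp: g_def norm_mult c mult_ac abs_mult ennreal_mult[symmetric])
  also have "\<dots> \<le> (\<integral>\<^sup>+x. (ennreal (norm (f x)))\<^sup>2 \<partial>lborel) * (\<integral>\<^sup>+x. ennreal (c * gauss (x /\<^sub>R \<epsilon>)) \<partial>(lborel :: 'a measure))"
    using schur_convolution[of "\<lambda>x. ennreal (norm (f x))" "\<lambda>x. ennreal (c * gauss (x /\<^sub>R \<epsilon>))"] by simp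
  \<comment> \<open>The mass of the kernel does not depend on \<epsilon>: the dilation cancels the
    power of \<epsilon> in \<open>c\<close>, and two factors \<open>sqrt (2 * pi) ^ DIM('a)\<close>
    remain.\<close>
  also have "(\<integral>\<^sup>+x. ennreal (c * gauss (x /\<^sub>R \<epsilon>)) \<partial>(lborel::'a measure)) = ennreal ((2 * pi) ^ DIM('a))"
  proof -
    have "(\<integral>\<^sup>+x. ennreal (c * gauss (x /\<^sub>R \<epsilon>)) \<partial>(lborel::'a measure)) = ennreal (\<epsilon> ^ DIM('a)) * (\<integral>\<^sup>+x. ennreal (c * gauss x) \<partial>(lborel::'a measure))"
      using \<epsilon> by (subst nn_integral_lborel_affine[of _ \<epsilon> 0]) auto
    also have "(\<integral>\<^sup>+x. ennreal (c * gauss x) \<partial>(lborel::'a measure)) = ennreal (\<integral>x. c * gauss x \<partial>(lborel::'a measure))"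
      using c by (intro nn_integral_eq_integral integrable_mult_right integrable_gauss) auto
    also have "\<dots> = ennreal (c * sqrt (2 * pi) ^ DIM('a))"
      by (simp add: integral_gauss_real)
    also have "ennreal (\<epsilon> ^ DIM('a)) * ennreal (c * sqrt (2 * pi) ^ DIM('a)) = ennreal ((2 * pi) ^ DIM('a))"
    proof -
      have "sqrt (2 * pi) ^ DIM('a) * sqrt (2 * pi) ^ DIM('a) = (2 * pi) ^ DIM('a)"
        unfolding power_mult_distrib[symmetric] real_sqrt_mult_self by simp
      then have "\<epsilon> ^ DIM('a) * (c * sqrt (2 * pi) ^ DIM('a)) = (2 * pi) ^ DIM('a)"
        unfolding c_def power_divide times_divide_eq_left using \<epsilon> by simp
      then show ?thesis using \<epsilon> c by (subst ennreal_mult[symmetric]) auto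
    qed
    finally show ?thesis .
  qed
  finally show ?thesis by (simp add: ennreal_power mult.commute)
qed

text \<open>Fatou's lemma along \<epsilon> = 1/(n + 1), where the damping factor tends to 1. The
  right-hand side may be infinite.\<close>

lemma plancherel_le:
  fixes f :: "'a::euclidean_space \<Rightarrow> complex"
  assumes f: "integrable lborel f"
  shows "(\<integral>\<^sup>+\<xi>. ennreal ((norm (fourier f \<xi>))\<^sup>2) \<partial>lborel) \<le>
     ennreal ((2 * pi) ^ DIM('a)) * (\<integral>\<^sup>+x. ennreal ((norm (f x))\<^sup>2) \<partial>lborel)" (is "_ \<le> ?B")
proof -
  have [measurable]: "f \<in> borel_measurable borel" using f by auto
  define \<epsilon> :: "nat \<Rightarrow> real" where "\<epsilon> n = inverse (real (Suc n))" for n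
  have "(\<lambda>n. (norm (fourier f \<xi>))\<^sup>2 * gauss (\<epsilon> n *\<^sub>R \<xi>)) \<longlonglongrightarrow> (norm (fourier f \<xi>))\<^sup>2 * gauss (0 *\<^sub>R \<xi>)" for \<xi>
    unfolding gauss_def \<epsilon>_def by (intro tendsto_intros LIMSEQ_inverse_real_of_nat) auto
  then have lim: "(\<lambda>n. ennreal ((norm (fourier f \<xi>))\<^sup>2 * gauss (\<epsilon> n *\<^sub>R \<xi>))) \<longlonglongrightarrow> ennreal ((norm (fourier f \<xi>))\<^sup>2)" for \<xi>
    by (intro tendsto_ennrealI) (simp add: gauss_def)
  have "(\<integral>\<^sup>+\<xi>. ennreal ((norm (fourier f \<xi>))\<^sup>2) \<partial>lborel) =
     (\<integral>\<^sup>+\<xi>. liminf (\<lambda>n. ennreal ((norm (fourier f \<xi>))\<^sup>2 * gauss (\<epsilon> n *\<^sub>R \<xi>))) \<partial>lborel)"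
    using lim_imp_Liminf[OF _ lim] by (intro nn_integral_cong) auto
  also have "\<dots> \<le> liminf (\<lambda>n. \<integral>\<^sup>+\<xi>. ennreal ((norm (fourier f \<xi>))\<^sup>2 * gauss (\<epsilon> n *\<^sub>R \<xi>)) \<partial>lborel)"
    by (rule nn_integral_liminf) measurable
  also have "\<dots> \<le> liminf (\<lambda>n::nat. ?B)"
    by (intro Liminf_mono always_eventually allI plancherel_gauss f) (simp add: \<epsilon>_def)
  also have "\<dots> = ?B" by (simp add: Liminf_const)
  finally show ?thesis .
qed

text \<open>Gaussian summation. With a factor \<open>gauss (\<epsilon> *\<^sub>R x)\<close>
  inserted, Fubini turns the outer transform into the average of
  \<open>f (y + \<epsilon> *\<^sub>R w)\<close> over Gaussian-distributed \<open>w\<close>. As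
  \<epsilon> tends to 0, dominated convergence applies on both sides: integrability of the inverse
  transform serves the first, continuity and boundedness of \<open>f\<close> the second.\<close>

lemma fourier_inversion:
  fixes f :: "'a::euclidean_space \<Rightarrow> complex"
  assumes cont: "continuous_on UNIV f" and bdd: "\<And>x. norm (f x) \<le> B"
    and f: "integrable lborel f" and Ff: "integrable lborel (inv_fourier f)"
  shows "fourier (inv_fourier f) y = f y"
proof -
  have [measurable]: "f \<in> borel_measurable borel" using f by auto
  have [measurable]: "inv_fourier f \<in> borel_measurable borel" by measurable
  define \<epsilon> :: "nat \<Rightarrow> real" where "\<epsilon> n = inverse (real (Suc n))" for n
  have \<epsilon>pos: "\<epsilon> n > 0" for n by (simp add: \<epsilon>_def)
  have \<epsilon>0: "\<epsilon> \<longlonglongrightarrow> 0" unfolding \<epsilon>_def by (rule LIMSEQ_inverse_real_of_nat)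
  let ?D = "DIM('a)"
  have g0: "gauss (0::'a) = 1" by (simp add: gauss_def)
  have 1: "(\<lambda>n. \<integral>x. complex_of_real (gauss (\<epsilon> n *\<^sub>R x)) * (cis (- (x \<bullet> y)) * inv_fourier f x) \<partial>lborel) \<longlonglongrightarrow>
      (\<integral>x. complex_of_real (gauss (0 *\<^sub>R x)) * (cis (- (x \<bullet> y)) * inv_fourier f x) \<partial>lborel)"
  proof (rule integral_dominated_convergence[where w="\<lambda>x. norm (inv_fourier f x)"])
    show "AE x in lborel. (\<lambda>n. complex_of_real (gauss (\<epsilon> n *\<^sub>R x)) * (cis (- (x \<bullet> y)) * inv_fourier f x)) \<longlonglongrightarrow>
      complex_of_real (gauss (0 *\<^sub>R x)) * (cis (- (x \<bullet> y)) * inv_fourier f x)"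
      unfolding gauss_def by (intro AE_I2 tendsto_intros \<epsilon>0) auto
    show "AE x in lborel. norm (complex_of_real (gauss (\<epsilon> n *\<^sub>R x)) * (cis (- (x \<bullet> y)) * inv_fourier f x)) \<le> norm (inv_fourier f x)" for n
      by (intro AE_I2) (auto simp: norm_mult intro!: mult_left_le_one_le gauss_le_1)
  qed (use Ff in \<open>auto\<close>)
  define c where "c = sqrt (2 * pi) ^ ?D / (2 * pi) ^ ?D"
  have 2: "(\<integral>x. complex_of_real (gauss (\<epsilon> n *\<^sub>R x)) * (cis (- (x \<bullet> y)) * inv_fourier f x) \<partial>lborel) =
     complex_of_real c * (\<integral>w. f (y + \<epsilon> n *\<^sub>R w) * complex_of_real (gauss w) \<partial>lborel)" for n
  proof -
    define h where "h x z = complex_of_real (gauss (\<epsilon> n *\<^sub>R x)) * (cis (- (x \<bullet> y)) * cis (x \<bullet> z) * f z) / of_real ((2 * pi) ^ ?D)" for x z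
    have [measurable]: "(\<lambda>(x, z). h x z) \<in> borel_measurable (borel \<Otimes>\<^sub>M borel)"
      unfolding h_def by measurable
    have gi: "integrable lborel (\<lambda>x::'a. complex_of_real (gauss (\<epsilon> n *\<^sub>R x)) / of_real ((2 * pi) ^ ?D))"
      using integrable_lborel_affine[OF integrable_gauss, of "\<epsilon> n" "0::'a"] \<epsilon>pos[of n] by auto
    have int: "integrable (lborel \<Otimes>\<^sub>M lborel) (\<lambda>(x, z). h x z)"
      by (rule Bochner_Integration.integrable_bound[OF integrable_lborel_pair_mult(1)[OF gi f]])
         (measurable, auto simp: h_def norm_mult norm_divide)
    have "(\<integral>x. complex_of_real (gauss (\<epsilon> n *\<^sub>R x)) * (cis (- (x \<bullet> y)) * inv_fourier f x) \<partial>lborel) =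
        (\<integral>x. (\<integral>z. h x z \<partial>lborel) \<partial>lborel)"
    proof (intro Bochner_Integration.integral_cong refl)
      fix x
      have "(\<integral>z. h x z \<partial>lborel) = (\<integral>z. (complex_of_real (gauss (\<epsilon> n *\<^sub>R x)) * cis (- (x \<bullet> y)) / of_real ((2 * pi) ^ ?D)) *
          (cis (- (z \<bullet> (- x))) * f z) \<partial>lborel)"
        by (intro Bochner_Integration.integral_cong refl) (simp add: h_def inner_commute)
      also have "\<dots> = (complex_of_real (gauss (\<epsilon> n *\<^sub>R x)) * cis (- (x \<bullet> y)) / of_real ((2 * pi) ^ ?D)) * fourier f (- x)"
        by (simp only: integral_mult_right_zero fourier_lborel[OF \<open>f \<in> borel_measurable borel\<close>])
      finally show "complex_of_real (gauss (\<epsilon> n *\<^sub>R x)) * (cis (- (x \<bullet> y)) * inv_fourier f x) = (\<integral>z. h x z \<partial>lborel)"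
        by (simp add: inv_fourier_eq_fourier)
    qed
    also have "\<dots> = (\<integral>z. (\<integral>x. h x z \<partial>lborel) \<partial>lborel)"
      by (rule lborel_pair.Fubini_integral[OF int, symmetric])
    also have "\<dots> = (\<integral>z. (f z / of_real ((2 * pi) ^ ?D)) * complex_of_real ((sqrt (2 * pi) / \<epsilon> n) ^ ?D * gauss ((z - y) /\<^sub>R \<epsilon> n)) \<partial>lborel)"
    proof (intro Bochner_Integration.integral_cong refl)
      fix z
      have "(\<integral>x. h x z \<partial>lborel) = (\<integral>x. (f z / of_real ((2 * pi) ^ ?D)) * (complex_of_real (gauss (\<epsilon> n *\<^sub>R x)) * cis (x \<bullet> (z - y))) \<partial>lborel)"
        by (intro Bochner_Integration.integral_cong refl) (simp add: h_def cis_mult inner_diff_right)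
      also have "\<dots> = (f z / of_real ((2 * pi) ^ ?D)) * complex_of_real ((sqrt (2 * pi) / \<epsilon> n) ^ ?D * gauss ((z - y) /\<^sub>R \<epsilon> n))"
        by (simp only: integral_mult_right_zero integral_gauss_scaled[OF \<epsilon>pos])
      finally show "(\<integral>x. h x z \<partial>lborel) = \<dots>" .
    qed
    also have "\<dots> = \<epsilon> n ^ ?D *\<^sub>R (\<integral>w. (f (y + \<epsilon> n *\<^sub>R w) / of_real ((2 * pi) ^ ?D)) * complex_of_real ((sqrt (2 * pi) / \<epsilon> n) ^ ?D * gauss w) \<partial>lborel)"
      using \<epsilon>pos[of n] by (subst integral_lborel_affine[of "\<epsilon> n" _ y]) auto
    also have "(\<integral>w. (f (y + \<epsilon> n *\<^sub>R w) / of_real ((2 * pi) ^ ?D)) * complex_of_real ((sqrt (2 * pi) / \<epsilon> n) ^ ?D * gauss w) \<partial>lborel) =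
       (\<integral>w. complex_of_real ((sqrt (2 * pi) / \<epsilon> n) ^ ?D / (2 * pi) ^ ?D) * (f (y + \<epsilon> n *\<^sub>R w) * complex_of_real (gauss w)) \<partial>lborel)"
      by (intro Bochner_Integration.integral_cong refl) simp
    also have "\<dots> = complex_of_real ((sqrt (2 * pi) / \<epsilon> n) ^ ?D / (2 * pi) ^ ?D) * (\<integral>w. f (y + \<epsilon> n *\<^sub>R w) * complex_of_real (gauss w) \<partial>lborel)"
      by (rule integral_mult_right_zero)
    also have "\<epsilon> n ^ ?D *\<^sub>R \<dots> = complex_of_real c * (\<integral>w. f (y + \<epsilon> n *\<^sub>R w) * complex_of_real (gauss w) \<partial>lborel)"
      using \<epsilon>pos[of n] by (simp add: c_def scaleR_conv_of_real power_divide)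
    finally show ?thesis .
  qed
  have 3: "(\<lambda>n. \<integral>w. f (y + \<epsilon> n *\<^sub>R w) * complex_of_real (gauss w) \<partial>lborel) \<longlonglongrightarrow>
      (\<integral>w. f (y + 0 *\<^sub>R w) * complex_of_real (gauss w) \<partial>lborel)"
  proof (rule integral_dominated_convergence[where w="\<lambda>w. B * gauss w"])
    show "integrable lborel (\<lambda>w::'a. B * gauss w)" by (intro integrable_mult_right integrable_gauss)
    show "AE w in lborel. (\<lambda>n. f (y + \<epsilon> n *\<^sub>R w) * complex_of_real (gauss w)) \<longlonglongrightarrow> f (y + 0 *\<^sub>R w) * complex_of_real (gauss w)"
    proof (intro AE_I2 tendsto_intros)
      fix w
      have "isCont f (y + 0 *\<^sub>R w)" using cont by (simp add: continuous_on_eq_continuous_at)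
      then show "(\<lambda>n. f (y + \<epsilon> n *\<^sub>R w)) \<longlonglongrightarrow> f (y + 0 *\<^sub>R w)"
        by (rule isCont_tendsto_compose) (intro tendsto_intros \<epsilon>0)
    qed
    show "AE w in lborel. norm (f (y + \<epsilon> n *\<^sub>R w) * complex_of_real (gauss w)) \<le> B * gauss w" for n
      using bdd by (intro AE_I2) (auto simp: norm_mult intro!: mult_right_mono)
  qed auto
  have "(\<lambda>n. complex_of_real c * (\<integral>w. f (y + \<epsilon> n *\<^sub>R w) * complex_of_real (gauss w) \<partial>lborel)) \<longlonglongrightarrow>
      complex_of_real c * (\<integral>w. f y * complex_of_real (gauss w) \<partial>(lborel :: 'a measure))"
    using tendsto_mult_left[OF 3, of "complex_of_real c"] by simp
  with 1 have "(\<integral>x. complex_of_real (gauss (0 *\<^sub>R x)) * (cis (- (x \<bullet> y)) * inv_fourier f x) \<partial>lborel) =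
     complex_of_real c * (\<integral>w. f y * complex_of_real (gauss w) \<partial>(lborel :: 'a measure))"
    unfolding 2 by (rule LIMSEQ_unique)
  also have "(\<integral>w. f y * complex_of_real (gauss w) \<partial>(lborel :: 'a measure)) = f y * complex_of_real (sqrt (2 * pi) ^ ?D)"
    by (simp only: integral_mult_right_zero integral_complex_of_real integral_gauss_real)
  also have "complex_of_real c * \<dots> = f y"
  proof -
    have "sqrt (2 * pi) ^ ?D * sqrt (2 * pi) ^ ?D = (2 * pi) ^ ?D"
      unfolding power_mult_distrib[symmetric] real_sqrt_mult_self by simp
    then have "c * sqrt (2 * pi) ^ ?D = 1" unfolding c_def times_divide_eq_left by simp
    then have "complex_of_real c * complex_of_real (sqrt (2 * pi) ^ ?D) = 1"
      by (metis of_real_1 of_real_mult)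
    then show ?thesis by (metis mult.left_commute mult.right_neutral)
  qed
  finally show ?thesis by (simp add: fourier_lborel g0)
qed

section \<open>Sampling Fourier integrals at perturbed lattice points\<close>

text \<open>With \<open>t\<close> the squared norm and \<open>D\<close> the dimension, raise 1 +
  t/(2 D) \<le> exp (t/(2 D)) to the power \<open>D\<close>.\<close>

lemma exp_le_jw: "gauss x \<le> (2 * real DIM('a)) ^ DIM('a) * jw x" for x :: "'a::euclidean_space"
proof -
  define t where "t = (norm x)\<^sup>2"
  have t: "0 \<le> t" by (simp add: t_def)
  have D: "real DIM('a) \<ge> 1" using DIM_positive[where 'a='a] by linarith
  have "(1 + t) / (2 * real DIM('a)) \<le> 1 + t / (2 * real DIM('a))"
  proof -
    have "1 / (2 * real DIM('a)) \<le> 1" using D by (simp only: divide_le_eq_1) linarith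
    then show ?thesis by (simp only: add_divide_distrib add_right_mono)
  qed
  also have "\<dots> \<le> exp (t / (2 * real DIM('a)))" by (rule exp_ge_add_one_self)
  finally have "((1 + t) / (2 * real DIM('a))) ^ DIM('a) \<le> exp (t / (2 * real DIM('a))) ^ DIM('a)"
    using t by (intro power_mono) auto
  also have "\<dots> = exp (t / 2)" using D by (simp add: exp_of_nat_mult[symmetric])
  finally have "(1 + t) ^ DIM('a) \<le> (2 * real DIM('a)) ^ DIM('a) * exp (t / 2)"
    using D by (simp add: power_divide field_simps)
  moreover have "0 < (1 + t) ^ DIM('a)" using t by (intro zero_less_power) auto
  ultimately show ?thesis
    unfolding gauss_def jw_def t_def[symmetric] by (simp add: exp_minus field_simps)
qed

lemma schur_finite:
  fixes a :: "'i \<Rightarrow> real" and k :: "'i \<Rightarrow> 'i \<Rightarrow> real"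
  assumes F: "finite F" and k: "\<And>i j. 0 \<le> k i j" "\<And>i j. k i j = k j i"
    and C: "\<And>i. i \<in> F \<Longrightarrow> (\<Sum>j\<in>F. k i j) \<le> C"
  shows "(\<Sum>i\<in>F. \<Sum>j\<in>F. a i * a j * k i j) \<le> C * (\<Sum>i\<in>F. (a i)\<^sup>2)"
proof -
  have "(\<Sum>i\<in>F. \<Sum>j\<in>F. a i * a j * k i j) \<le> (\<Sum>i\<in>F. \<Sum>j\<in>F. ((a i)\<^sup>2 * k i j + (a j)\<^sup>2 * k i j) / 2)"
  proof (intro sum_mono)
    fix i j
    have "a i * a j \<le> ((a i)\<^sup>2 + (a j)\<^sup>2) / 2" using sum_squares_bound[of "a i" "a j"] by simp
    then have "a i * a j * k i j \<le> ((a i)\<^sup>2 + (a j)\<^sup>2) / 2 * k i j" by (rule mult_right_mono) (rule k)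
    then show "a i * a j * k i j \<le> ((a i)\<^sup>2 * k i j + (a j)\<^sup>2 * k i j) / 2" by (simp add: field_simps)
  qed
  also have "\<dots> = ((\<Sum>i\<in>F. \<Sum>j\<in>F. (a i)\<^sup>2 * k i j) + (\<Sum>i\<in>F. \<Sum>j\<in>F. (a j)\<^sup>2 * k i j)) / 2"
    by (simp add: sum.distrib sum_divide_distrib[symmetric])
  also have "(\<Sum>i\<in>F. \<Sum>j\<in>F. (a j)\<^sup>2 * k i j) = (\<Sum>i\<in>F. \<Sum>j\<in>F. (a i)\<^sup>2 * k i j)"
    by (subst sum.swap) (simp add: k(2))
  also have "(\<Sum>i\<in>F. \<Sum>j\<in>F. (a i)\<^sup>2 * k i j) = (\<Sum>i\<in>F. (a i)\<^sup>2 * (\<Sum>j\<in>F. k i j))"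
    by (simp add: sum_distrib_left)
  also have "((\<Sum>i\<in>F. (a i)\<^sup>2 * (\<Sum>j\<in>F. k i j)) + (\<Sum>i\<in>F. (a i)\<^sup>2 * (\<Sum>j\<in>F. k i j))) / 2 \<le> (\<Sum>i\<in>F. (a i)\<^sup>2 * C)"
    using C by (simp, intro sum_mono mult_left_mono) auto
  finally show ?thesis by (simp add: sum_distrib_left mult.commute)
qed

lemma nn_integral_count_space_ge_sum:
  fixes f :: "'i \<Rightarrow> ennreal"
  assumes "finite F" "F \<subseteq> I"
  shows "(\<Sum>i\<in>F. f i) \<le> (\<integral>\<^sup>+i. f i \<partial>count_space I)"
proof -
  have "(\<Sum>i\<in>F. f i) = (\<integral>\<^sup>+i. f i * indicator F i \<partial>count_space I)"
    using assms by (subst nn_integral_count_space'[of F]) auto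
  also have "\<dots> \<le> (\<integral>\<^sup>+i. f i \<partial>count_space I)"
    by (intro nn_integral_mono) (auto simp: indicator_def)
  finally show ?thesis .
qed

text \<open>A large-sieve argument. With \<open>a \<tau>\<close> the sampled values, the sum
  \<open>S\<close> of their squared moduli is the integral of \<open>G\<close> against the
  exponential sum \<open>E\<close> with coefficients \<open>cnj (a \<tau>)\<close>, and
  Cauchy-Schwarz leaves the square integral of \<open>E\<close> over the cell. The cell is majorized
  by a Gaussian, whose Fourier transform makes the exponentials almost orthogonal: the row sums of
  the Gram matrix are bounded by lattice sums of \<open>jw\<close>. The result is that S^2 is at
  most a constant times \<open>S\<close> times the square integral of \<open>G\<close>.\<close>

lemma sampling_inequality:
  fixes \<rho> :: real
  assumes \<rho>: "0 \<le> \<rho>"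
  shows "\<exists>C>0. \<forall>(G :: 'a::euclidean_space \<Rightarrow> complex) \<mu> c F \<zeta>. integrable lborel G \<longrightarrow>
     integrable lborel (\<lambda>x. (norm (G x))\<^sup>2) \<longrightarrow>
     (\<forall>x. x - \<mu> \<notin> unit_cube \<longrightarrow> G x = 0) \<longrightarrow> finite F \<longrightarrow> F \<subseteq> int_lattice \<longrightarrow>
     (\<forall>\<tau>\<in>F. norm (\<zeta> \<tau> - \<tau> - c) \<le> \<rho>) \<longrightarrow>
     (\<Sum>\<tau>\<in>F. (norm (\<integral>x. G x * cis (x \<bullet> \<zeta> \<tau>) \<partial>lborel))\<^sup>2) \<le> C * (\<integral>x. (norm (G x))\<^sup>2 \<partial>lborel)"
proof -
  obtain C0 where C0: "C0 > 0" "\<And>v::'a. (\<integral>\<^sup>+\<nu>. ennreal (jw (\<nu> - v)) \<partial>count_space int_lattice) \<le> ennreal C0"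
    using jw_lattice_sum by blast
  let ?D = "DIM('a)"
  define K where "K = (2 * real ?D) ^ ?D * (2 * (1 + (2 * \<rho>)\<^sup>2)) ^ ?D"
  have K: "K > 0" unfolding K_def by (intro mult_pos_pos zero_less_power add_pos_nonneg) auto
  \<comment> \<open>The factors are, in this order, the majorization of the cell by a Gaussian, the
    Fourier transform of the Gaussian, and the bound for the row sums of the Gram matrix.\<close>
  define C1 where "C1 = exp ((real ?D)\<^sup>2 / 2) * (sqrt (2 * pi) ^ ?D * (K * C0))"
  have C1: "C1 > 0" using K C0 by (simp add: C1_def)
  have main: "(\<Sum>\<tau>\<in>F. (norm (\<integral>x. G x * cis (x \<bullet> \<zeta> \<tau>) \<partial>lborel))\<^sup>2) \<le> C1 * (\<integral>x. (norm (G x))\<^sup>2 \<partial>lborel)"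
    if G: "integrable lborel G" and G2: "integrable lborel (\<lambda>x. (norm (G x))\<^sup>2)"
      and supp: "\<And>x. x - \<mu> \<notin> unit_cube \<Longrightarrow> G x = 0"
      and F: "finite F" "F \<subseteq> int_lattice" and \<zeta>: "\<And>\<tau>. \<tau> \<in> F \<Longrightarrow> norm (\<zeta> \<tau> - \<tau> - c) \<le> \<rho>"
    for G :: "'a \<Rightarrow> complex" and \<mu> c F \<zeta>
  proof -
    have [measurable]: "G \<in> borel_measurable borel" using G by auto
    define a where "a \<tau> = (\<integral>x. G x * cis (x \<bullet> \<zeta> \<tau>) \<partial>lborel)" for \<tau>
    define S where "S = (\<Sum>\<tau>\<in>F. (norm (a \<tau>))\<^sup>2)"
    define E where "E x = (\<Sum>\<tau>\<in>F. cnj (a \<tau>) * cis (x \<bullet> \<zeta> \<tau>))" for x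
    have [measurable]: "E \<in> borel_measurable borel" unfolding E_def by measurable
    have S0: "0 \<le> S" by (auto simp: S_def intro!: sum_nonneg)
    have Gi: "integrable lborel (\<lambda>x. G x * cis (x \<bullet> \<zeta> \<tau>))" for \<tau>
      using integrable_cis_mult[OF G, of "\<lambda>x. x \<bullet> \<zeta> \<tau>"] by (simp add: mult.commute)
    have "complex_of_real S = (\<Sum>\<tau>\<in>F. cnj (a \<tau>) * a \<tau>)"
      by (simp add: S_def complex_norm_square mult.commute del: of_real_power)
    also have "\<dots> = (\<integral>x. (\<Sum>\<tau>\<in>F. cnj (a \<tau>) * (G x * cis (x \<bullet> \<zeta> \<tau>))) \<partial>lborel)"
      unfolding a_def by (subst Bochner_Integration.integral_sum) (auto intro!: integrable_mult_right Gi)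
    also have "\<dots> = (\<integral>x. G x * E x \<partial>lborel)"
      by (simp add: E_def sum_distrib_left mult_ac)
    finally have SE: "complex_of_real S = (\<integral>x. G x * E x \<partial>lborel)" .
    have GE: "integrable lborel (\<lambda>x. G x * E x)"
      unfolding E_def sum_distrib_left mult.left_commute[of "G _"]
      by (intro Bochner_Integration.integrable_sum integrable_mult_right Gi)
    define w where "w x = norm (E x) * indicator unit_cube (x - \<mu>)" for x
    have [measurable]: "w \<in> borel_measurable borel" unfolding w_def by measurable
    have "ennreal S = ennreal (norm (complex_of_real S))" using S0 by simp
    also have "\<dots> \<le> (\<integral>\<^sup>+x. ennreal (norm (G x * E x)) \<partial>lborel)"
      unfolding SE by (rule integral_norm_bound_ennreal[OF GE])
    also have "\<dots> = (\<integral>\<^sup>+x. ennreal (norm (G x)) * ennreal (w x) \<partial>lborel)"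
      using supp by (intro nn_integral_cong) (auto simp: w_def norm_mult ennreal_mult indicator_def)
    finally have "(ennreal S)\<^sup>2 \<le> (\<integral>\<^sup>+x. ennreal (norm (G x)) * ennreal (w x) \<partial>lborel)\<^sup>2"
      by (rule power_mono) auto
    also have "\<dots> \<le> (\<integral>\<^sup>+x. (ennreal (norm (G x)))\<^sup>2 \<partial>lborel) * (\<integral>\<^sup>+x. (ennreal (w x))\<^sup>2 \<partial>lborel)"
      by (rule Cauchy_Schwarz_nn_integral) auto
    also have "(\<integral>\<^sup>+x. (ennreal (norm (G x)))\<^sup>2 \<partial>lborel) = ennreal (\<integral>x. (norm (G x))\<^sup>2 \<partial>lborel)"
      using G2 by (simp add: ennreal_power nn_integral_eq_integral)
    also have "(\<integral>\<^sup>+x. (ennreal (w x))\<^sup>2 \<partial>lborel) \<le> ennreal (C1 * S)"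
    proof -
      define P where "P x = complex_of_real (gauss (x - \<mu>)) * (E x * cnj (E x))" for x
      define p where "p \<tau> \<tau>' x = cnj (a \<tau>) * a \<tau>' * (complex_of_real (gauss (x - \<mu>)) * cis (x \<bullet> (\<zeta> \<tau> - \<zeta> \<tau>')))" for \<tau> \<tau>' x
      have Pp: "P x = (\<Sum>\<tau>\<in>F. \<Sum>\<tau>'\<in>F. p \<tau> \<tau>' x)" for x
      proof -
        have "p \<tau> \<tau>' x = complex_of_real (gauss (x - \<mu>)) * (cnj (a \<tau>) * cis (x \<bullet> \<zeta> \<tau>) * cnj (cnj (a \<tau>') * cis (x \<bullet> \<zeta> \<tau>')))" for \<tau> \<tau>'
        proof -
          have c: "cis (x \<bullet> (\<zeta> \<tau> - \<zeta> \<tau>')) = cis (x \<bullet> \<zeta> \<tau>) * cnj (cis (x \<bullet> \<zeta> \<tau>'))"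
            by (simp add: cis_cnj cis_mult inner_diff_right)
          show ?thesis unfolding p_def c by (simp only: complex_cnj_mult complex_cnj_cnj mult_ac)
        qed
        then show ?thesis
          unfolding P_def E_def cnj_sum sum_product by (simp only: sum_distrib_left)
      qed
      define Q where "Q v x = cis (\<mu> \<bullet> v) * (complex_of_real (gauss x) * cis (x \<bullet> v))" for v x
      have shift: "complex_of_real (gauss (x - \<mu>)) * cis (x \<bullet> v) = Q v (x + - \<mu>)" for x v
        by (simp add: Q_def inner_diff_left cis_mult)
      have gi: "integrable lborel (\<lambda>x. complex_of_real (gauss (x - \<mu>)) * cis (x \<bullet> v))" for v
        unfolding shift integrable_lborel_shift unfolding Q_def by (intro integrable_mult_right integral_gauss)
      have gint: "norm (\<integral>x. complex_of_real (gauss (x - \<mu>)) * cis (x \<bullet> v) \<partial>lborel) = sqrt (2 * pi) ^ ?D * gauss v" for v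
        unfolding shift integral_lborel_shift unfolding Q_def integral_mult_right_zero integral_gauss
        by (simp add: norm_mult norm_power abs_mult)
      have pi': "integrable lborel (p \<tau> \<tau>')" for \<tau> \<tau>' unfolding p_def by (intro integrable_mult_right gi)
      have np: "norm (\<integral>x. p \<tau> \<tau>' x \<partial>lborel) = norm (a \<tau>) * norm (a \<tau>') * (sqrt (2 * pi) ^ ?D * gauss (\<zeta> \<tau> - \<zeta> \<tau>'))" for \<tau> \<tau>'
        unfolding p_def integral_mult_right_zero norm_mult gint by simp
      have Pi: "integrable lborel P" unfolding Pp by (intro Bochner_Integration.integrable_sum pi')
      have Pr: "P x = complex_of_real (gauss (x - \<mu>) * (norm (E x))\<^sup>2)" for x
        unfolding P_def by (simp only: complex_norm_square[symmetric] of_real_mult)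
      have Pri: "integrable lborel (\<lambda>x. gauss (x - \<mu>) * (norm (E x))\<^sup>2)"
        using Pi unfolding Pr by (simp only: complex_of_real_integrable_eq)
      have "(\<integral>x. gauss (x - \<mu>) * (norm (E x))\<^sup>2 \<partial>lborel) \<le> norm (complex_of_real (\<integral>x. gauss (x - \<mu>) * (norm (E x))\<^sup>2 \<partial>lborel))"
        by simp
      also have "\<dots> = norm (\<integral>x. P x \<partial>lborel)" unfolding Pr integral_complex_of_real ..
      also have "\<dots> = norm (\<Sum>\<tau>\<in>F. \<Sum>\<tau>'\<in>F. \<integral>x. p \<tau> \<tau>' x \<partial>lborel)"
        unfolding Pp by (subst Bochner_Integration.integral_sum) (auto simp: pi' intro!: Bochner_Integration.integrable_sum)
      also have "\<dots> \<le> (\<Sum>\<tau>\<in>F. \<Sum>\<tau>'\<in>F. norm (a \<tau>) * norm (a \<tau>') * (sqrt (2 * pi) ^ ?D * gauss (\<zeta> \<tau> - \<zeta> \<tau>')))"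
        unfolding np[symmetric] by (intro order_trans[OF norm_sum] sum_mono order_trans[OF norm_sum] order_refl)
      also have "\<dots> \<le> (sqrt (2 * pi) ^ ?D * (K * C0)) * (\<Sum>\<tau>\<in>F. (norm (a \<tau>))\<^sup>2)"
      proof (rule schur_finite[OF F(1)])
        show "0 \<le> sqrt (2 * pi) ^ ?D * gauss (\<zeta> \<tau> - \<zeta> \<tau>')" for \<tau> \<tau>' by simp
        show "sqrt (2 * pi) ^ ?D * gauss (\<zeta> \<tau> - \<zeta> \<tau>') = sqrt (2 * pi) ^ ?D * gauss (\<zeta> \<tau>' - \<zeta> \<tau>)" for \<tau> \<tau>'
          by (simp add: gauss_def norm_minus_commute)
        fix \<tau> assume \<tau>: "\<tau> \<in> F"
        have "gauss (\<zeta> \<tau> - \<zeta> \<tau>') \<le> K * jw (\<tau>' - \<tau>)" if \<tau>': "\<tau>' \<in> F" for \<tau>'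
        proof -
          \<comment> \<open>Each node is its lattice point plus the common \<open>c\<close> plus an
            error of size at most \<rho>. In a difference \<open>c\<close> cancels, so the total
            error is at most 2 \<rho>.\<close>
          have eq: "(\<zeta> \<tau> - \<zeta> \<tau>') + ((\<zeta> \<tau>' - \<tau>' - c) - (\<zeta> \<tau> - \<tau> - c)) = \<tau> - \<tau>'" by simp
          have "norm ((\<zeta> \<tau>' - \<tau>' - c) - (\<zeta> \<tau> - \<tau> - c)) \<le> 2 * \<rho>"
            using norm_triangle_ineq4[of "\<zeta> \<tau>' - \<tau>' - c" "\<zeta> \<tau> - \<tau> - c"] \<zeta>[OF \<tau>] \<zeta>[OF \<tau>'] by linarith
          from jw_peetre[OF this, of "\<zeta> \<tau> - \<zeta> \<tau>'"]
          have "jw (\<zeta> \<tau> - \<zeta> \<tau>') \<le> (2 * (1 + (2 * \<rho>)\<^sup>2)) ^ ?D * jw (\<tau>' - \<tau>)"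
            unfolding eq using jw_minus[of "\<tau>' - \<tau>"] by simp
          then have "(2 * real ?D) ^ ?D * jw (\<zeta> \<tau> - \<zeta> \<tau>') \<le> (2 * real ?D) ^ ?D * ((2 * (1 + (2 * \<rho>)\<^sup>2)) ^ ?D * jw (\<tau>' - \<tau>))"
            by (intro mult_left_mono) auto
          with exp_le_jw[of "\<zeta> \<tau> - \<zeta> \<tau>'"] show ?thesis unfolding K_def mult.assoc by linarith
        qed
        then have "(\<Sum>\<tau>'\<in>F. sqrt (2 * pi) ^ ?D * gauss (\<zeta> \<tau> - \<zeta> \<tau>')) \<le> (\<Sum>\<tau>'\<in>F. sqrt (2 * pi) ^ ?D * (K * jw (\<tau>' - \<tau>)))"
          by (intro sum_mono mult_left_mono) auto
        also have "\<dots> = sqrt (2 * pi) ^ ?D * (K * (\<Sum>\<tau>'\<in>F. jw (\<tau>' - \<tau>)))"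
          by (simp add: sum_distrib_left)
        also have "(\<Sum>\<tau>'\<in>F. jw (\<tau>' - \<tau>)) \<le> C0"
        proof -
          have "ennreal (\<Sum>\<tau>'\<in>F. jw (\<tau>' - \<tau>)) = (\<Sum>\<tau>'\<in>F. ennreal (jw (\<tau>' - \<tau>)))"
            by (simp add: sum_ennreal jw_nonneg)
          also have "\<dots> \<le> ennreal C0"
            using nn_integral_count_space_ge_sum[OF F] C0(2) by (rule order_trans)
          finally show ?thesis using C0(1) by (simp add: ennreal_le_iff)
        qed
        finally show "(\<Sum>\<tau>'\<in>F. sqrt (2 * pi) ^ ?D * gauss (\<zeta> \<tau> - \<zeta> \<tau>')) \<le> sqrt (2 * pi) ^ ?D * (K * C0)"
          using K by (simp add: mult_left_mono)
      qed
      finally have B: "(\<integral>x. gauss (x - \<mu>) * (norm (E x))\<^sup>2 \<partial>lborel) \<le> (sqrt (2 * pi) ^ ?D * (K * C0)) * S"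
        by (simp only: S_def)
      have "(\<integral>\<^sup>+x. (ennreal (w x))\<^sup>2 \<partial>lborel) \<le> (\<integral>\<^sup>+x. ennreal (exp ((real ?D)\<^sup>2 / 2)) * ennreal (gauss (x - \<mu>) * (norm (E x))\<^sup>2) \<partial>lborel)"
      proof (intro nn_integral_mono)
        fix x
        show "(ennreal (w x))\<^sup>2 \<le> ennreal (exp ((real ?D)\<^sup>2 / 2)) * ennreal (gauss (x - \<mu>) * (norm (E x))\<^sup>2)"
        proof (cases "x - \<mu> \<in> unit_cube")
          case True
          then have "(norm (x - \<mu>))\<^sup>2 \<le> (real ?D)\<^sup>2" by (intro power_mono norm_unit_cube_le) auto
          then have "1 \<le> exp ((real ?D)\<^sup>2 / 2) * gauss (x - \<mu>)" by (simp add: gauss_def exp_add[symmetric])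
          then have "1 * (norm (E x))\<^sup>2 \<le> exp ((real ?D)\<^sup>2 / 2) * gauss (x - \<mu>) * (norm (E x))\<^sup>2"
            by (intro mult_right_mono) auto
          then show ?thesis using True by (simp add: w_def ennreal_power ennreal_mult[symmetric] ennreal_leI mult.assoc)
        qed (simp add: w_def)
      qed
      also have "\<dots> = ennreal (exp ((real ?D)\<^sup>2 / 2)) * ennreal (\<integral>x. gauss (x - \<mu>) * (norm (E x))\<^sup>2 \<partial>lborel)"
        by (subst nn_integral_cmult) (auto simp: nn_integral_eq_integral[OF Pri])
      also have "\<dots> \<le> ennreal (exp ((real ?D)\<^sup>2 / 2)) * ennreal ((sqrt (2 * pi) ^ ?D * (K * C0)) * S)"
        using B by (intro mult_left_mono ennreal_leI) auto
      also have "\<dots> = ennreal (C1 * S)"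
        using K C0 S0 by (simp add: C1_def ennreal_mult[symmetric] mult.assoc)
      finally show ?thesis .
    qed
    finally have "(ennreal S)\<^sup>2 \<le> ennreal (\<integral>x. (norm (G x))\<^sup>2 \<partial>lborel) * ennreal (C1 * S)"
      by (simp add: mult_left_mono)
    then have "ennreal (S\<^sup>2) \<le> ennreal ((\<integral>x. (norm (G x))\<^sup>2 \<partial>lborel) * (C1 * S))"
      using S0 C1 by (simp add: ennreal_power ennreal_mult[symmetric])
    then have "S * S \<le> (C1 * (\<integral>x. (norm (G x))\<^sup>2 \<partial>lborel)) * S"
      using S0 C1 by (subst (asm) ennreal_le_iff) (auto simp: power2_eq_square mult_ac)
    \<comment> \<open>A factor \<open>S\<close> is cancelled; for \<open>S = 0\<close> the claim is
      trivial.\<close>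
    then have "S \<le> C1 * (\<integral>x. (norm (G x))\<^sup>2 \<partial>lborel)"
      using S0 C1 by (cases "S = 0") (auto simp: mult_le_cancel_right)
    then show ?thesis by (simp only: S_def a_def)
  qed
  show ?thesis using C1 main by (intro exI[of _ C1]) blast
qed

section \<open>Weak approximate identities\<close>

lemma cnj_borel_measurable [measurable]:
  assumes [measurable]: "f \<in> borel_measurable M"
  shows "(\<lambda>x. cnj (f x)) \<in> borel_measurable M"
proof -
  have "cnj \<in> borel_measurable borel" by (intro borel_measurable_continuous_onI continuous_intros)
  then show ?thesis using assms measurable_compose by blast
qed

text \<open>The argument with three thirds of \<epsilon>: the translation error of \<open>G\<close>
  is that of \<open>H\<close> plus twice the distance of \<open>G\<close> and \<open>H\<close>,
  since translations preserve the integral. It serves both the passage from measurable to open sets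
  and the passage from simple functions to their limits.\<close>

lemma tendsto_L1_translation_approx:
  fixes G :: "'a::euclidean_space \<Rightarrow> complex"
  assumes G: "integrable lborel G"
    and approx: "\<And>e. e > 0 \<Longrightarrow> \<exists>H. integrable lborel H \<and> (\<integral>x. norm (G x - H x) \<partial>lborel) < e \<and>
       ((\<lambda>n. \<integral>x. norm (H (x + v n) - H x) \<partial>lborel) \<longlonglongrightarrow> 0)"
  shows "(\<lambda>n::nat. \<integral>x. norm (G (x + v n) - G x) \<partial>lborel) \<longlonglongrightarrow> 0"
proof (rule LIMSEQ_I)
  fix e :: real assume e: "0 < e"
  then obtain H where H: "integrable lborel H" and d: "(\<integral>x. norm (G x - H x) \<partial>lborel) < e / 3"
    and lim: "(\<lambda>n. \<integral>x. norm (H (x + v n) - H x) \<partial>lborel) \<longlonglongrightarrow> 0"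
    using approx[of "e/3"] by auto
  obtain N where N: "\<And>n. n \<ge> N \<Longrightarrow> norm ((\<integral>x. norm (H (x + v n) - H x) \<partial>lborel) - 0) < e / 3"
    using LIMSEQ_D[OF lim, of "e/3"] e by auto
  have sh: "integrable lborel (\<lambda>x. F (x + t))" if "integrable lborel F" for F :: "'a \<Rightarrow> complex" and t
    using that by (simp add: integrable_lborel_shift)
  have "norm ((\<integral>x. norm (G (x + v n) - G x) \<partial>lborel) - 0) < e" if n: "n \<ge> N" for n
  proof -
    have i: "integrable lborel (\<lambda>x. norm (G x - H x))" "integrable lborel (\<lambda>x. norm (H (x + v n) - H x))"
      "integrable lborel (\<lambda>x. norm (G (x + v n) - H (x + v n)))"
      using G H sh by (auto intro!: integrable_norm Bochner_Integration.integrable_diff)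
    have "(\<integral>x. norm (G (x + v n) - G x) \<partial>lborel) \<le>
       (\<integral>x. norm (G (x + v n) - H (x + v n)) + norm (H (x + v n) - H x) + norm (G x - H x) \<partial>lborel)"
    proof (rule integral_mono)
      show "integrable lborel (\<lambda>x. norm (G (x + v n) - G x))"
        using G sh by (auto intro!: integrable_norm Bochner_Integration.integrable_diff)
      show "integrable lborel (\<lambda>x. norm (G (x + v n) - H (x + v n)) + norm (H (x + v n) - H x) + norm (G x - H x))"
        using i by (intro Bochner_Integration.integrable_add)
      show "norm (G (x + v n) - G x) \<le> norm (G (x + v n) - H (x + v n)) + norm (H (x + v n) - H x) + norm (G x - H x)" for x
        using norm_triangle_ineq[of "G (x + v n) - H (x + v n)" "H (x + v n) - H x"]
          norm_triangle_ineq[of "G (x + v n) - H x" "H x - G x"] norm_minus_commute[of "H x" "G x"]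
        by simp
    qed
    also have "\<dots> = (\<integral>x. norm (G (x + v n) - H (x + v n)) \<partial>lborel) + (\<integral>x. norm (H (x + v n) - H x) \<partial>lborel) + (\<integral>x. norm (G x - H x) \<partial>lborel)"
      using i by (simp add: Bochner_Integration.integral_add)
    also have "(\<integral>x. norm (G (x + v n) - H (x + v n)) \<partial>lborel) = (\<integral>x. norm (G x - H x) \<partial>lborel)"
      using integral_lborel_shift[of "\<lambda>x. norm (G x - H x)" "v n"] by simp
    finally have "(\<integral>x. norm (G (x + v n) - G x) \<partial>lborel) < e"
      using d N[OF n] by simp
    moreover have "0 \<le> (\<integral>x. norm (G (x + v n) - G x) \<partial>lborel)" by simp
    ultimately show ?thesis by simp
  qed
  then show "\<exists>no. \<forall>n\<ge>no. norm ((\<integral>x. norm (G (x + v n) - G x) \<partial>lborel) - 0) < e" by blast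
qed

text \<open>Induction over integrable functions. A set of finite measure is replaced by an open
  superset of nearly the same measure; for an open \<open>U\<close> the translation error is twice
  the measure of \<open>U\<close> minus twice the measure of the overlap of \<open>U\<close> with
  its translate.\<close>

lemma tendsto_L1_translation:
  fixes G :: "'a::euclidean_space \<Rightarrow> complex"
  assumes G: "integrable lborel G" and v: "v \<longlonglongrightarrow> 0"
  shows "(\<lambda>n::nat. \<integral>x. norm (G (x + v n) - G x) \<partial>lborel) \<longlonglongrightarrow> 0"
  using G
proof (induction rule: integrable_induct)
  case (base A c)
  then have [measurable]: "A \<in> sets borel" and A: "emeasure lborel A < \<infinity>" by auto
  have iA: "integrable lborel (\<lambda>x. indicator A x *\<^sub>R c)"
    using A by (intro integrable_scaleR_left) (simp add: integrable_indicator_iff)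
  show ?case
  proof (rule tendsto_L1_translation_approx[OF iA])
    fix e :: real assume e: "e > 0"
    define e' where "e' = e / (norm c + 1)"
    have e': "e' > 0" "norm c * e' < e"
    proof -
      have "0 < norm c + 1" by (simp add: add_nonneg_pos)
      then show "e' > 0" "norm c * e' < e" using e by (auto simp: e'_def field_simps)
    qed
    obtain U where U: "open U" "A \<subseteq> U" "emeasure lborel (U - A) < ennreal e'"
      using outer_regular_lborel[of A e'] e' by auto
    have [measurable]: "U \<in> sets borel" using U by auto
    have "emeasure lborel U \<le> emeasure lborel A + emeasure lborel (U - A)"
      using U(2) by (subst plus_emeasure) (auto simp: Un_absorb1)
    also have "\<dots> < \<infinity>" using A U(3) by (auto simp: less_top[symmetric] top_unique)
    finally have mU: "emeasure lborel U < \<infinity>" .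
    have iU: "integrable lborel (\<lambda>x. indicator U x :: real)" using mU by (simp add: integrable_indicator_iff)
    have iUs: "integrable lborel (\<lambda>x. indicator U (x + t) :: real)" for t
      using iU integrable_lborel_shift[of "\<lambda>x. indicator U x :: real" t] by simp
    have iUU: "integrable lborel (\<lambda>x. indicator U x * indicator U (x + t) :: real)" for t
      by (rule Bochner_Integration.integrable_bound[OF iU]) (auto simp: indicator_def)
    have iUc: "integrable lborel (\<lambda>x. indicator U x *\<^sub>R c)" using iU by (rule integrable_scaleR_left)
    \<comment> \<open>Inside \<open>U\<close> the overlap converges because \<open>U\<close> is
      open, and outside the factor \<open>indicator U x\<close> vanishes. Working with the overlap
      thus gives convergence also at boundary points of \<open>U\<close>.\<close>
    have "(\<lambda>n. \<integral>x. indicator U x * indicator U (x + v n) \<partial>lborel) \<longlonglongrightarrow> (\<integral>x. indicator U x \<partial>(lborel :: 'a measure) :: real)"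
    proof (rule integral_dominated_convergence[where w="indicator U"])
      show "AE x in lborel. (\<lambda>n. indicator U x * indicator U (x + v n) :: real) \<longlonglongrightarrow> indicator U x"
      proof (rule AE_I2)
        fix x :: 'a
        show "(\<lambda>n. indicator U x * indicator U (x + v n) :: real) \<longlonglongrightarrow> indicator U x"
        proof (cases "x \<in> U")
          case True
          have "(\<lambda>n. x + v n) \<longlonglongrightarrow> x + 0" by (intro tendsto_intros v)
          then have "eventually (\<lambda>n. x + v n \<in> U) sequentially"
            using topological_tendstoD[of "\<lambda>n. x + v n" x sequentially U] U(1) True by auto
          then have "eventually (\<lambda>n. indicator U x * indicator U (x + v n) = (indicator U x :: real)) sequentially"
            by eventually_elim (auto simp: True)
          then show ?thesis by (rule tendsto_eventually)
        qed simp
      qed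
      show "integrable lborel (indicator U :: 'a \<Rightarrow> real)" by (rule iU)
    qed (auto simp: indicator_def)
    then have "(\<lambda>n. norm c * (2 * ((\<integral>x. indicator U x \<partial>(lborel :: 'a measure)) - (\<integral>x. indicator U x * indicator U (x + v n) \<partial>lborel)))) \<longlonglongrightarrow>
       norm c * (2 * ((\<integral>x. indicator U x \<partial>(lborel :: 'a measure)) - (\<integral>x. indicator U x \<partial>(lborel :: 'a measure))))"
      by (intro tendsto_intros)
    moreover have "(\<integral>x. norm (indicator U (x + t) *\<^sub>R c - indicator U x *\<^sub>R c) \<partial>lborel) =
        norm c * (2 * ((\<integral>x. indicator U x \<partial>(lborel :: 'a measure)) - (\<integral>x. indicator U x * indicator U (x + t) \<partial>lborel)))" for t
    proof -
      have "(\<integral>x. norm (indicator U (x + t) *\<^sub>R c - indicator U x *\<^sub>R c) \<partial>lborel) =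
         (\<integral>x. norm c * (indicator U x + indicator U (x + t) - 2 * (indicator U x * indicator U (x + t))) \<partial>lborel)"
        by (intro Bochner_Integration.integral_cong refl) (auto simp: indicator_def)
      also have "\<dots> = norm c * ((\<integral>x. indicator U x \<partial>lborel) + (\<integral>x. indicator U (x + t) \<partial>lborel) - 2 * (\<integral>x. indicator U x * indicator U (x + t) \<partial>lborel))"
        using iU iUs iUU by (simp add: Bochner_Integration.integral_add Bochner_Integration.integral_diff)
      also have "(\<integral>x. indicator U (x + t) \<partial>lborel) = (\<integral>x. indicator U x \<partial>(lborel :: 'a measure) :: real)"
        by (rule integral_lborel_shift)
      finally show ?thesis by (simp add: algebra_simps)
    qed
    ultimately have "(\<lambda>n. \<integral>x. norm (indicator U (x + v n) *\<^sub>R c - indicator U x *\<^sub>R c) \<partial>lborel) \<longlonglongrightarrow> 0" by simp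
    moreover have "(\<integral>x. norm (indicator A x *\<^sub>R c - indicator U x *\<^sub>R c) \<partial>lborel) < e"
    proof -
      have "(\<integral>x. norm (indicator A x *\<^sub>R c - indicator U x *\<^sub>R c) \<partial>lborel) = (\<integral>x. norm c * indicator (U - A) x \<partial>lborel)"
        using U(2) by (intro Bochner_Integration.integral_cong refl) (auto simp: indicator_def)
      also have "\<dots> = norm c * measure lborel (U - A)" by simp
      also have "\<dots> \<le> norm c * e'"
        using U(3) e'(1) by (intro mult_left_mono) (auto simp: measure_def enn2real_leI less_imp_le)
      finally show ?thesis using e'(2) by simp
    qed
    ultimately show "\<exists>H. integrable lborel H \<and> (\<integral>x. norm (indicator A x *\<^sub>R c - H x) \<partial>lborel) < e \<and>
       ((\<lambda>n. \<integral>x. norm (H (x + v n) - H x) \<partial>lborel) \<longlonglongrightarrow> 0)"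
      using iUc by blast
  qed
next
  case (add f g)
  have sh: "integrable lborel (\<lambda>x. F (x + t))" if "integrable lborel F" for F :: "'a \<Rightarrow> complex" and t
    using that by (simp add: integrable_lborel_shift)
  have i: "integrable lborel (\<lambda>x. norm (f (x + t) - f x))" "integrable lborel (\<lambda>x. norm (g (x + t) - g x))" for t
    using add.hyps sh by (auto intro!: integrable_norm Bochner_Integration.integrable_diff)
  show ?case
  proof (rule tendsto_sandwich[OF _ _ tendsto_const])
    show "eventually (\<lambda>n. 0 \<le> (\<integral>x. norm (f (x + v n) + g (x + v n) - (f x + g x)) \<partial>lborel)) sequentially" by simp
    show "eventually (\<lambda>n. (\<integral>x. norm (f (x + v n) + g (x + v n) - (f x + g x)) \<partial>lborel) \<le>
       (\<integral>x. norm (f (x + v n) - f x) \<partial>lborel) + (\<integral>x. norm (g (x + v n) - g x) \<partial>lborel)) sequentially"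
    proof (intro always_eventually allI)
      fix n
      have "(\<integral>x. norm (f (x + v n) + g (x + v n) - (f x + g x)) \<partial>lborel) \<le> (\<integral>x. norm (f (x + v n) - f x) + norm (g (x + v n) - g x) \<partial>lborel)"
      proof (rule integral_mono)
        show "integrable lborel (\<lambda>x. norm (f (x + v n) + g (x + v n) - (f x + g x)))"
          using add.hyps sh by (auto intro!: integrable_norm Bochner_Integration.integrable_diff Bochner_Integration.integrable_add)
        show "norm (f (x + v n) + g (x + v n) - (f x + g x)) \<le> norm (f (x + v n) - f x) + norm (g (x + v n) - g x)" for x
          using norm_triangle_ineq[of "f (x + v n) - f x" "g (x + v n) - g x"] by (simp add: algebra_simps)
      qed (use i in auto)
      then show "(\<integral>x. norm (f (x + v n) + g (x + v n) - (f x + g x)) \<partial>lborel) \<le>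
       (\<integral>x. norm (f (x + v n) - f x) \<partial>lborel) + (\<integral>x. norm (g (x + v n) - g x) \<partial>lborel)"
        using i by (simp add: Bochner_Integration.integral_add)
    qed
    show "(\<lambda>n. (\<integral>x. norm (f (x + v n) - f x) \<partial>lborel) + (\<integral>x. norm (g (x + v n) - g x) \<partial>lborel)) \<longlonglongrightarrow> 0"
      using tendsto_add[OF add.IH] by simp
  qed
next
  case (lim f s)
  show ?case
  proof (rule tendsto_L1_translation_approx[OF lim.hyps(4)])
    fix e :: real assume e: "e > 0"
    have [measurable]: "f \<in> borel_measurable borel" "\<And>i. s i \<in> borel_measurable borel" using lim.hyps(1,4) by auto
    \<comment> \<open>The simple functions satisfy \<open>norm (s i x) \<le> 2 * norm (f x)\<close>,
      which explains the dominating function.\<close>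
    have "(\<lambda>i. \<integral>x. norm (f x - s i x) \<partial>lborel) \<longlonglongrightarrow> (\<integral>x. 0 \<partial>(lborel :: 'a measure))"
    proof (rule integral_dominated_convergence[where w="\<lambda>x. 3 * norm (f x)"])
      show "AE x in lborel. (\<lambda>i. norm (f x - s i x)) \<longlonglongrightarrow> 0"
      proof (rule AE_I2)
        fix x
        have "(\<lambda>i. norm (f x - s i x)) \<longlonglongrightarrow> norm (f x - f x)"
          using lim.hyps(2) by (intro tendsto_intros) auto
        then show "(\<lambda>i. norm (f x - s i x)) \<longlonglongrightarrow> 0" by simp
      qed
      show "AE x in lborel. norm (norm (f x - s i x)) \<le> 3 * norm (f x)" for i
      proof (rule AE_I2)
        fix x
        show "norm (norm (f x - s i x)) \<le> 3 * norm (f x)"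
          using norm_triangle_ineq4[of "f x" "s i x"] lim.hyps(3)[of x i] by simp
      qed
    qed (use lim.hyps(4) in auto)
    then have "(\<lambda>i. \<integral>x. norm (f x - s i x) \<partial>lborel) \<longlonglongrightarrow> 0" by simp
    from LIMSEQ_D[OF this e] obtain i where "norm ((\<integral>x. norm (f x - s i x) \<partial>lborel) - 0) < e" by blast
    then show "\<exists>H. integrable lborel H \<and> (\<integral>x. norm (f x - H x) \<partial>lborel) < e \<and>
       ((\<lambda>n. \<integral>x. norm (H (x + v n) - H x) \<partial>lborel) \<longlonglongrightarrow> 0)"
      using lim.IH[of i] lim.hyps(1) by auto
  qed
qed

lemma integrable_bounded_mult:
  fixes G :: "'a::euclidean_space \<Rightarrow> complex"
  assumes [measurable]: "\<sigma> \<in> borel_measurable borel" and bdd: "\<And>x. norm (\<sigma> x) \<le> M"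
    and G: "integrable lborel G"
  shows "integrable lborel (\<lambda>x. \<sigma> x * G x)"
proof (rule Bochner_Integration.integrable_bound[OF integrable_mult_right[OF G, of "of_real M"]])
  have "0 \<le> M" using bdd[of undefined] norm_ge_zero order_trans by blast
  then show "AE x in lborel. norm (\<sigma> x * G x) \<le> norm (complex_of_real M * G x)"
    using bdd by (intro AE_I2) (auto simp: norm_mult intro!: mult_right_mono)
qed (use G in measurable)

text \<open>Only this weak form of the convergence of approximate identities is available for a merely
  bounded \<open>\<sigma>\<close>.\<close>

lemma weak_approximate_identity:
  fixes \<sigma> G \<Theta> :: "'a::euclidean_space \<Rightarrow> complex"
  assumes [measurable]: "\<sigma> \<in> borel_measurable borel" and bdd: "\<And>x. norm (\<sigma> x) \<le> M"
    and G: "integrable lborel G" and \<Theta>: "integrable lborel \<Theta>"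
  shows "(\<lambda>k::nat. \<integral>w. \<Theta> w * (\<integral>y. \<sigma> y * G (y + w /\<^sub>R 2 ^ k) \<partial>lborel) \<partial>lborel) \<longlonglongrightarrow>
     (\<integral>w. \<Theta> w \<partial>lborel) * (\<integral>y. \<sigma> y * G y \<partial>lborel)"
proof -
  have [measurable]: "G \<in> borel_measurable borel" "\<Theta> \<in> borel_measurable borel" using G \<Theta> by auto
  have M: "0 \<le> M" using bdd[of undefined] norm_ge_zero order_trans by blast
  have Gs: "integrable lborel (\<lambda>y. G (y + t))" for t using G by (simp add: integrable_lborel_shift)
  have i: "integrable lborel (\<lambda>y. \<sigma> y * G (y + t))" for t
    by (rule integrable_bounded_mult[OF _ bdd Gs]) measurable
  have i0: "integrable lborel (\<lambda>y. \<sigma> y * G y)" using i[of 0] by simp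
  have lim: "(\<lambda>k. \<integral>y. \<sigma> y * G (y + w /\<^sub>R 2 ^ k) \<partial>lborel) \<longlonglongrightarrow> (\<integral>y. \<sigma> y * G y \<partial>lborel)" for w
  proof (rule Lim_transform_bound[THEN LIM_zero_cancel])
    have "(\<lambda>k. inverse ((2::real) ^ k)) \<longlonglongrightarrow> 0"
      by (rule LIMSEQ_inverse_realpow_zero) simp
    then have "(\<lambda>k. inverse ((2::real) ^ k) *\<^sub>R w) \<longlonglongrightarrow> 0 *\<^sub>R w" by (intro tendsto_intros)
    then have "(\<lambda>k. w /\<^sub>R 2 ^ k) \<longlonglongrightarrow> 0" by simp
    from tendsto_mult_left[OF tendsto_L1_translation[OF G this], of M]
    show "(\<lambda>k. M * (\<integral>y. norm (G (y + w /\<^sub>R 2 ^ k) - G y) \<partial>lborel)) \<longlonglongrightarrow> 0" by simp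
    show "\<forall>\<^sub>F k in sequentially. norm ((\<integral>y. \<sigma> y * G (y + w /\<^sub>R 2 ^ k) \<partial>lborel) - (\<integral>y. \<sigma> y * G y \<partial>lborel)) \<le>
       norm (M * (\<integral>y. norm (G (y + w /\<^sub>R 2 ^ k) - G y) \<partial>lborel))"
    proof (intro always_eventually allI)
      fix k
      let ?t = "w /\<^sub>R 2 ^ k"
      have "norm ((\<integral>y. \<sigma> y * G (y + ?t) \<partial>lborel) - (\<integral>y. \<sigma> y * G y \<partial>lborel)) = norm (\<integral>y. \<sigma> y * G (y + ?t) - \<sigma> y * G y \<partial>lborel)"
        by (simp add: Bochner_Integration.integral_diff i i0)
      also have "\<dots> \<le> (\<integral>y. norm (\<sigma> y * G (y + ?t) - \<sigma> y * G y) \<partial>lborel)" by (rule integral_norm_bound)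
      also have "\<dots> \<le> (\<integral>y. M * norm (G (y + ?t) - G y) \<partial>lborel)"
      proof (rule integral_mono)
        show "integrable lborel (\<lambda>y. norm (\<sigma> y * G (y + ?t) - \<sigma> y * G y))"
          by (intro integrable_norm Bochner_Integration.integrable_diff i i0)
        show "integrable lborel (\<lambda>y. M * norm (G (y + ?t) - G y))"
          by (intro integrable_mult_right integrable_norm Bochner_Integration.integrable_diff Gs G)
        show "norm (\<sigma> y * G (y + ?t) - \<sigma> y * G y) \<le> M * norm (G (y + ?t) - G y)" for y
          unfolding right_diff_distrib[symmetric] norm_mult by (intro mult_right_mono bdd) auto
      qed
      also have "\<dots> = norm (M * (\<integral>y. norm (G (y + ?t) - G y) \<partial>lborel))"
        using M by (simp add: abs_mult)
      finally show "norm ((\<integral>y. \<sigma> y * G (y + ?t) \<partial>lborel) - (\<integral>y. \<sigma> y * G y \<partial>lborel)) \<le>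
       norm (M * (\<integral>y. norm (G (y + ?t) - G y) \<partial>lborel))" .
    qed
  qed
  have bound: "norm (\<integral>y. \<sigma> y * G (y + t) \<partial>lborel) \<le> M * (\<integral>y. norm (G y) \<partial>lborel)" for t
  proof -
    have "norm (\<integral>y. \<sigma> y * G (y + t) \<partial>lborel) \<le> (\<integral>y. norm (\<sigma> y * G (y + t)) \<partial>lborel)" by (rule integral_norm_bound)
    also have "\<dots> \<le> (\<integral>y. M * norm (G (y + t)) \<partial>lborel)"
      using i Gs bdd by (intro integral_mono integrable_norm integrable_mult_right) (auto simp: norm_mult intro!: mult_right_mono)
    also have "\<dots> = M * (\<integral>y. norm (G y) \<partial>lborel)"
      using integral_lborel_shift[of "\<lambda>y. norm (G y)" t] by simp
    finally show ?thesis .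
  qed
  have "(\<lambda>k. \<integral>w. \<Theta> w * (\<integral>y. \<sigma> y * G (y + w /\<^sub>R 2 ^ k) \<partial>lborel) \<partial>lborel) \<longlonglongrightarrow>
     (\<integral>w. \<Theta> w * (\<integral>y. \<sigma> y * G y \<partial>lborel) \<partial>lborel)"
  proof (rule integral_dominated_convergence[where w="\<lambda>w. norm (\<Theta> w) * (M * (\<integral>y. norm (G y) \<partial>lborel))"])
    show "integrable lborel (\<lambda>w. norm (\<Theta> w) * (M * (\<integral>y. norm (G y) \<partial>lborel)))"
      by (intro integrable_mult_left integrable_norm \<Theta>)
    show "AE w in lborel. (\<lambda>k. \<Theta> w * (\<integral>y. \<sigma> y * G (y + w /\<^sub>R 2 ^ k) \<partial>lborel)) \<longlonglongrightarrow> \<Theta> w * (\<integral>y. \<sigma> y * G y \<partial>lborel)"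
      by (intro AE_I2 tendsto_mult tendsto_const lim)
    show "AE w in lborel. norm (\<Theta> w * (\<integral>y. \<sigma> y * G (y + w /\<^sub>R 2 ^ k) \<partial>lborel)) \<le> norm (\<Theta> w) * (M * (\<integral>y. norm (G y) \<partial>lborel))" for k
      by (intro AE_I2) (auto simp: norm_mult intro!: mult_left_mono bound)
  qed measurable
  then show ?thesis by (simp only: integral_mult_left_zero)
qed

text \<open>Fubini in two directions. The first identity moves the kernel from \<sigma> to the test
  function; the second writes the pairing as a \<open>K\<close>-average of pairings with translates
  of \<open>G\<close>, the shape to which approximate identities apply.\<close>

lemma convolution_pairing:
  fixes \<sigma> G K :: "'a::euclidean_space \<Rightarrow> complex"
  assumes [measurable]: "\<sigma> \<in> borel_measurable borel" and bdd: "\<And>x. norm (\<sigma> x) \<le> M"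
    and G: "integrable lborel G" and K: "integrable lborel K"
  shows "(\<integral>z. (\<integral>y. K (z - y) * \<sigma> y \<partial>lborel) * G z \<partial>lborel) = (\<integral>y. \<sigma> y * (\<integral>z. K (z - y) * G z \<partial>lborel) \<partial>lborel)"
    and "(\<integral>z. (\<integral>y. K (z - y) * \<sigma> y \<partial>lborel) * G z \<partial>lborel) = (\<integral>w. K w * (\<integral>y. \<sigma> y * G (y + w) \<partial>lborel) \<partial>lborel)"
    and "integrable lborel (\<lambda>y. \<integral>z. K (z - y) * G z \<partial>lborel)"
proof -
  have [measurable]: "G \<in> borel_measurable borel" "K \<in> borel_measurable borel" using G K by auto
  have M: "0 \<le> M" using bdd[of undefined] norm_ge_zero order_trans by blast
  have Kr: "integrable lborel (\<lambda>y. K (z - y))" for z using K by (simp add: integrable_lborel_reflect)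
  have int: "integrable (lborel \<Otimes>\<^sub>M lborel) (\<lambda>(z, y). K (z - y) * G z)"
  proof (rule lborel_pair.Fubini_integrable)
    have "(\<integral>y. norm (K (z - y) * G z) \<partial>lborel) = (\<integral>y. norm (K y) \<partial>lborel) * norm (G z)" for z
      using integral_lborel_reflect[of "\<lambda>y. norm (K y)" z] by (simp add: norm_mult)
    then show "integrable lborel (\<lambda>x. \<integral>y. norm (case (x, y) of (z, y) \<Rightarrow> K (z - y) * G z) \<partial>lborel)"
      using G by simp
    show "AE x in lborel. integrable lborel (\<lambda>y. case (x, y) of (z, y) \<Rightarrow> K (z - y) * G z)"
      using Kr by simp
  qed measurable
  have int2: "integrable (lborel \<Otimes>\<^sub>M lborel) (\<lambda>(z, y). \<sigma> y * (K (z - y) * G z))"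
    by (rule Bochner_Integration.integrable_bound[OF integrable_mult_right[OF int, of "of_real M"]])
       (measurable, auto simp: norm_mult M case_prod_unfold intro!: mult_right_mono bdd AE_I2)
  show "integrable lborel (\<lambda>y. \<integral>z. K (z - y) * G z \<partial>lborel)"
    by (rule lborel_pair.integrable_snd[OF int])
  have "(\<integral>z. (\<integral>y. K (z - y) * \<sigma> y \<partial>lborel) * G z \<partial>lborel) = (\<integral>z. (\<integral>y. \<sigma> y * (K (z - y) * G z) \<partial>lborel) \<partial>lborel)"
    unfolding integral_mult_left_zero[symmetric] by (simp add: mult_ac)
  also have "\<dots> = (\<integral>y. (\<integral>z. \<sigma> y * (K (z - y) * G z) \<partial>lborel) \<partial>lborel)"
    by (rule lborel_pair.Fubini_integral[OF int2, symmetric])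
  finally show 1: "(\<integral>z. (\<integral>y. K (z - y) * \<sigma> y \<partial>lborel) * G z \<partial>lborel) = (\<integral>y. \<sigma> y * (\<integral>z. K (z - y) * G z \<partial>lborel) \<partial>lborel)"
    by simp
  have s: "(\<integral>z. K (z - y) * G z \<partial>lborel) = (\<integral>w. K w * G (y + w) \<partial>lborel)" for y
    using integral_lborel_shift[of "\<lambda>z. K (z - y) * G z" y] by (simp add: add.commute)
  have int3: "integrable (lborel \<Otimes>\<^sub>M lborel) (\<lambda>(w, y). K w * (\<sigma> y * G (y + w)))"
  proof (rule lborel_pair.Fubini_integrable)
    have Gs: "integrable lborel (\<lambda>y. G (y + t))" for t using G by (simp add: integrable_lborel_shift)
    have i: "integrable lborel (\<lambda>y. \<sigma> y * G (y + t))" for t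
      by (rule integrable_bounded_mult[OF _ bdd Gs]) measurable
    then show "AE x in lborel. integrable lborel (\<lambda>y. case (x, y) of (w, y) \<Rightarrow> K w * (\<sigma> y * G (y + w)))"
      by simp
    show "integrable lborel (\<lambda>x. \<integral>y. norm (case (x, y) of (w, y) \<Rightarrow> K w * (\<sigma> y * G (y + w))) \<partial>lborel)"
    proof (rule Bochner_Integration.integrable_bound[OF integrable_mult_right[OF K, of "of_real (M * (\<integral>y. norm (G y) \<partial>lborel))"]])
      show "AE x in lborel. norm (\<integral>y. norm (case (x, y) of (w, y) \<Rightarrow> K w * (\<sigma> y * G (y + w))) \<partial>lborel) \<le>
         norm (complex_of_real (M * (\<integral>y. norm (G y) \<partial>lborel)) * K x)"
      proof (rule AE_I2)
        fix x
        have "(\<integral>y. norm (\<sigma> y * G (y + x)) \<partial>lborel) \<le> (\<integral>y. M * norm (G (y + x)) \<partial>lborel)"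
          using i Gs bdd by (intro integral_mono integrable_norm integrable_mult_right) (auto simp: norm_mult intro!: mult_right_mono)
        also have "\<dots> = M * (\<integral>y. norm (G y) \<partial>lborel)"
          using integral_lborel_shift[of "\<lambda>y. norm (G y)" x] by simp
        finally have "norm (K x) * (\<integral>y. norm (\<sigma> y * G (y + x)) \<partial>lborel) \<le> norm (K x) * (M * (\<integral>y. norm (G y) \<partial>lborel))"
          by (intro mult_left_mono) auto
        then show "norm (\<integral>y. norm (case (x, y) of (w, y) \<Rightarrow> K w * (\<sigma> y * G (y + w))) \<partial>lborel) \<le>
         norm (complex_of_real (M * (\<integral>y. norm (G y) \<partial>lborel)) * K x)"
          using M by (simp add: norm_mult[of "K x"] norm_mult[of "of_real _"] abs_mult mult_ac)
      qed
    qed measurable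
  qed measurable
  have "(\<integral>y. \<sigma> y * (\<integral>z. K (z - y) * G z \<partial>lborel) \<partial>lborel) = (\<integral>y. (\<integral>w. K w * (\<sigma> y * G (y + w)) \<partial>lborel) \<partial>lborel)"
    unfolding s integral_mult_right_zero[symmetric] by (simp add: mult_ac)
  also have "\<dots> = (\<integral>w. (\<integral>y. K w * (\<sigma> y * G (y + w)) \<partial>lborel) \<partial>lborel)"
    by (rule lborel_pair.Fubini_integral[OF int3])
  finally show "(\<integral>z. (\<integral>y. K (z - y) * \<sigma> y \<partial>lborel) * G z \<partial>lborel) = (\<integral>w. K w * (\<integral>y. \<sigma> y * G (y + w) \<partial>lborel) \<partial>lborel)"
    unfolding 1 by simp
qed

text \<open>Dilated Gaussians form an approximate identity. Their convolutions with \<open>w\<close>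
  vanish by assumption, so in the limit \<open>w\<close> pairs to 0 with every integrable
  function.\<close>

lemma AE_zero_if_gauss_orthogonal:
  fixes w :: "'a::euclidean_space \<Rightarrow> complex"
  assumes [measurable]: "w \<in> borel_measurable borel" and bdd: "\<And>x. norm (w x) \<le> M"
    and orth: "\<And>a z. a > 0 \<Longrightarrow> (\<integral>y. w y * complex_of_real (gauss (a *\<^sub>R (y - z))) \<partial>lborel) = 0"
  shows "AE x in lborel. w x = 0"
proof -
  have gi: "integrable lborel (\<lambda>x::'a. complex_of_real (gauss x))"
    by (intro integrable_of_real integrable_gauss)
  have *: "(\<integral>y. w y * G y \<partial>lborel) = 0" if G: "integrable lborel G" for G
  proof -
    have z: "(\<integral>v. complex_of_real (gauss v) * (\<integral>y. w y * G (y + v /\<^sub>R 2 ^ k) \<partial>lborel) \<partial>lborel) = 0" for k :: nat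
    proof -
      \<comment> \<open>The Gaussian dilated to width \<open>2 ^ -k\<close> with its mass preserved;
        convolving \<open>w\<close> with it evaluates exactly the pairings that vanish by
        assumption.\<close>
      define K where "K x = 2 ^ (k * DIM('a)) * complex_of_real (gauss (2 ^ k *\<^sub>R x))" for x :: 'a
      have K: "integrable lborel K"
        unfolding K_def using integrable_lborel_affine[OF gi, of "2^k" 0] by simp
      have "(\<integral>v. complex_of_real (gauss v) * (\<integral>y. w y * G (y + v /\<^sub>R 2 ^ k) \<partial>lborel) \<partial>lborel) =
         (\<integral>v. K v * (\<integral>y. w y * G (y + v) \<partial>lborel) \<partial>lborel)"
        by (subst integral_lborel_affine[of "2^k" _ 0])
           (simp_all add: K_def power_mult scaleR_conv_of_real flip: integral_mult_right_zero, simp add: mult_ac)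
      also have "\<dots> = (\<integral>z. (\<integral>y. K (z - y) * w y \<partial>lborel) * G z \<partial>lborel)"
        by (rule convolution_pairing(2)[OF _ bdd G K, symmetric]) measurable
      also have "(\<lambda>z. \<integral>y. K (z - y) * w y \<partial>lborel) = (\<lambda>z. 0)"
      proof
        fix z
        have "(\<integral>y. K (z - y) * w y \<partial>lborel) = (\<integral>y. 2 ^ (k * DIM('a)) * (w y * complex_of_real (gauss (2 ^ k *\<^sub>R (y - z)))) \<partial>lborel)"
          by (intro Bochner_Integration.integral_cong refl) (simp add: K_def gauss_def norm_minus_commute)
        also have "\<dots> = 0" using orth[of "2^k" z] by simp
        finally show "(\<integral>y. K (z - y) * w y \<partial>lborel) = 0" .
      qed
      finally show ?thesis by simp
    qed
    have "(\<integral>v. complex_of_real (gauss v) \<partial>(lborel :: 'a measure)) * (\<integral>y. w y * G y \<partial>lborel) = 0"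
      using weak_approximate_identity[OF assms(1) bdd G gi] unfolding z
      by (rule LIMSEQ_unique[OF tendsto_const, symmetric])
    moreover have "(\<integral>v. complex_of_real (gauss v) \<partial>(lborel :: 'a measure)) \<noteq> 0"
      by (simp add: integral_complex_of_real integral_gauss_real)
    ultimately show ?thesis by simp
  qed
  have n: "AE x in lborel. x \<in> ball 0 (real n) \<longrightarrow> w x = 0" for n :: nat
  proof -
    \<comment> \<open>For this \<open>G\<close> the pairing is the integral of the squared modulus
      of \<open>w\<close> over a ball; restricting to a ball keeps \<open>G\<close>
      integrable.\<close>
    define G where "G x = cnj (w x) * indicator (ball 0 (real n)) x" for x
    have iB: "integrable lborel (\<lambda>x::'a. indicator (ball 0 (real n)) x :: complex)"
    proof -
      have "integrable lborel (\<lambda>x::'a. complex_of_real (indicator (ball 0 (real n)) x))"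
        by (intro integrable_of_real integrable_real_indicator emeasure_bounded_finite) auto
      then show ?thesis by (simp add: indicator_def of_bool_def if_distrib cong: if_cong)
    qed
    have G: "integrable lborel G"
      unfolding G_def by (rule integrable_bounded_mult[where M=M]) (use bdd iB in \<open>auto intro!: cnj_borel_measurable\<close>)
    have wG: "integrable lborel (\<lambda>x. w x * G x)" by (rule integrable_bounded_mult[OF _ bdd G]) measurable
    have eq: "w x * G x = complex_of_real ((norm (w x))\<^sup>2 * indicator (ball 0 (real n)) x)" for x
      unfolding G_def by (simp add: complex_norm_square mult.assoc[symmetric] indicator_def del: of_real_power)
    have i: "integrable lborel (\<lambda>x. (norm (w x))\<^sup>2 * indicator (ball 0 (real n)) x)"
      using wG unfolding eq by (simp only: complex_of_real_integrable_eq)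
    have "complex_of_real (\<integral>x. (norm (w x))\<^sup>2 * indicator (ball 0 (real n)) x \<partial>lborel) = 0"
      using *[OF G] unfolding eq integral_complex_of_real .
    then have "(\<integral>x. (norm (w x))\<^sup>2 * indicator (ball 0 (real n)) x \<partial>lborel) = 0" by simp
    then have "AE x in lborel. (norm (w x))\<^sup>2 * indicator (ball 0 (real n)) x = 0"
      using i by (subst (asm) integral_nonneg_eq_0_iff_AE) auto
    then show ?thesis by eventually_elim (auto simp: indicator_def)
  qed
  then have "AE x in lborel. \<forall>n::nat. x \<in> ball 0 (real n) \<longrightarrow> w x = 0"
    by (intro AE_all_countable[THEN iffD2] allI)
  then show ?thesis
  proof eventually_elim
    case (elim x)
    obtain n :: nat where "norm x < real n" using reals_Archimedean2 by blast
    then show ?case using elim by (auto simp: dist_norm)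
  qed
qed

section \<open>Schwartz functions\<close>

lemma iter_pderiv_pderiv_dir: "iter_pderiv bs (pderiv_dir b f) = iter_pderiv (bs @ [b]) f"
  by (simp add: iter_pderiv_def)

lemma schwartz_pderiv_dir:
  assumes "f \<in> schwartz" "b \<in> Basis"
  shows "pderiv_dir b f \<in> schwartz"
  unfolding schwartz_def
proof (intro CollectI ballI)
  fix bs :: "'a list" assume "bs \<in> lists Basis"
  then have "bs @ [b] \<in> lists Basis" using assms(2) by auto
  with assms(1) show "(\<forall>x. iter_pderiv bs (pderiv_dir b f) differentiable at x) \<and>
      (\<forall>m. \<exists>C. \<forall>x. norm x ^ m * norm (iter_pderiv bs (pderiv_dir b f) x) \<le> C)"
    unfolding iter_pderiv_pderiv_dir by (auto simp: schwartz_def)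
qed

lemma schwartz_differentiable:
  assumes "f \<in> schwartz" shows "f differentiable (at x)"
proof -
  have "[] \<in> lists (Basis :: 'a set)" by simp
  with assms have "iter_pderiv [] f differentiable (at x)" unfolding schwartz_def by blast
  then show ?thesis by (simp add: iter_pderiv_def)
qed

lemma schwartz_moment:
  assumes "f \<in> schwartz" shows "\<exists>C. \<forall>x. norm x ^ m * norm (f x) \<le> C"
proof -
  have "[] \<in> lists (Basis :: 'a set)" by simp
  with assms have "\<exists>C. \<forall>x. norm x ^ m * norm (iter_pderiv [] f x) \<le> C" unfolding schwartz_def by blast
  then show ?thesis by (simp add: iter_pderiv_def)
qed

lemma schwartz_continuous: "f \<in> schwartz \<Longrightarrow> continuous_on UNIV f"
  using schwartz_differentiable differentiable_imp_continuous_within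
  by (metis continuous_at_imp_continuous_on)

lemma schwartz_borel: "f \<in> schwartz \<Longrightarrow> f \<in> borel_measurable borel"
  by (intro borel_measurable_continuous_onI schwartz_continuous)

text \<open>With \<open>t\<close> the squared norm and M = DIM L one has (1 + t)^M \<le> 2^M (1 +
  t^M), so the moments of orders 0 and 2 M give the claim.\<close>

lemma decay_from_moments:
  fixes g :: "'a::euclidean_space \<Rightarrow> complex"
  assumes "\<And>m::nat. \<exists>C. \<forall>x. norm x ^ m * norm (g x) \<le> C"
  shows "\<exists>C>0. \<forall>x. norm (g x) \<le> C * jw x ^ L"
proof -
  let ?M = "DIM('a) * L"
  obtain C0 where C0: "\<And>x. norm (g x) \<le> C0" using assms[of 0] by auto
  obtain C1 where C1: "\<And>x. norm x ^ (2 * ?M) * norm (g x) \<le> C1" using assms by blast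
  let ?C = "2 ^ ?M * (\<bar>C0\<bar> + \<bar>C1\<bar> + 1)"
  have "norm (g x) \<le> ?C * jw x ^ L" for x
  proof -
    let ?t = "(norm x)\<^sup>2"
    have "(1 + ?t) ^ ?M \<le> (2 * max 1 ?t) ^ ?M" by (intro power_mono) auto
    also have "\<dots> = 2 ^ ?M * max 1 ?t ^ ?M" by (simp add: power_mult_distrib)
    also have "\<dots> \<le> 2 ^ ?M * (1 + ?t ^ ?M)"
      by (intro mult_left_mono) (auto simp: max_def)
    finally have "(1 + ?t) ^ ?M * norm (g x) \<le> 2 ^ ?M * (1 + ?t ^ ?M) * norm (g x)"
      by (intro mult_right_mono) auto
    also have "\<dots> = 2 ^ ?M * (norm (g x) + norm x ^ (2 * ?M) * norm (g x))"
    proof -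
      have "?t ^ ?M = norm x ^ (2 * ?M)" by (rule power_mult[symmetric])
      then show ?thesis by (simp only: distrib_left distrib_right mult_1_right mult.assoc)
    qed
    also have "\<dots> \<le> ?C"
      using C0[of x] C1[of x] by (intro mult_left_mono) auto
    finally have *: "(1 + ?t) ^ ?M * norm (g x) \<le> ?C" .
    have "0 < (1 + ?t) ^ ?M" by (intro zero_less_power add_pos_nonneg) auto
    then have "norm (g x) \<le> ?C * inverse ((1 + ?t) ^ ?M)" using * by (simp add: field_simps)
    also have "inverse ((1 + ?t) ^ ?M) = jw x ^ L" by (simp add: jw_def power_inverse power_mult)
    finally show ?thesis .
  qed
  moreover have "?C > 0" by (intro mult_pos_pos) auto
  ultimately show ?thesis by blast
qed

lemma schwartz_decay: "f \<in> schwartz \<Longrightarrow> \<exists>C>0. \<forall>x. norm (f x) \<le> C * jw x ^ L"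
  by (intro decay_from_moments schwartz_moment)

lemma integrable_if_le_jw:
  fixes g :: "'a::euclidean_space \<Rightarrow> complex"
  assumes [measurable]: "g \<in> borel_measurable borel" and "\<And>x. norm (g x) \<le> C * jw x"
  shows "integrable lborel g"
  by (rule Bochner_Integration.integrable_bound[OF integrable_mult_right[OF integrable_jw, of C]])
     (use assms(2) order_trans[OF _ abs_ge_self] in auto)

lemma schwartz_integrable: "f \<in> schwartz \<Longrightarrow> integrable lborel f"
  using schwartz_decay[of f 1] integrable_if_le_jw[OF schwartz_borel, of f] by auto

lemma schwartz_bounded: "f \<in> schwartz \<Longrightarrow> \<exists>C. \<forall>x. norm (f x) \<le> C"
  using schwartz_decay[of f 0] by auto

section \<open>Derivatives and decay of Fourier transforms\<close>

text \<open>The substitute for integration by parts. The integral of \<open>F (x + b) - F x\<close>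
  over \<open>x\<close> is 0 by translation invariance; by the fundamental theorem along the
  segment, Fubini and translation invariance once more, it is also the integral of the
  derivative.\<close>

lemma integral_directional_derivative_zero:
  fixes F :: "'a::euclidean_space \<Rightarrow> complex"
  assumes der: "\<And>x. (F has_derivative F' x) (at x)" and cont: "continuous_on UNIV (\<lambda>x. F' x b)"
    and F: "integrable lborel F" and D: "integrable lborel (\<lambda>x. F' x b)"
  shows "(\<integral>x. F' x b \<partial>lborel) = 0"
proof -
  have [measurable]: "(\<lambda>x. F' x b) \<in> borel_measurable borel" using D by auto
  have ftc: "(\<integral>s. indicator {0..1::real} s *\<^sub>R F' (x + s *\<^sub>R b) b \<partial>lborel) = F (x + b) - F x" for x
  proof -
    have "(\<integral>s. indicator {0..1::real} s *\<^sub>R F' (x + s *\<^sub>R b) b \<partial>lborel) = F (x + 1 *\<^sub>R b) - F (x + 0 *\<^sub>R b)"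
    proof (rule integral_FTC_atLeastAtMost[where F="\<lambda>s. F (x + s *\<^sub>R b)"])
      fix s :: real
      have "((\<lambda>s. F (x + s *\<^sub>R b)) has_derivative (\<lambda>h. F' (x + s *\<^sub>R b) (h *\<^sub>R b))) (at s within {0..1})"
        by (rule has_derivative_compose[OF _ der]) (auto intro!: derivative_eq_intros)
      moreover have "F' (x + s *\<^sub>R b) (h *\<^sub>R b) = h *\<^sub>R F' (x + s *\<^sub>R b) b" for h
        using has_derivative_bounded_linear[OF der] by (simp add: linear_simps)
      ultimately show "((\<lambda>s. F (x + s *\<^sub>R b)) has_vector_derivative F' (x + s *\<^sub>R b) b) (at s within {0..1})"
        by (simp add: has_vector_derivative_def)
      show "continuous_on {0..1} (\<lambda>s. F' (x + s *\<^sub>R b) b)"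
        by (rule continuous_on_compose2[OF cont]) (auto intro!: continuous_intros)
    qed simp
    then show ?thesis by simp
  qed
  have int: "integrable (lborel \<Otimes>\<^sub>M lborel) (\<lambda>(s::real, x). indicator {0..1} s *\<^sub>R F' (x + s *\<^sub>R b) b)"
  proof (rule lborel_pair.Fubini_integrable)
    have Ds: "integrable lborel (\<lambda>x. F' (x + t) b)" for t using D by (simp add: integrable_lborel_shift[of "\<lambda>x. F' x b"])
    have "(\<integral>x. norm (F' (x + t) b) \<partial>lborel) = (\<integral>x. norm (F' x b) \<partial>lborel)" for t
      by (rule integral_lborel_shift)
    then show "integrable lborel (\<lambda>x::real. \<integral>y. norm (case (x, y) of (s, x) \<Rightarrow> indicator {0..1} s *\<^sub>R F' (x + s *\<^sub>R b) b) \<partial>lborel)"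
      by simp
    show "AE x in lborel. integrable lborel (\<lambda>y. case (x::real, y) of (s, x) \<Rightarrow> indicator {0..1} s *\<^sub>R F' (x + s *\<^sub>R b) b)"
      using Ds by simp
  qed measurable
  have "0 = (\<integral>x. F (x + b) - F x \<partial>lborel)"
    using F by (simp add: integrable_lborel_shift Bochner_Integration.integral_diff integral_lborel_shift)
  also have "\<dots> = (\<integral>x. (\<integral>s. indicator {0..1::real} s *\<^sub>R F' (x + s *\<^sub>R b) b \<partial>lborel) \<partial>lborel)"
    by (simp add: ftc)
  also have "\<dots> = (\<integral>s. (\<integral>x. indicator {0..1::real} s *\<^sub>R F' (x + s *\<^sub>R b) b \<partial>lborel) \<partial>lborel)"
    by (rule lborel_pair.Fubini_integral[OF int])
  also have "\<dots> = (\<integral>s. indicator {0..1::real} s *\<^sub>R (\<integral>x. F' x b \<partial>lborel) \<partial>lborel)"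
    by (simp add: integral_lborel_shift[of "\<lambda>x. F' x b"])
  also have "\<dots> = (\<integral>x. F' x b \<partial>lborel)" by simp
  finally show ?thesis by simp
qed

lemma has_derivative_cis_inner:
  "((\<lambda>x. cis (- (x \<bullet> \<xi>))) has_derivative (\<lambda>h. - (\<i> * of_real (h \<bullet> \<xi>)) * cis (- (x \<bullet> \<xi>)))) (at x)"
proof -
  have e: "(exp has_derivative (\<lambda>h. exp z * h)) (at z)" for z :: complex
    using DERIV_exp[of z] by (simp add: has_field_derivative_def)
  have i: "((\<lambda>x. \<i> * complex_of_real (- (x \<bullet> \<xi>))) has_derivative (\<lambda>h. \<i> * complex_of_real (- (h \<bullet> \<xi>)))) (at x)"
  proof (rule has_derivative_mult_right)
    have "((\<lambda>x. - (x \<bullet> \<xi>)) has_derivative (\<lambda>h. - (h \<bullet> \<xi>))) (at x)" by (auto intro!: derivative_eq_intros)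
    then show "((\<lambda>x. complex_of_real (- (x \<bullet> \<xi>))) has_derivative (\<lambda>h. complex_of_real (- (h \<bullet> \<xi>)))) (at x)"
      by (rule has_derivative_of_real)
  qed
  from has_derivative_compose[OF i e]
  show ?thesis by (simp add: cis_conv_exp mult.commute)
qed

text \<open>The derivative of the product of the character and \<open>f\<close> in direction
  \<open>b\<close> has integral 0, and the product rule splits it into the two sides.\<close>

lemma fourier_pderiv_dir:
  assumes f: "f \<in> schwartz" and b: "b \<in> Basis"
  shows "fourier (pderiv_dir b f) \<xi> = \<i> * of_real (b \<bullet> \<xi>) * fourier f \<xi>"
proof -
  let ?D = "pderiv_dir b f"
  have D: "?D \<in> schwartz" by (rule schwartz_pderiv_dir[OF f b])
  have [measurable]: "f \<in> borel_measurable borel" "?D \<in> borel_measurable borel"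
    using f D by (auto intro: schwartz_borel)
  let ?F' = "\<lambda>x h. cis (- (x \<bullet> \<xi>)) * frechet_derivative f (at x) h + - (\<i> * of_real (h \<bullet> \<xi>)) * cis (- (x \<bullet> \<xi>)) * f x"
  have i: "integrable lborel (\<lambda>x. cis (- (x \<bullet> \<xi>)) * f x)" "integrable lborel (\<lambda>x. cis (- (x \<bullet> \<xi>)) * ?D x)"
    using schwartz_integrable[OF f] schwartz_integrable[OF D] by (auto intro!: integrable_cis_mult)
  have eq: "?F' x b = cis (- (x \<bullet> \<xi>)) * ?D x - (\<i> * of_real (b \<bullet> \<xi>)) * (cis (- (x \<bullet> \<xi>)) * f x)" for x
    by (simp add: pderiv_dir_def)
  have "(\<integral>x. ?F' x b \<partial>lborel) = 0"
  proof (rule integral_directional_derivative_zero[where F'="?F'" and b=b])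
    show "((\<lambda>x. cis (- (x \<bullet> \<xi>)) * f x) has_derivative ?F' x) (at x)" for x
      by (rule has_derivative_mult[OF has_derivative_cis_inner])
         (use schwartz_differentiable[OF f] frechet_derivative_works in blast)
    show "continuous_on UNIV (\<lambda>x. ?F' x b)"
      unfolding eq using schwartz_continuous[OF f] schwartz_continuous[OF D] by (intro continuous_intros)
    show "integrable lborel (\<lambda>x. ?F' x b)"
      unfolding eq using i by (intro Bochner_Integration.integrable_diff integrable_mult_right)
  qed (rule i)
  then have "fourier ?D \<xi> - \<i> * of_real (b \<bullet> \<xi>) * fourier f \<xi> = 0"
    unfolding eq using i by (simp add: fourier_lborel Bochner_Integration.integral_diff)
  then show ?thesis by simp
qed

lemma fourier_moment_dir:
  assumes "f \<in> schwartz" "b \<in> Basis"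
  shows "\<exists>C. \<forall>\<xi>. \<bar>b \<bullet> \<xi>\<bar> ^ m * norm (fourier f \<xi>) \<le> C"
  using assms(1)
proof (induction m arbitrary: f)
  case 0
  then show ?case using norm_fourier_le[OF schwartz_integrable] by auto
next
  case (Suc m)
  obtain C where C: "\<And>\<xi>. \<bar>b \<bullet> \<xi>\<bar> ^ m * norm (fourier (pderiv_dir b f) \<xi>) \<le> C"
    using Suc.IH[OF schwartz_pderiv_dir[OF Suc.prems assms(2)]] by blast
  have "\<bar>b \<bullet> \<xi>\<bar> ^ Suc m * norm (fourier f \<xi>) \<le> C" for \<xi>
    using C[of \<xi>] by (simp add: fourier_pderiv_dir[OF Suc.prems assms(2)] norm_mult mult_ac)
  then show ?case by blast
qed

lemma fourier_decay:
  assumes f: "f \<in> schwartz"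
  shows "\<exists>C>0. \<forall>\<xi>::'a::euclidean_space. norm (fourier f \<xi>) \<le> C * jw \<xi> ^ L"
proof (rule decay_from_moments)
  fix m :: nat
  have "\<forall>b\<in>(Basis::'a set). \<exists>C. \<forall>\<xi>. \<bar>b \<bullet> \<xi>\<bar> ^ m * norm (fourier f \<xi>) \<le> C"
    using fourier_moment_dir[OF f] by blast
  then obtain C where C: "\<And>b \<xi>. b \<in> (Basis::'a set) \<Longrightarrow> \<bar>b \<bullet> \<xi>\<bar> ^ m * norm (fourier f \<xi>) \<le> C b" by metis
  have "norm \<xi> ^ m * norm (fourier f \<xi>) \<le> real DIM('a) ^ m * (\<Sum>b\<in>Basis. C b)" for \<xi>
  proof -
    \<comment> \<open>The norm is at most the dimension times the largest coordinate, so that a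
      single directional moment controls the full one.\<close>
    let ?M = "Max ((\<lambda>b. \<bar>b \<bullet> \<xi>\<bar>) ` Basis)"
    have "?M \<in> (\<lambda>b. \<bar>b \<bullet> \<xi>\<bar>) ` (Basis::'a set)" by (intro Max_in) auto
    then obtain b0 where b0: "?M = \<bar>b0 \<bullet> \<xi>\<bar>" "b0 \<in> Basis" by (rule imageE)
    have "norm \<xi> \<le> (\<Sum>b\<in>Basis. \<bar>\<xi> \<bullet> b\<bar>)" by (rule norm_le_l1)
    also have "\<dots> \<le> (\<Sum>b\<in>(Basis::'a set). ?M)"
      by (intro sum_mono Max_ge) (auto simp: inner_commute)
    finally have "norm \<xi> \<le> real DIM('a) * \<bar>b0 \<bullet> \<xi>\<bar>" by (simp add: b0)
    then have "norm \<xi> ^ m \<le> (real DIM('a) * \<bar>b0 \<bullet> \<xi>\<bar>) ^ m" by (rule power_mono) simp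
    then have "norm \<xi> ^ m * norm (fourier f \<xi>) \<le> (real DIM('a) * \<bar>b0 \<bullet> \<xi>\<bar>) ^ m * norm (fourier f \<xi>)"
      by (rule mult_right_mono) simp
    also have "\<dots> = real DIM('a) ^ m * (\<bar>b0 \<bullet> \<xi>\<bar> ^ m * norm (fourier f \<xi>))" by (simp add: power_mult_distrib)
    also have "\<dots> \<le> real DIM('a) ^ m * (\<Sum>b\<in>Basis. C b)"
    proof (intro mult_left_mono)
      have "0 \<le> C b" if "b \<in> Basis" for b
        by (rule order_trans[OF _ C[OF that, of \<xi>]]) simp
      then have "C b0 \<le> (\<Sum>b\<in>Basis. C b)" using b0(2) by (intro member_le_sum) auto
      then show "\<bar>b0 \<bullet> \<xi>\<bar> ^ m * norm (fourier f \<xi>) \<le> (\<Sum>b\<in>Basis. C b)"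
        using C[OF b0(2), of \<xi>] by linarith
    qed simp
    finally show ?thesis .
  qed
  then show "\<exists>C. \<forall>\<xi>. norm \<xi> ^ m * norm (fourier f \<xi>) \<le> C" by blast
qed

lemma inv_fourier_decay:
  assumes f: "f \<in> schwartz"
  shows "\<exists>C>0. \<forall>\<xi>::'a::euclidean_space. norm (inv_fourier f \<xi>) \<le> C * jw \<xi> ^ L"
proof -
  obtain C where C: "C > 0" "\<And>\<xi>. norm (fourier f \<xi>) \<le> C * jw \<xi> ^ L" using fourier_decay[OF f] by blast
  have "norm (inv_fourier f \<xi>) \<le> (C / (2 * pi) ^ DIM('a)) * jw \<xi> ^ L" for \<xi>
    using C(2)[of "-\<xi>"] by (simp add: inv_fourier_eq_fourier norm_divide norm_power norm_mult jw_minus divide_right_mono)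
  then show ?thesis using C(1) by (intro exI[of _ "C / (2 * pi) ^ DIM('a)"]) auto
qed

lemma fourier_schwartz_integrable: "f \<in> schwartz \<Longrightarrow> integrable lborel (fourier f)"
  using fourier_decay[of f 1] integrable_if_le_jw[OF fourier_measurable[OF schwartz_borel], of f] by auto

lemma inv_fourier_schwartz_integrable: "f \<in> schwartz \<Longrightarrow> integrable lborel (inv_fourier f)"
  using inv_fourier_decay[of f 1] integrable_if_le_jw[OF inv_fourier_measurable[OF schwartz_borel], of f] by auto

section \<open>Gaussians are Schwartz functions\<close>

text \<open>Polynomial functions, given by closure rules so that two properties follow by induction:
  directional derivatives stay in the set, and growth is at most polynomial. Every iterated
  derivative of a Gaussian is such a function times the Gaussian.\<close>

inductive_set poly_fun :: "('a::euclidean_space \<Rightarrow> complex) set" where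
  const: "(\<lambda>_. c) \<in> poly_fun"
| inner: "(\<lambda>x. of_real (x \<bullet> v)) \<in> poly_fun"
| add: "p \<in> poly_fun \<Longrightarrow> q \<in> poly_fun \<Longrightarrow> (\<lambda>x. p x + q x) \<in> poly_fun"
| mult: "p \<in> poly_fun \<Longrightarrow> q \<in> poly_fun \<Longrightarrow> (\<lambda>x. p x * q x) \<in> poly_fun"

lemma poly_fun_has_derivative:
  "p \<in> poly_fun \<Longrightarrow> \<exists>p'. (\<forall>x. (p has_derivative p' x) (at x)) \<and> (\<forall>b. (\<lambda>x. p' x b) \<in> poly_fun)"
proof (induction rule: poly_fun.induct)
  case (const c)
  show ?case by (intro exI[of _ "\<lambda>x h. 0"]) (auto intro: poly_fun.const)
next
  case (inner v)
  have "((\<lambda>x. of_real (x \<bullet> v)) has_derivative (\<lambda>h. complex_of_real (h \<bullet> v))) (at x)" for x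
    by (auto intro!: derivative_eq_intros)
  then show ?case by (intro exI[of _ "\<lambda>x h. of_real (h \<bullet> v)"]) (auto intro: poly_fun.const)
next
  case (add p q)
  then obtain p' q' where
    p': "\<And>x. (p has_derivative p' x) (at x)" "\<And>b. (\<lambda>x. p' x b) \<in> poly_fun" and
    q': "\<And>x. (q has_derivative q' x) (at x)" "\<And>b. (\<lambda>x. q' x b) \<in> poly_fun" by blast
  show ?case
    by (intro exI[of _ "\<lambda>x h. p' x h + q' x h"]) (auto intro!: has_derivative_add p' q' poly_fun.add)
next
  case (mult p q)
  then obtain p' q' where
    p': "\<And>x. (p has_derivative p' x) (at x)" "\<And>b. (\<lambda>x. p' x b) \<in> poly_fun" and
    q': "\<And>x. (q has_derivative q' x) (at x)" "\<And>b. (\<lambda>x. q' x b) \<in> poly_fun" by blast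
  show ?case
    by (intro exI[of _ "\<lambda>x h. p x * q' x h + p' x h * q x"])
       (auto intro!: has_derivative_mult p' q' poly_fun.add poly_fun.mult mult.hyps)
qed

lemma poly_fun_bound:
  "p \<in> poly_fun \<Longrightarrow> \<exists>C m. C \<ge> 0 \<and> (\<forall>x. norm (p x) \<le> C * (1 + norm x) ^ m)"
proof (induction rule: poly_fun.induct)
  case (const c)
  show ?case by (intro exI[of _ "norm c"] exI[of _ 0]) auto
next
  case (inner v)
  have "\<bar>x \<bullet> v\<bar> \<le> norm v * (1 + norm x)" for x
    using Cauchy_Schwarz_ineq2[of x v] norm_ge_zero[of v]
    by (auto simp only: distrib_left mult_1_right mult.commute[of "norm v"])
  then show ?case by (intro exI[of _ "norm v"] exI[of _ 1]) auto
next
  case (add p q)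
  then obtain C m C' m' where
    p: "C \<ge> 0" "\<And>x. norm (p x) \<le> C * (1 + norm x) ^ m" and
    q: "C' \<ge> 0" "\<And>x. norm (q x) \<le> C' * (1 + norm x) ^ m'" by blast
  have "norm (p x + q x) \<le> (C + C') * (1 + norm x) ^ (m + m')" for x
  proof -
    have "(1 + norm x) ^ m \<le> (1 + norm x) ^ (m + m')" "(1 + norm x) ^ m' \<le> (1 + norm x) ^ (m + m')"
      by (auto intro!: power_increasing)
    then have "C * (1 + norm x) ^ m \<le> C * (1 + norm x) ^ (m + m')" "C' * (1 + norm x) ^ m' \<le> C' * (1 + norm x) ^ (m + m')"
      using p(1) q(1) by (auto intro!: mult_left_mono)
    then show ?thesis using norm_triangle_ineq[of "p x" "q x"] p(2)[of x] q(2)[of x] by (simp add: distrib_right)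
  qed
  then show ?case using p(1) q(1) by (intro exI[of _ "C + C'"] exI[of _ "m + m'"]) auto
next
  case (mult p q)
  then obtain C m C' m' where
    p: "C \<ge> 0" "\<And>x. norm (p x) \<le> C * (1 + norm x) ^ m" and
    q: "C' \<ge> 0" "\<And>x. norm (q x) \<le> C' * (1 + norm x) ^ m'" by blast
  have "norm (p x * q x) \<le> (C * C') * (1 + norm x) ^ (m + m')" for x
  proof -
    have "norm (p x) * norm (q x) \<le> (C * (1 + norm x) ^ m) * (C' * (1 + norm x) ^ m')"
      using p q by (intro mult_mono) (auto intro: order_trans[OF norm_ge_zero])
    then show ?thesis by (simp add: norm_mult power_add mult_ac)
  qed
  then show ?case using p(1) q(1) by (intro exI[of _ "C * C'"] exI[of _ "m + m'"]) auto
qed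

definition scaled_gauss :: "real \<Rightarrow> 'a::euclidean_space \<Rightarrow> 'a \<Rightarrow> complex" where
  "scaled_gauss a c x = complex_of_real (gauss (a *\<^sub>R (x - c)))"

lemma has_derivative_scaled_gauss:
  "(scaled_gauss a c has_derivative (\<lambda>h. of_real (- a\<^sup>2 * ((x - c) \<bullet> h)) * scaled_gauss a c x)) (at x)"
proof -
  have eq: "scaled_gauss a c = (\<lambda>x. complex_of_real (exp (- (a\<^sup>2 * ((x - c) \<bullet> (x - c))) / 2)))"
    by (simp add: fun_eq_iff scaled_gauss_def gauss_def power_mult_distrib power2_norm_eq_inner)
  have "((\<lambda>x. (x - c) \<bullet> (x - c)) has_derivative (\<lambda>h. 2 * ((x - c) \<bullet> h))) (at x)"
    by (auto intro!: derivative_eq_intros simp: inner_commute)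
  then have "((\<lambda>x. - (a\<^sup>2 * ((x - c) \<bullet> (x - c))) / 2) has_derivative (\<lambda>h. - a\<^sup>2 * ((x - c) \<bullet> h))) (at x)"
    by (auto intro!: derivative_eq_intros simp: inner_commute)
  from has_derivative_of_real[OF has_derivative_exp[OF this], where 'a=complex]
  show ?thesis unfolding eq by (simp only: of_real_mult real_scaleR_def mult.commute)
qed

lemma iter_pderiv_scaled_gauss:
  "\<exists>p\<in>poly_fun. iter_pderiv bs (scaled_gauss a c) = (\<lambda>x. p x * scaled_gauss a c x)"
proof (induction bs)
  case Nil
  show ?case by (rule bexI[of _ "\<lambda>_. 1"]) (auto simp: iter_pderiv_def intro: poly_fun.const)
next
  case (Cons b bs)
  then obtain p where p: "p \<in> poly_fun" "iter_pderiv bs (scaled_gauss a c) = (\<lambda>x. p x * scaled_gauss a c x)" by blast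
  obtain p' where p': "\<And>x. (p has_derivative p' x) (at x)" "\<And>b. (\<lambda>x. p' x b) \<in> poly_fun"
    using poly_fun_has_derivative[OF p(1)] by blast
  let ?q = "\<lambda>x. p' x b + p x * (complex_of_real (- a\<^sup>2) * (of_real (x \<bullet> b) + of_real (- (c \<bullet> b))))"
  have "iter_pderiv (b # bs) (scaled_gauss a c) = pderiv_dir b (\<lambda>x. p x * scaled_gauss a c x)"
    using p(2) by (simp add: iter_pderiv_def)
  also have "\<dots> = (\<lambda>x. ?q x * scaled_gauss a c x)"
  proof
    fix x
    have "((\<lambda>x. p x * scaled_gauss a c x) has_derivative
       (\<lambda>h. p x * (of_real (- a\<^sup>2 * ((x - c) \<bullet> h)) * scaled_gauss a c x) + p' x h * scaled_gauss a c x)) (at x)"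
      by (rule has_derivative_mult[OF p'(1) has_derivative_scaled_gauss])
    from frechet_derivative_at[OF this, THEN fun_cong, of b]
    have "pderiv_dir b (\<lambda>x. p x * scaled_gauss a c x) x =
        p x * (of_real (- a\<^sup>2 * ((x - c) \<bullet> b)) * scaled_gauss a c x) + p' x b * scaled_gauss a c x"
      by (simp only: pderiv_dir_def)
    then show "pderiv_dir b (\<lambda>x. p x * scaled_gauss a c x) x = ?q x * scaled_gauss a c x"
      by (simp add: inner_diff_left algebra_simps)
  qed
  finally show ?case
    by (rule bexI[of _ ?q]) (intro poly_fun.intros p(1) p'(2))
qed

lemma gauss_moment:
  fixes c :: "'a::euclidean_space"
  assumes a: "a > 0"
  shows "\<exists>C. \<forall>x. (1 + norm x) ^ m * norm (scaled_gauss a c x) \<le> C"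
proof -
  let ?M = "real (Suc m)"
  \<comment> \<open>Chosen so that the power \<open>Suc m\<close> of
    \<open>exp (\<delta> * s\<^sup>2)\<close> is exactly the factor that the Gaussian cancels. The
    exponent \<open>Suc m\<close> instead of \<open>m\<close> keeps the denominator nonzero.\<close>
  define \<delta> where "\<delta> = a\<^sup>2 / (2 * ?M)"
  have \<delta>: "\<delta> > 0" using a by (simp add: \<delta>_def)
  define A where "A = max 2 (1 / \<delta>)"
  have A: "A \<ge> 2" "A * \<delta> \<ge> 1" using \<delta> by (auto simp: A_def max_def field_simps)
  have "(1 + norm x) ^ Suc m * norm (scaled_gauss a c x) \<le> ((1 + norm c) * A) ^ Suc m" for x
  proof -
    define s where "s = norm (x - c)"
    have s: "0 \<le> s" by (simp add: s_def)
    have "norm x \<le> s + norm c" unfolding s_def using norm_triangle_ineq[of "x - c" c] by simp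
    moreover have "0 \<le> s * norm c" using s by simp
    ultimately have 1: "1 + norm x \<le> (1 + norm c) * (1 + s)" by (simp add: algebra_simps)
    have "s \<le> 1 + s\<^sup>2" using sum_squares_bound[of s 1] s by simp
    then have "1 + s \<le> 2 + s\<^sup>2" by simp
    also have "\<dots> \<le> A + (A * \<delta>) * s\<^sup>2" using A mult_right_mono[of 1 "A * \<delta>" "s\<^sup>2"] by simp
    also have "\<dots> = A * (1 + \<delta> * s\<^sup>2)" by (simp add: algebra_simps)
    also have "\<dots> \<le> A * exp (\<delta> * s\<^sup>2)" using A exp_ge_add_one_self[of "\<delta> * s\<^sup>2"] by (intro mult_left_mono) auto
    finally have "(1 + norm c) * (1 + s) \<le> (1 + norm c) * (A * exp (\<delta> * s\<^sup>2))" by (intro mult_left_mono) auto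
    with 1 have "1 + norm x \<le> ((1 + norm c) * A) * exp (\<delta> * s\<^sup>2)" by (simp add: mult.assoc)
    then have "(1 + norm x) ^ Suc m \<le> (((1 + norm c) * A) * exp (\<delta> * s\<^sup>2)) ^ Suc m" by (rule power_mono) simp
    also have "\<dots> = ((1 + norm c) * A) ^ Suc m * exp (a\<^sup>2 * s\<^sup>2 / 2)"
    proof -
      have "?M * (\<delta> * s\<^sup>2) = a\<^sup>2 * s\<^sup>2 / 2" by (simp add: \<delta>_def del: of_nat_Suc)
      then show ?thesis unfolding power_mult_distrib[of "(1 + norm c) * A"] exp_of_nat_mult[symmetric] by simp
    qed
    finally have "(1 + norm x) ^ Suc m * norm (scaled_gauss a c x) \<le>
       ((1 + norm c) * A) ^ Suc m * exp (a\<^sup>2 * s\<^sup>2 / 2) * norm (scaled_gauss a c x)" by (rule mult_right_mono) simp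
    also have nrm: "norm (scaled_gauss a c x) = exp (- (a\<^sup>2 * s\<^sup>2 / 2))"
      by (simp add: scaled_gauss_def gauss_def s_def power_mult_distrib)
    also have "((1 + norm c) * A) ^ Suc m * exp (a\<^sup>2 * s\<^sup>2 / 2) * exp (- (a\<^sup>2 * s\<^sup>2 / 2)) = ((1 + norm c) * A) ^ Suc m"
      by (simp add: mult.assoc exp_minus)
    finally show ?thesis by (simp only: nrm)
  qed
  moreover have "(1 + norm x) ^ m * norm (scaled_gauss a c x) \<le> (1 + norm x) ^ Suc m * norm (scaled_gauss a c x)" for x
    by (intro mult_right_mono power_increasing) auto
  ultimately show ?thesis by (meson order_trans)
qed

text \<open>This supplies explicit test functions: an identity of distributions, stated for Schwartz
  functions, can be evaluated at Gaussians of every width and centre.\<close>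

lemma scaled_gauss_schwartz:
  assumes a: "a > 0" shows "scaled_gauss a c \<in> schwartz"
  unfolding schwartz_def
proof (intro CollectI ballI conjI allI)
  fix bs :: "'a list"
  obtain p where p: "p \<in> poly_fun" "iter_pderiv bs (scaled_gauss a c) = (\<lambda>x. p x * scaled_gauss a c x)"
    using iter_pderiv_scaled_gauss by blast
  show "iter_pderiv bs (scaled_gauss a c) differentiable at x" for x
  proof -
    obtain p' where "\<And>x. (p has_derivative p' x) (at x)" using poly_fun_has_derivative[OF p(1)] by blast
    from has_derivative_mult[OF this has_derivative_scaled_gauss]
    show ?thesis unfolding p(2) differentiable_def by blast
  qed
  fix m :: nat
  obtain C k where C: "C \<ge> 0" "\<And>x. norm (p x) \<le> C * (1 + norm x) ^ k" using poly_fun_bound[OF p(1)] by blast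
  obtain B where B: "\<And>x. (1 + norm x) ^ (m + k) * norm (scaled_gauss a c x) \<le> B" using gauss_moment[OF a] by blast
  have "norm x ^ m * norm (p x * scaled_gauss a c x) \<le> C * B" for x
  proof -
    have "norm x ^ m * norm (p x) \<le> (1 + norm x) ^ m * (C * (1 + norm x) ^ k)"
      using C by (intro mult_mono power_mono) auto
    then have "norm x ^ m * norm (p x) * norm (scaled_gauss a c x) \<le> (1 + norm x) ^ m * (C * (1 + norm x) ^ k) * norm (scaled_gauss a c x)"
      by (rule mult_right_mono) simp
    also have "\<dots> = C * ((1 + norm x) ^ (m + k) * norm (scaled_gauss a c x))" by (simp add: power_add mult_ac)
    also have "\<dots> \<le> C * B" by (intro mult_left_mono B C)
    finally show ?thesis by (simp add: norm_mult mult.assoc)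
  qed
  then show "\<exists>C. \<forall>x. norm x ^ m * norm (iter_pderiv bs (scaled_gauss a c) x) \<le> C"
    unfolding p(2) by blast
qed

section \<open>Borel representatives and uniqueness of bounded functions\<close>

lemma lebesgue_complex_borel_version:
  fixes g :: "'a::euclidean_space \<Rightarrow> complex"
  assumes g: "g \<in> borel_measurable lebesgue"
  shows "\<exists>g'\<in>borel_measurable borel. AE x in lborel. g x = g' x"
proof -
  have "(\<lambda>x. Re (g x)) \<in> borel_measurable lebesgue" "(\<lambda>x. Im (g x)) \<in> borel_measurable lebesgue"
    using g by measurable
  from this[THEN completion_ex_borel_measurable_real]
  obtain u v where [measurable]: "u \<in> borel_measurable lborel" "v \<in> borel_measurable lborel"
    and ae: "AE x in lborel. Re (g x) = u x" "AE x in lborel. Im (g x) = v x" by blast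
  have "(\<lambda>x. Complex (u x) (v x)) \<in> borel_measurable borel" unfolding Complex_eq by measurable
  moreover have "AE x in lborel. g x = Complex (u x) (v x)"
    using ae
  proof eventually_elim
    case (elim x)
    then show ?case by (metis complex.exhaust_sel)
  qed
  ultimately show ?thesis by (intro bexI[where x="\<lambda>x. Complex (u x) (v x)"])
qed

text \<open>Setting a Borel version to 0 where it exceeds the essential bound makes the bound hold
  everywhere, so later estimates are free of exceptional sets.\<close>

lemma L_infty_borel_version:
  assumes g: "g \<in> L_infty"
  shows "\<exists>g' C. g' \<in> borel_measurable borel \<and> (\<forall>x. norm (g' x) \<le> C) \<and> (AE x in lborel. g x = g' x)"
proof -
  from g have g1: "g \<in> borel_measurable lebesgue" and "\<exists>C. AE x in lebesgue. norm (g x) \<le> C"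
    by (auto simp: L_infty_def)
  then obtain C where C: "AE x in lborel. norm (g x) \<le> C" by (auto simp: AE_completion_iff)
  obtain g' where [measurable]: "g' \<in> borel_measurable borel" and ae: "AE x in lborel. g x = g' x"
    using lebesgue_complex_borel_version[OF g1] by blast
  let ?h = "\<lambda>x. if norm (g' x) \<le> C then g' x else 0"
  have "?h \<in> borel_measurable borel" by measurable
  moreover have "norm (?h x) \<le> \<bar>C\<bar>" for x by auto
  moreover have "AE x in lborel. g x = ?h x" using C ae by eventually_elim auto
  ultimately show ?thesis by blast
qed

lemma distr_of_cong_AE:
  assumes [measurable]: "g \<in> borel_measurable lebesgue" "g' \<in> borel_measurable borel" "h \<in> borel_measurable borel"
    and ae: "AE x in lborel. g x = g' x"
  shows "distr_of g h = (\<integral>x. g' x * h x \<partial>lborel)"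
proof -
  have m: "g' \<in> borel_measurable lebesgue" "h \<in> borel_measurable lebesgue"
    by (auto intro: measurable_completion)
  have "(\<integral>x. g x * h x \<partial>lebesgue) = (\<integral>x. g' x * h x \<partial>lebesgue)"
    using ae m by (intro integral_cong_AE) (auto simp: AE_completion_iff)
  also have "\<dots> = (\<integral>x. g' x * h x \<partial>lborel)" by (rule integral_completion) measurable
  finally show ?thesis by (simp add: distr_of_def)
qed

text \<open>Gaussians already separate bounded functions. Consequently the function selected in
  \<open>fourier_multiplier\<close> is determined up to null sets.\<close>

lemma L_infty_unique:
  assumes g: "g1 \<in> L_infty" "g2 \<in> L_infty" and eq: "\<And>h. h \<in> schwartz \<Longrightarrow> distr_of g1 h = distr_of g2 h"
  shows "AE x in lborel. g1 x = g2 x"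
proof -
  obtain g1' C1 where 1: "g1' \<in> borel_measurable borel" "\<And>x. norm (g1' x) \<le> C1" "AE x in lborel. g1 x = g1' x"
    using L_infty_borel_version[OF g(1)] by blast
  obtain g2' C2 where 2: "g2' \<in> borel_measurable borel" "\<And>x. norm (g2' x) \<le> C2" "AE x in lborel. g2 x = g2' x"
    using L_infty_borel_version[OF g(2)] by blast
  note [measurable] = 1(1) 2(1)
  have "AE x in lborel. g1' x - g2' x = 0"
  proof (rule AE_zero_if_gauss_orthogonal)
    show "norm (g1' x - g2' x) \<le> C1 + C2" for x
      using norm_triangle_ineq4[of "g1' x" "g2' x"] 1(2)[of x] 2(2)[of x] by simp
    fix a :: real and z :: 'a assume a: "a > 0"
    have s: "scaled_gauss a z \<in> schwartz" by (rule scaled_gauss_schwartz[OF a])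
    note b = schwartz_borel[OF s]
    have "distr_of g1 (scaled_gauss a z) = (\<integral>x. g1' x * scaled_gauss a z x \<partial>lborel)"
      using g 1 b by (intro distr_of_cong_AE) (auto simp: L_infty_def)
    moreover have "distr_of g2 (scaled_gauss a z) = (\<integral>x. g2' x * scaled_gauss a z x \<partial>lborel)"
      using g 2 b by (intro distr_of_cong_AE) (auto simp: L_infty_def)
    ultimately have "(\<integral>x. g1' x * scaled_gauss a z x \<partial>lborel) = (\<integral>x. g2' x * scaled_gauss a z x \<partial>lborel)"
      using eq[OF s] by simp
    moreover have "integrable lborel (\<lambda>x. g1' x * scaled_gauss a z x)" "integrable lborel (\<lambda>x. g2' x * scaled_gauss a z x)"
      by (rule integrable_bounded_mult[OF 1(1,2) schwartz_integrable[OF s]], rule integrable_bounded_mult[OF 2(1,2) schwartz_integrable[OF s]])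
    ultimately have "(\<integral>x. (g1' x - g2' x) * scaled_gauss a z x \<partial>lborel) = 0"
      by (simp add: left_diff_distrib Bochner_Integration.integral_diff)
    then show "(\<integral>y. (g1' y - g2' y) * complex_of_real (gauss (a *\<^sub>R (y - z))) \<partial>lborel) = 0"
      by (simp add: scaled_gauss_def)
  qed measurable
  then show ?thesis using 1(3) 2(3) by eventually_elim simp
qed

section \<open>Fourier multipliers as convolutions\<close>

definition conv :: "('a::euclidean_space \<Rightarrow> complex) \<Rightarrow> ('a \<Rightarrow> complex) \<Rightarrow> 'a \<Rightarrow> complex" where
  "conv K \<sigma> z = (\<integral>y. K (z - y) * \<sigma> y \<partial>lborel)"

lemma conv_measurable [measurable]:
  assumes [measurable]: "K \<in> borel_measurable borel" "\<sigma> \<in> borel_measurable borel"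
  shows "conv K \<sigma> \<in> borel_measurable borel"
  unfolding conv_def by measurable

lemma conv_bounded:
  assumes K: "integrable lborel K" and [measurable]: "\<sigma> \<in> borel_measurable borel" and bdd: "\<And>x. norm (\<sigma> x) \<le> M"
  shows "norm (conv K \<sigma> z) \<le> (\<integral>x. norm (K x) \<partial>lborel) * M"
proof -
  have Kr: "integrable lborel (\<lambda>y. K (z - y))" using K by (simp add: integrable_lborel_reflect)
  have "integrable lborel (\<lambda>y. \<sigma> y * K (z - y))" by (rule integrable_bounded_mult[OF _ bdd Kr]) measurable
  then have i: "integrable lborel (\<lambda>y. K (z - y) * \<sigma> y)" by (simp add: mult.commute)
  have "norm (conv K \<sigma> z) \<le> (\<integral>y. norm (K (z - y) * \<sigma> y) \<partial>lborel)"
    unfolding conv_def by (rule integral_norm_bound)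
  also have "\<dots> \<le> (\<integral>y. norm (K (z - y)) * M \<partial>lborel)"
  proof (rule integral_mono)
    show "integrable lborel (\<lambda>y. norm (K (z - y) * \<sigma> y))" using i by (rule integrable_norm)
    show "integrable lborel (\<lambda>y. norm (K (z - y)) * M)" using Kr by (intro integrable_mult_left integrable_norm)
  qed (auto simp: norm_mult intro!: mult_left_mono bdd)
  also have "\<dots> = (\<integral>x. norm (K x) \<partial>lborel) * M"
    using integral_lborel_reflect[of "\<lambda>y. norm (K y)" z] by simp
  finally show ?thesis .
qed

lemma inv_fourier_lborel:
  fixes f :: "'a::euclidean_space \<Rightarrow> complex"
  assumes "f \<in> borel_measurable borel"
  shows "inv_fourier f x = (\<integral>\<xi>. cis (x \<bullet> \<xi>) * f \<xi> \<partial>lborel) / of_real ((2 * pi) ^ DIM('a))"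
  by (simp add: inv_fourier_eq_fourier fourier_lborel[OF assms] inner_commute)

text \<open>By Fubini. Multipliers are defined by transposition, and the left-hand side is the
  transposed multiplier applied to the test function \<open>h\<close>; the right-hand side is the
  transpose of convolution with \<open>inv_fourier m\<close>.\<close>

lemma fourier_mult_inv_fourier:
  fixes m h :: "'a::euclidean_space \<Rightarrow> complex"
  assumes m: "integrable lborel m" and h: "integrable lborel h"
  shows "fourier (\<lambda>x. m x * inv_fourier h x) y = (\<integral>z. inv_fourier m (z - y) * h z \<partial>lborel)"
proof -
  have [measurable]: "m \<in> borel_measurable borel" "h \<in> borel_measurable borel" using m h by auto
  let ?c = "complex_of_real ((2 * pi) ^ DIM('a))"
  define F where "F \<eta> z = cis (- (\<eta> \<bullet> y)) * cis (\<eta> \<bullet> z) * m \<eta> * h z / ?c" for \<eta> z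
  have [measurable]: "(\<lambda>(\<eta>, z). F \<eta> z) \<in> borel_measurable (borel \<Otimes>\<^sub>M borel)" unfolding F_def by measurable
  have int: "integrable (lborel \<Otimes>\<^sub>M lborel) (\<lambda>(\<eta>, z). F \<eta> z)"
    by (rule Bochner_Integration.integrable_bound[OF integrable_divide[OF integrable_lborel_pair_mult(1)[OF m h], of ?c]])
       (measurable, auto simp: F_def norm_mult norm_divide)
  have "fourier (\<lambda>x. m x * inv_fourier h x) y = (\<integral>\<eta>. (\<integral>z. F \<eta> z \<partial>lborel) \<partial>lborel)"
  proof (subst fourier_lborel, measurable, intro Bochner_Integration.integral_cong refl)
    fix \<eta>
    have "(\<integral>z. F \<eta> z \<partial>lborel) = (\<integral>z. (cis (- (\<eta> \<bullet> y)) * m \<eta> / ?c) * (cis (\<eta> \<bullet> z) * h z) \<partial>lborel)"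
      by (intro Bochner_Integration.integral_cong refl) (simp add: F_def mult_ac)
    also have "\<dots> = (cis (- (\<eta> \<bullet> y)) * m \<eta> / ?c) * (\<integral>z. cis (\<eta> \<bullet> z) * h z \<partial>lborel)"
      by (rule integral_mult_right_zero)
    finally show "cis (- (\<eta> \<bullet> y)) * (m \<eta> * inv_fourier h \<eta>) = (\<integral>z. F \<eta> z \<partial>lborel)"
      by (simp add: inv_fourier_lborel)
  qed
  also have "\<dots> = (\<integral>z. (\<integral>\<eta>. F \<eta> z \<partial>lborel) \<partial>lborel)"
    by (rule lborel_pair.Fubini_integral[OF int, symmetric])
  also have "\<dots> = (\<integral>z. inv_fourier m (z - y) * h z \<partial>lborel)"
  proof (intro Bochner_Integration.integral_cong refl)
    fix z
    have "(\<integral>\<eta>. F \<eta> z \<partial>lborel) = (\<integral>\<eta>. (h z / ?c) * (cis ((z - y) \<bullet> \<eta>) * m \<eta>) \<partial>lborel)"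
    proof (intro Bochner_Integration.integral_cong refl)
      fix \<eta>
      have c: "cis ((z - y) \<bullet> \<eta>) = cis (- (\<eta> \<bullet> y)) * cis (\<eta> \<bullet> z)"
        by (simp add: cis_mult inner_diff_left inner_commute[of \<eta>])
      show "F \<eta> z = (h z / ?c) * (cis ((z - y) \<bullet> \<eta>) * m \<eta>)" unfolding F_def c by simp
    qed
    also have "\<dots> = (h z / ?c) * (\<integral>\<eta>. cis ((z - y) \<bullet> \<eta>) * m \<eta> \<partial>lborel)"
      by (rule integral_mult_right_zero)
    finally show "(\<integral>\<eta>. F \<eta> z \<partial>lborel) = inv_fourier m (z - y) * h z" by (simp add: inv_fourier_lborel)
  qed
  finally show ?thesis .
qed

text \<open>The convolution is an admissible witness for the choice in
  \<open>fourier_multiplier\<close>. Hence the chosen function is admissible too, and two admissible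
  functions agree almost everywhere.\<close>

lemma fourier_multiplier_AE_eq_conv:
  fixes m :: "'a::euclidean_space \<Rightarrow> complex"
  assumes m: "integrable lborel m" and K: "integrable lborel (inv_fourier m)"
    and \<sigma>: "\<sigma> \<in> L_infty" and [measurable]: "\<sigma>' \<in> borel_measurable borel"
    and bdd: "\<And>x. norm (\<sigma>' x) \<le> M" and ae: "AE x in lborel. \<sigma> x = \<sigma>' x"
  shows "AE z in lborel. fourier_multiplier m \<sigma> z = conv (inv_fourier m) \<sigma>' z"
proof -
  have [measurable]: "m \<in> borel_measurable borel" using m by auto
  let ?P = "\<lambda>g. g \<in> L_infty \<and> (\<forall>h\<in>schwartz.
     distr_of g h = inv_fourier_distr (mult_distr m (fourier_distr (distr_of \<sigma>))) h)"
  let ?g = "conv (inv_fourier m) \<sigma>'"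
  have gm: "?g \<in> borel_measurable borel" by measurable
  have "?g \<in> L_infty"
  proof -
    have "AE x in lebesgue. norm (?g x) \<le> (\<integral>x. norm (inv_fourier m x) \<partial>lborel) * M"
      by (intro AE_I2 conv_bounded[OF K _ bdd]) measurable
    then show ?thesis using gm by (auto simp: L_infty_def intro!: measurable_completion)
  qed
  moreover have "distr_of ?g h = inv_fourier_distr (mult_distr m (fourier_distr (distr_of \<sigma>))) h" if h: "h \<in> schwartz" for h
  proof -
    have hi: "integrable lborel h" by (rule schwartz_integrable[OF h])
    have [measurable]: "h \<in> borel_measurable borel" by (rule schwartz_borel[OF h])
    have "inv_fourier_distr (mult_distr m (fourier_distr (distr_of \<sigma>))) h = distr_of \<sigma> (fourier (\<lambda>x. m x * inv_fourier h x))"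
      by (simp add: inv_fourier_distr_def mult_distr_def fourier_distr_def)
    also have "\<dots> = (\<integral>y. \<sigma>' y * fourier (\<lambda>x. m x * inv_fourier h x) y \<partial>lborel)"
      using \<sigma> ae by (intro distr_of_cong_AE) (auto simp: L_infty_def)
    also have "\<dots> = (\<integral>z. (\<integral>y. inv_fourier m (z - y) * \<sigma>' y \<partial>lborel) * h z \<partial>lborel)"
      unfolding fourier_mult_inv_fourier[OF m hi]
      by (rule convolution_pairing(1)[OF _ bdd hi K, symmetric]) measurable
    also have "\<dots> = distr_of ?g h"
      unfolding conv_def[symmetric] distr_of_def by (rule integral_completion[symmetric]) measurable
    finally show ?thesis by simp
  qed
  ultimately have Pg: "?P ?g" by blast
  have "?P (fourier_multiplier m \<sigma>)"
    unfolding fourier_multiplier_def by (rule someI[where P="?P", OF Pg])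
  then show ?thesis using Pg by (intro L_infty_unique) auto
qed

section \<open>Tensor products of functions of the separate variables\<close>

definition tensor :: "('a \<Rightarrow> complex) \<Rightarrow> ('N::finite \<Rightarrow> 'a \<Rightarrow> complex) \<Rightarrow> 'a \<times> ('a^'N) \<Rightarrow> complex" where
  "tensor p0 p = (\<lambda>(y, \<eta>). p0 y * (\<Prod>j\<in>UNIV. p j (\<eta> $ j)))"

lemma tensor_measurable [measurable]:
  fixes p0 :: "'a::euclidean_space \<Rightarrow> complex" and p :: "'N::finite \<Rightarrow> 'a \<Rightarrow> complex"
  assumes [measurable]: "p0 \<in> borel_measurable borel" "\<And>j. p j \<in> borel_measurable borel"
  shows "tensor p0 p \<in> borel_measurable borel"
  unfolding tensor_def case_prod_unfold by measurable

lemma tensor_integrable: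
  fixes p0 :: "'a::euclidean_space \<Rightarrow> complex" and p :: "'N::finite \<Rightarrow> 'a \<Rightarrow> complex"
  assumes "integrable lborel p0" "\<And>j. integrable lborel (p j)"
  shows "integrable lborel (tensor p0 p)"
  unfolding tensor_def by (intro integrable_lborel_pair_mult(2) integrable_vec_prod assms)

lemma tensor_integral:
  fixes p0 :: "'a::euclidean_space \<Rightarrow> complex" and p :: "'N::finite \<Rightarrow> 'a \<Rightarrow> complex"
  assumes "integrable lborel p0" "\<And>j. integrable lborel (p j)"
  shows "(\<integral>z. tensor p0 p z \<partial>lborel) = (\<integral>y. p0 y \<partial>lborel) * (\<Prod>j\<in>UNIV. \<integral>y. p j y \<partial>lborel)"
  unfolding tensor_def using assms
  by (subst integral_lborel_pair_mult) (auto intro: integrable_vec_prod simp: integral_vec_prod)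

lemma fourier_tensor:
  fixes p0 :: "'a::euclidean_space \<Rightarrow> complex" and p :: "'N::finite \<Rightarrow> 'a \<Rightarrow> complex"
  assumes p0: "integrable lborel p0" and p: "\<And>j. integrable lborel (p j)"
  shows "fourier (tensor p0 p) = tensor (fourier p0) (\<lambda>j. fourier (p j))"
proof
  fix z :: "'a \<times> ('a^'N)"
  obtain x \<xi> where z: "z = (x, \<xi>)" by (cases z)
  have [measurable]: "p0 \<in> borel_measurable borel" "\<And>j. p j \<in> borel_measurable borel" using p0 p by auto
  have e: "cis (- (w \<bullet> (x, \<xi>))) = cis (- (fst w \<bullet> x)) * (\<Prod>j\<in>UNIV. cis (- (snd w $ j \<bullet> \<xi> $ j)))" for w
    by (cases w) (simp add: inner_vec_def cis_sum[symmetric] cis_mult sum_negf)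
  have "fourier (tensor p0 p) z = (\<integral>w. tensor (\<lambda>y. cis (- (y \<bullet> x)) * p0 y) (\<lambda>j y. cis (- (y \<bullet> \<xi> $ j)) * p j y) w \<partial>lborel)"
    unfolding z by (subst fourier_lborel, measurable, intro Bochner_Integration.integral_cong refl)
      (simp add: tensor_def case_prod_unfold prod.distrib e)
  also have "\<dots> = fourier p0 x * (\<Prod>j\<in>UNIV. fourier (p j) (\<xi> $ j))"
    by (subst tensor_integral) (auto simp: fourier_lborel intro!: integrable_cis_mult p0 p)
  finally show "fourier (tensor p0 p) z = tensor (fourier p0) (\<lambda>j. fourier (p j)) z" by (simp add: tensor_def z)
qed

lemma inv_fourier_tensor:
  fixes p0 :: "'a::euclidean_space \<Rightarrow> complex" and p :: "'N::finite \<Rightarrow> 'a \<Rightarrow> complex"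
  assumes p0: "integrable lborel p0" and p: "\<And>j. integrable lborel (p j)"
  shows "inv_fourier (tensor p0 p) = tensor (inv_fourier p0) (\<lambda>j. inv_fourier (p j))"
proof
  fix z :: "'a \<times> ('a^'N)"
  obtain x \<xi> where z: "z = (x, \<xi>)" by (cases z)
  define c where "c = complex_of_real ((2 * pi) ^ DIM('a))"
  have "complex_of_real ((2 * pi) ^ DIM('a \<times> ('a^'N))) = c * c ^ CARD('N)"
    unfolding c_def by (simp only: DIM_prod DIM_cart power_add power_mult of_real_mult of_real_power mult.commute[of "CARD('N)"])
  then have "inv_fourier (tensor p0 p) z = fourier (tensor p0 p) (- x, - \<xi>) / (c * c ^ CARD('N))"
    by (simp add: inv_fourier_eq_fourier z)
  also have "fourier (tensor p0 p) (- x, - \<xi>) = fourier p0 (- x) * (\<Prod>j\<in>UNIV. fourier (p j) (- \<xi> $ j))"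
    by (simp add: fourier_tensor[OF p0 p]) (simp add: tensor_def)
  also have "\<dots> / (c * c ^ CARD('N)) = inv_fourier p0 x * (\<Prod>j\<in>UNIV. inv_fourier (p j) (\<xi> $ j))"
    by (simp add: inv_fourier_eq_fourier prod_dividef c_def)
  finally show "inv_fourier (tensor p0 p) z = tensor (inv_fourier p0) (\<lambda>j. inv_fourier (p j)) z"
    by (simp add: z tensor_def)
qed

section \<open>Composition of convolutions and reproducing kernels\<close>

lemma conv_conv:
  assumes K: "integrable lborel K" and K': "integrable lborel K'"
    and [measurable]: "\<sigma> \<in> borel_measurable borel" and bdd: "\<And>x. norm (\<sigma> x) \<le> M"
  shows "conv K' (conv K \<sigma>) z = conv (conv K' K) \<sigma> z"
proof -
  have G: "integrable lborel (\<lambda>y. K' (z - y))" using K' by (simp add: integrable_lborel_reflect)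
  have "conv K' (conv K \<sigma>) z = (\<integral>y. (\<integral>w. K (y - w) * \<sigma> w \<partial>lborel) * K' (z - y) \<partial>lborel)"
    by (simp add: conv_def mult.commute)
  also have "\<dots> = (\<integral>w. \<sigma> w * (\<integral>y. K (y - w) * K' (z - y) \<partial>lborel) \<partial>lborel)"
    by (rule convolution_pairing(1)[OF _ bdd G K]) measurable
  also have "\<dots> = conv (conv K' K) \<sigma> z"
    unfolding conv_def
  proof (intro Bochner_Integration.integral_cong refl)
    fix w
    show "\<sigma> w * (\<integral>y. K (y - w) * K' (z - y) \<partial>lborel) = (\<integral>y. K' (z - w - y) * K y \<partial>lborel) * \<sigma> w"
      using integral_lborel_shift[of "\<lambda>y. K (y - w) * K' (z - y)" w] by (simp add: algebra_simps)
  qed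
  finally show ?thesis .
qed

text \<open>The hypothesis says that the transform of \<open>K'\<close> is 1 wherever
  \<open>m\<close> does not vanish. After a shift the convolution is the transposed multiplier
  \<open>m\<close> applied to the reflected \<open>K'\<close>, so the product of symbols appears
  directly under one transform.\<close>

lemma conv_reproducing_kernel:
  assumes m: "integrable lborel m" and K': "integrable lborel K'"
    and F: "\<And>x. fourier K' x * m x = m x"
  shows "conv K' (inv_fourier m) z = inv_fourier m z"
proof -
  have [measurable]: "m \<in> borel_measurable borel" "K' \<in> borel_measurable borel" using m K' by auto
  have Kr: "integrable lborel (\<lambda>y. K' (- y))" using K' integrable_lborel_reflect[of K' 0] by simp
  have "conv K' (inv_fourier m) z = (\<integral>y. inv_fourier m (y - (- z)) * K' (- y) \<partial>lborel)"
    unfolding conv_def using integral_lborel_shift[of "\<lambda>y. K' (z - y) * inv_fourier m y" z] by (simp add: mult.commute)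
  also have "\<dots> = fourier (\<lambda>x. m x * inv_fourier (\<lambda>y. K' (- y)) x) (- z)"
    by (rule fourier_mult_inv_fourier[OF m Kr, symmetric])
  also have "(\<lambda>x. m x * inv_fourier (\<lambda>y. K' (- y)) x) = (\<lambda>x. m x / of_real ((2 * pi) ^ DIM('a)))"
  proof
    fix x
    have "fourier (\<lambda>y. K' (- y)) (- x) = fourier K' x"
      using integral_lborel_reflect[of "\<lambda>y. cis (- (y \<bullet> x)) * K' y" 0] by (simp add: fourier_lborel)
    then have "m x * inv_fourier (\<lambda>y. K' (- y)) x = (fourier K' x * m x) / of_real ((2 * pi) ^ DIM('a))"
      by (simp add: inv_fourier_eq_fourier mult.commute)
    then show "m x * inv_fourier (\<lambda>y. K' (- y)) x = m x / of_real ((2 * pi) ^ DIM('a))" by (simp only: F)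
  qed
  also have "fourier \<dots> (- z) = inv_fourier m z"
    by (simp add: inv_fourier_eq_fourier fourier_lborel)
  finally show ?thesis .
qed

section \<open>Dilated cutoffs and Littlewood-Paley pieces\<close>

definition dil :: "('a::euclidean_space \<Rightarrow> complex) \<Rightarrow> nat \<Rightarrow> 'a \<Rightarrow> complex" where
  "dil f k y = f (y /\<^sub>R 2 ^ k)"

lemma inv_fourier_dil:
  fixes f :: "'a::euclidean_space \<Rightarrow> complex"
  assumes [measurable]: "f \<in> borel_measurable borel"
  shows "inv_fourier (dil f k) x = (2 ^ k) ^ DIM('a) * inv_fourier f (2 ^ k *\<^sub>R x)"
proof -
  have [measurable]: "dil f k \<in> borel_measurable borel" unfolding dil_def by measurable
  have "(\<integral>\<xi>. cis (x \<bullet> \<xi>) * dil f k \<xi> \<partial>lborel) = (2 ^ k) ^ DIM('a) * (\<integral>\<xi>. cis ((2 ^ k *\<^sub>R x) \<bullet> \<xi>) * f \<xi> \<partial>lborel)"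
    by (subst integral_lborel_affine[of "2^k" _ 0]) (simp_all add: dil_def scaleR_conv_of_real)
  then show ?thesis by (simp add: inv_fourier_lborel)
qed

lemma dil_integrable: "integrable lborel f \<Longrightarrow> integrable lborel (dil f k)"
  unfolding dil_def using integrable_lborel_affine[of f "inverse (2^k)" 0] by simp

lemma inv_fourier_dil_integrable:
  fixes f :: "'a::euclidean_space \<Rightarrow> complex"
  assumes "f \<in> borel_measurable borel" "integrable lborel (inv_fourier f)"
  shows "integrable lborel (inv_fourier (dil f k))"
proof -
  have "inv_fourier (dil f k) = (\<lambda>x. (2 ^ k) ^ DIM('a) * inv_fourier f (0 + 2 ^ k *\<^sub>R x))"
    by (simp add: fun_eq_iff inv_fourier_dil[OF assms(1)])
  moreover have "integrable lborel (\<lambda>x. (2 ^ k) ^ DIM('a) * inv_fourier f (0 + 2 ^ k *\<^sub>R x))"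
    by (rule integrable_mult_right[OF integrable_lborel_affine[OF assms(2)]]) simp
  ultimately show ?thesis by simp
qed

context
  fixes \<phi> :: "'a::euclidean_space \<Rightarrow> complex"
  assumes \<phi>: "lp_cutoff \<phi>"
begin

lemma cutoff_schwartz: "\<phi> \<in> schwartz"
  using \<phi> unfolding lp_cutoff_def by blast

lemma cutoff_eq_1: "norm y \<le> 1 \<Longrightarrow> \<phi> y = 1"
  using \<phi> unfolding lp_cutoff_def by blast

lemma cutoff_eq_0:
  assumes "2 < norm y" shows "\<phi> y = 0"
proof (rule ccontr)
  assume "\<phi> y \<noteq> 0"
  then have "y \<in> closure {y. \<phi> y \<noteq> 0}" using closure_subset[of "{y. \<phi> y \<noteq> 0}"] by blast
  then have "norm y \<le> 2" using \<phi> unfolding lp_cutoff_def by blast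
  with assms show False by simp
qed

lemma cutoff_borel [measurable]: "\<phi> \<in> borel_measurable borel"
  by (rule schwartz_borel[OF cutoff_schwartz])

lemma dil_cutoff_borel [measurable]: "dil \<phi> k \<in> borel_measurable borel"
  unfolding dil_def by measurable

lemma lp_piece_0: "lp_piece \<phi> 0 = dil \<phi> 0"
  by (simp add: lp_piece_def dil_def fun_eq_iff Let_def)

lemma lp_piece_Suc: "lp_piece \<phi> (Suc k) y = dil \<phi> (Suc k) y - dil \<phi> k y"
  by (simp add: lp_piece_def dil_def Let_def)

lemma lp_piece_integrable: "integrable lborel (lp_piece \<phi> k)"
proof (cases k)
  case 0
  then show ?thesis using dil_integrable[OF schwartz_integrable[OF cutoff_schwartz]] by (simp add: lp_piece_0)
next
  case (Suc k)
  have "lp_piece \<phi> (Suc k) = (\<lambda>y. dil \<phi> (Suc k) y - dil \<phi> k y)" by (simp add: fun_eq_iff lp_piece_Suc)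
  then show ?thesis using dil_integrable[OF schwartz_integrable[OF cutoff_schwartz]] Suc by simp
qed

text \<open>Piece \<open>k\<close> vanishes outside the ball of radius \<open>2 ^ Suc k\<close>, and
  in that ball the cutoff of scale \<open>Suc k\<close> is 1. Scale \<open>k\<close> would not do,
  since its cutoff is prescribed to be 1 only up to radius \<open>2 ^ k\<close>.\<close>

lemma lp_piece_mult_dil: "dil \<phi> (Suc k) y * lp_piece \<phi> k y = lp_piece \<phi> k y"
proof (cases "norm y \<le> 2 ^ Suc k")
  case True
  then have "norm (y /\<^sub>R 2 ^ Suc k) \<le> 1" by (simp add: divide_simps norm_scaleR)
  then show ?thesis using cutoff_eq_1 by (simp add: dil_def)
next
  case False
  have d: "dil \<phi> i y = 0" if "i \<le> k" for i
  proof -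
    have "(2::real) ^ i \<le> 2 ^ k" using that by (intro power_increasing) auto
    then have "2 * 2 ^ i < norm y" using False unfolding power_Suc by linarith
    then have "2 < norm (y /\<^sub>R 2 ^ i)" by (simp add: field_simps norm_scaleR)
    then show ?thesis using cutoff_eq_0 by (simp add: dil_def)
  qed
  show ?thesis
  proof (cases k)
    case 0 then show ?thesis using d[of 0] by (simp add: lp_piece_0)
  next
    case (Suc i) then show ?thesis using d[of k] d[of i] by (simp add: lp_piece_Suc)
  qed
qed

lemma inv_fourier_cutoff_integrable: "integrable lborel (inv_fourier (dil \<phi> k))"
  by (intro inv_fourier_dil_integrable inv_fourier_schwartz_integrable cutoff_schwartz) measurable

lemma inv_fourier_lp_piece:
  "inv_fourier (lp_piece \<phi> 0) = inv_fourier (dil \<phi> 0)"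
  "inv_fourier (lp_piece \<phi> (Suc k)) x = inv_fourier (dil \<phi> (Suc k)) x - inv_fourier (dil \<phi> k) x"
proof -
  have i: "integrable lborel (\<lambda>\<xi>. cis (x \<bullet> \<xi>) * dil \<phi> k \<xi>)" for k
    by (intro integrable_cis_mult dil_integrable schwartz_integrable cutoff_schwartz) measurable
  have "lp_piece \<phi> (Suc k) \<in> borel_measurable borel" using lp_piece_integrable by auto
  then show "inv_fourier (lp_piece \<phi> (Suc k)) x = inv_fourier (dil \<phi> (Suc k)) x - inv_fourier (dil \<phi> k) x"
    using i by (simp add: inv_fourier_lborel lp_piece_Suc right_diff_distrib Bochner_Integration.integral_diff diff_divide_distrib)
qed (simp add: lp_piece_0)

lemma inv_fourier_lp_piece_integrable: "integrable lborel (inv_fourier (lp_piece \<phi> k))"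
proof (cases k)
  case (Suc i)
  have "inv_fourier (lp_piece \<phi> (Suc i)) = (\<lambda>x. inv_fourier (dil \<phi> (Suc i)) x - inv_fourier (dil \<phi> i) x)"
    by (simp add: fun_eq_iff inv_fourier_lp_piece)
  then show ?thesis using Suc inv_fourier_cutoff_integrable by simp
qed (simp add: inv_fourier_lp_piece inv_fourier_cutoff_integrable)

lemma sum_inv_fourier_lp_piece: "(\<Sum>k\<le>K. inv_fourier (lp_piece \<phi> k) x) = inv_fourier (dil \<phi> K) x"
  by (induction K) (simp_all add: inv_fourier_lp_piece)

lemma fourier_inv_fourier_dil: "fourier (inv_fourier (dil \<phi> k)) = dil \<phi> k"
proof
  fix y
  obtain B where "\<And>x. norm (\<phi> x) \<le> B" using schwartz_bounded[OF cutoff_schwartz] by blast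
  then have B: "norm (dil \<phi> k x) \<le> B" for x by (simp add: dil_def)
  show "fourier (inv_fourier (dil \<phi> k)) y = dil \<phi> k y"
  proof (rule fourier_inversion[OF _ B])
    show "continuous_on UNIV (dil \<phi> k)"
      unfolding dil_def by (rule continuous_on_compose2[OF schwartz_continuous[OF cutoff_schwartz]]) (auto intro!: continuous_intros)
  qed (auto intro: dil_integrable schwartz_integrable cutoff_schwartz inv_fourier_cutoff_integrable)
qed

section \<open>Littlewood-Paley decomposition of a bounded symbol in all variables\<close>

definition piece_kernel :: "nat \<Rightarrow> ('N::finite \<Rightarrow> nat) \<Rightarrow> 'a \<times> ('a^'N) \<Rightarrow> complex" where
  "piece_kernel k0 k = tensor (inv_fourier (lp_piece \<phi> k0)) (\<lambda>j. inv_fourier (lp_piece \<phi> (k j)))"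

definition dil_kernel :: "nat \<Rightarrow> ('N::finite \<Rightarrow> nat) \<Rightarrow> 'a \<times> ('a^'N) \<Rightarrow> complex" where
  "dil_kernel k0 k = tensor (inv_fourier (dil \<phi> k0)) (\<lambda>j. inv_fourier (dil \<phi> (k j)))"

lemma piece_kernel_integrable: "integrable lborel (piece_kernel k0 k)"
  unfolding piece_kernel_def by (intro tensor_integrable inv_fourier_lp_piece_integrable)

lemma dil_kernel_integrable: "integrable lborel (dil_kernel k0 k)"
  unfolding dil_kernel_def by (intro tensor_integrable inv_fourier_cutoff_integrable)

text \<open>The identity holds for the kernels themselves and passes to \<sigma> by associativity of
  convolution. It allows the kernel to be moved onto the test function while the piece, with its
  uniformly local norm, stays untouched.\<close>

lemma conv_piece_kernel_reproducing:
  fixes \<sigma> :: "'a \<times> ('a^'N::finite) \<Rightarrow> complex"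
  assumes [measurable]: "\<sigma> \<in> borel_measurable borel" and bdd: "\<And>x. norm (\<sigma> x) \<le> M"
  shows "conv (dil_kernel (Suc k0) (\<lambda>j. Suc (k j))) (conv (piece_kernel k0 k) \<sigma>) z = conv (piece_kernel k0 k) \<sigma> z"
proof -
  let ?m = "tensor (lp_piece \<phi> k0) (\<lambda>j. lp_piece \<phi> (k j))"
  let ?K' = "dil_kernel (Suc k0) (\<lambda>j. Suc (k j))"
  have K: "piece_kernel k0 k = inv_fourier ?m"
    unfolding piece_kernel_def by (rule inv_fourier_tensor[symmetric]) (rule lp_piece_integrable)+
  have F: "fourier ?K' = tensor (dil \<phi> (Suc k0)) (\<lambda>j. dil \<phi> (Suc (k j)))"
    unfolding dil_kernel_def by (subst fourier_tensor) (auto simp: inv_fourier_cutoff_integrable fourier_inv_fourier_dil)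
  have "conv ?K' (piece_kernel k0 k) = piece_kernel k0 k"
  proof
    fix z
    show "conv ?K' (piece_kernel k0 k) z = piece_kernel k0 k z" unfolding K
    proof (rule conv_reproducing_kernel)
      show "integrable lborel ?m" by (intro tensor_integrable lp_piece_integrable)
      show "integrable lborel ?K'" by (rule dil_kernel_integrable)
      fix x :: "'a \<times> ('a^'N)"
      obtain y \<eta> where x: "x = (y, \<eta>)" by (cases x)
      have "fourier ?K' x * ?m x = (dil \<phi> (Suc k0) y * lp_piece \<phi> k0 y) * (\<Prod>j\<in>UNIV. dil \<phi> (Suc (k j)) (\<eta> $ j) * lp_piece \<phi> (k j) (\<eta> $ j))"
        unfolding F x tensor_def by (simp add: prod.distrib mult_ac)
      then show "fourier ?K' x * ?m x = ?m x"
        by (simp only: lp_piece_mult_dil) (simp add: x tensor_def)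
    qed
  qed
  then show ?thesis
    by (subst conv_conv[OF piece_kernel_integrable dil_kernel_integrable _ bdd]) (auto)
qed

lemma Delta_AE_eq_conv:
  assumes \<sigma>: "\<sigma> \<in> L_infty" and \<sigma>': "\<sigma>' \<in> borel_measurable borel"
    and bdd: "\<And>x. norm (\<sigma>' x) \<le> M" and ae: "AE x in lborel. \<sigma> x = \<sigma>' x"
  shows "AE z in lborel. fourier_multiplier (tensor (lp_piece \<phi> k0) (\<lambda>j. lp_piece \<phi> (k j))) \<sigma> z = conv (piece_kernel k0 k) \<sigma>' z"
proof -
  let ?m = "tensor (lp_piece \<phi> k0) (\<lambda>j. lp_piece \<phi> (k j))"
  have K: "piece_kernel k0 k = inv_fourier ?m"
    unfolding piece_kernel_def by (rule inv_fourier_tensor[symmetric]) (rule lp_piece_integrable)+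
  show ?thesis unfolding K
    by (rule fourier_multiplier_AE_eq_conv[OF _ _ \<sigma> \<sigma>' bdd ae])
       (auto intro: tensor_integrable lp_piece_integrable piece_kernel_integrable simp: K[symmetric])
qed

text \<open>Over a full box of indices the sum factors into one sum per variable, and each of these
  telescopes. This dictates the exhaustion by boxes with a common upper index
  \<open>K\<close>.\<close>

lemma sum_piece_kernel:
  fixes z :: "'a \<times> ('a^'N::finite)"
  shows "(\<Sum>k0\<le>K. \<Sum>k\<in>PiE UNIV (\<lambda>_. {..K}). piece_kernel k0 k z) = dil_kernel K (\<lambda>_. K) z"
proof -
  obtain y \<eta> where z: "z = (y, \<eta>)" by (cases z)
  have "(\<Sum>k0\<le>K. \<Sum>k\<in>PiE UNIV (\<lambda>_. {..K}). piece_kernel k0 k z) =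
     (\<Sum>k0\<le>K. inv_fourier (lp_piece \<phi> k0) y) * (\<Sum>k\<in>PiE UNIV (\<lambda>_. {..K}). \<Prod>j\<in>UNIV. inv_fourier (lp_piece \<phi> (k j)) (\<eta> $ j))"
    by (simp add: piece_kernel_def tensor_def z sum_product)
  also have "(\<Sum>k\<in>PiE UNIV (\<lambda>_. {..K}). \<Prod>j\<in>UNIV. inv_fourier (lp_piece \<phi> (k j)) (\<eta> $ j)) =
     (\<Prod>j\<in>UNIV. \<Sum>i\<le>K. inv_fourier (lp_piece \<phi> i) (\<eta> $ j))"
    by (rule prod_sum_PiE[symmetric]) auto
  finally show ?thesis by (simp add: sum_inv_fourier_lp_piece dil_kernel_def tensor_def z)
qed

text \<open>By telescoping, a partial sum is the convolution with a mass-preserving dilate of one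
  integrable kernel of mass 1, so the weak convergence of approximate identities applies.\<close>

lemma tendsto_sum_pieces:
  fixes \<sigma> :: "'a \<times> ('a^'N::finite) \<Rightarrow> complex"
  assumes [measurable]: "\<sigma> \<in> borel_measurable borel" and bdd: "\<And>x. norm (\<sigma> x) \<le> M" and G: "integrable lborel G"
  shows "(\<lambda>K. \<Sum>k0\<le>K. \<Sum>k\<in>PiE UNIV (\<lambda>_. {..K}). \<integral>z. conv (piece_kernel k0 k) \<sigma> z * G z \<partial>lborel) \<longlonglongrightarrow> (\<integral>z. \<sigma> z * G z \<partial>lborel)"
proof -
  let ?\<Theta> = "dil_kernel 0 (\<lambda>_. 0) :: 'a \<times> ('a^'N) \<Rightarrow> complex"
  have [measurable]: "piece_kernel k0 k \<in> borel_measurable borel" for k0 and k :: "'N \<Rightarrow> nat"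
    using borel_measurable_integrable[OF piece_kernel_integrable] by simp
  have "(\<Sum>k0\<le>K. \<Sum>k\<in>PiE UNIV (\<lambda>_. {..K}). \<integral>z. conv (piece_kernel k0 k) \<sigma> z * G z \<partial>lborel) =
      (\<integral>w. ?\<Theta> w * (\<integral>y. \<sigma> y * G (y + w /\<^sub>R 2 ^ K) \<partial>lborel) \<partial>lborel)" for K
  proof -
    let ?P = "PiE (UNIV :: 'N set) (\<lambda>_. {..K})"
    have i: "integrable lborel (\<lambda>z. conv (piece_kernel k0 k) \<sigma> z * G z)" for k0 and k :: "'N \<Rightarrow> nat"
      by (rule integrable_bounded_mult[OF _ conv_bounded[OF piece_kernel_integrable _ bdd] G]) measurable
    have j: "integrable lborel (\<lambda>y. piece_kernel k0 k (z - y) * \<sigma> y)" for k0 and k :: "'N \<Rightarrow> nat" and z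
    proof -
      have "integrable lborel (\<lambda>y. piece_kernel k0 k (z - y))"
        using piece_kernel_integrable by (simp add: integrable_lborel_reflect)
      then have "integrable lborel (\<lambda>y. \<sigma> y * piece_kernel k0 k (z - y))"
        by (intro integrable_bounded_mult[OF _ bdd]) measurable
      then show ?thesis by (simp add: mult.commute)
    qed
    have "(\<Sum>k0\<le>K. \<Sum>k\<in>?P. \<integral>z. conv (piece_kernel k0 k) \<sigma> z * G z \<partial>lborel) =
        (\<integral>z. (\<Sum>k0\<le>K. \<Sum>k\<in>?P. conv (piece_kernel k0 k) \<sigma> z * G z) \<partial>lborel)"
      using i by (simp add: Bochner_Integration.integral_sum)
    also have "\<dots> = (\<integral>z. conv (dil_kernel K (\<lambda>_. K)) \<sigma> z * G z \<partial>lborel)"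
    proof (intro Bochner_Integration.integral_cong refl)
      fix z
      have "(\<Sum>k0\<le>K. \<Sum>k\<in>?P. conv (piece_kernel k0 k) \<sigma> z) = (\<integral>y. (\<Sum>k0\<le>K. \<Sum>k\<in>?P. piece_kernel k0 k (z - y) * \<sigma> y) \<partial>lborel)"
        unfolding conv_def using j by (simp add: Bochner_Integration.integral_sum)
      also have "\<dots> = conv (dil_kernel K (\<lambda>_. K)) \<sigma> z"
        by (simp only: conv_def sum_piece_kernel flip: sum_distrib_right)
      finally show "(\<Sum>k0\<le>K. \<Sum>k\<in>?P. conv (piece_kernel k0 k) \<sigma> z * G z) = conv (dil_kernel K (\<lambda>_. K)) \<sigma> z * G z"
        by (simp only: flip: sum_distrib_right)
    qed
    also have "\<dots> = (\<integral>w. dil_kernel K (\<lambda>_. K) w * (\<integral>y. \<sigma> y * G (y + w) \<partial>lborel) \<partial>lborel)"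
      unfolding conv_def by (rule convolution_pairing(2)[OF _ bdd G dil_kernel_integrable]) measurable
    \<comment> \<open>All variables are rescaled by the same factor. The kernel then becomes the
      fixed one of scale 0, and \<open>K\<close> survives only in the translation of
      \<open>G\<close>.\<close>
    also have "\<dots> = (\<integral>w. (dil_kernel K (\<lambda>_. K) (w /\<^sub>R 2 ^ K) * (\<integral>y. \<sigma> y * G (y + w /\<^sub>R 2 ^ K) \<partial>lborel)) / (2 ^ K) ^ DIM('a \<times> ('a^'N)) \<partial>lborel)"
      unfolding integral_divide_zero
      by (subst integral_lborel_affine[of "inverse (2 ^ K)" _ 0])
         (simp_all add: scaleR_conv_of_real power_inverse divide_inverse mult.commute)
    also have "\<dots> = (\<integral>w. ?\<Theta> w * (\<integral>y. \<sigma> y * G (y + w /\<^sub>R 2 ^ K) \<partial>lborel) \<partial>lborel)"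
    proof (intro Bochner_Integration.integral_cong refl)
      fix w :: "'a \<times> ('a^'N)"
      obtain y \<eta> where w: "w = (y, \<eta>)" by (cases w)
      have "dil_kernel K (\<lambda>_. K) (w /\<^sub>R 2 ^ K) = (2 ^ K) ^ DIM('a \<times> ('a^'N)) * ?\<Theta> w"
        unfolding dil_kernel_def tensor_def w
        by (simp add: inv_fourier_dil prod.distrib power_add power_mult[symmetric] mult_ac)
      then show "(dil_kernel K (\<lambda>_. K) (w /\<^sub>R 2 ^ K) * (\<integral>y. \<sigma> y * G (y + w /\<^sub>R 2 ^ K) \<partial>lborel)) / (2 ^ K) ^ DIM('a \<times> ('a^'N)) =
        ?\<Theta> w * (\<integral>y. \<sigma> y * G (y + w /\<^sub>R 2 ^ K) \<partial>lborel)"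
        by simp
    qed
    finally show ?thesis .
  qed
  moreover have "(\<integral>w. ?\<Theta> w \<partial>lborel) = 1"
  proof -
    \<comment> \<open>The mass is the value of the Fourier transform at the origin, where every
      cutoff equals 1.\<close>
    have "(\<integral>w. ?\<Theta> w \<partial>lborel) = fourier ?\<Theta> 0"
      using borel_measurable_integrable[OF dil_kernel_integrable[of 0 "\<lambda>_. 0"]] by (subst fourier_lborel) auto
    also have "\<dots> = tensor (dil \<phi> 0) (\<lambda>j. dil \<phi> 0) (0 :: 'a \<times> ('a^'N))"
      unfolding dil_kernel_def by (subst fourier_tensor) (auto simp: inv_fourier_cutoff_integrable fourier_inv_fourier_dil)
    also have "\<dots> = 1" by (simp add: tensor_def dil_def zero_prod_def cutoff_eq_1)
    finally show ?thesis .
  qed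
  ultimately show ?thesis
    using weak_approximate_identity[OF assms(1) bdd G dil_kernel_integrable[of 0 "\<lambda>_. 0"]] by simp
qed

end

section \<open>Norms on lattice cells\<close>

lemma epowr_top [simp]: "epowr \<top> a = \<top>" by (simp add: epowr_def)

lemma epowr_ennreal: "0 \<le> x \<Longrightarrow> epowr (ennreal x) a = ennreal (x powr a)"
  by (simp add: epowr_def)

lemma epowr_0 [simp]: "epowr 0 a = 0" by (simp add: epowr_def)

lemma epowr_1 [simp]: "epowr x 1 = x"
  by (cases x) (auto simp: epowr_ennreal)

lemma epowr_mono:
  assumes "x \<le> y" "0 \<le> a" shows "epowr x a \<le> epowr y a"
proof (cases "y = \<top>")
  case False
  then obtain s t where "x = ennreal s" "y = ennreal t" "0 \<le> s" "0 \<le> t"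
    using assms(1) by (metis ennreal_cases top_unique)
  then show ?thesis using assms by (auto simp: epowr_ennreal intro!: ennreal_leI powr_mono2)
qed simp

lemma epowr_eq_0_iff: "epowr x a = 0 \<longleftrightarrow> x = 0"
  by (cases x) (auto simp: epowr_ennreal ennreal_eq_0_iff)

lemma epowr_mult: "epowr (x * y) a = epowr x a * epowr y a"
proof (cases "x = \<top> \<or> y = \<top>")
  case True
  then show ?thesis
    by (auto simp: ennreal_mult_top ennreal_top_mult epowr_eq_0_iff)
next
  case False
  then obtain s t where "x = ennreal s" "y = ennreal t" "0 \<le> s" "0 \<le> t"
    by (metis ennreal_cases)
  then show ?thesis by (simp add: epowr_ennreal ennreal_mult[symmetric] powr_mult)
qed

lemma epowr_prod: "epowr (\<Prod>i\<in>A. f i) a = (\<Prod>i\<in>A. epowr (f i) a)"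
proof (induction A rule: infinite_finite_induct)
  case (insert x F) then show ?case by (simp add: epowr_mult)
qed (simp_all add: epowr_def)

lemma epowr_epowr: "epowr (epowr x a) b = epowr x (a * b)"
  by (cases x) (simp_all add: epowr_ennreal powr_powr)

lemma epowr_2: "epowr x 2 = x\<^sup>2"
  by (cases x) (simp_all add: epowr_ennreal ennreal_power powr_numeral)

lemma epowr_half_power2: "(epowr x (1/2))\<^sup>2 = x"
  by (simp add: epowr_2[symmetric] epowr_epowr)

lemma epowr_power2_half: "epowr (x\<^sup>2) (1/2) = x"
  by (simp add: epowr_2[symmetric] epowr_epowr)

lemma nn_integral_Cauchy_Schwarz_epowr:
  assumes [measurable]: "f \<in> borel_measurable M" "g \<in> borel_measurable M"
  shows "(\<integral>\<^sup>+x. f x * g x \<partial>M) \<le> epowr (\<integral>\<^sup>+x. (f x)\<^sup>2 \<partial>M) (1/2) * epowr (\<integral>\<^sup>+x. (g x)\<^sup>2 \<partial>M) (1/2)"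
  using epowr_mono[OF Cauchy_Schwarz_nn_integral[OF assms], of "1/2"]
  by (simp add: epowr_power2_half epowr_mult)

section \<open>Sums over countable sets and suprema\<close>

text \<open>The finite sets are initial segments of an enumeration of \<open>K\<close>. What matters
  is that one increasing sequence serves all summands \<open>f\<close> at once, so that it can be
  used under a further integral.\<close>

lemma nn_integral_count_space_SUP_finite:
  assumes K: "countable K"
  obtains F :: "nat \<Rightarrow> 'k set" where "\<And>n. finite (F n)" "\<And>n. F n \<subseteq> K" "incseq F"
    "\<And>f. (\<integral>\<^sup>+k. f k \<partial>count_space K) = (SUP n. \<Sum>k\<in>F n. f k :: ennreal)"
proof -
  define F where "F n = {k \<in> K. to_nat_on K k < n}" for n
  have fin: "finite (F n)" for n
  proof (rule finite_imageD)
    show "finite (to_nat_on K ` F n)" by (rule finite_subset[of _ "{..<n}"]) (auto simp: F_def)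
    show "inj_on (to_nat_on K) (F n)" using inj_on_to_nat_on[OF K] by (rule inj_on_subset) (auto simp: F_def)
  qed
  have inc: "incseq F" by (auto simp: incseq_def F_def)
  have sub: "F n \<subseteq> K" for n by (auto simp: F_def)
  have "(\<integral>\<^sup>+k. f k \<partial>count_space K) = (SUP n. \<Sum>k\<in>F n. f k)" for f :: "'k \<Rightarrow> ennreal"
  proof -
    have "(\<integral>\<^sup>+k. f k \<partial>count_space K) = (\<integral>\<^sup>+k. (SUP n. f k * indicator (F n) k) \<partial>count_space K)"
    proof (rule nn_integral_cong)
      fix k assume "k \<in> space (count_space K)"
      then have k: "k \<in> F (Suc (to_nat_on K k))" by (simp add: F_def)
      show "f k = (SUP n. f k * indicator (F n) k)"
        by (rule antisym, rule SUP_upper2[of "Suc (to_nat_on K k)"], use k in simp_all, intro SUP_least, simp add: indicator_def)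
    qed
    also have "\<dots> = (SUP n. \<integral>\<^sup>+k. f k * indicator (F n) k \<partial>count_space K)"
      by (rule nn_integral_monotone_convergence_SUP) (auto simp: incseq_def le_fun_def F_def indicator_def)
    also have "\<dots> = (SUP n. \<Sum>k\<in>F n. f k)"
    proof (rule SUP_cong[OF refl])
      fix n
      show "(\<integral>\<^sup>+k. f k * indicator (F n) k \<partial>count_space K) = (\<Sum>k\<in>F n. f k)"
        using fin by (subst nn_integral_count_space'[of "F n"]) (auto simp: F_def)
    qed
    finally show ?thesis .
  qed
  with fin sub inc show thesis by (rule that)
qed

lemma nn_integral_count_space_le_if_finite_sums:
  fixes f :: "'i \<Rightarrow> ennreal"
  assumes I: "countable I" and B: "\<And>F. finite F \<Longrightarrow> F \<subseteq> I \<Longrightarrow> (\<Sum>i\<in>F. f i) \<le> B"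
  shows "(\<integral>\<^sup>+i. f i \<partial>count_space I) \<le> B"
proof (rule nn_integral_count_space_SUP_finite[OF I])
  fix F assume F: "\<And>n. finite (F n)" "\<And>n. F n \<subseteq> I"
    and eq: "\<And>f. (\<integral>\<^sup>+i. f i \<partial>count_space I) = (SUP n. \<Sum>i\<in>F n. f i :: ennreal)"
  show ?thesis unfolding eq by (intro SUP_least B F)
qed

lemma infsum_eq_nn_integral:
  fixes f :: "'i \<Rightarrow> ennreal"
  assumes I: "countable I"
  shows "(\<Sum>\<^sub>\<infinity>i\<in>I. f i) = (\<integral>\<^sup>+i. f i \<partial>count_space I)"
proof -
  have eq: "(\<Sum>\<^sub>\<infinity>i\<in>I. f i) = (SUP F\<in>{F. finite F \<and> F \<subseteq> I}. sum f F)"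
    by (rule nonneg_infsum_complete) simp
  show ?thesis unfolding eq
  proof (rule antisym)
    show "(SUP F\<in>{F. finite F \<and> F \<subseteq> I}. sum f F) \<le> (\<integral>\<^sup>+i. f i \<partial>count_space I)"
      by (intro SUP_least) (auto intro: nn_integral_count_space_ge_sum)
    show "(\<integral>\<^sup>+i. f i \<partial>count_space I) \<le> (SUP F\<in>{F. finite F \<and> F \<subseteq> I}. sum f F)"
      by (intro nn_integral_count_space_le_if_finite_sums I) (auto intro: SUP_upper)
  qed
qed

text \<open>A finite sum of suprema is the supremum of the sums over all choice functions. The
  induction carries a constant \<open>c\<close> that absorbs the terms already chosen. It turns a
  supremum over frequencies near each lattice point into one choice of nodes for the sampling
  inequality.\<close>

lemma sum_SUP_le_if_choices:
  fixes a :: "'t \<Rightarrow> 'z \<Rightarrow> ennreal"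
  assumes F: "finite F" and ne: "\<And>t. t \<in> F \<Longrightarrow> S t \<noteq> {}"
    and B: "\<And>z. (\<And>t. t \<in> F \<Longrightarrow> z t \<in> S t) \<Longrightarrow> (\<Sum>t\<in>F. a t (z t)) \<le> B"
  shows "(\<Sum>t\<in>F. SUP \<zeta>\<in>S t. a t \<zeta>) \<le> B"
proof -
  have "c + (\<Sum>t\<in>F. SUP \<zeta>\<in>S t. a t \<zeta>) \<le> B"
    if "\<And>z. (\<And>t. t \<in> F \<Longrightarrow> z t \<in> S t) \<Longrightarrow> c + (\<Sum>t\<in>F. a t (z t)) \<le> B" for c
    using F ne that
  proof (induction F arbitrary: c rule: finite_induct)
    case empty
    then show ?case by simp
  next
    case (insert t0 F)
    have "c + (SUP \<zeta>\<in>S t0. a t0 \<zeta>) + (\<Sum>t\<in>F. SUP \<zeta>\<in>S t. a t \<zeta>) =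
        (SUP \<zeta>\<in>S t0. a t0 \<zeta> + (c + (\<Sum>t\<in>F. SUP \<zeta>\<in>S t. a t \<zeta>)))"
      using insert.prems(1)[of t0] by (subst ennreal_SUP_add_left) (auto simp: add_ac)
    also have "\<dots> \<le> B"
    proof (rule SUP_least)
      fix \<zeta> assume \<zeta>: "\<zeta> \<in> S t0"
      have "(a t0 \<zeta> + c) + (\<Sum>t\<in>F. SUP \<zeta>\<in>S t. a t \<zeta>) \<le> B"
      proof (rule insert.IH)
        show "S t \<noteq> {}" if "t \<in> F" for t using insert.prems(1) that by auto
        fix z assume z: "\<And>t. t \<in> F \<Longrightarrow> z t \<in> S t"
        have "c + (\<Sum>t\<in>insert t0 F. a t ((z(t0 := \<zeta>)) t)) \<le> B"
          using z \<zeta> by (intro insert.prems(2)) auto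
        moreover have "(\<Sum>t\<in>F. a t ((z(t0 := \<zeta>)) t)) = (\<Sum>t\<in>F. a t (z t))"
          using insert.hyps by (intro sum.cong) auto
        ultimately show "a t0 \<zeta> + c + (\<Sum>t\<in>F. a t (z t)) \<le> B"
          using insert.hyps by (simp add: add_ac)
      qed
      then show "a t0 \<zeta> + (c + (\<Sum>t\<in>F. SUP \<zeta>\<in>S t. a t \<zeta>)) \<le> B" by (simp add: add_ac)
    qed
    finally show ?case using insert.hyps by (simp add: add_ac)
  qed
  from this[of 0] B show ?thesis by simp
qed

section \<open>The two conditions on the weight, in terms of cells\<close>

text \<open>Sequences with finite values are passed to the real-valued definition through
  \<open>enn2real\<close>. Finiteness is required at every point of the space, on and off the
  lattice.\<close>

lemma class_B_ennreal:
  fixes W :: "real^'n^'N \<Rightarrow> real"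
  assumes "W \<in> class_B"
  shows "\<exists>c>0. \<forall>(a0 :: real^'n \<Rightarrow> ennreal) (a :: 'N \<Rightarrow> real^'n \<Rightarrow> ennreal).
     (\<forall>\<mu>. a0 \<mu> < \<top>) \<longrightarrow> (\<forall>j \<mu>. a j \<mu> < \<top>) \<longrightarrow>
     (\<integral>\<^sup>+\<nu>. ennreal (W \<nu>) * a0 (\<Sum>j\<in>UNIV. \<nu> $ j) * (\<Prod>j\<in>UNIV. a j (\<nu> $ j)) \<partial>count_space int_lattice)
       \<le> ennreal c * epowr (\<integral>\<^sup>+\<mu>. (a0 \<mu>)\<^sup>2 \<partial>count_space int_lattice) (1/2) *
         (\<Prod>j\<in>UNIV. epowr (\<integral>\<^sup>+\<mu>. (a j \<mu>)\<^sup>2 \<partial>count_space int_lattice) (1/2))"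
proof -
  have L: "countable (int_lattice :: 'b::euclidean_space set)" by (rule countable_int_lattice)
  from assms obtain c where W0: "\<And>\<nu>. \<nu> \<in> int_lattice \<Longrightarrow> 0 \<le> W \<nu>" and c: "0 < c"
    and B: "\<And>(A0 :: real^'n \<Rightarrow> real) (A :: 'N \<Rightarrow> real^'n \<Rightarrow> real).
          (\<forall>\<mu>\<in>int_lattice. 0 \<le> A0 \<mu> \<and> (\<forall>j. 0 \<le> A j \<mu>)) \<Longrightarrow>
          (\<Sum>\<^sub>\<infinity>\<nu>\<in>int_lattice. ennreal (W \<nu> * A0 (\<Sum>j\<in>UNIV. \<nu> $ j) * (\<Prod>j\<in>UNIV. A j (\<nu> $ j))))
            \<le> ennreal c * lq_norm int_lattice 2 (\<lambda>\<mu>. ennreal (A0 \<mu>))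
                * (\<Prod>j\<in>UNIV. lq_norm int_lattice 2 (\<lambda>\<mu>. ennreal (A j \<mu>)))"
    unfolding class_B_def by blast
  have l2: "lq_norm int_lattice 2 f = epowr (\<integral>\<^sup>+\<mu>. (f \<mu>)\<^sup>2 \<partial>count_space int_lattice) (1/2)"
    for f :: "real^'n \<Rightarrow> ennreal"
    by (simp add: lq_norm_def infsum_eq_nn_integral[OF L] epowr_2)
  show ?thesis
  proof (intro exI[of _ c] conjI c allI impI)
    fix a0 :: "real^'n \<Rightarrow> ennreal" and a :: "'N \<Rightarrow> real^'n \<Rightarrow> ennreal"
    assume a0: "\<forall>\<mu>. a0 \<mu> < \<top>" and a: "\<forall>j \<mu>. a j \<mu> < \<top>"
    have "(\<integral>\<^sup>+\<nu>. ennreal (W \<nu>) * a0 (\<Sum>j\<in>UNIV. \<nu> $ j) * (\<Prod>j\<in>UNIV. a j (\<nu> $ j)) \<partial>count_space int_lattice) =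
        (\<integral>\<^sup>+\<nu>. ennreal (W \<nu> * enn2real (a0 (\<Sum>j\<in>UNIV. \<nu> $ j)) * (\<Prod>j\<in>UNIV. enn2real (a j (\<nu> $ j)))) \<partial>count_space int_lattice)"
      using W0 a0 a
      by (intro nn_integral_cong) (simp add: ennreal_mult prod_nonneg flip: prod_ennreal)
    also have "\<dots> \<le> ennreal c * lq_norm int_lattice 2 (\<lambda>\<mu>. ennreal (enn2real (a0 \<mu>)))
                * (\<Prod>j\<in>UNIV. lq_norm int_lattice 2 (\<lambda>\<mu>. ennreal (enn2real (a j \<mu>))))"
      unfolding infsum_eq_nn_integral[OF L, symmetric] by (rule B) simp
    finally show "(\<integral>\<^sup>+\<nu>. ennreal (W \<nu>) * a0 (\<Sum>j\<in>UNIV. \<nu> $ j) * (\<Prod>j\<in>UNIV. a j (\<nu> $ j)) \<partial>count_space int_lattice)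
       \<le> ennreal c * epowr (\<integral>\<^sup>+\<mu>. (a0 \<mu>)\<^sup>2 \<partial>count_space int_lattice) (1/2) *
         (\<Prod>j\<in>UNIV. epowr (\<integral>\<^sup>+\<mu>. (a j \<mu>)\<^sup>2 \<partial>count_space int_lattice) (1/2))"
      using a0 a by (simp add: l2)
  qed
qed

text \<open>Moderate growth makes the values of \<open>W\<close> on a cell comparable to the value
  at its lattice point. This connects the continuous weight in the symbol norm with the class B
  inequality, which sees lattice points only.\<close>

lemma class_M_cell:
  fixes W :: "'a::euclidean_space \<Rightarrow> real"
  assumes "W \<in> class_M"
  shows "\<exists>C>0. \<forall>\<nu> \<xi>. \<xi> \<in> unit_cube \<longrightarrow> W (\<xi> + \<nu>) \<le> C * W \<nu>"
proof -
  from assms obtain C M where C: "C > 0" "M > 0" and W: "\<And>\<xi>. 0 < W \<xi>" "\<And>\<xi> \<eta>. W (\<xi> + \<eta>) \<le> C * W \<xi> * japanese_bracket \<eta> powr M"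
    unfolding class_M_def by blast
  let ?B = "sqrt (1 + (real DIM('a))\<^sup>2) powr M"
  have "0 < 1 + (real DIM('a))\<^sup>2" by (intro add_pos_nonneg) auto
  then have B: "?B > 0" by simp
  have "W (\<xi> + \<nu>) \<le> (C * ?B) * W \<nu>" if "\<xi> \<in> unit_cube" for \<xi> \<nu>
  proof -
    have "(norm \<xi>)\<^sup>2 \<le> (real DIM('a))\<^sup>2" using norm_unit_cube_le[OF that] by (intro power_mono) auto
    then have "japanese_bracket \<xi> powr M \<le> ?B"
      unfolding japanese_bracket_def using C by (intro powr_mono2) auto
    then have "C * W \<nu> * japanese_bracket \<xi> powr M \<le> C * W \<nu> * ?B"
      using C W(1)[of \<nu>] by (intro mult_left_mono) auto
    then show ?thesis using W(2)[of \<nu> \<xi>] by (simp add: mult_ac add.commute[of \<xi>])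
  qed
  then show ?thesis using C B by (intro exI[of _ "C * ?B"]) auto
qed

section \<open>Square integrals over lattice cells\<close>

text \<open>The squared local L2 norm, written with the Borel measure. Keeping the square makes it
  additive over cells; roots are taken at the end by \<open>epowr\<close> with exponent 1/2.\<close>

definition cell_sq :: "('a::euclidean_space \<Rightarrow> complex) \<Rightarrow> 'a \<Rightarrow> ennreal" where
  "cell_sq f \<nu> = (\<integral>\<^sup>+x. (ennreal (norm (f (x + \<nu>))))\<^sup>2 * indicator unit_cube x \<partial>lborel)"

lemma Lp_norm_unit_cube:
  "Lp_norm (restrict_space lebesgue unit_cube) 2 (\<lambda>x. f (x + \<nu>)) = epowr (cell_sq f \<nu>) (1/2)"
proof -
  have c: "unit_cube \<inter> space lebesgue \<in> sets (lebesgue :: 'a measure)" by (simp add: sets_completionI_sets)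
  have "(\<integral>\<^sup>+x. ennreal (norm (f (x + \<nu>)) powr 2) \<partial>restrict_space lebesgue unit_cube) =
      (\<integral>\<^sup>+x. ennreal (norm (f (x + \<nu>)) powr 2) * indicator unit_cube x \<partial>lebesgue)"
    by (rule nn_integral_restrict_space[OF c])
  also have "\<dots> = cell_sq f \<nu>"
    unfolding cell_sq_def nn_integral_completion by (simp add: ennreal_power powr_numeral)
  finally show ?thesis by (simp add: Lp_norm_def)
qed

lemma L2ul_norm_eq: "L2ul_norm f = (SUP \<nu>\<in>int_lattice. epowr (cell_sq f \<nu>) (1/2))"
  by (simp add: L2ul_norm_def Lp_norm_unit_cube)

lemma cell_sq_le_L2ul: "\<nu> \<in> int_lattice \<Longrightarrow> cell_sq f \<nu> \<le> (L2ul_norm f)\<^sup>2"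
proof -
  assume "\<nu> \<in> int_lattice"
  then have "epowr (cell_sq f \<nu>) (1/2) \<le> L2ul_norm f" unfolding L2ul_norm_eq by (rule SUP_upper)
  then have "(epowr (cell_sq f \<nu>) (1/2))\<^sup>2 \<le> (L2ul_norm f)\<^sup>2" by (rule power_mono) simp
  then show ?thesis by (simp add: epowr_half_power2)
qed

lemma cell_sq_cong_AE:
  assumes "AE x in lborel. f x = g x"
  shows "cell_sq f \<nu> = cell_sq g \<nu>"
proof -
  have "AE x in lborel. f (x + \<nu>) = g (x + \<nu>)"
  proof -
    obtain N where N: "N \<in> null_sets lborel" "{x. f x \<noteq> g x} \<subseteq> N"
      using assms by (auto elim!: AE_E simp: null_sets_def)
    then have [measurable]: "N \<in> sets borel" and "AE x in lborel. x \<notin> N" by (auto intro: AE_not_in)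
    then have "AE x in distr lborel borel ((+) \<nu>). x \<notin> N"
      unfolding lborel_distr_plus by blast
    then have "AE x in lborel. \<nu> + x \<notin> N" by (subst (asm) AE_distr_iff) auto
    then show ?thesis by eventually_elim (use N(2) in \<open>auto simp: add.commute\<close>)
  qed
  then show ?thesis unfolding cell_sq_def
    by (intro nn_integral_cong_AE) (erule eventually_mono, simp)
qed

lemma L2ul_norm_cong_AE: "AE x in lborel. f x = g x \<Longrightarrow> L2ul_norm f = L2ul_norm g"
  using cell_sq_cong_AE[of f g] by (simp add: L2ul_norm_eq)

lemma amalgam_norm_2_eq: "amalgam_norm 2 q f = lq_norm int_lattice q (\<lambda>\<nu>. epowr (cell_sq f \<nu>) (1/2))"
  by (simp add: amalgam_norm_def Lp_norm_unit_cube)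

section \<open>Localization\<close>

context
  fixes \<phi> :: "'a::euclidean_space \<Rightarrow> complex"
  assumes \<phi>: "lp_cutoff \<phi>"
begin

text \<open>The inverse Fourier transform of the cutoff is the convolution kernel in \<open>\<xi>\<close>; in the space
  variable it becomes the compactly supported factor \<open>\<phi>((y - x) / 2\<^sup>k)\<close>.\<close>

lemma localization_formula:
  assumes f: "integrable lborel f"
  shows "(\<integral>\<xi>. inv_fourier (dil \<phi> k) (\<xi> - \<xi>') * (cis (x \<bullet> \<xi>) * fourier f \<xi>) \<partial>lborel) =
     (\<integral>y. f y * (cis ((x - y) \<bullet> \<xi>') * dil \<phi> k (y - x)) \<partial>lborel)"
proof -
  let ?K = "inv_fourier (dil \<phi> k)"
  have K: "integrable lborel ?K" by (rule inv_fourier_cutoff_integrable[OF \<phi>])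
  have [measurable]: "?K \<in> borel_measurable borel" "f \<in> borel_measurable borel" using K f by auto
  have Ks: "integrable lborel (\<lambda>\<xi>. ?K (\<xi> - \<xi>'))" using K integrable_lborel_shift[of ?K "-\<xi>'"] by simp
  define F where "F \<xi> y = ?K (\<xi> - \<xi>') * (cis (x \<bullet> \<xi>) * (cis (- (y \<bullet> \<xi>)) * f y))" for \<xi> y
  have [measurable]: "(\<lambda>(\<xi>, y). F \<xi> y) \<in> borel_measurable (borel \<Otimes>\<^sub>M borel)" unfolding F_def by measurable
  have int: "integrable (lborel \<Otimes>\<^sub>M lborel) (\<lambda>(\<xi>, y). F \<xi> y)"
    by (rule Bochner_Integration.integrable_bound[OF integrable_lborel_pair_mult(1)[OF Ks f]])
       (measurable, auto simp: F_def norm_mult)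
  have "(\<integral>\<xi>. ?K (\<xi> - \<xi>') * (cis (x \<bullet> \<xi>) * fourier f \<xi>) \<partial>lborel) = (\<integral>\<xi>. (\<integral>y. F \<xi> y \<partial>lborel) \<partial>lborel)"
    unfolding F_def by (simp add: fourier_lborel)
  also have "\<dots> = (\<integral>y. (\<integral>\<xi>. F \<xi> y \<partial>lborel) \<partial>lborel)"
    by (rule lborel_pair.Fubini_integral[OF int, symmetric])
  also have "\<dots> = (\<integral>y. f y * (cis ((x - y) \<bullet> \<xi>') * dil \<phi> k (y - x)) \<partial>lborel)"
  proof (intro Bochner_Integration.integral_cong refl)
    fix y
    have "(\<integral>\<xi>. F \<xi> y \<partial>lborel) = (\<integral>\<eta>. F (\<eta> + \<xi>') y \<partial>lborel)" by (rule integral_lborel_shift[symmetric])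
    also have "\<dots> = (\<integral>\<eta>. (f y * cis ((x - y) \<bullet> \<xi>')) * (cis (- (\<eta> \<bullet> (y - x))) * ?K \<eta>) \<partial>lborel)"
    proof (intro Bochner_Integration.integral_cong refl)
      fix \<eta>
      have c: "cis (x \<bullet> (\<eta> + \<xi>')) * cis (- (y \<bullet> (\<eta> + \<xi>'))) = cis ((x - y) \<bullet> \<xi>') * cis (- (\<eta> \<bullet> (y - x)))"
        by (simp add: cis_mult inner_diff_left inner_diff_right inner_add_right inner_commute[of \<eta>]) (simp add: algebra_simps)
      have "F (\<eta> + \<xi>') y = ?K \<eta> * ((cis (x \<bullet> (\<eta> + \<xi>')) * cis (- (y \<bullet> (\<eta> + \<xi>')))) * f y)"
        unfolding F_def add_diff_cancel_right' by (simp only: mult.assoc)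
      then show "F (\<eta> + \<xi>') y = (f y * cis ((x - y) \<bullet> \<xi>')) * (cis (- (\<eta> \<bullet> (y - x))) * ?K \<eta>)"
        unfolding c by (simp only: mult_ac)
    qed
    also have "\<dots> = (f y * cis ((x - y) \<bullet> \<xi>')) * fourier ?K (y - x)"
      by (simp add: fourier_lborel)
    also have "fourier ?K (y - x) = dil \<phi> k (y - x)" by (simp add: fourier_inv_fourier_dil[OF \<phi>])
    finally show "(\<integral>\<xi>. F \<xi> y \<partial>lborel) = f y * (cis ((x - y) \<bullet> \<xi>') * dil \<phi> k (y - x))" by (simp add: mult.assoc)
  qed
  finally show ?thesis .
qed

lemma dil_cutoff_eq_0: "2 * 2 ^ k < norm y \<Longrightarrow> dil \<phi> k y = 0"
  unfolding dil_def by (rule cutoff_eq_0[OF \<phi>]) (simp add: field_simps)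

text \<open>In the localized form \<open>f\<close> is multiplied by a cutoff supported in the ball
  of radius \<open>2 * 2 ^ k\<close> around \<open>x\<close>. This is what permits exchanging
  \<open>f\<close> for a restriction of it.\<close>

lemma localization_cong:
  assumes f: "integrable lborel f" and g: "integrable lborel g"
    and eq: "\<And>y. norm (y - x) \<le> 2 * 2 ^ k \<Longrightarrow> f y = g y"
  shows "(\<integral>\<xi>. inv_fourier (dil \<phi> k) (\<xi> - \<xi>') * (cis (x \<bullet> \<xi>) * fourier f \<xi>) \<partial>lborel) =
     (\<integral>\<xi>. inv_fourier (dil \<phi> k) (\<xi> - \<xi>') * (cis (x \<bullet> \<xi>) * fourier g \<xi>) \<partial>lborel)"
  unfolding localization_formula[OF f] localization_formula[OF g]
proof (intro Bochner_Integration.integral_cong refl)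
  fix y
  show "f y * (cis ((x - y) \<bullet> \<xi>') * dil \<phi> k (y - x)) = g y * (cis ((x - y) \<bullet> \<xi>') * dil \<phi> k (y - x))"
    using eq[of y] dil_cutoff_eq_0[of k "y - x"] by (cases "norm (y - x) \<le> 2 * 2 ^ k") auto
qed

text \<open>The kernel is \<open>R ^ DIM('a)\<close> times a fixed rapidly decreasing function of
  the argument dilated by \<open>R = 2 ^ k\<close>. Its squared amplitude gives two powers of the
  volume factor and the integration in \<open>x'\<close> returns one.\<close>

lemma kernel_cell_decay:
  "\<exists>C>0. \<forall>k \<kappa> \<mu> x. x - \<mu> \<in> unit_cube \<longrightarrow>
     (\<integral>\<^sup>+x'. (ennreal (norm (inv_fourier (dil \<phi> k) (x - (x' + \<kappa>)))))\<^sup>2 * indicator unit_cube x' \<partial>lborel)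
       \<le> ennreal (C * (2 ^ k) ^ DIM('a) * (jw (\<kappa> - \<mu>))\<^sup>2)"
proof -
  \<comment> \<open>The squared kernel then carries four factors of the weight: two give the decay
    in \<open>\<kappa> - \<mu>\<close>, one makes the integral over \<open>x'\<close> finite, and
    the last is bounded by 1.\<close>
  obtain C where C: "C > 0" "\<And>\<xi>. norm (inv_fourier \<phi> \<xi>) \<le> C * jw \<xi> ^ 2"
    using inv_fourier_decay[OF cutoff_schwartz[OF \<phi>], of 2] by blast
  define B where "B = (2 * (1 + (2 * real DIM('a))\<^sup>2)) ^ DIM('a)"
  have B: "B > 0" unfolding B_def by (intro mult_pos_pos zero_less_power add_pos_nonneg) auto
  define J where "J = (\<integral>x. jw (x::'a) \<partial>lborel)"
  have J: "0 \<le> J" unfolding J_def by (intro integral_nonneg_AE) (simp add: jw_nonneg)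
  have "(\<integral>\<^sup>+x'. (ennreal (norm (inv_fourier (dil \<phi> k) (x - (x' + \<kappa>)))))\<^sup>2 * indicator unit_cube x' \<partial>lborel)
       \<le> ennreal ((C\<^sup>2 * B\<^sup>2 * (J + 1)) * (2 ^ k) ^ DIM('a) * (jw (\<kappa> - \<mu>))\<^sup>2)"
    if x: "x - \<mu> \<in> unit_cube" for k \<kappa> \<mu> x
  proof -
    define R where "R = (2::real) ^ k"
    have R: "R \<ge> 1" by (simp add: R_def)
    have pw: "(norm (inv_fourier (dil \<phi> k) (x - (x' + \<kappa>))))\<^sup>2 \<le>
        (R ^ DIM('a))\<^sup>2 * (C\<^sup>2 * (B\<^sup>2 * (jw (\<kappa> - \<mu>))\<^sup>2)) * jw (R *\<^sub>R (x' - (x - \<kappa>)))" if x': "x' \<in> unit_cube" for x'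
    proof -
      define z where "z = x - (x' + \<kappa>)"
      have jz: "jw (R *\<^sub>R z) \<le> jw z"
      proof -
        have "(norm z)\<^sup>2 \<le> (norm (R *\<^sub>R z))\<^sup>2"
          using R by (intro power_mono) (auto simp: mult_le_cancel_right1)
        then have "(1 + (norm z)\<^sup>2) ^ DIM('a) \<le> (1 + (norm (R *\<^sub>R z))\<^sup>2) ^ DIM('a)"
          by (intro power_mono add_left_mono) auto
        moreover have "0 < (1 + (norm z)\<^sup>2) ^ DIM('a)" by (intro zero_less_power add_pos_nonneg) auto
        ultimately show ?thesis unfolding jw_def by (intro le_imp_inverse_le)
      qed
      have "norm (x' - (x - \<mu>)) \<le> 2 * real DIM('a)"
        using norm_triangle_ineq4[of x' "x - \<mu>"] norm_unit_cube_le[OF x'] norm_unit_cube_le[OF x] by linarith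
      from jw_peetre[OF this, of z] have "jw z \<le> B * jw (\<mu> - \<kappa>)" by (simp add: B_def z_def)
      also have "jw (\<mu> - \<kappa>) = jw (\<kappa> - \<mu>)" using jw_minus[of "\<kappa> - \<mu>"] by simp
      finally have jz2: "jw z \<le> B * jw (\<kappa> - \<mu>)" .
      have "norm (inv_fourier (dil \<phi> k) z) = R ^ DIM('a) * norm (inv_fourier \<phi> (R *\<^sub>R z))"
        by (simp add: inv_fourier_dil[OF cutoff_borel[OF \<phi>]] norm_mult norm_power R_def)
      also have "\<dots> \<le> R ^ DIM('a) * (C * jw (R *\<^sub>R z) ^ 2)"
        using R by (intro mult_left_mono C(2)) auto
      finally have "(norm (inv_fourier (dil \<phi> k) z))\<^sup>2 \<le> (R ^ DIM('a) * (C * jw (R *\<^sub>R z) ^ 2))\<^sup>2"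
        by (intro power_mono) auto
      also have "\<dots> = (R ^ DIM('a))\<^sup>2 * (C\<^sup>2 * (jw (R *\<^sub>R z) ^ 2 * (jw (R *\<^sub>R z) * jw (R *\<^sub>R z))))"
        by (simp add: power_mult_distrib power2_eq_square)
      also have "\<dots> \<le> (R ^ DIM('a))\<^sup>2 * (C\<^sup>2 * ((B * jw (\<kappa> - \<mu>)) ^ 2 * (jw (R *\<^sub>R z) * 1)))"
        using order_trans[OF jz jz2] by (intro mult_left_mono mult_mono power_mono jw_le_1) (auto simp: jw_nonneg)
      also have "jw (R *\<^sub>R z) = jw (R *\<^sub>R (x' - (x - \<kappa>)))"
        using jw_minus[of "R *\<^sub>R z"] by (simp add: z_def scaleR_right_diff_distrib algebra_simps)
      finally show ?thesis by (simp add: z_def power_mult_distrib mult_ac)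
    qed
    let ?c = "(R ^ DIM('a))\<^sup>2 * (C\<^sup>2 * (B\<^sup>2 * (jw (\<kappa> - \<mu>))\<^sup>2))"
    have "(\<integral>\<^sup>+x'. (ennreal (norm (inv_fourier (dil \<phi> k) (x - (x' + \<kappa>)))))\<^sup>2 * indicator unit_cube x' \<partial>lborel) \<le>
        (\<integral>\<^sup>+x'. ennreal ?c * ennreal (jw (R *\<^sub>R (x' - (x - \<kappa>)))) \<partial>lborel)"
      using pw by (intro nn_integral_mono) (auto simp: indicator_def ennreal_power ennreal_mult[symmetric] jw_nonneg intro!: ennreal_leI)
    also have "\<dots> = ennreal ?c * (\<integral>\<^sup>+x'. ennreal (jw (R *\<^sub>R (x' - (x - \<kappa>)))) \<partial>lborel)"
      by (rule nn_integral_cmult) measurable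
    also have "(\<integral>\<^sup>+x'. ennreal (jw (R *\<^sub>R (x' - (x - \<kappa>)))) \<partial>lborel) = (\<integral>\<^sup>+x'. ennreal (jw (R *\<^sub>R x')) \<partial>(lborel :: 'a measure))"
      using nn_integral_lborel_shift[of "\<lambda>x'. ennreal (jw (R *\<^sub>R x'))" "- (x - \<kappa>)"]
      by (simp only: diff_conv_add_uminus) simp
    \<comment> \<open>The factor \<open>R ^ DIM('a)\<close> is split off so that the dilation in the
      integral absorbs it; the other one stays as the growth in \<open>k\<close>.\<close>
    also have "ennreal ?c * \<dots> = ennreal (R ^ DIM('a) * (C\<^sup>2 * (B\<^sup>2 * (jw (\<kappa> - \<mu>))\<^sup>2))) * (ennreal (R ^ DIM('a)) * (\<integral>\<^sup>+x'. ennreal (jw (R *\<^sub>R x')) \<partial>(lborel :: 'a measure)))"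
    proof -
      have n: "0 \<le> R ^ DIM('a)" "0 \<le> R ^ DIM('a) * (C\<^sup>2 * (B\<^sup>2 * (jw (\<kappa> - \<mu>))\<^sup>2))" using R by auto
      have "?c = R ^ DIM('a) * (C\<^sup>2 * (B\<^sup>2 * (jw (\<kappa> - \<mu>))\<^sup>2)) * R ^ DIM('a)"
        by (simp only: power2_eq_square[of "R ^ DIM('a)"] mult_ac)
      then have "ennreal ?c = ennreal (R ^ DIM('a) * (C\<^sup>2 * (B\<^sup>2 * (jw (\<kappa> - \<mu>))\<^sup>2))) * ennreal (R ^ DIM('a))"
        by (simp only: ennreal_mult[OF n(2,1)])
      then show ?thesis by (simp only: mult.assoc)
    qed
    also have "ennreal (R ^ DIM('a)) * (\<integral>\<^sup>+x'. ennreal (jw (R *\<^sub>R x')) \<partial>(lborel :: 'a measure)) = (\<integral>\<^sup>+x'. ennreal (jw x') \<partial>(lborel :: 'a measure))"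
      using R by (subst nn_integral_lborel_affine[of _ R 0]) auto
    also have "\<dots> = ennreal J" unfolding J_def by (rule nn_integral_eq_integral[OF integrable_jw]) (simp add: jw_nonneg)
    also have "ennreal (R ^ DIM('a) * (C\<^sup>2 * (B\<^sup>2 * (jw (\<kappa> - \<mu>))\<^sup>2))) * ennreal J = ennreal (R ^ DIM('a) * (C\<^sup>2 * (B\<^sup>2 * (jw (\<kappa> - \<mu>))\<^sup>2)) * J)"
      using R J by (intro ennreal_mult[symmetric]) auto
    also have "\<dots> \<le> ennreal (R ^ DIM('a) * (C\<^sup>2 * (B\<^sup>2 * (jw (\<kappa> - \<mu>))\<^sup>2)) * (J + 1))"
      using R by (intro ennreal_leI mult_left_mono) auto
    finally show ?thesis by (simp add: R_def mult_ac)
  qed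
  moreover have "C\<^sup>2 * B\<^sup>2 * (J + 1) > 0" using C B J by (intro mult_pos_pos) auto
  ultimately show ?thesis by blast
qed

end

section \<open>The estimate on a cell\<close>

lemma ennreal_norm_integral_le:
  fixes f :: "'a \<Rightarrow> 'b::{banach, second_countable_topology}"
  shows "ennreal (norm (\<integral>x. f x \<partial>M)) \<le> (\<integral>\<^sup>+x. ennreal (norm (f x)) \<partial>M)"
proof (cases "integrable M f")
  case False
  then show ?thesis by (simp add: not_integrable_integral_eq)
qed (rule integral_norm_bound_ennreal)

lemma unit_cube_Pair: "(x, y) \<in> unit_cube \<longleftrightarrow> x \<in> unit_cube \<and> y \<in> unit_cube"
  unfolding unit_cube_def mem_Collect_eq Basis_prod_def ball_Un by simp

lemma int_lattice_Pair: "(x, y) \<in> int_lattice \<longleftrightarrow> x \<in> int_lattice \<and> y \<in> int_lattice"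
  unfolding int_lattice_def mem_Collect_eq Basis_prod_def ball_Un by simp

lemma unit_cube_vec: "x \<in> unit_cube \<longleftrightarrow> (\<forall>j. x $ j \<in> unit_cube)"
  unfolding unit_cube_def by (auto simp: Basis_vec_def inner_axis)

lemma int_lattice_vec: "x \<in> int_lattice \<longleftrightarrow> (\<forall>j. x $ j \<in> int_lattice)"
  unfolding int_lattice_def by (auto simp: Basis_vec_def inner_axis)

lemma indicator_unit_cube_vec:
  "(indicator unit_cube x :: ennreal) = (\<Prod>j\<in>UNIV. indicator unit_cube (x $ j))"
  by (auto simp: indicator_def unit_cube_vec)

lemma integrable_if_supported_on_cell:
  fixes f :: "'a::euclidean_space \<Rightarrow> 'b::{banach, second_countable_topology}"
  assumes [measurable]: "f \<in> borel_measurable borel" and bdd: "\<And>x. norm (f x) \<le> M"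
    and supp: "\<And>x. x - \<mu> \<notin> unit_cube \<Longrightarrow> f x = 0"
  shows "integrable lborel f"
proof (rule integrableI_bounded)
  have "(\<integral>\<^sup>+x. ennreal (norm (f x)) \<partial>lborel) \<le> (\<integral>\<^sup>+x. ennreal M * indicator unit_cube (x - \<mu>) \<partial>lborel)"
    using bdd supp by (intro nn_integral_mono) (auto simp: indicator_def intro!: ennreal_leI)
  also have "\<dots> = ennreal M * (\<integral>\<^sup>+x. indicator unit_cube (x - \<mu>) \<partial>lborel)"
    by (rule nn_integral_cmult) measurable
  also have "(\<integral>\<^sup>+x. indicator unit_cube (x - \<mu>) \<partial>lborel) = 1"
    using nn_integral_lborel_shift[of "indicator unit_cube" "-\<mu>"] by (simp add: emeasure_unit_cube)
  finally show "(\<integral>\<^sup>+x. ennreal (norm (f x)) \<partial>lborel) < \<infinity>" by (simp add: le_less_trans)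
qed measurable

lemma nn_integral_lattice_cells_pair:
  fixes F :: "'a::euclidean_space \<Rightarrow> 'b::euclidean_space \<Rightarrow> ennreal"
  assumes [measurable]: "(\<lambda>(x, y). F x y) \<in> borel_measurable (borel \<Otimes>\<^sub>M borel)"
  shows "(\<integral>\<^sup>+x. \<integral>\<^sup>+y. F x y \<partial>lborel \<partial>lborel) =
    (\<integral>\<^sup>+\<kappa>. \<integral>\<^sup>+\<nu>. (\<integral>\<^sup>+x. \<integral>\<^sup>+y. F (x + \<kappa>) (y + \<nu>) * indicator unit_cube y * indicator unit_cube x \<partial>lborel \<partial>lborel)
       \<partial>count_space int_lattice \<partial>count_space int_lattice)"
proof -
  have "(\<integral>\<^sup>+x. \<integral>\<^sup>+y. F x y \<partial>lborel \<partial>lborel) =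
      (\<integral>\<^sup>+\<kappa>. (\<integral>\<^sup>+x. (\<integral>\<^sup>+y. F (x + \<kappa>) y \<partial>lborel) * indicator unit_cube x \<partial>lborel) \<partial>count_space int_lattice)"
    by (rule nn_integral_lattice_cells) measurable
  also have "\<dots> = (\<integral>\<^sup>+\<kappa>. \<integral>\<^sup>+\<nu>. (\<integral>\<^sup>+x. \<integral>\<^sup>+y. F (x + \<kappa>) (y + \<nu>) * indicator unit_cube y * indicator unit_cube x \<partial>lborel \<partial>lborel)
       \<partial>count_space int_lattice \<partial>count_space int_lattice)"
  proof (rule nn_integral_cong)
    fix \<kappa> :: 'a
    have "(\<integral>\<^sup>+x. (\<integral>\<^sup>+y. F (x + \<kappa>) y \<partial>lborel) * indicator unit_cube x \<partial>lborel) =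
        (\<integral>\<^sup>+x. (\<integral>\<^sup>+\<nu>. (\<integral>\<^sup>+y. F (x + \<kappa>) (y + \<nu>) * indicator unit_cube y * indicator unit_cube x \<partial>lborel) \<partial>count_space int_lattice) \<partial>lborel)"
    proof (rule nn_integral_cong)
      fix x
      have "(\<integral>\<^sup>+y. F (x + \<kappa>) y \<partial>lborel) * indicator unit_cube x = (\<integral>\<^sup>+y. F (x + \<kappa>) y * indicator unit_cube x \<partial>lborel)"
        by (simp add: nn_integral_multc)
      also have "\<dots> = (\<integral>\<^sup>+\<nu>. (\<integral>\<^sup>+y. F (x + \<kappa>) (y + \<nu>) * indicator unit_cube x * indicator unit_cube y \<partial>lborel) \<partial>count_space int_lattice)"
        by (rule nn_integral_lattice_cells) measurable
      finally show "(\<integral>\<^sup>+y. F (x + \<kappa>) y \<partial>lborel) * indicator unit_cube x =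
        (\<integral>\<^sup>+\<nu>. (\<integral>\<^sup>+y. F (x + \<kappa>) (y + \<nu>) * indicator unit_cube y * indicator unit_cube x \<partial>lborel) \<partial>count_space int_lattice)"
        by (simp add: mult_ac)
    qed
    also have "\<dots> = (\<integral>\<^sup>+\<nu>. (\<integral>\<^sup>+x. \<integral>\<^sup>+y. F (x + \<kappa>) (y + \<nu>) * indicator unit_cube y * indicator unit_cube x \<partial>lborel \<partial>lborel) \<partial>count_space int_lattice)"
      by (rule nn_integral_count_space_nn_integral[OF countable_int_lattice]) measurable
    finally show "(\<integral>\<^sup>+x. (\<integral>\<^sup>+y. F (x + \<kappa>) y \<partial>lborel) * indicator unit_cube x \<partial>lborel) = \<dots>" .
  qed
  finally show ?thesis .
qed

lemma nn_integral_lborel_pair: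
  fixes F :: "'a::euclidean_space \<Rightarrow> 'b::euclidean_space \<Rightarrow> ennreal"
  assumes [measurable]: "(\<lambda>(x, y). F x y) \<in> borel_measurable (borel \<Otimes>\<^sub>M borel)"
  shows "(\<integral>\<^sup>+x. \<integral>\<^sup>+y. F x y \<partial>lborel \<partial>lborel) = (\<integral>\<^sup>+z. F (fst z) (snd z) \<partial>lborel)"
proof -
  have "(\<lambda>z. F (fst z) (snd z)) \<in> borel_measurable (lborel \<Otimes>\<^sub>M lborel)"
    using assms by (simp add: case_prod_unfold cong: measurable_cong_sets)
  from lborel.nn_integral_fst[OF this] show ?thesis by (simp add: lborel_prod)
qed

section \<open>Phase-space estimate for the transposed test function\<close>

context
  fixes \<phi> :: "real^'n \<Rightarrow> complex"
  assumes \<phi>: "lp_cutoff \<phi>"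
begin

text \<open>The contribution of the space variable once the kernel acts on the test function: a
  Fourier integral of \<open>h\<close> times the translated kernel, evaluated at the sum \<zeta> of
  the frequencies.\<close>

definition x_part :: "nat \<Rightarrow> (real^'n \<Rightarrow> complex) \<Rightarrow> real^'n \<Rightarrow> real^'n \<Rightarrow> complex" where
  "x_part k h x' \<zeta> = (\<integral>x. h x * inv_fourier (dil \<phi> k) (x - x') * cis (x \<bullet> \<zeta>) \<partial>lborel)"

lemma inv_fourier_dil_borel [measurable]: "inv_fourier (dil \<phi> k) \<in> borel_measurable borel"
  using dil_cutoff_borel[OF \<phi>] by (rule inv_fourier_measurable)

lemma x_part_measurable [measurable]:
  assumes [measurable]: "h \<in> borel_measurable borel" "f \<in> borel_measurable M" "g \<in> borel_measurable M"
  shows "(\<lambda>w. x_part k h (f w) (g w)) \<in> borel_measurable M"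
proof -
  have "(\<lambda>p. x_part k h (fst p) (snd p)) \<in> borel_measurable (borel \<Otimes>\<^sub>M borel)"
    unfolding x_part_def by measurable
  from measurable_compose[OF _ this, of "\<lambda>w. (f w, g w)" M] show ?thesis by simp
qed

lemma inv_fourier_dil_bounded: "\<exists>B. \<forall>x. norm (inv_fourier (dil \<phi> k) x) \<le> B"
proof -
  obtain C where C: "\<And>\<xi>. norm (inv_fourier \<phi> \<xi>) \<le> C"
    using inv_fourier_decay[OF cutoff_schwartz[OF \<phi>], of 0] by auto
  have "norm (inv_fourier (dil \<phi> k) x) \<le> (2 ^ k) ^ CARD('n) * C" for x
    by (simp add: inv_fourier_dil[OF cutoff_borel[OF \<phi>]] norm_mult norm_power C)
  then show ?thesis by blast
qed

text \<open>For fixed \<open>x'\<close> this is a Fourier integral of a function living on the cell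
  of \<mu>, so the sum over \<tau> is a sampling sum. The supremum stands outside the integral over
  the cell, hence each choice of nodes is the same for all \<open>x'\<close>; integrating the
  sampling bound over \<open>x'\<close> leaves the square integral of the kernel over a
  cell.\<close>

lemma x_part_lattice_sum:
  fixes \<rho> :: real
  assumes \<rho>: "0 \<le> \<rho>"
  shows "\<exists>C>0. \<forall>k \<kappa> \<mu> h M v. h \<in> borel_measurable borel \<longrightarrow> (\<forall>x. norm (h x) \<le> M) \<longrightarrow>
     (\<forall>x. x - \<mu> \<notin> unit_cube \<longrightarrow> h x = 0) \<longrightarrow>
     (\<integral>\<^sup>+\<tau>. (SUP \<zeta>\<in>{\<zeta>. norm (\<zeta> - \<tau> - v) \<le> \<rho>}.
        \<integral>\<^sup>+x. (ennreal (norm (x_part k h (x + \<kappa>) \<zeta>)))\<^sup>2 * indicator unit_cube x \<partial>lborel) \<partial>count_space int_lattice)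
     \<le> ennreal (C * (2 ^ k) ^ CARD('n) * (jw (\<kappa> - \<mu>))\<^sup>2) * (\<integral>\<^sup>+x. (ennreal (norm (h x)))\<^sup>2 \<partial>lborel)"
proof -
  obtain Cs where Cs: "Cs > 0" and samp: "\<And>(G :: real^'n \<Rightarrow> complex) \<mu> c F \<zeta>. integrable lborel G \<Longrightarrow>
     integrable lborel (\<lambda>x. (norm (G x))\<^sup>2) \<Longrightarrow>
     (\<forall>x. x - \<mu> \<notin> unit_cube \<longrightarrow> G x = 0) \<Longrightarrow> finite F \<Longrightarrow> F \<subseteq> int_lattice \<Longrightarrow>
     (\<forall>\<tau>\<in>F. norm (\<zeta> \<tau> - \<tau> - c) \<le> \<rho>) \<Longrightarrow>
     (\<Sum>\<tau>\<in>F. (norm (\<integral>x. G x * cis (x \<bullet> \<zeta> \<tau>) \<partial>lborel))\<^sup>2) \<le> Cs * (\<integral>x. (norm (G x))\<^sup>2 \<partial>lborel)"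
    using sampling_inequality[OF \<rho>, where 'a="real^'n"] by blast
  obtain Ck where Ck: "Ck > 0" and ker: "\<And>k \<kappa> \<mu> x. x - \<mu> \<in> unit_cube \<Longrightarrow>
     (\<integral>\<^sup>+x'. (ennreal (norm (inv_fourier (dil \<phi> k) (x - (x' + \<kappa>)))))\<^sup>2 * indicator unit_cube x' \<partial>lborel)
       \<le> ennreal (Ck * (2 ^ k) ^ CARD('n) * (jw (\<kappa> - \<mu>))\<^sup>2)"
    using kernel_cell_decay[OF \<phi>] by auto
  have main: "(\<integral>\<^sup>+\<tau>. (SUP \<zeta>\<in>{\<zeta>. norm (\<zeta> - \<tau> - v) \<le> \<rho>}.
        \<integral>\<^sup>+x. (ennreal (norm (x_part k h (x + \<kappa>) \<zeta>)))\<^sup>2 * indicator unit_cube x \<partial>lborel) \<partial>count_space int_lattice)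
     \<le> ennreal ((Cs * Ck) * (2 ^ k) ^ CARD('n) * (jw (\<kappa> - \<mu>))\<^sup>2) * (\<integral>\<^sup>+x. (ennreal (norm (h x)))\<^sup>2 \<partial>lborel)"
    if hm [measurable]: "h \<in> borel_measurable borel" and hb: "\<And>x. norm (h x) \<le> M"
      and supp: "\<And>x. x - \<mu> \<notin> unit_cube \<Longrightarrow> h x = 0" for k \<kappa> \<mu> h M v
  proof (rule nn_integral_count_space_le_if_finite_sums[OF countable_int_lattice], rule sum_SUP_le_if_choices)
    fix F :: "(real^'n) set" assume F: "finite F" "F \<subseteq> int_lattice"
    show "finite F" by (rule F)
    show "{\<zeta>. norm (\<zeta> - \<tau> - v) \<le> \<rho>} \<noteq> {}" for \<tau> :: "real^'n"
      using \<rho> by (auto intro!: exI[of _ "\<tau> + v"])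
    fix z assume z: "\<And>\<tau>. \<tau> \<in> F \<Longrightarrow> z \<tau> \<in> {\<zeta>. norm (\<zeta> - \<tau> - v) \<le> \<rho>}"
    obtain B where B: "\<And>x. norm (inv_fourier (dil \<phi> k) x) \<le> B" using inv_fourier_dil_bounded by blast
    let ?\<Phi> = "inv_fourier (dil \<phi> k)"
    have "(\<Sum>\<tau>\<in>F. \<integral>\<^sup>+x. (ennreal (norm (x_part k h (x + \<kappa>) (z \<tau>))))\<^sup>2 * indicator unit_cube x \<partial>lborel) =
        (\<integral>\<^sup>+x. (\<Sum>\<tau>\<in>F. (ennreal (norm (x_part k h (x + \<kappa>) (z \<tau>))))\<^sup>2 * indicator unit_cube x) \<partial>lborel)"
      by (rule nn_integral_sum[symmetric]) measurable
    also have "\<dots> \<le> (\<integral>\<^sup>+x'. (\<integral>\<^sup>+x. ennreal Cs * ((ennreal (norm (h x)))\<^sup>2 * ((ennreal (norm (?\<Phi> (x - (x' + \<kappa>)))))\<^sup>2 * indicator unit_cube x')) \<partial>lborel) \<partial>lborel)"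
    proof (rule nn_integral_mono)
      fix x' :: "real^'n"
      define G where "G x = h x * ?\<Phi> (x - (x' + \<kappa>))" for x
      have Gm [measurable]: "G \<in> borel_measurable borel" unfolding G_def by measurable
      have Gs: "G x = 0" if "x - \<mu> \<notin> unit_cube" for x using supp[OF that] by (simp add: G_def)
      have M0: "0 \<le> M" using hb[of 0] norm_ge_zero order_trans by blast
      have Gb: "norm (G x) \<le> M * B" for x
        unfolding G_def norm_mult by (intro mult_mono hb B M0) auto
      have G1: "integrable lborel G" by (rule integrable_if_supported_on_cell[OF Gm Gb Gs])
      have G2: "integrable lborel (\<lambda>x. (norm (G x))\<^sup>2)"
        by (rule integrable_if_supported_on_cell[where M="(M * B)\<^sup>2" and \<mu>=\<mu>]) (auto simp: Gs intro!: power_mono Gb)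
      have xp: "x_part k h (x' + \<kappa>) \<zeta> = (\<integral>x. G x * cis (x \<bullet> \<zeta>) \<partial>lborel)" for \<zeta>
        by (simp add: x_part_def G_def)
      have "(\<Sum>\<tau>\<in>F. (ennreal (norm (x_part k h (x' + \<kappa>) (z \<tau>))))\<^sup>2) = ennreal (\<Sum>\<tau>\<in>F. (norm (\<integral>x. G x * cis (x \<bullet> z \<tau>) \<partial>lborel))\<^sup>2)"
        by (simp add: xp ennreal_power sum_ennreal)
      also have "\<dots> \<le> ennreal (Cs * (\<integral>x. (norm (G x))\<^sup>2 \<partial>lborel))"
        using z by (intro ennreal_leI samp[OF G1 G2 _ F, of \<mu> _ v]) (auto simp: Gs)
      also have "\<dots> = ennreal Cs * (\<integral>\<^sup>+x. ennreal ((norm (G x))\<^sup>2) \<partial>lborel)"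
        using Cs by (subst nn_integral_eq_integral[OF G2]) (auto simp: ennreal_mult)
      also have "\<dots> = (\<integral>\<^sup>+x. ennreal Cs * ((ennreal (norm (h x)))\<^sup>2 * (ennreal (norm (?\<Phi> (x - (x' + \<kappa>)))))\<^sup>2) \<partial>lborel)"
        by (subst nn_integral_cmult[symmetric]) (auto simp: G_def norm_mult power_mult_distrib ennreal_mult ennreal_power)
      finally have *: "(\<Sum>\<tau>\<in>F. (ennreal (norm (x_part k h (x' + \<kappa>) (z \<tau>))))\<^sup>2) \<le>
         (\<integral>\<^sup>+x. ennreal Cs * ((ennreal (norm (h x)))\<^sup>2 * (ennreal (norm (?\<Phi> (x - (x' + \<kappa>)))))\<^sup>2) \<partial>lborel)" .
      show "(\<Sum>\<tau>\<in>F. (ennreal (norm (x_part k h (x' + \<kappa>) (z \<tau>))))\<^sup>2 * indicator unit_cube x') \<le>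
          (\<integral>\<^sup>+x. ennreal Cs * ((ennreal (norm (h x)))\<^sup>2 * ((ennreal (norm (?\<Phi> (x - (x' + \<kappa>)))))\<^sup>2 * indicator unit_cube x')) \<partial>lborel)"
        using * by (cases "x' \<in> unit_cube") auto
    qed
    also have "\<dots> = (\<integral>\<^sup>+x. (\<integral>\<^sup>+x'. ennreal Cs * ((ennreal (norm (h x)))\<^sup>2 * ((ennreal (norm (?\<Phi> (x - (x' + \<kappa>)))))\<^sup>2 * indicator unit_cube x')) \<partial>lborel) \<partial>lborel)"
      by (rule lborel_pair.Fubini') measurable
    also have "\<dots> = (\<integral>\<^sup>+x. ennreal Cs * ((ennreal (norm (h x)))\<^sup>2 * (\<integral>\<^sup>+x'. (ennreal (norm (?\<Phi> (x - (x' + \<kappa>)))))\<^sup>2 * indicator unit_cube x' \<partial>lborel)) \<partial>lborel)"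
      by (simp add: nn_integral_cmult)
    also have "\<dots> \<le> (\<integral>\<^sup>+x. ennreal Cs * ((ennreal (norm (h x)))\<^sup>2 * ennreal (Ck * (2 ^ k) ^ CARD('n) * (jw (\<kappa> - \<mu>))\<^sup>2)) \<partial>lborel)"
    proof (rule nn_integral_mono)
      fix x
      show "ennreal Cs * ((ennreal (norm (h x)))\<^sup>2 * (\<integral>\<^sup>+x'. (ennreal (norm (?\<Phi> (x - (x' + \<kappa>)))))\<^sup>2 * indicator unit_cube x' \<partial>lborel)) \<le>
        ennreal Cs * ((ennreal (norm (h x)))\<^sup>2 * ennreal (Ck * (2 ^ k) ^ CARD('n) * (jw (\<kappa> - \<mu>))\<^sup>2))"
      proof (cases "x - \<mu> \<in> unit_cube")
        case True
        then show ?thesis by (intro mult_left_mono ker) auto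
      qed (simp add: supp)
    qed
    also have "\<dots> = ennreal Cs * ((\<integral>\<^sup>+x. (ennreal (norm (h x)))\<^sup>2 \<partial>lborel) * ennreal (Ck * (2 ^ k) ^ CARD('n) * (jw (\<kappa> - \<mu>))\<^sup>2))"
      by (simp add: nn_integral_cmult nn_integral_multc)
    also have "\<dots> = ennreal ((Cs * Ck) * (2 ^ k) ^ CARD('n) * (jw (\<kappa> - \<mu>))\<^sup>2) * (\<integral>\<^sup>+x. (ennreal (norm (h x)))\<^sup>2 \<partial>lborel)"
    proof -
      have n: "0 \<le> Cs" "0 \<le> Ck * (2 ^ k) ^ CARD('n) * (jw (\<kappa> - \<mu>))\<^sup>2" using Cs Ck by auto
      have "(Cs * Ck) * (2 ^ k) ^ CARD('n) * (jw (\<kappa> - \<mu>))\<^sup>2 = Cs * (Ck * (2 ^ k) ^ CARD('n) * (jw (\<kappa> - \<mu>))\<^sup>2)"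
        by (simp only: mult.assoc)
      then have e: "ennreal ((Cs * Ck) * (2 ^ k) ^ CARD('n) * (jw (\<kappa> - \<mu>))\<^sup>2) = ennreal Cs * ennreal (Ck * (2 ^ k) ^ CARD('n) * (jw (\<kappa> - \<mu>))\<^sup>2)"
        by (simp only: ennreal_mult[OF n])
      show ?thesis unfolding e by (simp only: mult_ac)
    qed
    finally show "(\<Sum>\<tau>\<in>F. \<integral>\<^sup>+x. (ennreal (norm (x_part k h (x + \<kappa>) (z \<tau>))))\<^sup>2 * indicator unit_cube x \<partial>lborel) \<le>
      ennreal ((Cs * Ck) * (2 ^ k) ^ CARD('n) * (jw (\<kappa> - \<mu>))\<^sup>2) * (\<integral>\<^sup>+x. (ennreal (norm (h x)))\<^sup>2 \<partial>lborel)" .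
  qed
  show ?thesis
    by (intro exI[of _ "Cs * Ck"] conjI allI impI mult_pos_pos Cs Ck, rule main; blast)
qed

text \<open>Phase space is cut into cells \<open>(\<kappa>, \<nu>)\<close>. Cauchy-Schwarz on a cell
  separates \<open>u\<close> from the remaining factors, the class B inequality sums over \<nu>, and
  the decay in \<open>\<kappa> - \<mu>\<close> sums over \<kappa>. The bound is uniform in the shift
  \<eta>, over which the frequency kernels are integrated later.\<close>

lemma x_part_form_estimate:
  fixes W :: "real^'n^'N \<Rightarrow> real"
  assumes WM: "W \<in> class_M" and WB: "W \<in> class_B"
  shows "\<exists>C>0. \<forall>k \<mu> h M u g \<eta>. h \<in> borel_measurable borel \<longrightarrow> (\<forall>x. norm (h x) \<le> M) \<longrightarrow>
     (\<forall>x. x - \<mu> \<notin> unit_cube \<longrightarrow> h x = 0) \<longrightarrow> u \<in> borel_measurable borel \<longrightarrow>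
     (\<forall>j. integrable lborel (g j)) \<longrightarrow>
     (\<integral>\<^sup>+x. \<integral>\<^sup>+\<xi>. ennreal (norm (u (x, \<xi>))) * (ennreal (norm (x_part k h x (\<Sum>j\<in>UNIV. \<xi> $ j + \<eta> $ j))) *
         (\<Prod>j\<in>UNIV. ennreal (norm (fourier (g j) (\<xi> $ j + \<eta> $ j))))) \<partial>lborel \<partial>lborel)
      \<le> ennreal (C * sqrt ((2 ^ k) ^ CARD('n))) * L2ul_norm (\<lambda>(x, \<xi>). of_real (inverse (W \<xi>)) * u (x, \<xi>)) *
        epowr (\<integral>\<^sup>+x. (ennreal (norm (h x)))\<^sup>2 \<partial>lborel) (1/2) *
        (\<Prod>j\<in>UNIV. epowr (\<integral>\<^sup>+x. (ennreal (norm (g j x)))\<^sup>2 \<partial>lborel) (1/2))"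
proof -
  \<comment> \<open>For frequencies in one cell, the sum of the \<open>N\<close> components differs
    from its value at the lattice point by at most \<open>N\<close> times the norm bound of the unit
    cube.\<close>
  let ?\<rho> = "real CARD('N) * real CARD('n)"
  have \<rho>0: "0 \<le> ?\<rho>" by simp
  obtain CA where CA: "CA > 0" and xsum: "\<And>k \<kappa> \<mu> h M v. h \<in> borel_measurable borel \<Longrightarrow> (\<forall>x. norm (h x) \<le> M) \<Longrightarrow>
     (\<forall>x. x - \<mu> \<notin> unit_cube \<longrightarrow> h x = 0) \<Longrightarrow>
     (\<integral>\<^sup>+\<tau>. (SUP \<zeta>\<in>{\<zeta>. norm (\<zeta> - \<tau> - v) \<le> ?\<rho>}.
        \<integral>\<^sup>+x. (ennreal (norm (x_part k h (x + \<kappa>) \<zeta>)))\<^sup>2 * indicator unit_cube x \<partial>lborel) \<partial>count_space int_lattice)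
     \<le> ennreal (CA * (2 ^ k) ^ CARD('n) * (jw (\<kappa> - \<mu>))\<^sup>2) * (\<integral>\<^sup>+x. (ennreal (norm (h x)))\<^sup>2 \<partial>lborel)"
    using x_part_lattice_sum[OF \<rho>0] by blast
  obtain CW where CW: "CW > 0" and Wcell: "\<And>\<nu> \<xi>. \<xi> \<in> unit_cube \<Longrightarrow> W (\<xi> + \<nu>) \<le> CW * W \<nu>"
    using class_M_cell[OF WM] by blast
  have Wpos: "0 < W \<xi>" for \<xi> using WM by (simp add: class_M_def)
  have Wm [measurable]: "W \<in> borel_measurable borel"
    using WM by (intro borel_measurable_continuous_onI) (simp add: class_M_def)
  obtain CB where CB: "CB > 0" and WBe: "\<And>(a0 :: real^'n \<Rightarrow> ennreal) (a :: 'N \<Rightarrow> real^'n \<Rightarrow> ennreal).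
     (\<forall>\<mu>. a0 \<mu> < \<top>) \<Longrightarrow> (\<forall>j \<mu>. a j \<mu> < \<top>) \<Longrightarrow>
     (\<integral>\<^sup>+\<nu>. ennreal (W \<nu>) * a0 (\<Sum>j\<in>UNIV. \<nu> $ j) * (\<Prod>j\<in>UNIV. a j (\<nu> $ j)) \<partial>count_space int_lattice)
       \<le> ennreal CB * epowr (\<integral>\<^sup>+\<mu>. (a0 \<mu>)\<^sup>2 \<partial>count_space int_lattice) (1/2) *
         (\<Prod>j\<in>UNIV. epowr (\<integral>\<^sup>+\<mu>. (a j \<mu>)\<^sup>2 \<partial>count_space int_lattice) (1/2))"
    using class_B_ennreal[OF WB] by blast
  obtain CJ where CJ: "CJ > 0" "\<And>v::real^'n. (\<integral>\<^sup>+\<nu>. ennreal (jw (\<nu> - v)) \<partial>count_space int_lattice) \<le> ennreal CJ"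
    using jw_lattice_sum by blast
  \<comment> \<open>One root of the Plancherel constant for each of the \<open>N\<close>
    functions.\<close>
  define P where "P = sqrt ((2 * pi) ^ CARD('n)) ^ CARD('N)"
  have P: "P > 0" by (simp add: P_def)
  define C where "C = CW * (CB * (sqrt CA * (CJ * P)))"
  have C: "C > 0" using CW CB CA CJ P by (simp add: C_def)
  have main: "(\<integral>\<^sup>+x. \<integral>\<^sup>+\<xi>. ennreal (norm (u (x, \<xi>))) * (ennreal (norm (x_part k h x (\<Sum>j\<in>UNIV. \<xi> $ j + \<eta> $ j))) *
         (\<Prod>j\<in>UNIV. ennreal (norm (fourier (g j) (\<xi> $ j + \<eta> $ j))))) \<partial>lborel \<partial>lborel)
      \<le> ennreal (C * sqrt ((2 ^ k) ^ CARD('n))) * L2ul_norm (\<lambda>(x, \<xi>). of_real (inverse (W \<xi>)) * u (x, \<xi>)) *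
        epowr (\<integral>\<^sup>+x. (ennreal (norm (h x)))\<^sup>2 \<partial>lborel) (1/2) *
        (\<Prod>j\<in>UNIV. epowr (\<integral>\<^sup>+x. (ennreal (norm (g j x)))\<^sup>2 \<partial>lborel) (1/2))" (is "?LHS \<le> ?RHS")
    if hm [measurable]: "h \<in> borel_measurable borel" and hb: "\<And>x. norm (h x) \<le> M"
      and supp: "\<And>x. x - \<mu> \<notin> unit_cube \<Longrightarrow> h x = 0" and um [measurable]: "u \<in> borel_measurable borel"
      and g: "\<And>j. integrable lborel (g j)"
    for k \<mu> h M and u :: "(real^'n) \<times> (real^'n^'N) \<Rightarrow> complex" and g :: "'N \<Rightarrow> real^'n \<Rightarrow> complex" and \<eta> :: "real^'n^'N"
  proof -
    have gm [measurable]: "g j \<in> borel_measurable borel" for j using g[of j] by auto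
    define U where "U = L2ul_norm (\<lambda>(x, \<xi>). of_real (inverse (W \<xi>)) * u (x, \<xi>))"
    define h2 where "h2 = (\<integral>\<^sup>+x. (ennreal (norm (h x)))\<^sup>2 \<partial>lborel)"
    \<comment> \<open>The sequence that is read at the sum of the lattice frequencies. The supremum
      over nearby frequencies makes it depend on \<nu> only through that sum.\<close>
    define A0 where "A0 \<kappa> \<tau> = (SUP \<zeta>\<in>{\<zeta>. norm (\<zeta> - \<tau> - (\<Sum>j\<in>UNIV. \<eta> $ j)) \<le> ?\<rho>}.
        \<integral>\<^sup>+x. (ennreal (norm (x_part k h (x + \<kappa>) \<zeta>)))\<^sup>2 * indicator unit_cube x \<partial>lborel)" for \<kappa> \<tau> :: "real^'n"
    define A where "A j \<nu> = (\<integral>\<^sup>+\<xi>. (ennreal (norm (fourier (g j) (\<xi> + \<nu> + \<eta> $ j))))\<^sup>2 * indicator unit_cube \<xi> \<partial>lborel)" for j \<nu>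
    have h2fin: "h2 < \<top>"
    proof -
      have "integrable lborel (\<lambda>x. (norm (h x))\<^sup>2)"
        by (rule integrable_if_supported_on_cell[where M="M\<^sup>2" and \<mu>=\<mu>]) (auto simp: supp intro!: power_mono hb)
      then show ?thesis by (simp add: h2_def ennreal_power nn_integral_eq_integral)
    qed
    have A0sum: "(\<integral>\<^sup>+\<tau>. A0 \<kappa> \<tau> \<partial>count_space int_lattice) \<le> ennreal (CA * (2 ^ k) ^ CARD('n) * (jw (\<kappa> - \<mu>))\<^sup>2) * h2" for \<kappa>
      unfolding A0_def h2_def by (rule xsum[OF hm, of M]) (auto simp: hb supp)
    have A0fin: "A0 \<kappa> \<tau> < \<top>" if "\<tau> \<in> int_lattice" for \<kappa> \<tau>
    proof -
      have "A0 \<kappa> \<tau> = (\<Sum>\<tau>\<in>{\<tau>}. A0 \<kappa> \<tau>)" by simp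
      also have "\<dots> \<le> (\<integral>\<^sup>+\<tau>. A0 \<kappa> \<tau> \<partial>count_space int_lattice)"
        using that by (intro nn_integral_count_space_ge_sum) auto
      also have "\<dots> \<le> ennreal (CA * (2 ^ k) ^ CARD('n) * (jw (\<kappa> - \<mu>))\<^sup>2) * h2" by (rule A0sum)
      also have "\<dots> < \<top>" using h2fin by (simp add: ennreal_mult_less_top)
      finally show ?thesis .
    qed
    have Asum: "(\<integral>\<^sup>+\<nu>. A j \<nu> \<partial>count_space int_lattice) \<le> ennreal ((2 * pi) ^ CARD('n)) * (\<integral>\<^sup>+x. (ennreal (norm (g j x)))\<^sup>2 \<partial>lborel)" for j
    proof -
      have "(\<integral>\<^sup>+\<nu>. A j \<nu> \<partial>count_space int_lattice) = (\<integral>\<^sup>+\<xi>. (ennreal (norm (fourier (g j) (\<xi> + \<eta> $ j))))\<^sup>2 \<partial>lborel)"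
        unfolding A_def by (rule nn_integral_lattice_cells[symmetric]) measurable
      also have "\<dots> = (\<integral>\<^sup>+\<xi>. (ennreal (norm (fourier (g j) \<xi>)))\<^sup>2 \<partial>lborel)"
        by (rule nn_integral_lborel_shift) measurable
      also have "\<dots> \<le> ennreal ((2 * pi) ^ CARD('n)) * (\<integral>\<^sup>+x. (ennreal (norm (g j x)))\<^sup>2 \<partial>lborel)"
        using plancherel_le[OF g[of j]] by (simp add: ennreal_power)
      finally show ?thesis .
    qed
    have Afin: "A j \<nu> < \<top>" for j \<nu>
    proof -
      let ?B = "\<integral>x. norm (g j x) \<partial>lborel"
      have "A j \<nu> \<le> (\<integral>\<^sup>+\<xi>. ennreal (?B\<^sup>2) * indicator unit_cube (\<xi> :: real^'n) \<partial>lborel)"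
        unfolding A_def
        by (intro nn_integral_mono mult_right_mono) (auto simp: ennreal_power intro!: ennreal_leI power_mono norm_fourier_le g)
      also have "\<dots> < \<top>" by (simp add: nn_integral_cmult_indicator emeasure_unit_cube)
      finally show ?thesis .
    qed
    define F where "F x \<xi> = ennreal (norm (u (x, \<xi>))) * (ennreal (norm (x_part k h x (\<Sum>j\<in>UNIV. \<xi> $ j + \<eta> $ j))) *
         (\<Prod>j\<in>UNIV. ennreal (norm (fourier (g j) (\<xi> $ j + \<eta> $ j)))))" for x \<xi>
    have Fm [measurable]: "(\<lambda>(x, \<xi>). F x \<xi>) \<in> borel_measurable (borel \<Otimes>\<^sub>M borel)" unfolding F_def by measurable
    have cell: "(\<integral>\<^sup>+x. \<integral>\<^sup>+\<xi>. F (x + \<kappa>) (\<xi> + \<nu>) * indicator unit_cube \<xi> * indicator unit_cube x \<partial>lborel \<partial>lborel) \<le>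
        ennreal CW * U * (ennreal (W \<nu>) * epowr (A0 \<kappa> (\<Sum>j\<in>UNIV. \<nu> $ j)) (1/2) * (\<Prod>j\<in>UNIV. epowr (A j (\<nu> $ j)) (1/2)))"
      if \<kappa>: "\<kappa> \<in> int_lattice" and \<nu>: "\<nu> \<in> int_lattice" for \<kappa> \<nu>
    proof -
      define a where "a z = ennreal (norm (u (z + (\<kappa>, \<nu>)))) * indicator unit_cube z" for z
      define b1 where "b1 \<xi> = (\<Prod>j\<in>UNIV. ennreal (norm (fourier (g j) (\<xi> $ j + \<nu> $ j + \<eta> $ j))))" for \<xi> :: "real^'n^'N"
      define b2 where "b2 x \<xi> = ennreal (norm (x_part k h (x + \<kappa>) (\<Sum>j\<in>UNIV. \<xi> $ j + \<nu> $ j + \<eta> $ j)))" for x and \<xi> :: "real^'n^'N"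
      define b where "b x \<xi> = b2 x \<xi> * b1 \<xi> * (indicator unit_cube x * indicator unit_cube \<xi>)" for x \<xi>
      have [measurable]: "a \<in> borel_measurable borel" unfolding a_def by measurable
      have [measurable]: "b1 \<in> borel_measurable borel" unfolding b1_def by measurable
      have [measurable]: "(\<lambda>(x, \<xi>). b2 x \<xi>) \<in> borel_measurable (borel \<Otimes>\<^sub>M borel)" unfolding b2_def by measurable
      have bm: "(\<lambda>z. b (fst z) (snd z)) \<in> borel_measurable borel"
        unfolding b_def b1_def b2_def by measurable
      have [measurable]: "(\<lambda>(x, \<xi>). b x \<xi>) \<in> borel_measurable (borel \<Otimes>\<^sub>M borel)" unfolding b_def by measurable
      have "(\<integral>\<^sup>+x. \<integral>\<^sup>+\<xi>. F (x + \<kappa>) (\<xi> + \<nu>) * indicator unit_cube \<xi> * indicator unit_cube x \<partial>lborel \<partial>lborel) =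
          (\<integral>\<^sup>+x. \<integral>\<^sup>+\<xi>. a (x, \<xi>) * b x \<xi> \<partial>lborel \<partial>lborel)"
        by (intro nn_integral_cong) (auto simp: F_def a_def b_def b1_def b2_def indicator_def unit_cube_Pair mult_ac)
      also have "\<dots> = (\<integral>\<^sup>+z. a (fst z, snd z) * b (fst z) (snd z) \<partial>lborel)"
        by (rule nn_integral_lborel_pair) measurable
      also have "\<dots> \<le> epowr (\<integral>\<^sup>+z. (a (fst z, snd z))\<^sup>2 \<partial>lborel) (1/2) * epowr (\<integral>\<^sup>+z. (b (fst z) (snd z))\<^sup>2 \<partial>lborel) (1/2)"
        using bm by (intro nn_integral_Cauchy_Schwarz_epowr) auto
      also have "\<dots> \<le> (ennreal (CW * W \<nu>) * U) * epowr (A0 \<kappa> (\<Sum>j\<in>UNIV. \<nu> $ j) * (\<Prod>j\<in>UNIV. A j (\<nu> $ j))) (1/2)"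
      proof (intro mult_mono)
        have "(\<integral>\<^sup>+z. (a (fst z, snd z))\<^sup>2 \<partial>lborel) \<le>
            (\<integral>\<^sup>+z. (ennreal (CW * W \<nu>))\<^sup>2 * ((ennreal (norm ((\<lambda>(x, \<xi>). of_real (inverse (W \<xi>)) * u (x, \<xi>)) (z + (\<kappa>, \<nu>)))))\<^sup>2 * indicator unit_cube z) \<partial>lborel)"
        proof (rule nn_integral_mono)
          fix z :: "(real^'n) \<times> (real^'n^'N)"
          obtain x \<xi> where z: "z = (x, \<xi>)" by (cases z)
          show "(a (fst z, snd z))\<^sup>2 \<le> (ennreal (CW * W \<nu>))\<^sup>2 * ((ennreal (norm ((\<lambda>(x, \<xi>). of_real (inverse (W \<xi>)) * u (x, \<xi>)) (z + (\<kappa>, \<nu>)))))\<^sup>2 * indicator unit_cube z)"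
          proof (cases "z \<in> unit_cube")
            case True
            then have "\<xi> \<in> unit_cube" by (simp add: z unit_cube_Pair)
            \<comment> \<open>This comparison pulls the weight out of the cell:
              \<open>W \<nu>\<close> is kept for the class B inequality, while the reciprocal of
              \<open>W\<close> joins \<open>u\<close> in the uniformly local norm.\<close>
            then have "W (\<xi> + \<nu>) \<le> CW * W \<nu>" by (rule Wcell)
            then have "1 \<le> (CW * W \<nu>) * inverse (W (\<xi> + \<nu>))" using Wpos[of "\<xi> + \<nu>"] by (simp add: field_simps)
            then have "1 * norm (u (z + (\<kappa>, \<nu>))) \<le> ((CW * W \<nu>) * inverse (W (\<xi> + \<nu>))) * norm (u (z + (\<kappa>, \<nu>)))"
              by (intro mult_right_mono) auto
            then have "norm (u (z + (\<kappa>, \<nu>))) \<le> (CW * W \<nu>) * norm ((\<lambda>(x, \<xi>). of_real (inverse (W \<xi>)) * u (x, \<xi>)) (z + (\<kappa>, \<nu>)))"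
              using Wpos[of "\<xi> + \<nu>"] by (simp add: z norm_mult norm_inverse mult.assoc)
            then have "ennreal (norm (u (z + (\<kappa>, \<nu>)))) \<le> ennreal (CW * W \<nu>) * ennreal (norm ((\<lambda>(x, \<xi>). of_real (inverse (W \<xi>)) * u (x, \<xi>)) (z + (\<kappa>, \<nu>))))"
              using CW Wpos[of \<nu>] by (subst ennreal_mult[symmetric]) (auto intro: ennreal_leI)
            then have "(ennreal (norm (u (z + (\<kappa>, \<nu>)))))\<^sup>2 \<le> (ennreal (CW * W \<nu>) * ennreal (norm ((\<lambda>(x, \<xi>). of_real (inverse (W \<xi>)) * u (x, \<xi>)) (z + (\<kappa>, \<nu>)))))\<^sup>2"
              by (rule power_mono) simp
            then show ?thesis using True by (simp add: a_def power_mult_distrib)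
          qed (simp add: a_def)
        qed
        also have "\<dots> = (ennreal (CW * W \<nu>))\<^sup>2 * cell_sq (\<lambda>(x, \<xi>). of_real (inverse (W \<xi>)) * u (x, \<xi>)) (\<kappa>, \<nu>)"
          unfolding cell_sq_def case_prod_unfold by (rule nn_integral_cmult) measurable
        also have "\<dots> \<le> (ennreal (CW * W \<nu>))\<^sup>2 * U\<^sup>2"
          unfolding U_def using \<kappa> \<nu> by (intro mult_left_mono cell_sq_le_L2ul) (auto simp: int_lattice_Pair)
        finally have "(\<integral>\<^sup>+z. (a (fst z, snd z))\<^sup>2 \<partial>lborel) \<le> (ennreal (CW * W \<nu>) * U)\<^sup>2" by (simp add: power_mult_distrib)
        from epowr_mono[OF this, of "1/2"]
        show "epowr (\<integral>\<^sup>+z. (a (fst z, snd z))\<^sup>2 \<partial>lborel) (1/2) \<le> ennreal (CW * W \<nu>) * U" by (simp add: epowr_power2_half)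
        have "(\<integral>\<^sup>+z. (b (fst z) (snd z))\<^sup>2 \<partial>lborel) = (\<integral>\<^sup>+x. \<integral>\<^sup>+\<xi>. (b x \<xi>)\<^sup>2 \<partial>lborel \<partial>lborel)"
          by (rule nn_integral_lborel_pair[symmetric]) measurable
        also have "\<dots> = (\<integral>\<^sup>+\<xi>. \<integral>\<^sup>+x. (b x \<xi>)\<^sup>2 \<partial>lborel \<partial>lborel)"
          by (rule lborel_pair.Fubini') measurable
        also have "\<dots> = (\<integral>\<^sup>+\<xi>. ((b1 \<xi>)\<^sup>2 * indicator unit_cube \<xi>) * (\<integral>\<^sup>+x. (b2 x \<xi>)\<^sup>2 * indicator unit_cube x \<partial>lborel) \<partial>lborel)"
        proof (rule nn_integral_cong)
          fix \<xi>
          have "(b x \<xi>)\<^sup>2 = ((b1 \<xi>)\<^sup>2 * indicator unit_cube \<xi>) * ((b2 x \<xi>)\<^sup>2 * indicator unit_cube x)" for x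
            by (auto simp: b_def indicator_def power_mult_distrib mult.commute)
          then show "(\<integral>\<^sup>+x. (b x \<xi>)\<^sup>2 \<partial>lborel) = ((b1 \<xi>)\<^sup>2 * indicator unit_cube \<xi>) * (\<integral>\<^sup>+x. (b2 x \<xi>)\<^sup>2 * indicator unit_cube x \<partial>lborel)"
            by (simp add: nn_integral_cmult)
        qed
        also have "\<dots> \<le> (\<integral>\<^sup>+\<xi>. ((b1 \<xi>)\<^sup>2 * indicator unit_cube \<xi>) * A0 \<kappa> (\<Sum>j\<in>UNIV. \<nu> $ j) \<partial>lborel)"
        proof (rule nn_integral_mono)
          fix \<xi> :: "real^'n^'N"
          show "((b1 \<xi>)\<^sup>2 * indicator unit_cube \<xi>) * (\<integral>\<^sup>+x. (b2 x \<xi>)\<^sup>2 * indicator unit_cube x \<partial>lborel) \<le>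
              ((b1 \<xi>)\<^sup>2 * indicator unit_cube \<xi>) * A0 \<kappa> (\<Sum>j\<in>UNIV. \<nu> $ j)"
          proof (cases "\<xi> \<in> unit_cube")
            case True
            have "norm (\<Sum>j\<in>UNIV. \<xi> $ j) \<le> (\<Sum>j\<in>(UNIV::'N set). real CARD('n))"
            proof (rule order_trans[OF norm_sum], rule sum_mono)
              fix j show "norm (\<xi> $ j) \<le> real CARD('n)"
                using True norm_unit_cube_le[of "\<xi> $ j"] by (simp add: unit_cube_vec)
            qed
            then have n: "norm ((\<Sum>j\<in>UNIV. \<xi> $ j + \<nu> $ j + \<eta> $ j) - (\<Sum>j\<in>UNIV. \<nu> $ j) - (\<Sum>j\<in>UNIV. \<eta> $ j)) \<le> ?\<rho>"
              by (simp add: sum.distrib)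
            have "(\<integral>\<^sup>+x. (b2 x \<xi>)\<^sup>2 * indicator unit_cube x \<partial>lborel) \<le> A0 \<kappa> (\<Sum>j\<in>UNIV. \<nu> $ j)"
              unfolding A0_def b2_def by (rule SUP_upper) (use n in simp)
            then show ?thesis by (rule mult_left_mono) simp
          qed simp
        qed
        also have "\<dots> = (\<integral>\<^sup>+\<xi>. (b1 \<xi>)\<^sup>2 * indicator unit_cube \<xi> \<partial>lborel) * A0 \<kappa> (\<Sum>j\<in>UNIV. \<nu> $ j)"
          by (rule nn_integral_multc) measurable
        also have "(\<integral>\<^sup>+\<xi>. (b1 \<xi>)\<^sup>2 * indicator unit_cube \<xi> \<partial>lborel) =
            (\<integral>\<^sup>+\<xi>. (\<Prod>j\<in>UNIV. (ennreal (norm (fourier (g j) (\<xi> $ j + \<nu> $ j + \<eta> $ j))))\<^sup>2 * indicator unit_cube (\<xi> $ j)) \<partial>lborel)"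
          by (simp add: b1_def indicator_unit_cube_vec prod.distrib prod_power_distrib)
        also have "\<dots> = (\<Prod>j\<in>UNIV. A j (\<nu> $ j))"
          unfolding A_def by (rule nn_integral_vec_prod) measurable
        finally have "(\<integral>\<^sup>+z. (b (fst z) (snd z))\<^sup>2 \<partial>lborel) \<le> A0 \<kappa> (\<Sum>j\<in>UNIV. \<nu> $ j) * (\<Prod>j\<in>UNIV. A j (\<nu> $ j))"
          by (simp add: mult.commute)
        then show "epowr (\<integral>\<^sup>+z. (b (fst z) (snd z))\<^sup>2 \<partial>lborel) (1/2) \<le> epowr (A0 \<kappa> (\<Sum>j\<in>UNIV. \<nu> $ j) * (\<Prod>j\<in>UNIV. A j (\<nu> $ j))) (1/2)"
          by (rule epowr_mono) simp
      qed auto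
      also have "\<dots> = ennreal CW * U * (ennreal (W \<nu>) * epowr (A0 \<kappa> (\<Sum>j\<in>UNIV. \<nu> $ j)) (1/2) * (\<Prod>j\<in>UNIV. epowr (A j (\<nu> $ j)) (1/2)))"
        using CW Wpos[of \<nu>] by (simp add: epowr_mult epowr_prod ennreal_mult mult_ac)
      finally show ?thesis .
    qed
    have row: "(\<integral>\<^sup>+\<nu>. (\<integral>\<^sup>+x. \<integral>\<^sup>+\<xi>. F (x + \<kappa>) (\<xi> + \<nu>) * indicator unit_cube \<xi> * indicator unit_cube x \<partial>lborel \<partial>lborel) \<partial>count_space int_lattice) \<le>
       (ennreal CW * U * (ennreal CB * (ennreal (sqrt (CA * (2 ^ k) ^ CARD('n))) * epowr h2 (1/2)) *
          (\<Prod>j\<in>UNIV. ennreal (sqrt ((2 * pi) ^ CARD('n))) * epowr (\<integral>\<^sup>+x. (ennreal (norm (g j x)))\<^sup>2 \<partial>lborel) (1/2)))) * ennreal (jw (\<kappa> - \<mu>))"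
      if \<kappa>: "\<kappa> \<in> int_lattice" for \<kappa>
    proof -
      \<comment> \<open>Finiteness of \<open>A0\<close> is available at lattice points; the value 0
        elsewhere secures it everywhere, as \<open>WBe\<close> demands.\<close>
      let ?a0 = "\<lambda>\<tau>. if \<tau> \<in> int_lattice then epowr (A0 \<kappa> \<tau>) (1/2) else 0"
      have fin0: "?a0 \<tau> < \<top>" for \<tau>
        using A0fin[of \<tau> \<kappa>] by (auto simp: epowr_def less_top)
      have fin: "epowr (A j \<nu>) (1/2) < \<top>" for j \<nu>
        using Afin[of j \<nu>] by (auto simp: epowr_def less_top)
      have "(\<integral>\<^sup>+\<nu>. (\<integral>\<^sup>+x. \<integral>\<^sup>+\<xi>. F (x + \<kappa>) (\<xi> + \<nu>) * indicator unit_cube \<xi> * indicator unit_cube x \<partial>lborel \<partial>lborel) \<partial>count_space int_lattice) \<le>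
        (\<integral>\<^sup>+\<nu>. ennreal CW * U * (ennreal (W \<nu>) * ?a0 (\<Sum>j\<in>UNIV. \<nu> $ j) * (\<Prod>j\<in>UNIV. epowr (A j (\<nu> $ j)) (1/2))) \<partial>count_space int_lattice)"
      proof (rule nn_integral_mono)
        fix \<nu> assume "\<nu> \<in> space (count_space (int_lattice :: (real^'n^'N) set))"
        then have \<nu>: "\<nu> \<in> int_lattice" by simp
        then have s: "(\<Sum>j\<in>UNIV. \<nu> $ j) \<in> int_lattice" by (intro int_lattice_sum) (simp add: int_lattice_vec)
        show "(\<integral>\<^sup>+x. \<integral>\<^sup>+\<xi>. F (x + \<kappa>) (\<xi> + \<nu>) * indicator unit_cube \<xi> * indicator unit_cube x \<partial>lborel \<partial>lborel) \<le>
          ennreal CW * U * (ennreal (W \<nu>) * ?a0 (\<Sum>j\<in>UNIV. \<nu> $ j) * (\<Prod>j\<in>UNIV. epowr (A j (\<nu> $ j)) (1/2)))"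
          using cell[OF \<kappa> \<nu>] s by simp
      qed
      also have "\<dots> = ennreal CW * U * (\<integral>\<^sup>+\<nu>. ennreal (W \<nu>) * ?a0 (\<Sum>j\<in>UNIV. \<nu> $ j) * (\<Prod>j\<in>UNIV. epowr (A j (\<nu> $ j)) (1/2)) \<partial>count_space int_lattice)"
        by (rule nn_integral_cmult) simp
      also have "\<dots> \<le> ennreal CW * U * (ennreal CB * epowr (\<integral>\<^sup>+\<tau>. (?a0 \<tau>)\<^sup>2 \<partial>count_space int_lattice) (1/2) *
         (\<Prod>j\<in>UNIV. epowr (\<integral>\<^sup>+\<nu>. (epowr (A j \<nu>) (1/2))\<^sup>2 \<partial>count_space int_lattice) (1/2)))"
        using fin0 fin by (intro mult_left_mono WBe[of ?a0 "\<lambda>j \<nu>. epowr (A j \<nu>) (1/2)"]) auto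
      also have "(\<integral>\<^sup>+\<tau>. (?a0 \<tau>)\<^sup>2 \<partial>count_space int_lattice) = (\<integral>\<^sup>+\<tau>. A0 \<kappa> \<tau> \<partial>count_space int_lattice)"
        by (intro nn_integral_cong) (simp add: epowr_half_power2)
      also have "ennreal CW * U * (ennreal CB * epowr (\<integral>\<^sup>+\<tau>. A0 \<kappa> \<tau> \<partial>count_space int_lattice) (1/2) *
         (\<Prod>j\<in>UNIV. epowr (\<integral>\<^sup>+\<nu>. (epowr (A j \<nu>) (1/2))\<^sup>2 \<partial>count_space int_lattice) (1/2))) \<le>
        ennreal CW * U * (ennreal CB * (ennreal (sqrt (CA * (2 ^ k) ^ CARD('n)) * jw (\<kappa> - \<mu>)) * epowr h2 (1/2)) *
          (\<Prod>j\<in>UNIV. ennreal (sqrt ((2 * pi) ^ CARD('n))) * epowr (\<integral>\<^sup>+x. (ennreal (norm (g j x)))\<^sup>2 \<partial>lborel) (1/2)))"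
      proof (intro mult_left_mono mult_mono prod_mono_ennreal)
        have n: "0 \<le> CA * (2 ^ k) ^ CARD('n) * (jw (\<kappa> - \<mu>))\<^sup>2" using CA by simp
        have "epowr (\<integral>\<^sup>+\<tau>. A0 \<kappa> \<tau> \<partial>count_space int_lattice) (1/2) \<le> epowr (ennreal (CA * (2 ^ k) ^ CARD('n) * (jw (\<kappa> - \<mu>))\<^sup>2) * h2) (1/2)"
          by (rule epowr_mono[OF A0sum]) simp
        \<comment> \<open>The root of the squared weight is the weight itself, and that is still
          summable over \<kappa>.\<close>
        also have "\<dots> = ennreal (sqrt (CA * (2 ^ k) ^ CARD('n)) * jw (\<kappa> - \<mu>)) * epowr h2 (1/2)"
          unfolding epowr_mult epowr_ennreal[OF n] using n
          by (simp add: powr_half_sqrt real_sqrt_mult jw_nonneg)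
        finally show "epowr (\<integral>\<^sup>+\<tau>. A0 \<kappa> \<tau> \<partial>count_space int_lattice) (1/2) \<le> ennreal (sqrt (CA * (2 ^ k) ^ CARD('n)) * jw (\<kappa> - \<mu>)) * epowr h2 (1/2)" .
        fix j
        have n: "0 \<le> (2 * pi) ^ CARD('n)" by simp
        have "epowr (\<integral>\<^sup>+\<nu>. (epowr (A j \<nu>) (1/2))\<^sup>2 \<partial>count_space int_lattice) (1/2) = epowr (\<integral>\<^sup>+\<nu>. A j \<nu> \<partial>count_space int_lattice) (1/2)"
          by (simp add: epowr_half_power2)
        also have "\<dots> \<le> epowr (ennreal ((2 * pi) ^ CARD('n)) * (\<integral>\<^sup>+x. (ennreal (norm (g j x)))\<^sup>2 \<partial>lborel)) (1/2)"
          by (rule epowr_mono[OF Asum]) simp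
        also have "\<dots> = ennreal (sqrt ((2 * pi) ^ CARD('n))) * epowr (\<integral>\<^sup>+x. (ennreal (norm (g j x)))\<^sup>2 \<partial>lborel) (1/2)"
          unfolding epowr_mult epowr_ennreal[OF n] powr_half_sqrt[OF n] ..
        finally show "epowr (\<integral>\<^sup>+\<nu>. (epowr (A j \<nu>) (1/2))\<^sup>2 \<partial>count_space int_lattice) (1/2) \<le>
           ennreal (sqrt ((2 * pi) ^ CARD('n))) * epowr (\<integral>\<^sup>+x. (ennreal (norm (g j x)))\<^sup>2 \<partial>lborel) (1/2)" .
      qed auto
      also have "\<dots> = (ennreal CW * U * (ennreal CB * (ennreal (sqrt (CA * (2 ^ k) ^ CARD('n))) * epowr h2 (1/2)) *
          (\<Prod>j\<in>UNIV. ennreal (sqrt ((2 * pi) ^ CARD('n))) * epowr (\<integral>\<^sup>+x. (ennreal (norm (g j x)))\<^sup>2 \<partial>lborel) (1/2)))) * ennreal (jw (\<kappa> - \<mu>))"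
      proof -
        have "ennreal (sqrt (CA * (2 ^ k) ^ CARD('n)) * jw (\<kappa> - \<mu>)) = ennreal (sqrt (CA * (2 ^ k) ^ CARD('n))) * ennreal (jw (\<kappa> - \<mu>))"
          using CA by (intro ennreal_mult) (auto simp: jw_nonneg)
        then show ?thesis by (simp only: mult_ac)
      qed
      finally show ?thesis .
    qed
    have "?LHS = (\<integral>\<^sup>+x. \<integral>\<^sup>+\<xi>. F x \<xi> \<partial>lborel \<partial>lborel)" by (simp add: F_def)
    also have "\<dots> = (\<integral>\<^sup>+\<kappa>. \<integral>\<^sup>+\<nu>. (\<integral>\<^sup>+x. \<integral>\<^sup>+\<xi>. F (x + \<kappa>) (\<xi> + \<nu>) * indicator unit_cube \<xi> * indicator unit_cube x \<partial>lborel \<partial>lborel)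
       \<partial>count_space int_lattice \<partial>count_space int_lattice)"
      by (rule nn_integral_lattice_cells_pair[OF Fm])
    also have "\<dots> \<le> (\<integral>\<^sup>+\<kappa>. (ennreal CW * U * (ennreal CB * (ennreal (sqrt (CA * (2 ^ k) ^ CARD('n))) * epowr h2 (1/2)) *
          (\<Prod>j\<in>UNIV. ennreal (sqrt ((2 * pi) ^ CARD('n))) * epowr (\<integral>\<^sup>+x. (ennreal (norm (g j x)))\<^sup>2 \<partial>lborel) (1/2)))) * ennreal (jw (\<kappa> - \<mu>)) \<partial>count_space int_lattice)"
      by (rule nn_integral_mono) (rule row, simp)
    also have "\<dots> = (ennreal CW * U * (ennreal CB * (ennreal (sqrt (CA * (2 ^ k) ^ CARD('n))) * epowr h2 (1/2)) *
          (\<Prod>j\<in>UNIV. ennreal (sqrt ((2 * pi) ^ CARD('n))) * epowr (\<integral>\<^sup>+x. (ennreal (norm (g j x)))\<^sup>2 \<partial>lborel) (1/2)))) *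
          (\<integral>\<^sup>+\<kappa>. ennreal (jw (\<kappa> - \<mu>)) \<partial>count_space int_lattice)"
      by (rule nn_integral_cmult) simp
    also have "\<dots> \<le> (ennreal CW * U * (ennreal CB * (ennreal (sqrt (CA * (2 ^ k) ^ CARD('n))) * epowr h2 (1/2)) *
          (\<Prod>j\<in>UNIV. ennreal (sqrt ((2 * pi) ^ CARD('n))) * epowr (\<integral>\<^sup>+x. (ennreal (norm (g j x)))\<^sup>2 \<partial>lborel) (1/2)))) * ennreal CJ"
      by (intro mult_left_mono CJ) simp
    also have "\<dots> = ?RHS"
    proof -
      have p: "(\<Prod>j\<in>(UNIV::'N set). ennreal (sqrt ((2 * pi) ^ CARD('n)))) = ennreal P"
        by (simp add: P_def ennreal_power)
      have "C * sqrt ((2 ^ k) ^ CARD('n)) = CW * (CB * (sqrt (CA * (2 ^ k) ^ CARD('n)) * (CJ * P)))"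
        by (simp add: C_def real_sqrt_mult)
      then have c: "ennreal (C * sqrt ((2 ^ k) ^ CARD('n))) = ennreal CW * (ennreal CB * (ennreal (sqrt (CA * (2 ^ k) ^ CARD('n))) * (ennreal CJ * ennreal P)))"
        using CW CB CA CJ P by (simp add: ennreal_mult)
      show ?thesis unfolding c prod.distrib p U_def[symmetric] h2_def[symmetric] by (simp only: mult_ac)
    qed
    finally show ?thesis .
  qed
  show ?thesis
    by (intro exI[of _ C] conjI C allI impI, rule main) auto
qed

end

declare cutoff_borel [measurable del] dil_cutoff_borel [measurable del]
  inv_fourier_dil_borel [measurable del] x_part_measurable [measurable del]

section \<open>Moving the reproducing kernel to the test function\<close>

text \<open>Pairing \<open>T_op \<sigma> f\<close> with \<open>h\<close> is, up to the power of 2 pi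
  in the operator, pairing \<sigma> with this function on phase space when \<open>F j\<close> is the
  Fourier transform of \<open>f j\<close>.\<close>

definition test_fun :: "(real^'n \<Rightarrow> complex) \<Rightarrow> ('N::finite \<Rightarrow> real^'n \<Rightarrow> complex) \<Rightarrow> (real^'n) \<times> (real^'n^'N) \<Rightarrow> complex" where
  "test_fun h F z = h (fst z) * (cis (fst z \<bullet> (\<Sum>j\<in>UNIV. snd z $ j)) * (\<Prod>j\<in>UNIV. F j (snd z $ j)))"

lemma test_fun_measurable [measurable]:
  fixes F :: "'N::finite \<Rightarrow> real^'n \<Rightarrow> complex"
  assumes [measurable]: "h \<in> borel_measurable borel" "\<And>j. F j \<in> borel_measurable borel"
  shows "test_fun h F \<in> borel_measurable borel"
  unfolding test_fun_def by measurable

lemma test_fun_integrable: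
  fixes F :: "'N::finite \<Rightarrow> real^'n \<Rightarrow> complex"
  assumes h: "integrable lborel h" and F: "\<And>j. integrable lborel (F j)"
  shows "integrable lborel (test_fun h F)"
proof -
  have [measurable]: "h \<in> borel_measurable borel" "F j \<in> borel_measurable borel" for j using h F[of j] by auto
  show ?thesis
    by (rule Bochner_Integration.integrable_bound[OF integrable_lborel_pair_mult(2)[OF h integrable_vec_prod[OF F]]])
       (measurable, auto simp: test_fun_def norm_mult)
qed

lemma cis_inner_sum: "cis (x \<bullet> (\<Sum>j\<in>UNIV. v j)) = (\<Prod>j\<in>(UNIV::'N::finite set). cis (x \<bullet> v j))"
  by (simp add: inner_sum_right cis_sum)

context
  fixes \<phi> :: "real^'n \<Rightarrow> complex"
  assumes \<phi>: "lp_cutoff \<phi>"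
begin

text \<open>For fixed \<open>x\<close> the frequency integral factors into \<open>N\<close>
  localized integrals. On the support of \<open>h\<close> the point \<open>x\<close> is within
  \<open>CARD('n)\<close> of \<mu>, so each \<open>f j\<close> may be exchanged for
  \<open>g j\<close>; shifting the frequencies by \<open>\<xi>'\<close> and integrating in
  \<open>x\<close> first then produces \<open>x_part\<close>. The integral over \<eta> is left
  standing because it will be estimated by the L1 norms of the frequency kernels.\<close>

lemma kernel_on_test_fun:
  fixes f g :: "'N::finite \<Rightarrow> real^'n \<Rightarrow> complex"
  assumes hm [measurable]: "h \<in> borel_measurable borel" and hb: "\<And>x. norm (h x) \<le> M"
    and supp: "\<And>x. x - \<mu> \<notin> unit_cube \<Longrightarrow> h x = 0"
    and f: "\<And>j. integrable lborel (f j)" and g: "\<And>j. integrable lborel (g j)"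
    and fg: "\<And>j y. norm (y - \<mu>) \<le> 2 * 2 ^ k j + real CARD('n) \<Longrightarrow> f j y = g j y"
  shows "(\<integral>z. dil_kernel \<phi> k0 k (z - (x', \<xi>')) * test_fun h (\<lambda>j. fourier (f j)) z \<partial>lborel) =
    (\<integral>\<eta>. (\<Prod>j\<in>UNIV. inv_fourier (dil \<phi> (k j)) (\<eta> $ j) * fourier (g j) (\<xi>' $ j + \<eta> $ j)) *
        x_part \<phi> k0 h x' (\<Sum>j\<in>UNIV. \<xi>' $ j + \<eta> $ j) \<partial>lborel)"
proof -
  note inv_fourier_dil_borel[OF \<phi>, measurable]
  have [measurable]: "f j \<in> borel_measurable borel" "g j \<in> borel_measurable borel" for j using f[of j] g[of j] by auto
  have hi: "integrable lborel h" by (rule integrable_if_supported_on_cell[OF hm hb supp])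
  let ?\<Phi> = "\<lambda>j. inv_fourier (dil \<phi> (k j))" and ?\<Psi> = "inv_fourier (dil \<phi> k0)"
  let ?G = "test_fun h (\<lambda>j. fourier (f j))" and ?K = "dil_kernel \<phi> k0 k"
  have M0: "0 \<le> M" using hb[of 0] norm_ge_zero order_trans by blast
  have \<Phi>i: "integrable lborel (?\<Phi> j)" for j by (rule inv_fourier_cutoff_integrable[OF \<phi>])
  have [measurable]: "?K \<in> borel_measurable borel"
    using borel_measurable_integrable[OF dil_kernel_integrable[OF \<phi>]] by simp
  have Gb: "norm (?G z) \<le> M * (\<Prod>j\<in>UNIV. \<integral>x. norm (f j x) \<partial>lborel)" for z
  proof -
    have "norm (?G z) = norm (h (fst z)) * (\<Prod>j\<in>UNIV. norm (fourier (f j) (snd z $ j)))"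
      by (simp add: test_fun_def norm_mult prod_norm)
    also have "\<dots> \<le> M * (\<Prod>j\<in>UNIV. \<integral>x. norm (f j x) \<partial>lborel)"
      by (intro mult_mono hb prod_mono conjI norm_fourier_le f M0 prod_nonneg) auto
    finally show ?thesis .
  qed
  have Ks: "integrable lborel (\<lambda>z. ?K (z - (x', \<xi>')))"
    unfolding diff_conv_add_uminus integrable_lborel_shift by (rule dil_kernel_integrable[OF \<phi>])
  have "integrable lborel (\<lambda>z. ?G z * ?K (z - (x', \<xi>')))"
    by (rule integrable_bounded_mult[OF _ Gb Ks]) measurable
  then have int: "integrable (lborel \<Otimes>\<^sub>M lborel) (\<lambda>z. ?K (z - (x', \<xi>')) * ?G z)"
    by (simp add: lborel_prod mult.commute)
  define L where "L f j x = (\<integral>\<xi>. ?\<Phi> j (\<xi> - \<xi>' $ j) * (cis (x \<bullet> \<xi>) * fourier f \<xi>) \<partial>lborel)" for f j x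
  have Li: "integrable lborel (\<lambda>\<xi>. ?\<Phi> j (\<xi> - a) * (cis (x \<bullet> \<xi>) * fourier (f j) \<xi>))" for j x a
  proof -
    have s: "integrable lborel (\<lambda>\<xi>. ?\<Phi> j (\<xi> - a))"
      using integrable_lborel_shift[of "?\<Phi> j" "- a"] \<Phi>i by simp
    have "integrable lborel (\<lambda>\<xi>. (cis (x \<bullet> \<xi>) * fourier (f j) \<xi>) * ?\<Phi> j (\<xi> - a))"
      by (rule integrable_bounded_mult[where M="\<integral>x. norm (f j x) \<partial>lborel", OF _ _ s])
         (auto simp: norm_mult intro!: norm_fourier_le f)
    then show ?thesis by (simp add: mult.commute)
  qed
  have Lgi: "integrable lborel (\<lambda>\<eta>. ?\<Phi> j \<eta> * (cis (x \<bullet> (\<xi>' $ j + \<eta>)) * fourier (g j) (\<xi>' $ j + \<eta>)))" for j x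
  proof -
    have "integrable lborel (\<lambda>\<eta>. (cis (x \<bullet> (\<xi>' $ j + \<eta>)) * fourier (g j) (\<xi>' $ j + \<eta>)) * ?\<Phi> j \<eta>)"
      by (rule integrable_bounded_mult[where M="\<integral>x. norm (g j x) \<partial>lborel", OF _ _ \<Phi>i])
         (auto simp: norm_mult intro!: norm_fourier_le g)
    then show ?thesis by (simp add: mult.commute)
  qed
  have Lg: "L (g j) j x = (\<integral>\<eta>. ?\<Phi> j \<eta> * (cis (x \<bullet> (\<xi>' $ j + \<eta>)) * fourier (g j) (\<xi>' $ j + \<eta>)) \<partial>lborel)" for j x
    unfolding L_def
    using integral_lborel_shift[of "\<lambda>\<xi>. ?\<Phi> j (\<xi> - \<xi>' $ j) * (cis (x \<bullet> \<xi>) * fourier (g j) \<xi>)" "\<xi>' $ j"]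
    by (simp add: add.commute)
  \<comment> \<open>The integrand after the exchange and the shift of the frequencies. It is
    absolutely integrable in both variables because the transforms of the \<open>g j\<close> are
    bounded and the kernels integrable.\<close>
  define S where "S x \<eta> = (h x * ?\<Psi> (x - x')) * (\<Prod>j\<in>UNIV. ?\<Phi> j (\<eta> $ j) * (cis (x \<bullet> (\<xi>' $ j + \<eta> $ j)) * fourier (g j) (\<xi>' $ j + \<eta> $ j)))" for x and \<eta> :: "real^'n^'N"
  have Sm [measurable]: "(\<lambda>(x, \<eta>). S x \<eta>) \<in> borel_measurable (borel \<Otimes>\<^sub>M borel)" unfolding S_def by measurable
  have h\<Phi>: "integrable lborel (\<lambda>x. h x * ?\<Psi> (x - x'))"
  proof -
    have "integrable lborel (\<lambda>x. ?\<Psi> (x - x'))"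
      using integrable_lborel_shift[of ?\<Psi> "- x'"] inv_fourier_cutoff_integrable[OF \<phi>] by simp
    then show ?thesis by (rule integrable_bounded_mult[OF hm hb])
  qed
  have Sint: "integrable (lborel \<Otimes>\<^sub>M lborel) (\<lambda>(x, \<eta>). S x \<eta>)"
  proof (rule Bochner_Integration.integrable_bound)
    let ?B = "\<lambda>j. complex_of_real (\<integral>x. norm (g j x) \<partial>lborel)"
    show "integrable (lborel \<Otimes>\<^sub>M lborel) (\<lambda>(x, \<eta> :: real^'n^'N). (h x * ?\<Psi> (x - x')) * (\<Prod>j\<in>UNIV. ?\<Phi> j (\<eta> $ j) * ?B j))"
      by (intro integrable_lborel_pair_mult(1) h\<Phi> integrable_vec_prod[where f="\<lambda>j \<eta>. ?\<Phi> j \<eta> * ?B j"] integrable_mult_left \<Phi>i)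
    show "AE p in lborel \<Otimes>\<^sub>M lborel. norm (case p of (x, \<eta>) \<Rightarrow> S x \<eta>) \<le>
       norm (case p of (x, \<eta> :: real^'n^'N) \<Rightarrow> (h x * ?\<Psi> (x - x')) * (\<Prod>j\<in>UNIV. ?\<Phi> j (\<eta> $ j) * ?B j))"
    proof (rule AE_I2)
      fix p :: "(real^'n) \<times> (real^'n^'N)"
      obtain x \<eta> where p: "p = (x, \<eta>)" by (cases p)
      have "(\<Prod>j\<in>UNIV. norm (?\<Phi> j (\<eta> $ j)) * norm (fourier (g j) (\<xi>' $ j + \<eta> $ j))) \<le> (\<Prod>j\<in>UNIV. norm (?\<Phi> j (\<eta> $ j)) * norm (?B j))"
        by (intro prod_mono conjI mult_left_mono) (auto intro!: order_trans[OF norm_fourier_le[OF g]])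
      then have "norm (h x * ?\<Psi> (x - x')) * (\<Prod>j\<in>UNIV. norm (?\<Phi> j (\<eta> $ j)) * norm (fourier (g j) (\<xi>' $ j + \<eta> $ j))) \<le>
          norm (h x * ?\<Psi> (x - x')) * (\<Prod>j\<in>UNIV. norm (?\<Phi> j (\<eta> $ j)) * norm (?B j))"
        by (rule mult_left_mono) simp
      then show "norm (case p of (x, \<eta>) \<Rightarrow> S x \<eta>) \<le>
       norm (case p of (x, \<eta> :: real^'n^'N) \<Rightarrow> (h x * ?\<Psi> (x - x')) * (\<Prod>j\<in>UNIV. ?\<Phi> j (\<eta> $ j) * ?B j))"
        unfolding p S_def prod.case norm_mult[of "h x * _"] prod_norm[symmetric] norm_mult[of "?\<Phi> _ _"] norm_mult[of "cis _"] norm_cis mult_1 .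
    qed
  qed measurable
  have "(\<integral>z. ?K (z - (x', \<xi>')) * ?G z \<partial>lborel) = (\<integral>x. (\<integral>\<xi>. ?K ((x, \<xi>) - (x', \<xi>')) * ?G (x, \<xi>) \<partial>lborel) \<partial>lborel)"
    using lborel_pair.integral_fst'[OF int] by (simp add: lborel_prod)
  also have "\<dots> = (\<integral>x. (\<integral>\<eta>. S x \<eta> \<partial>lborel) \<partial>lborel)"
  proof (rule Bochner_Integration.integral_cong[OF refl])
    fix x
    have "(\<integral>\<xi>. ?K ((x, \<xi>) - (x', \<xi>')) * ?G (x, \<xi>) \<partial>lborel) =
        (\<integral>\<xi>. (h x * ?\<Psi> (x - x')) * (\<Prod>j\<in>UNIV. ?\<Phi> j (\<xi> $ j - \<xi>' $ j) * (cis (x \<bullet> \<xi> $ j) * fourier (f j) (\<xi> $ j))) \<partial>lborel)"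
      by (intro Bochner_Integration.integral_cong refl)
         (simp add: dil_kernel_def[OF \<phi>] tensor_def test_fun_def cis_inner_sum prod.distrib mult_ac)
    also have "\<dots> = (h x * ?\<Psi> (x - x')) * (\<Prod>j\<in>UNIV. L (f j) j x)"
      unfolding L_def integral_mult_right_zero
      by (subst integral_vec_prod[where f="\<lambda>j \<xi>. ?\<Phi> j (\<xi> - \<xi>' $ j) * (cis (x \<bullet> \<xi>) * fourier (f j) \<xi>)"]) (auto intro: Li)
    also have "\<dots> = (h x * ?\<Psi> (x - x')) * (\<Prod>j\<in>UNIV. L (g j) j x)"
    proof (cases "x - \<mu> \<in> unit_cube")
      case True
      have "L (f j) j x = L (g j) j x" for j
        unfolding L_def
      proof (rule localization_cong[OF \<phi> f g])
        fix y assume "norm (y - x) \<le> 2 * 2 ^ k j"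
        moreover have "norm (x - \<mu>) \<le> real CARD('n)" using norm_unit_cube_le[OF True] by simp
        ultimately have "norm (y - \<mu>) \<le> 2 * 2 ^ k j + real CARD('n)"
          using norm_triangle_ineq[of "y - x" "x - \<mu>"] by simp
        then show "f j y = g j y" by (rule fg)
      qed
      then show ?thesis by simp
    qed (simp add: supp)
    also have "\<dots> = (\<integral>\<eta>. S x \<eta> \<partial>lborel)"
      unfolding S_def Lg integral_mult_right_zero
      by (subst integral_vec_prod[where f="\<lambda>j \<eta>. ?\<Phi> j \<eta> * (cis (x \<bullet> (\<xi>' $ j + \<eta>)) * fourier (g j) (\<xi>' $ j + \<eta>))"]) (auto intro: Lgi)
    finally show "(\<integral>\<xi>. ?K ((x, \<xi>) - (x', \<xi>')) * ?G (x, \<xi>) \<partial>lborel) = (\<integral>\<eta>. S x \<eta> \<partial>lborel)" .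
  qed
  also have "\<dots> = (\<integral>\<eta>. (\<integral>x. S x \<eta> \<partial>lborel) \<partial>lborel)"
    by (rule lborel_pair.Fubini_integral[OF Sint, symmetric])
  also have "\<dots> = (\<integral>\<eta>. (\<Prod>j\<in>UNIV. ?\<Phi> j (\<eta> $ j) * fourier (g j) (\<xi>' $ j + \<eta> $ j)) *
        x_part \<phi> k0 h x' (\<Sum>j\<in>UNIV. \<xi>' $ j + \<eta> $ j) \<partial>lborel)"
  proof (intro Bochner_Integration.integral_cong refl)
    fix \<eta> :: "real^'n^'N"
    have "S x \<eta> = (\<Prod>j\<in>UNIV. ?\<Phi> j (\<eta> $ j) * fourier (g j) (\<xi>' $ j + \<eta> $ j)) *
        (h x * ?\<Psi> (x - x') * cis (x \<bullet> (\<Sum>j\<in>UNIV. \<xi>' $ j + \<eta> $ j)))" for x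
      unfolding S_def cis_inner_sum prod.distrib by (simp only: mult_ac)
    then show "(\<integral>x. S x \<eta> \<partial>lborel) = (\<Prod>j\<in>UNIV. ?\<Phi> j (\<eta> $ j) * fourier (g j) (\<xi>' $ j + \<eta> $ j)) *
        x_part \<phi> k0 h x' (\<Sum>j\<in>UNIV. \<xi>' $ j + \<eta> $ j)"
      unfolding x_part_def[OF \<phi>] by (simp only: integral_mult_right_zero)
  qed
  finally show ?thesis .
qed

text \<open>The amplitude of the dilated kernel compensates its contraction. Hence the scales
  \<open>k j\<close> leave no trace in the constant contributed by the frequency kernels.\<close>

lemma nn_integral_norm_inv_fourier_dil:
  "(\<integral>\<^sup>+x. ennreal (norm (inv_fourier (dil \<phi> k) x)) \<partial>lborel) = ennreal (\<integral>x. norm (inv_fourier \<phi> x) \<partial>lborel)"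
proof -
  have i: "integrable lborel (inv_fourier \<phi>)" by (rule inv_fourier_schwartz_integrable[OF cutoff_schwartz[OF \<phi>]])
  then have [measurable]: "inv_fourier \<phi> \<in> borel_measurable borel" by auto
  have "(\<integral>\<^sup>+x. ennreal (norm (inv_fourier (dil \<phi> k) x)) \<partial>lborel) =
      (\<integral>\<^sup>+x. ennreal ((2 ^ k) ^ CARD('n)) * ennreal (norm (inv_fourier \<phi> (0 + 2 ^ k *\<^sub>R x))) \<partial>lborel)"
    by (intro nn_integral_cong) (simp add: inv_fourier_dil[OF cutoff_borel[OF \<phi>]] norm_mult norm_power ennreal_mult)
  also have "\<dots> = ennreal ((2 ^ k) ^ CARD('n)) * (\<integral>\<^sup>+x. ennreal (norm (inv_fourier \<phi> (0 + 2 ^ k *\<^sub>R x))) \<partial>lborel)"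
    by (rule nn_integral_cmult) measurable
  also have "\<dots> = (\<integral>\<^sup>+x. ennreal (norm (inv_fourier \<phi> x)) \<partial>lborel)"
    by (subst nn_integral_lborel_affine[where c="2^k" and t=0]) auto
  also have "\<dots> = ennreal (\<integral>x. norm (inv_fourier \<phi> x) \<partial>lborel)"
    using i by (intro nn_integral_eq_integral) auto
  finally show ?thesis .
qed

text \<open>Replace \<open>u\<close> by its convolution with the kernel and transpose. The modulus
  is then bounded by an average over \<eta>, weighted by the moduli of the frequency kernels, of
  forms that are estimated uniformly in \<eta>; the total weight is the L1 norm of one kernel to the
  power \<open>N\<close>.\<close>

lemma test_fun_pairing_estimate:
  fixes W :: "real^'n^'N \<Rightarrow> real"
  assumes WM: "W \<in> class_M" and WB: "W \<in> class_B"
  shows "\<exists>C>0. \<forall>k0 k \<mu> h M u Mu f. h \<in> borel_measurable borel \<longrightarrow> (\<forall>x. norm (h x) \<le> M) \<longrightarrow>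
     (\<forall>x. x - \<mu> \<notin> unit_cube \<longrightarrow> h x = 0) \<longrightarrow> u \<in> borel_measurable borel \<longrightarrow> (\<forall>z. norm (u z) \<le> Mu) \<longrightarrow>
     (\<forall>z. conv (dil_kernel \<phi> k0 k) u z = u z) \<longrightarrow>
     (\<forall>j. integrable lborel (f j)) \<longrightarrow> (\<forall>j. integrable lborel (fourier (f j))) \<longrightarrow>
     ennreal (norm (\<integral>z. u z * test_fun h (\<lambda>j. fourier (f j)) z \<partial>lborel))
      \<le> ennreal (C * sqrt ((2 ^ k0) ^ CARD('n))) * L2ul_norm (\<lambda>(x, \<xi>). of_real (inverse (W \<xi>)) * u (x, \<xi>)) *
        epowr (\<integral>\<^sup>+x. (ennreal (norm (h x)))\<^sup>2 \<partial>lborel) (1/2) *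
        (\<Prod>j\<in>UNIV. epowr (\<integral>\<^sup>+x. (ennreal (norm (f j x)))\<^sup>2 * indicator (cball \<mu> (2 * 2 ^ k j + real CARD('n))) x \<partial>lborel) (1/2))"
proof -
  obtain C where C: "C > 0" and core: "\<And>k \<mu> h M u g \<eta>. h \<in> borel_measurable borel \<Longrightarrow> (\<forall>x. norm (h x) \<le> M) \<Longrightarrow>
     (\<forall>x. x - \<mu> \<notin> unit_cube \<longrightarrow> h x = 0) \<Longrightarrow> u \<in> borel_measurable borel \<Longrightarrow>
     (\<forall>j. integrable lborel (g j)) \<Longrightarrow>
     (\<integral>\<^sup>+x. \<integral>\<^sup>+\<xi>. ennreal (norm (u (x, \<xi>))) * (ennreal (norm (x_part \<phi> k h x (\<Sum>j\<in>UNIV. \<xi> $ j + \<eta> $ j))) *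
         (\<Prod>j\<in>UNIV. ennreal (norm (fourier (g j) (\<xi> $ j + \<eta> $ j))))) \<partial>lborel \<partial>lborel)
      \<le> ennreal (C * sqrt ((2 ^ k) ^ CARD('n))) * L2ul_norm (\<lambda>(x, \<xi>). of_real (inverse (W \<xi>)) * u (x, \<xi>)) *
        epowr (\<integral>\<^sup>+x. (ennreal (norm (h x)))\<^sup>2 \<partial>lborel) (1/2) *
        (\<Prod>j\<in>UNIV. epowr (\<integral>\<^sup>+x. (ennreal (norm (g j x)))\<^sup>2 \<partial>lborel) (1/2))"
    using x_part_form_estimate[OF \<phi> WM WB] by blast
  define I where "I = (\<integral>x. norm (inv_fourier \<phi> x) \<partial>lborel)"
  have I: "0 \<le> I" by (simp add: I_def)
  define C' where "C' = (I + 1) ^ CARD('N) * C"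
  have C': "C' > 0" using I C by (simp add: C'_def)
  have main: "ennreal (norm (\<integral>z. u z * test_fun h (\<lambda>j. fourier (f j)) z \<partial>lborel))
      \<le> ennreal (C' * sqrt ((2 ^ k0) ^ CARD('n))) * L2ul_norm (\<lambda>(x, \<xi>). of_real (inverse (W \<xi>)) * u (x, \<xi>)) *
        epowr (\<integral>\<^sup>+x. (ennreal (norm (h x)))\<^sup>2 \<partial>lborel) (1/2) *
        (\<Prod>j\<in>UNIV. epowr (\<integral>\<^sup>+x. (ennreal (norm (f j x)))\<^sup>2 * indicator (cball \<mu> (2 * 2 ^ k j + real CARD('n))) x \<partial>lborel) (1/2))"
    if hm [measurable]: "h \<in> borel_measurable borel" and hb: "\<And>x. norm (h x) \<le> M"
      and supp: "\<And>x. x - \<mu> \<notin> unit_cube \<Longrightarrow> h x = 0" and um [measurable]: "u \<in> borel_measurable borel"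
      and ub: "\<And>z. norm (u z) \<le> Mu" and rep: "\<And>z. conv (dil_kernel \<phi> k0 k) u z = u z"
      and f: "\<And>j. integrable lborel (f j)" and Ff: "\<And>j. integrable lborel (fourier (f j))"
    for k0 k \<mu> h M Mu and u :: "(real^'n) \<times> (real^'n^'N) \<Rightarrow> complex" and f :: "'N \<Rightarrow> real^'n \<Rightarrow> complex"
  proof -
    note inv_fourier_dil_borel[OF \<phi>, measurable] x_part_measurable[OF \<phi>, measurable]
    \<comment> \<open>The radius is the support radius of the cutoff at scale \<open>k j\<close>
      plus a bound for the distance of a point of the cell from \<mu>.\<close>
    define g where "g j x = f j x * indicator (cball \<mu> (2 * 2 ^ k j + real CARD('n))) x" for j x
    have [measurable]: "f j \<in> borel_measurable borel" for j using f[of j] by auto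
    have [measurable]: "cball \<mu> r \<in> sets borel" for r by (intro borel_closed) auto
    have [measurable]: "g j \<in> borel_measurable borel" for j unfolding g_def by measurable
    have g: "integrable lborel (g j)" for j
      by (rule Bochner_Integration.integrable_bound[OF f[of j]]) (auto simp: g_def indicator_def)
    have fg: "f j y = g j y" if "norm (y - \<mu>) \<le> 2 * 2 ^ k j + real CARD('n)" for j y
      using that by (simp add: g_def dist_norm norm_minus_commute)
    have hi: "integrable lborel h" by (rule integrable_if_supported_on_cell[OF hm hb supp])
    let ?G = "test_fun h (\<lambda>j. fourier (f j))" and ?K = "dil_kernel \<phi> k0 k"
    let ?\<Phi> = "\<lambda>j. inv_fourier (dil \<phi> (k j))"
    let ?R = "ennreal (C * sqrt ((2 ^ k0) ^ CARD('n))) * L2ul_norm (\<lambda>(x, \<xi>). of_real (inverse (W \<xi>)) * u (x, \<xi>)) *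
        epowr (\<integral>\<^sup>+x. (ennreal (norm (h x)))\<^sup>2 \<partial>lborel) (1/2) *
        (\<Prod>j\<in>UNIV. epowr (\<integral>\<^sup>+x. (ennreal (norm (g j x)))\<^sup>2 \<partial>lborel) (1/2))"
    define b where "b \<eta> x \<xi> = ennreal (norm (u (x, \<xi>))) * (ennreal (norm (x_part \<phi> k0 h x (\<Sum>j\<in>UNIV. \<xi> $ j + \<eta> $ j))) *
         (\<Prod>j\<in>UNIV. ennreal (norm (fourier (g j) (\<xi> $ j + \<eta> $ j)))))" for \<eta> :: "real^'n^'N" and x and \<xi> :: "real^'n^'N"
    define p where "p \<eta> = (\<Prod>j\<in>UNIV. ennreal (norm (?\<Phi> j (\<eta> $ j))))" for \<eta> :: "real^'n^'N"
    have [measurable]: "p \<in> borel_measurable borel" unfolding p_def by measurable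
    have bm [measurable]: "(\<lambda>(w, \<eta>). b \<eta> (fst w) (snd w)) \<in> borel_measurable (borel \<Otimes>\<^sub>M borel)"
      unfolding b_def by measurable
    have G: "integrable lborel ?G" by (rule test_fun_integrable[OF hi Ff])
    have "(\<integral>z. u z * ?G z \<partial>lborel) = (\<integral>z. (\<integral>y. ?K (z - y) * u y \<partial>lborel) * ?G z \<partial>lborel)"
      unfolding conv_def[symmetric] rep ..
    also have "\<dots> = (\<integral>y. u y * (\<integral>z. ?K (z - y) * ?G z \<partial>lborel) \<partial>lborel)"
      by (rule convolution_pairing(1)[OF um ub G dil_kernel_integrable[OF \<phi>]])
    finally have eq: "(\<integral>z. u z * ?G z \<partial>lborel) = (\<integral>y. u y * (\<integral>z. ?K (z - y) * ?G z \<partial>lborel) \<partial>lborel)" .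
    have "ennreal (norm (\<integral>z. u z * ?G z \<partial>lborel)) \<le> (\<integral>\<^sup>+y. ennreal (norm (u y * (\<integral>z. ?K (z - y) * ?G z \<partial>lborel))) \<partial>lborel)"
      unfolding eq by (rule ennreal_norm_integral_le)
    also have "\<dots> \<le> (\<integral>\<^sup>+y. (\<integral>\<^sup>+\<eta>. p \<eta> * b \<eta> (fst y) (snd y) \<partial>lborel) \<partial>lborel)"
    proof (rule nn_integral_mono)
      fix y :: "(real^'n) \<times> (real^'n^'N)"
      obtain x' \<xi>' where y: "y = (x', \<xi>')" by (cases y)
      have "ennreal (norm (u y * (\<integral>z. ?K (z - y) * ?G z \<partial>lborel))) = ennreal (norm (u y)) *
        ennreal (norm (\<integral>\<eta>. (\<Prod>j\<in>UNIV. ?\<Phi> j (\<eta> $ j) * fourier (g j) (\<xi>' $ j + \<eta> $ j)) *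
        x_part \<phi> k0 h x' (\<Sum>j\<in>UNIV. \<xi>' $ j + \<eta> $ j) \<partial>lborel))"
      proof -
        have "(\<integral>z. ?K (z - (x', \<xi>')) * ?G z \<partial>lborel) = (\<integral>\<eta>. (\<Prod>j\<in>UNIV. ?\<Phi> j (\<eta> $ j) * fourier (g j) (\<xi>' $ j + \<eta> $ j)) *
          x_part \<phi> k0 h x' (\<Sum>j\<in>UNIV. \<xi>' $ j + \<eta> $ j) \<partial>lborel)"
          by (rule kernel_on_test_fun[where \<mu>=\<mu> and M=M]) (auto intro: hb supp f g fg)
        then show ?thesis unfolding y by (simp add: norm_mult ennreal_mult)
      qed
      also have "\<dots> \<le> ennreal (norm (u y)) * (\<integral>\<^sup>+\<eta>. ennreal (norm ((\<Prod>j\<in>UNIV. ?\<Phi> j (\<eta> $ j) * fourier (g j) (\<xi>' $ j + \<eta> $ j)) *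
        x_part \<phi> k0 h x' (\<Sum>j\<in>UNIV. \<xi>' $ j + \<eta> $ j))) \<partial>lborel)"
        by (intro mult_left_mono ennreal_norm_integral_le) simp
      also have "\<dots> = (\<integral>\<^sup>+\<eta>. ennreal (norm (u y)) * ennreal (norm ((\<Prod>j\<in>UNIV. ?\<Phi> j (\<eta> $ j) * fourier (g j) (\<xi>' $ j + \<eta> $ j)) *
        x_part \<phi> k0 h x' (\<Sum>j\<in>UNIV. \<xi>' $ j + \<eta> $ j))) \<partial>lborel)"
        by (rule nn_integral_cmult[symmetric]) measurable
      also have "\<dots> = (\<integral>\<^sup>+\<eta>. p \<eta> * b \<eta> (fst y) (snd y) \<partial>lborel)"
        by (intro nn_integral_cong)
           (simp add: y p_def b_def norm_mult prod_norm[symmetric] prod.distrib ennreal_mult prod_nonneg prod_ennreal[symmetric] mult_ac)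
      finally show "ennreal (norm (u y * (\<integral>z. ?K (z - y) * ?G z \<partial>lborel))) \<le> (\<integral>\<^sup>+\<eta>. p \<eta> * b \<eta> (fst y) (snd y) \<partial>lborel)" .
    qed
    also have "\<dots> = (\<integral>\<^sup>+\<eta>. (\<integral>\<^sup>+y. p \<eta> * b \<eta> (fst y) (snd y) \<partial>lborel) \<partial>lborel)"
      by (rule lborel_pair.Fubini') measurable
    also have "\<dots> \<le> (\<integral>\<^sup>+\<eta>. p \<eta> * ?R \<partial>lborel)"
    proof (rule nn_integral_mono)
      fix \<eta> :: "real^'n^'N"
      have [measurable]: "(\<lambda>(x, \<xi>). b \<eta> x \<xi>) \<in> borel_measurable (borel \<Otimes>\<^sub>M borel)" unfolding b_def by measurable
      have "(\<integral>\<^sup>+y. p \<eta> * b \<eta> (fst y) (snd y) \<partial>lborel) = p \<eta> * (\<integral>\<^sup>+y. b \<eta> (fst y) (snd y) \<partial>lborel)"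
        by (rule nn_integral_cmult) (simp add: b_def)
      also have "(\<integral>\<^sup>+y. b \<eta> (fst y) (snd y) \<partial>lborel) = (\<integral>\<^sup>+x. \<integral>\<^sup>+\<xi>. b \<eta> x \<xi> \<partial>lborel \<partial>lborel)"
        by (rule nn_integral_lborel_pair[symmetric]) measurable
      also have "p \<eta> * \<dots> \<le> p \<eta> * ?R"
        unfolding b_def using hb supp g by (intro mult_left_mono core[OF hm _ _ um, of M \<mu>]) auto
      finally show "(\<integral>\<^sup>+y. p \<eta> * b \<eta> (fst y) (snd y) \<partial>lborel) \<le> p \<eta> * ?R" .
    qed
    also have "\<dots> = (\<integral>\<^sup>+\<eta>. p \<eta> \<partial>lborel) * ?R" by (rule nn_integral_multc) measurable
    also have "(\<integral>\<^sup>+\<eta>. p \<eta> \<partial>lborel) = ennreal (I ^ CARD('N))"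
      unfolding p_def using I
      by (subst nn_integral_vec_prod[where f="\<lambda>j \<eta>. ennreal (norm (?\<Phi> j \<eta>))"])
         (auto simp: nn_integral_norm_inv_fourier_dil I_def[symmetric] ennreal_power)
    also have "ennreal (I ^ CARD('N)) * ?R \<le> ennreal ((I + 1) ^ CARD('N)) * ?R"
      using I by (intro mult_right_mono ennreal_leI power_mono) auto
    also have "\<dots> = ennreal (C' * sqrt ((2 ^ k0) ^ CARD('n))) * L2ul_norm (\<lambda>(x, \<xi>). of_real (inverse (W \<xi>)) * u (x, \<xi>)) *
        epowr (\<integral>\<^sup>+x. (ennreal (norm (h x)))\<^sup>2 \<partial>lborel) (1/2) *
        (\<Prod>j\<in>UNIV. epowr (\<integral>\<^sup>+x. (ennreal (norm (g j x)))\<^sup>2 \<partial>lborel) (1/2))"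
      using I C by (simp add: C'_def ennreal_mult mult.assoc)
    also have "(\<lambda>j x. (ennreal (norm (g j x)))\<^sup>2) = (\<lambda>j x. (ennreal (norm (f j x)))\<^sup>2 * indicator (cball \<mu> (2 * 2 ^ k j + real CARD('n))) x)"
      by (auto simp: fun_eq_iff g_def indicator_def)
    finally show ?thesis .
  qed
  show ?thesis
    by (intro exI[of _ C'] conjI C' allI impI, rule main; blast)
qed

end

section \<open>Sequence spaces\<close>

text \<open>The graph of a convex power lies above its tangent at 1. This is Young's inequality with
  second factor 1.\<close>

lemma powr_ge_tangent:
  fixes t p :: real
  assumes p: "1 \<le> p" and t: "0 \<le> t"
  shows "1 + p * (t - 1) \<le> t powr p"
proof (cases "p = 1")
  case True
  then show ?thesis using t by simp
next
  case False
  define q where "q = p / (p - 1)"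
  have p1: "1 < p" using p False by simp
  have q: "1 < q" "1 / p + 1 / q = 1" using p1 by (auto simp: q_def field_simps)
  have "t * 1 \<le> t powr p / p + 1 powr q / q"
    using Youngs_inequality[OF p1 q(1,2) t, of 1] by simp
  then have "t \<le> t powr p / p + (p - 1) / p" by (simp add: q_def)
  then have "t * p \<le> (t powr p / p + (p - 1) / p) * p" using p1 by (intro mult_right_mono) auto
  also have "\<dots> = t powr p + (p - 1)" using p1 by (simp add: add_divide_distrib[symmetric])
  finally show ?thesis by (simp add: algebra_simps)
qed

text \<open>The tangent inequality is averaged over the values divided by their mean
  \<open>m\<close>; the linear terms then sum to 0.\<close>

lemma jensen_powr:
  fixes w x :: "'i \<Rightarrow> real"
  assumes F: "finite F" and w: "\<And>i. i \<in> F \<Longrightarrow> 0 \<le> w i" "(\<Sum>i\<in>F. w i) = 1"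
    and x: "\<And>i. i \<in> F \<Longrightarrow> 0 \<le> x i" and p: "1 \<le> p"
  shows "(\<Sum>i\<in>F. w i * x i) powr p \<le> (\<Sum>i\<in>F. w i * x i powr p)"
proof -
  define m where "m = (\<Sum>i\<in>F. w i * x i)"
  have m0: "0 \<le> m" unfolding m_def using w x by (intro sum_nonneg) auto
  show ?thesis
  proof (cases "m = 0")
    case True
    then show ?thesis unfolding m_def[symmetric] using w x by (auto intro!: sum_nonneg)
  next
    case False
    then have m: "m > 0" using m0 by simp
    have "1 = (\<Sum>i\<in>F. w i * (1 + p * (x i / m - 1)))"
    proof -
      have "(\<Sum>i\<in>F. w i * (1 + p * (x i / m - 1))) = (\<Sum>i\<in>F. w i * (1 - p) + (p / m) * (w i * x i))"
        by (intro sum.cong refl) (simp add: algebra_simps)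
      also have "\<dots> = (\<Sum>i\<in>F. w i) * (1 - p) + (p / m) * m"
        unfolding m_def by (simp add: sum.distrib sum_distrib_left sum_distrib_right)
      finally show ?thesis using w(2) m by simp
    qed
    also have "\<dots> \<le> (\<Sum>i\<in>F. w i * (x i / m) powr p)"
      using w x m p by (intro sum_mono mult_left_mono powr_ge_tangent) auto
    also have "\<dots> = (\<Sum>i\<in>F. w i * x i powr p) / m powr p"
      using x m by (simp add: powr_divide sum_divide_distrib)
    finally show ?thesis using m by (simp add: m_def[symmetric] pos_le_divide_eq)
  qed
qed

text \<open>The same device for the logarithm: ln t \<le> t - 1 is averaged over the values divided
  by their mean. If some value is 0, so is the product.\<close>

lemma weighted_am_gm:
  fixes w x :: "'i \<Rightarrow> real"
  assumes F: "finite F" and w: "\<And>i. i \<in> F \<Longrightarrow> 0 < w i" "(\<Sum>i\<in>F. w i) = 1"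
    and x: "\<And>i. i \<in> F \<Longrightarrow> 0 \<le> x i"
  shows "(\<Prod>i\<in>F. x i powr w i) \<le> (\<Sum>i\<in>F. w i * x i)"
proof (cases "\<exists>i\<in>F. x i = 0")
  case True
  then have "(\<Prod>i\<in>F. x i powr w i) = 0" using F by auto
  moreover have "0 \<le> (\<Sum>i\<in>F. w i * x i)" using w x by (intro sum_nonneg mult_nonneg_nonneg) (auto intro: less_imp_le)
  ultimately show ?thesis by simp
next
  case False
  then have xp: "0 < x i" if "i \<in> F" for i using x[OF that] that by force
  define m where "m = (\<Sum>i\<in>F. w i * x i)"
  have "F \<noteq> {}" using w(2) by auto
  then have m: "m > 0" unfolding m_def using F w xp by (intro sum_pos) auto
  have "(\<Sum>i\<in>F. w i * ln (x i / m)) \<le> (\<Sum>i\<in>F. w i * (x i / m - 1))"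
    using w xp m by (intro sum_mono mult_left_mono ln_le_minus_one) (auto intro: less_imp_le)
  also have "\<dots> = (\<Sum>i\<in>F. w i * x i) / m - (\<Sum>i\<in>F. w i)"
    by (simp add: right_diff_distrib sum_subtractf sum_divide_distrib)
  also have "\<dots> = 0" using m w(2) by (simp add: m_def)
  finally have "(\<Sum>i\<in>F. w i * ln (x i / m)) \<le> 0" .
  moreover have "(\<Sum>i\<in>F. w i * ln (x i / m)) = (\<Sum>i\<in>F. w i * ln (x i)) - ln m"
  proof -
    have "(\<Sum>i\<in>F. w i * ln (x i / m)) = (\<Sum>i\<in>F. w i * ln (x i) - w i * ln m)"
    proof (rule sum.cong[OF refl])
      fix i assume "i \<in> F"
      from xp[OF this] m show "w i * ln (x i / m) = w i * ln (x i) - w i * ln m"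
        by (simp add: ln_div right_diff_distrib)
    qed
    also have "\<dots> = (\<Sum>i\<in>F. w i * ln (x i)) - (\<Sum>i\<in>F. w i) * ln m"
      by (simp add: sum_subtractf sum_distrib_right)
    finally show ?thesis using w(2) by simp
  qed
  ultimately have "(\<Sum>i\<in>F. w i * ln (x i)) \<le> ln m" by simp
  then have "exp (\<Sum>i\<in>F. w i * ln (x i)) \<le> m" using m by (metis exp_le_cancel_iff exp_ln)
  moreover have "exp (\<Sum>i\<in>F. w i * ln (x i)) = (\<Prod>i\<in>F. x i powr w i)"
    using F xp by (simp add: exp_sum powr_def) (intro prod.cong refl, metis less_irrefl)
  ultimately show ?thesis by (simp add: m_def)
qed

text \<open>After dividing by the sum both terms lie between 0 and 1, where raising to a power at
  most 1 does not decrease.\<close>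

lemma powr_add_le:
  fixes x y s :: real
  assumes "0 \<le> x" "0 \<le> y" "0 < s" "s \<le> 1"
  shows "(x + y) powr s \<le> x powr s + y powr s"
proof (cases "x + y = 0")
  case False
  then have z: "x + y > 0" using assms by simp
  have u: "u \<le> u powr s" if "0 \<le> u" "u \<le> 1" for u :: real
  proof (cases "u = 0")
    case False
    then have "u powr 1 \<le> u powr s" using that assms by (intro powr_mono') auto
    then show ?thesis using that by simp
  qed simp
  have "1 = x / (x + y) + y / (x + y)" using z by (simp add: add_divide_distrib[symmetric])
  also have "\<dots> \<le> (x / (x + y)) powr s + (y / (x + y)) powr s"
    using assms z by (intro add_mono u) auto
  also have "\<dots> = (x powr s + y powr s) / (x + y) powr s"
    using assms z by (simp add: powr_divide add_divide_distrib)
  finally show ?thesis using z by (simp add: pos_le_divide_eq)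
qed (use assms in auto)

section \<open>Powers of suprema and of finite sums\<close>

lemma epowr_le_iff:
  assumes "0 < s" shows "epowr x s \<le> B \<longleftrightarrow> x \<le> epowr B (1 / s)"
proof
  assume "epowr x s \<le> B"
  from epowr_mono[OF this, of "1/s"] assms show "x \<le> epowr B (1 / s)" by (simp add: epowr_epowr)
next
  assume "x \<le> epowr B (1 / s)"
  from epowr_mono[OF this, of s] assms show "epowr x s \<le> B" by (simp add: epowr_epowr)
qed

text \<open>For a positive exponent \<open>epowr\<close> has the power with exponent
  \<open>1 / s\<close> as monotone inverse, and an order isomorphism preserves suprema.\<close>

lemma epowr_SUP:
  assumes "0 < s" shows "epowr (SUP i\<in>A. f i) s = (SUP i\<in>A. epowr (f i) s)"
proof (rule antisym)
  show "epowr (SUP i\<in>A. f i) s \<le> (SUP i\<in>A. epowr (f i) s)"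
    unfolding epowr_le_iff[OF assms] by (intro SUP_least) (unfold epowr_le_iff[OF assms, symmetric], rule SUP_upper)
  show "(SUP i\<in>A. epowr (f i) s) \<le> epowr (SUP i\<in>A. f i) s"
    using assms by (intro SUP_least epowr_mono SUP_upper) auto
qed

lemma epowr_sum_le:
  assumes F: "finite F" and s: "0 < s" "s \<le> 1"
  shows "epowr (\<Sum>i\<in>F. f i) s \<le> (\<Sum>i\<in>F. epowr (f i) s)"
  using F
proof (induction F rule: finite_induct)
  case (insert i F)
  have add: "epowr (x + y) s \<le> epowr x s + epowr y s" for x y
  proof (cases "x = \<top> \<or> y = \<top>")
    case False
    then obtain a b where "x = ennreal a" "y = ennreal b" "0 \<le> a" "0 \<le> b" by (metis ennreal_cases)
    then show ?thesis using powr_add_le[of a b s] s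
      by (simp add: epowr_ennreal flip: ennreal_plus)
  qed auto
  have "epowr (f i + (\<Sum>i\<in>F. f i)) s \<le> epowr (f i) s + epowr (\<Sum>i\<in>F. f i) s" by (rule add)
  also have "\<dots> \<le> epowr (f i) s + (\<Sum>i\<in>F. epowr (f i) s)" by (intro add_left_mono insert.IH)
  finally show ?case using insert.hyps by simp
qed simp

text \<open>Jensen's inequality with equal weights; the counterpart, for exponents at least 1, of
  subadditivity for exponents at most 1.\<close>

lemma epowr_sum_le_card:
  assumes F: "finite F" and s: "1 \<le> s"
  shows "epowr (\<Sum>i\<in>F. f i) s \<le> ennreal (real (card F) powr (s - 1)) * (\<Sum>i\<in>F. epowr (f i) s)"
proof (cases "F = {}")
  case False
  then have c: "0 < real (card F)" using F by (simp add: card_gt_0_iff)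
  show ?thesis
  proof (cases "\<exists>i\<in>F. f i = \<top>")
    case True
    then obtain i where i: "i \<in> F" "f i = \<top>" by blast
    then have "(\<Sum>i\<in>F. epowr (f i) s) = \<top>" using F by (auto intro!: bexI[of _ i])
    then show ?thesis using c by (simp add: ennreal_mult_top)
  next
    case False
    define x where "x i = enn2real (f i)" for i
    have x: "f i = ennreal (x i)" if "i \<in> F" for i using False that by (auto simp: x_def less_top)
    have x0: "0 \<le> x i" for i by (simp add: x_def)
    have "(\<Sum>i\<in>F. (1 / real (card F)) * x i) powr s \<le> (\<Sum>i\<in>F. (1 / real (card F)) * x i powr s)"
      using F c s by (intro jensen_powr) (auto simp: x0)
    then have "((\<Sum>i\<in>F. x i) / real (card F)) powr s \<le> (\<Sum>i\<in>F. x i powr s) / real (card F)"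
      by (simp add: sum_divide_distrib)
    then have "(\<Sum>i\<in>F. x i) powr s / real (card F) powr s \<le> (\<Sum>i\<in>F. x i powr s) / real (card F)"
      by (simp add: powr_divide x0 sum_nonneg)
    then have "(\<Sum>i\<in>F. x i) powr s \<le> ((\<Sum>i\<in>F. x i powr s) / real (card F)) * real (card F) powr s"
      using c by (simp add: pos_divide_le_eq)
    also have "\<dots> = real (card F) powr (s - 1) * (\<Sum>i\<in>F. x i powr s)"
      using c by (simp add: powr_diff)
    finally have le: "(\<Sum>i\<in>F. x i) powr s \<le> real (card F) powr (s - 1) * (\<Sum>i\<in>F. x i powr s)" .
    have "(\<Sum>i\<in>F. f i) = ennreal (\<Sum>i\<in>F. x i)" by (simp add: x x0 sum_ennreal)
    moreover have "(\<Sum>i\<in>F. epowr (f i) s) = ennreal (\<Sum>i\<in>F. x i powr s)"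
      by (simp add: x x0 epowr_ennreal sum_ennreal)
    ultimately show ?thesis
      using le by (simp add: epowr_ennreal sum_nonneg x0 ennreal_mult[symmetric] ennreal_leI)
  qed
qed simp

section \<open>Hoelder, Minkowski and quasi-triangle inequalities for sequences\<close>

context
  fixes I :: "'i set"
  assumes I: "countable I"
begin

lemma lq_norm_top: "lq_norm I \<top> a = (SUP i\<in>I. a i)"
  by (simp add: lq_norm_def)

lemma lq_norm_finite:
  "q \<noteq> \<top> \<Longrightarrow> lq_norm I q a = epowr (\<integral>\<^sup>+i. epowr (a i) (enn2real q) \<partial>count_space I) (1 / enn2real q)"
  by (simp add: lq_norm_def infsum_eq_nn_integral[OF I])

lemma lq_norm_le_iff:
  assumes "0 < q" "q \<noteq> \<top>"
  shows "lq_norm I q a \<le> B \<longleftrightarrow> (\<integral>\<^sup>+i. epowr (a i) (enn2real q) \<partial>count_space I) \<le> epowr B (enn2real q)"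
proof -
  have "0 < enn2real q" using assms by (simp add: enn2real_positive_iff less_top)
  then show ?thesis using assms by (simp add: lq_norm_finite epowr_le_iff)
qed

lemma epowr_lq_norm:
  assumes "0 < q" "q \<noteq> \<top>"
  shows "epowr (lq_norm I q a) (enn2real q) = (\<integral>\<^sup>+i. epowr (a i) (enn2real q) \<partial>count_space I)"
proof -
  have "0 < enn2real q" using assms by (simp add: enn2real_positive_iff less_top)
  then show ?thesis using assms by (simp add: lq_norm_finite epowr_epowr)
qed

lemma lq_norm_mono:
  assumes "0 < q" "\<And>i. i \<in> I \<Longrightarrow> a i \<le> b i"
  shows "lq_norm I q a \<le> lq_norm I q b"
proof (cases "q = \<top>")
  case True
  then show ?thesis using assms by (auto simp: lq_norm_top intro: SUP_mono)
next
  case False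
  show ?thesis unfolding lq_norm_le_iff[OF assms(1) False] epowr_lq_norm[OF assms(1) False]
    using assms by (intro nn_integral_mono epowr_mono) auto
qed

lemma le_lq_norm:
  assumes "0 < q" "i \<in> I"
  shows "a i \<le> lq_norm I q a"
proof (cases "q = \<top>")
  case True
  then show ?thesis using assms by (auto simp: lq_norm_top intro: SUP_upper)
next
  case False
  have q: "0 < enn2real q" using assms False by (simp add: enn2real_positive_iff less_top)
  have "epowr (a i) (enn2real q) = (\<Sum>i\<in>{i}. epowr (a i) (enn2real q))" by simp
  also have "\<dots> \<le> epowr (lq_norm I q a) (enn2real q)"
    unfolding epowr_lq_norm[OF assms(1) False] using assms by (intro nn_integral_count_space_ge_sum) auto
  finally show ?thesis using q by (simp add: epowr_le_iff epowr_epowr)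
qed

lemma lq_norm_cmult:
  assumes "0 < q"
  shows "lq_norm I q (\<lambda>i. c * a i) = c * lq_norm I q a"
proof (cases "q = \<top>")
  case True
  then show ?thesis by (simp add: lq_norm_top SUP_mult_left_ennreal)
next
  case False
  have q: "0 < enn2real q" using assms False by (simp add: enn2real_positive_iff less_top)
  show ?thesis using q by (simp add: lq_norm_finite[OF False] epowr_mult nn_integral_cmult epowr_epowr)
qed

text \<open>Each sequence is normalized by its norm. The numbers \<open>r / q j\<close> with
  \<open>q j\<close> finite sum to 1, so the weighted arithmetic-geometric inequality bounds the
  power \<open>r\<close> of the product pointwise, and summation gives the weights back. The
  argument covers all positive \<open>r\<close>, including values below 1.\<close>

lemma lq_norm_holder:
  fixes a :: "'N::finite \<Rightarrow> 'i \<Rightarrow> ennreal" and q :: "'N \<Rightarrow> ennreal"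
  assumes q: "\<And>j. 0 < q j" and r: "0 < r" and qr: "(\<Sum>j\<in>UNIV. 1 / q j) = 1 / r"
    and fin: "\<And>j. lq_norm I (q j) (a j) < \<top>"
  shows "lq_norm I r (\<lambda>i. \<Prod>j\<in>UNIV. a j i) \<le> (\<Prod>j\<in>UNIV. lq_norm I (q j) (a j))"
proof (cases "r = \<top>")
  case True
  then have "(\<Sum>j\<in>UNIV. 1 / q j) = 0" using qr by simp
  then have "q j = \<top>" for j by (auto simp: ennreal_divide_eq_0_iff)
  then show ?thesis using True
    by (auto simp: lq_norm_top intro!: SUP_least prod_mono_ennreal SUP_upper)
next
  case False
  define p where "p j = enn2real (q j)" for j
  define r' where "r' = enn2real r"
  have r': "0 < r'" "r = ennreal r'" using r False by (auto simp: r'_def enn2real_positive_iff less_top)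
  \<comment> \<open>The indices with finite exponent; the others contribute 0 to the sum of
    reciprocals.\<close>
  define J where "J = {j. q j \<noteq> \<top>}"
  have p: "0 < p j" "q j = ennreal (p j)" if "j \<in> J" for j
    using q[of j] that by (auto simp: p_def J_def enn2real_positive_iff less_top)
  define \<alpha> where "\<alpha> j = enn2real (lq_norm I (q j) (a j))" for j
  have \<alpha>: "lq_norm I (q j) (a j) = ennreal (\<alpha> j)" "0 \<le> \<alpha> j" for j using fin[of j] by (auto simp: \<alpha>_def)
  define x where "x j i = enn2real (a j i)" for j i
  have ai: "a j i \<le> ennreal (\<alpha> j)" if "i \<in> I" for i j
    using le_lq_norm[OF q[of j] that, of "a j"] by (simp add: \<alpha>)
  have x: "a j i = ennreal (x j i)" "0 \<le> x j i" if "i \<in> I" for i j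
    using le_less_trans[OF ai[OF that, of j] ennreal_less_top] by (auto simp: x_def)
  have xa: "x j i \<le> \<alpha> j" if "i \<in> I" for i j
    using ai[OF that, of j] x[OF that, of j] \<alpha>(2)[of j] by (simp add: ennreal_le_iff)
  have w: "(\<Sum>j\<in>J. r' / p j) = 1"
  proof -
    have "(\<Sum>j\<in>UNIV. 1 / q j) = (\<Sum>j\<in>J. 1 / q j)"
      by (rule sum.mono_neutral_right) (auto simp: J_def)
    also have "\<dots> = (\<Sum>j\<in>J. ennreal (1 / p j))"
      by (intro sum.cong refl) (simp add: p divide_ennreal[symmetric])
    also have "\<dots> = ennreal (\<Sum>j\<in>J. 1 / p j)" using p by (intro sum_ennreal) (auto intro: less_imp_le)
    finally have "ennreal (\<Sum>j\<in>J. 1 / p j) = ennreal (1 / r')"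
      using qr r' by (simp add: divide_ennreal[symmetric])
    then have "(\<Sum>j\<in>J. 1 / p j) = 1 / r'"
      using p r' by (subst (asm) ennreal_inj) (auto intro!: sum_nonneg intro: less_imp_le)
    then have "r' * (\<Sum>j\<in>J. 1 / p j) = 1" using r' by simp
    then show ?thesis by (simp add: sum_distrib_left)
  qed
  show ?thesis
  proof (cases "\<exists>j. \<alpha> j = 0")
    case True
    then obtain j0 where j0: "\<alpha> j0 = 0" by blast
    have "(\<Prod>j\<in>UNIV. a j i) = 0" if "i \<in> I" for i
    proof -
      have "a j0 i = 0" using ai[OF that, of j0] j0 by simp
      then show ?thesis by (metis UNIV_I finite_class.finite_UNIV prod_zero)
    qed
    then have "lq_norm I r (\<lambda>i. \<Prod>j\<in>UNIV. a j i) \<le> lq_norm I r (\<lambda>i. 0 * 0)"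
      by (intro lq_norm_mono r) simp
    also have "\<dots> = 0" by (subst lq_norm_cmult[OF r]) simp
    finally show ?thesis by simp
  next
    case False
    then have \<alpha>p: "0 < \<alpha> j" for j using \<alpha>(2)[of j] by (metis less_eq_real_def)
    define P where "P = (\<Prod>j\<in>UNIV. \<alpha> j)"
    have P: "0 < P" unfolding P_def by (intro prod_pos) (simp add: \<alpha>p)
    have pt: "epowr (\<Prod>j\<in>UNIV. a j i) r' \<le> ennreal (P powr r') * (\<Sum>j\<in>J. ennreal (r' / p j / \<alpha> j powr p j) * epowr (a j i) (p j))"
      if i: "i \<in> I" for i
    proof -
      have nn: "0 \<le> r' / p j / \<alpha> j powr p j * x j i powr p j" if "j \<in> J" for j
        using p(1)[OF that] r' by simp
      have "(\<Prod>j\<in>UNIV. x j i) = P * (\<Prod>j\<in>UNIV. x j i / \<alpha> j)"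
        unfolding prod_dividef P_def[symmetric] using P by simp
      also have "(\<Prod>j\<in>UNIV. x j i / \<alpha> j) = (\<Prod>j\<in>J. x j i / \<alpha> j) * (\<Prod>j\<in>-J. x j i / \<alpha> j)"
        by (subst prod.union_disjoint[symmetric]) (auto simp: Compl_partition)
      \<comment> \<open>Indices with infinite exponent contribute values divided by their supremum,
        hence factors at most 1.\<close>
      also have "\<dots> \<le> (\<Prod>j\<in>J. x j i / \<alpha> j) * 1"
        using xa[OF i] x(2)[OF i] \<alpha>p by (intro mult_left_mono prod_le_1 prod_nonneg) (auto simp: less_imp_le)
      finally have "(\<Prod>j\<in>UNIV. x j i) \<le> P * (\<Prod>j\<in>J. x j i / \<alpha> j)" using P by simp
      then have "(\<Prod>j\<in>UNIV. x j i) powr r' \<le> (P * (\<Prod>j\<in>J. x j i / \<alpha> j)) powr r'"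
        using r' x(2)[OF i] by (intro powr_mono2 prod_nonneg) auto
      also have "\<dots> = P powr r' * (\<Prod>j\<in>J. ((x j i / \<alpha> j) powr p j) powr (r' / p j))"
      proof -
        have "(\<Prod>j\<in>J. x j i / \<alpha> j) powr r' = (\<Prod>j\<in>J. (x j i / \<alpha> j) powr r')"
          using x(2)[OF i] \<alpha>(2) by (simp add: prod_powr_distrib)
        also have "\<dots> = (\<Prod>j\<in>J. ((x j i / \<alpha> j) powr p j) powr (r' / p j))"
        proof (rule prod.cong[OF refl])
          fix j assume "j \<in> J"
          from p(1)[OF this] show "(x j i / \<alpha> j) powr r' = ((x j i / \<alpha> j) powr p j) powr (r' / p j)"
            by (simp add: powr_powr)
        qed
        finally show ?thesis using P x(2)[OF i] \<alpha>(2) by (simp add: powr_mult prod_nonneg)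
      qed
      also have "\<dots> \<le> P powr r' * (\<Sum>j\<in>J. (r' / p j) * (x j i / \<alpha> j) powr p j)"
      proof (rule mult_left_mono)
        show "(\<Prod>j\<in>J. ((x j i / \<alpha> j) powr p j) powr (r' / p j)) \<le> (\<Sum>j\<in>J. (r' / p j) * (x j i / \<alpha> j) powr p j)"
          using w p r' by (intro weighted_am_gm) auto
      qed simp
      also have "(\<Sum>j\<in>J. (r' / p j) * (x j i / \<alpha> j) powr p j) = (\<Sum>j\<in>J. r' / p j / \<alpha> j powr p j * x j i powr p j)"
        using x(2)[OF i] \<alpha>(2) by (intro sum.cong refl) (simp add: powr_divide)
      finally have "ennreal ((\<Prod>j\<in>UNIV. x j i) powr r') \<le> ennreal (P powr r' * (\<Sum>j\<in>J. r' / p j / \<alpha> j powr p j * x j i powr p j))"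
        by (rule ennreal_leI)
      also have "ennreal ((\<Prod>j\<in>UNIV. x j i) powr r') = epowr (\<Prod>j\<in>UNIV. a j i) r'"
        using x[OF i] by (simp add: prod_ennreal epowr_ennreal prod_nonneg)
      also have "ennreal (P powr r' * (\<Sum>j\<in>J. r' / p j / \<alpha> j powr p j * x j i powr p j)) =
          ennreal (P powr r') * ennreal (\<Sum>j\<in>J. r' / p j / \<alpha> j powr p j * x j i powr p j)"
        by (rule ennreal_mult[OF _ sum_nonneg[OF nn]]) simp_all
      also have "ennreal (\<Sum>j\<in>J. r' / p j / \<alpha> j powr p j * x j i powr p j) = (\<Sum>j\<in>J. ennreal (r' / p j / \<alpha> j powr p j * x j i powr p j))"
        by (rule sum_ennreal[symmetric]) (rule nn)
      also have "\<dots> = (\<Sum>j\<in>J. ennreal (r' / p j / \<alpha> j powr p j) * epowr (a j i) (p j))"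
      proof (rule sum.cong[OF refl])
        fix j assume j: "j \<in> J"
        have "0 \<le> r' / p j / \<alpha> j powr p j" using p(1)[OF j] r' by simp
        then have "ennreal (r' / p j / \<alpha> j powr p j * x j i powr p j) = ennreal (r' / p j / \<alpha> j powr p j) * ennreal (x j i powr p j)"
          by (rule ennreal_mult) simp
        then show "ennreal (r' / p j / \<alpha> j powr p j * x j i powr p j) = ennreal (r' / p j / \<alpha> j powr p j) * epowr (a j i) (p j)"
          unfolding x(1)[OF i] epowr_ennreal[OF x(2)[OF i]] .
      qed
      finally show ?thesis .
    qed
    have "(\<integral>\<^sup>+i. epowr (\<Prod>j\<in>UNIV. a j i) r' \<partial>count_space I) \<le>
        (\<integral>\<^sup>+i. ennreal (P powr r') * (\<Sum>j\<in>J. ennreal (r' / p j / \<alpha> j powr p j) * epowr (a j i) (p j)) \<partial>count_space I)"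
      by (rule nn_integral_mono) (rule pt, simp)
    also have "\<dots> = ennreal (P powr r') * (\<Sum>j\<in>J. ennreal (r' / p j / \<alpha> j powr p j) * (\<integral>\<^sup>+i. epowr (a j i) (p j) \<partial>count_space I))"
      by (simp add: nn_integral_cmult nn_integral_sum)
    also have "(\<Sum>j\<in>J. ennreal (r' / p j / \<alpha> j powr p j) * (\<integral>\<^sup>+i. epowr (a j i) (p j) \<partial>count_space I)) = (\<Sum>j\<in>J. ennreal (r' / p j))"
    proof (intro sum.cong refl)
      fix j assume j: "j \<in> J"
      have "(\<integral>\<^sup>+i. epowr (a j i) (p j) \<partial>count_space I) = ennreal (\<alpha> j powr p j)"
        using epowr_lq_norm[OF q[of j], of "a j"] j \<alpha>[of j] by (simp add: J_def p_def epowr_ennreal)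
      then show "ennreal (r' / p j / \<alpha> j powr p j) * (\<integral>\<^sup>+i. epowr (a j i) (p j) \<partial>count_space I) = ennreal (r' / p j)"
        using \<alpha>p[of j] p[OF j] r' by (simp add: ennreal_mult[symmetric])
    qed
    also have "\<dots> = ennreal 1"
      unfolding w[symmetric] using p r' by (intro sum_ennreal) (auto intro: less_imp_le)
    finally have "lq_norm I r (\<lambda>i. \<Prod>j\<in>UNIV. a j i) \<le> ennreal P"
      unfolding lq_norm_le_iff[OF r \<open>r \<noteq> \<top>\<close>] r'_def[symmetric] using P by (simp add: epowr_ennreal)
    also have "ennreal P = (\<Prod>j\<in>UNIV. lq_norm I (q j) (a j))"
      unfolding P_def \<alpha>(1) using \<alpha>(2) by (intro prod_ennreal[symmetric]) auto
    finally show ?thesis .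
  qed
qed

text \<open>With \<beta> k the norms and \<open>B\<close> their sum, the sum over \<open>k\<close>
  is \<open>B\<close> times the average of the normalized sequences with weights \<beta> k / B.
  Jensen's inequality pointwise, followed by summation over \<open>I\<close>, gives the
  claim.\<close>

lemma lq_norm_minkowski_finite:
  assumes F: "finite F" and r: "1 \<le> r" "r \<noteq> \<top>"
  shows "lq_norm I r (\<lambda>i. \<Sum>k\<in>F. d k i) \<le> (\<Sum>k\<in>F. lq_norm I r (d k))"
proof (cases "\<exists>k\<in>F. lq_norm I r (d k) = \<top>")
  case True
  then have "(\<Sum>k\<in>F. lq_norm I r (d k)) = \<top>" using F by auto
  then show ?thesis by simp
next
  case False
  define p where "p = enn2real r"
  have r0: "0 < r" using r(1) by (metis ennreal_zero_less_one less_le_trans)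
  have p: "1 \<le> p" "r = ennreal p" "0 < p"
  proof -
    show "r = ennreal p" using r(2) by (simp add: p_def less_top)
    then show "1 \<le> p" using r(1) by (simp add: ennreal_ge_1)
    then show "0 < p" by simp
  qed
  define \<beta> where "\<beta> k = enn2real (lq_norm I r (d k))" for k
  have \<beta>: "lq_norm I r (d k) = ennreal (\<beta> k)" if "k \<in> F" for k using False that by (auto simp: \<beta>_def less_top)
  have \<beta>0: "0 \<le> \<beta> k" for k by (simp add: \<beta>_def)
  define x where "x k i = enn2real (d k i)" for k i
  have di: "d k i \<le> ennreal (\<beta> k)" if "k \<in> F" "i \<in> I" for k i
    using le_lq_norm[OF r0 that(2), of "d k"] by (simp add: \<beta>[OF that(1)])
  have x: "d k i = ennreal (x k i)" if "k \<in> F" "i \<in> I" for k i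
    using le_less_trans[OF di[OF that] ennreal_less_top] by (auto simp: x_def)
  have x0: "0 \<le> x k i" for k i by (simp add: x_def)
  have xz: "x k i = 0" if "k \<in> F" "i \<in> I" "\<beta> k = 0" for k i
    using di[OF that(1,2)] that(3) by (simp add: x_def)
  define B where "B = (\<Sum>k\<in>F. \<beta> k)"
  have B0: "0 \<le> B" unfolding B_def by (intro sum_nonneg \<beta>0)
  have pt: "epowr (\<Sum>k\<in>F. d k i) p \<le> ennreal (B powr p) * (\<Sum>k\<in>F. ennreal (\<beta> k / B / \<beta> k powr p) * epowr (d k i) p)"
    if i: "i \<in> I" for i
  proof (cases "B = 0")
    case True
    then have "\<beta> k = 0" if "k \<in> F" for k using F \<beta>0 that unfolding B_def by (simp add: sum_nonneg_eq_0_iff)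
    then have "(\<Sum>k\<in>F. d k i) = 0" using xz[OF _ i] x[OF _ i] by simp
    then show ?thesis by simp
  next
    case False
    then have B: "0 < B" using B0 by simp
    \<comment> \<open>If \<open>\<beta> k = 0\<close> the sequence \<open>x k\<close> vanishes on
      \<open>I\<close>, so the convention that division by 0 gives 0 is consistent with the
      identity.\<close>
    have "(\<Sum>k\<in>F. x k i) = B * (\<Sum>k\<in>F. (\<beta> k / B) * (x k i / \<beta> k))"
      unfolding sum_distrib_left using B xz[OF _ i] by (intro sum.cong refl) auto
    then have "(\<Sum>k\<in>F. x k i) powr p = B powr p * (\<Sum>k\<in>F. (\<beta> k / B) * (x k i / \<beta> k)) powr p"
      using B \<beta>0 x0 by (simp add: powr_mult sum_nonneg)
    also have "\<dots> \<le> B powr p * (\<Sum>k\<in>F. (\<beta> k / B) * (x k i / \<beta> k) powr p)"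
      using F B \<beta>0 x0 p by (intro mult_left_mono jensen_powr) (auto simp: sum_divide_distrib[symmetric] B_def[symmetric])
    also have "(\<Sum>k\<in>F. (\<beta> k / B) * (x k i / \<beta> k) powr p) = (\<Sum>k\<in>F. \<beta> k / B / \<beta> k powr p * x k i powr p)"
      using \<beta>0 x0 by (intro sum.cong refl) (simp add: powr_divide)
    finally have "ennreal ((\<Sum>k\<in>F. x k i) powr p) \<le> ennreal (B powr p * (\<Sum>k\<in>F. \<beta> k / B / \<beta> k powr p * x k i powr p))"
      by (rule ennreal_leI)
    also have "ennreal ((\<Sum>k\<in>F. x k i) powr p) = epowr (\<Sum>k\<in>F. d k i) p"
      using x[OF _ i] x0 by (simp add: sum_ennreal epowr_ennreal sum_nonneg)
    also have "ennreal (B powr p * (\<Sum>k\<in>F. \<beta> k / B / \<beta> k powr p * x k i powr p)) =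
       ennreal (B powr p) * ennreal (\<Sum>k\<in>F. \<beta> k / B / \<beta> k powr p * x k i powr p)"
      using \<beta>0 B0 by (intro ennreal_mult sum_nonneg) auto
    also have "ennreal (\<Sum>k\<in>F. \<beta> k / B / \<beta> k powr p * x k i powr p) = (\<Sum>k\<in>F. ennreal (\<beta> k / B / \<beta> k powr p * x k i powr p))"
      using \<beta>0 B0 by (intro sum_ennreal[symmetric]) auto
    also have "\<dots> = (\<Sum>k\<in>F. ennreal (\<beta> k / B / \<beta> k powr p) * epowr (d k i) p)"
      using \<beta>0 B0 x[OF _ i] x0 by (intro sum.cong refl) (simp add: epowr_ennreal ennreal_mult[symmetric])
    finally show ?thesis .
  qed
  have "(\<integral>\<^sup>+i. epowr (\<Sum>k\<in>F. d k i) p \<partial>count_space I) \<le>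
     (\<integral>\<^sup>+i. ennreal (B powr p) * (\<Sum>k\<in>F. ennreal (\<beta> k / B / \<beta> k powr p) * epowr (d k i) p) \<partial>count_space I)"
    by (rule nn_integral_mono) (rule pt, simp)
  also have "\<dots> = ennreal (B powr p) * (\<Sum>k\<in>F. ennreal (\<beta> k / B / \<beta> k powr p) * (\<integral>\<^sup>+i. epowr (d k i) p \<partial>count_space I))"
    by (simp add: nn_integral_cmult nn_integral_sum)
  also have "\<dots> \<le> ennreal (B powr p) * (\<Sum>k\<in>F. ennreal (\<beta> k / B))"
  proof (intro mult_left_mono sum_mono)
    fix k assume k: "k \<in> F"
    have e: "(\<integral>\<^sup>+i. epowr (d k i) p \<partial>count_space I) = ennreal (\<beta> k powr p)"
      using epowr_lq_norm[OF r0 r(2), of "d k"] \<beta>0 by (simp add: \<beta>[OF k] p_def[symmetric] epowr_ennreal)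
    show "ennreal (\<beta> k / B / \<beta> k powr p) * (\<integral>\<^sup>+i. epowr (d k i) p \<partial>count_space I) \<le> ennreal (\<beta> k / B)"
      unfolding e using \<beta>0[of k] B0 by (cases "\<beta> k = 0") (simp_all add: ennreal_mult[symmetric])
  qed simp
  also have "(\<Sum>k\<in>F. ennreal (\<beta> k / B)) = ennreal (B / B)"
    using \<beta>0 B0 by (simp add: sum_ennreal B_def sum_divide_distrib[symmetric])
  also have "ennreal (B powr p) * ennreal (B / B) \<le> ennreal (B powr p)"
    using B0 p by (cases "B = 0") auto
  finally have "lq_norm I r (\<lambda>i. \<Sum>k\<in>F. d k i) \<le> ennreal B"
    unfolding lq_norm_le_iff[OF r0 r(2)] p_def[symmetric] using B0 by (simp add: epowr_ennreal)
  also have "ennreal B = (\<Sum>k\<in>F. lq_norm I r (d k))"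
    using \<beta> \<beta>0 by (simp add: B_def sum_ennreal)
  finally show ?thesis .
qed

text \<open>For finite r \<ge> 1 this is Minkowski's inequality on finite index sets and monotone
  convergence, for which all \<open>i\<close> have to share one increasing sequence of finite sets.
  For r < 1 the power \<open>r\<close> is subadditive and Tonelli exchanges the two sums; for r =
  \<infinity> the supremum is moved inside the sum. The outer exponent \<open>min 1 r\<close> unites
  the cases.\<close>

lemma lq_norm_triangle:
  fixes d :: "'k \<Rightarrow> 'i \<Rightarrow> ennreal"
  assumes K: "countable K" and r: "0 < r"
  shows "lq_norm I r (\<lambda>i. \<integral>\<^sup>+k. d k i \<partial>count_space K) \<le> lq_norm K (min 1 r) (\<lambda>k. lq_norm I r (d k))"
proof -
  obtain F :: "nat \<Rightarrow> 'k set" where F: "\<And>n. finite (F n)" "\<And>n. F n \<subseteq> K" "incseq F"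
    and S: "\<And>f. (\<integral>\<^sup>+k. f k \<partial>count_space K) = (SUP n. \<Sum>k\<in>F n. f k :: ennreal)"
    using nn_integral_count_space_SUP_finite[OF K] by blast
  have lq1: "lq_norm K 1 f = (\<integral>\<^sup>+k. f k \<partial>count_space K)" for f :: "'k \<Rightarrow> ennreal"
    by (simp add: lq_norm_def infsum_eq_nn_integral[OF K])
  consider "r = \<top>" | "1 \<le> r" "r \<noteq> \<top>" | "r < 1" by fastforce
  then show ?thesis
  proof cases
    case 1
    have "(SUP i\<in>I. \<integral>\<^sup>+k. d k i \<partial>count_space K) \<le> (\<integral>\<^sup>+k. (SUP i\<in>I. d k i) \<partial>count_space K)"
      by (intro SUP_least nn_integral_mono SUP_upper)
    then show ?thesis using 1 by (simp add: lq_norm_top lq1 min_def)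
  next
    case 2
    define p where "p = enn2real r"
    have p: "0 < p" using r 2 by (simp add: p_def enn2real_positive_iff less_top)
    have "(\<integral>\<^sup>+i. epowr (\<integral>\<^sup>+k. d k i \<partial>count_space K) p \<partial>count_space I) = (\<integral>\<^sup>+i. (SUP n. epowr (\<Sum>k\<in>F n. d k i) p) \<partial>count_space I)"
      by (simp add: S epowr_SUP[OF p])
    also have "\<dots> = (SUP n. \<integral>\<^sup>+i. epowr (\<Sum>k\<in>F n. d k i) p \<partial>count_space I)"
    proof (rule nn_integral_monotone_convergence_SUP)
      show "incseq (\<lambda>n i. epowr (\<Sum>k\<in>F n. d k i) p)"
        unfolding incseq_def le_fun_def using F(1) p incseqD[OF F(3)]
        by (intro allI impI epowr_mono sum_mono2) auto
    qed simp
    also have "\<dots> \<le> epowr (\<integral>\<^sup>+k. lq_norm I r (d k) \<partial>count_space K) p"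
    proof (rule SUP_least)
      fix n
      have "lq_norm I r (\<lambda>i. \<Sum>k\<in>F n. d k i) \<le> (\<Sum>k\<in>F n. lq_norm I r (d k))"
        by (rule lq_norm_minkowski_finite[OF F(1) 2])
      also have "\<dots> \<le> (\<integral>\<^sup>+k. lq_norm I r (d k) \<partial>count_space K)"
        by (rule nn_integral_count_space_ge_sum[OF F(1,2)])
      finally show "(\<integral>\<^sup>+i. epowr (\<Sum>k\<in>F n. d k i) p \<partial>count_space I) \<le> epowr (\<integral>\<^sup>+k. lq_norm I r (d k) \<partial>count_space K) p"
        unfolding lq_norm_le_iff[OF r 2(2)] p_def .
    qed
    finally have "lq_norm I r (\<lambda>i. \<integral>\<^sup>+k. d k i \<partial>count_space K) \<le> (\<integral>\<^sup>+k. lq_norm I r (d k) \<partial>count_space K)"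
      unfolding lq_norm_le_iff[OF r 2(2)] p_def .
    then show ?thesis using 2 by (simp add: lq1 min_def)
  next
    case 3
    then have rt: "r \<noteq> \<top>" by auto
    define p where "p = enn2real r"
    have p: "0 < p" using r rt by (simp add: p_def enn2real_positive_iff less_top)
    have p1: "p \<le> 1" using 3 unfolding p_def by (metis enn2real_mono ennreal_1 enn2real_ennreal less_imp_le zero_le_one ennreal_one_less_top)
    have min: "min 1 r = r" using 3 by (simp add: min_def)
    have "(\<integral>\<^sup>+i. epowr (\<integral>\<^sup>+k. d k i \<partial>count_space K) p \<partial>count_space I) \<le> (\<integral>\<^sup>+i. (\<integral>\<^sup>+k. epowr (d k i) p \<partial>count_space K) \<partial>count_space I)"
    proof (rule nn_integral_mono)
      fix i
      have "epowr (\<integral>\<^sup>+k. d k i \<partial>count_space K) p = (SUP n. epowr (\<Sum>k\<in>F n. d k i) p)" by (simp add: S epowr_SUP[OF p])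
      also have "\<dots> \<le> (SUP n. \<Sum>k\<in>F n. epowr (d k i) p)"
        by (intro SUP_mono') (rule epowr_sum_le[OF F(1) p p1])
      finally show "epowr (\<integral>\<^sup>+k. d k i \<partial>count_space K) p \<le> (\<integral>\<^sup>+k. epowr (d k i) p \<partial>count_space K)" by (simp add: S)
    qed
    also have "\<dots> = (\<integral>\<^sup>+k. (\<integral>\<^sup>+i. epowr (d k i) p \<partial>count_space I) \<partial>count_space K)"
      by (rule nn_integral_count_space_nn_integral[OF K]) simp
    also have "\<dots> = (\<integral>\<^sup>+k. epowr (lq_norm I r (d k)) p \<partial>count_space K)"
      by (simp add: epowr_lq_norm[OF r rt] p_def)
    finally show ?thesis
      unfolding lq_norm_le_iff[OF r rt] min
      using p by (simp add: lq_norm_def rt infsum_eq_nn_integral[OF K] epowr_epowr p_def[symmetric])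
  qed
qed

end

section \<open>Boundedness on amalgam spaces\<close>

lemma nn_integral_int_lattice_shift:
  fixes g :: "'a::euclidean_space \<Rightarrow> ennreal"
  assumes "\<kappa> \<in> int_lattice"
  shows "(\<integral>\<^sup>+\<mu>. g (\<kappa> + \<mu>) \<partial>count_space int_lattice) = (\<integral>\<^sup>+\<mu>. g \<mu> \<partial>count_space int_lattice)"
proof (rule nn_integral_bij_count_space)
  show "bij_betw ((+) \<kappa>) int_lattice (int_lattice :: 'a set)"
    by (rule bij_betwI[where g="\<lambda>\<mu>. \<mu> - \<kappa>"]) (auto intro: int_lattice_add int_lattice_diff assms)
qed

lemma finite_int_lattice_ball:
  fixes \<rho> :: real
  assumes \<rho>: "0 \<le> \<rho>"
  shows "finite {\<kappa>::'a::euclidean_space. \<kappa> \<in> int_lattice \<and> norm \<kappa> \<le> \<rho>}" (is "finite ?L")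
proof (rule ccontr)
  assume "infinite ?L"
  obtain N :: nat where N: "(2 * \<rho> + 2) ^ DIM('a) < real N" using reals_Archimedean2 by blast
  obtain F where F: "finite F" "card F = N" "F \<subseteq> ?L" using infinite_arbitrarily_large[OF \<open>infinite ?L\<close>] by blast
  have "real (card F) \<le> (2 * \<rho> + 2) ^ DIM('a)" using F \<rho> by (intro card_lattice_ball) auto
  with N F show False by simp
qed

text \<open>A ball around \<mu> is covered by the cells of \<open>\<kappa> + \<mu>\<close> with
  \<kappa> in a fixed finite set \<Lambda>, whose cardinality is of order \<open>2 ^ k\<close> to
  the power of the dimension. The inner integral is thus bounded by a sum of card \<Lambda> shifted
  sequences, and shifts preserve the norm. The radius has \<open>Suc k\<close> because the
  reproducing kernel lives one scale above the piece.\<close>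

lemma lq_norm_ball_average:
  fixes q :: ennreal
  assumes q: "0 < q"
  shows "\<exists>C>0. \<forall>f k. f \<in> borel_measurable borel \<longrightarrow>
     lq_norm int_lattice q (\<lambda>\<mu>::'a::euclidean_space. epowr (\<integral>\<^sup>+x. (ennreal (norm (f x)))\<^sup>2 *
        indicator (cball \<mu> (2 * 2 ^ Suc k + real DIM('a))) x \<partial>lborel) (1/2)) \<le>
     ennreal (C * 2 powr (real DIM('a) / enn2real (min 2 q) * real k)) * amalgam_norm 2 q f"
proof -
  let ?D = "real DIM('a)"
  note L = countable_int_lattice
  define e where "e = enn2real (min 2 q)"
  have e: "0 < e"
    unfolding e_def using q by (auto simp: enn2real_positive_iff min_def less_top[symmetric])
  \<comment> \<open>With radius \<open>4 * 2 ^ k + D\<close> the counting bound has base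
    \<open>8 * 2 ^ k + 4 * D + 2\<close>, and every term is at most its coefficient times
    \<open>2 ^ k\<close>.\<close>
  define c0 where "c0 = 10 + 4 * ?D"
  have c0: "c0 > 0" by (simp add: c0_def add_pos_nonneg)
  define C where "C = (c0 ^ DIM('a)) powr (1 / e)"
  have C: "C > 0" using c0 by (simp add: C_def)
  have main: "lq_norm int_lattice q (\<lambda>\<mu>::'a. epowr (\<integral>\<^sup>+x. (ennreal (norm (f x)))\<^sup>2 *
        indicator (cball \<mu> (2 * 2 ^ Suc k + ?D)) x \<partial>lborel) (1/2)) \<le>
     ennreal (C * 2 powr (?D / e * real k)) * amalgam_norm 2 q f"
    if fm [measurable]: "f \<in> borel_measurable borel" for f :: "'a \<Rightarrow> complex" and k
  proof -
    let ?\<rho> = "2 * 2 ^ Suc k + ?D"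
    \<comment> \<open>The additional \<open>D\<close> is the norm bound for points of the unit cube:
      cells of other lattice points do not meet the ball.\<close>
    define \<Lambda> where "\<Lambda> = {\<kappa>::'a. \<kappa> \<in> int_lattice \<and> norm \<kappa> \<le> ?\<rho> + ?D}"
    define a where "a \<mu> = (\<integral>\<^sup>+x. (ennreal (norm (f x)))\<^sup>2 * indicator (cball \<mu> ?\<rho>) x \<partial>lborel)" for \<mu>
    define N where "N = amalgam_norm 2 q f"
    have \<rho>0: "0 \<le> ?\<rho> + ?D" by (simp add: add_nonneg_nonneg)
    have fin: "finite \<Lambda>" unfolding \<Lambda>_def by (rule finite_int_lattice_ball[OF \<rho>0])
    have "0 \<in> \<Lambda>" using \<rho>0 by (simp add: \<Lambda>_def int_lattice_0)
    then have card0: "0 < real (card \<Lambda>)" using fin by (auto simp: card_gt_0_iff)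
    have card: "real (card \<Lambda>) \<le> (c0 * 2 ^ k) ^ DIM('a)"
    proof -
      have "real (card \<Lambda>) \<le> (2 * (?\<rho> + ?D) + 2) ^ DIM('a)"
        using fin \<rho>0 by (intro card_lattice_ball) (auto simp: \<Lambda>_def)
      also have "\<dots> \<le> (c0 * 2 ^ k) ^ DIM('a)"
      proof (rule power_mono)
        have "4 * ?D + 2 \<le> (4 * ?D + 2) * 2 ^ k" using mult_left_mono[of 1 "2 ^ k" "4 * ?D + 2"] by simp
        then show "2 * (?\<rho> + ?D) + 2 \<le> c0 * 2 ^ k" by (simp add: c0_def algebra_simps)
      qed (rule add_nonneg_nonneg, use \<rho>0 in simp_all)
      finally show ?thesis .
    qed
    have [measurable]: "cball \<mu> r \<in> sets borel" for \<mu> :: 'a and r by (intro borel_closed) auto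
    have a_le: "a \<mu> \<le> (\<Sum>\<kappa>\<in>\<Lambda>. cell_sq f (\<kappa> + \<mu>))" if \<mu>: "\<mu> \<in> int_lattice" for \<mu>
    proof -
      have "a \<mu> = (\<integral>\<^sup>+\<nu>. (\<integral>\<^sup>+x. (ennreal (norm (f (x + \<nu>))))\<^sup>2 * indicator (cball \<mu> ?\<rho>) (x + \<nu>) * indicator unit_cube x \<partial>lborel) \<partial>count_space int_lattice)"
        unfolding a_def by (rule nn_integral_lattice_cells) measurable
      also have "\<dots> \<le> (\<integral>\<^sup>+\<nu>. cell_sq f \<nu> * indicator ((\<lambda>\<kappa>. \<kappa> + \<mu>) ` \<Lambda>) \<nu> \<partial>count_space int_lattice)"
      proof (rule nn_integral_mono)
        fix \<nu> :: 'a assume "\<nu> \<in> space (count_space int_lattice)"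
        then have \<nu>: "\<nu> \<in> int_lattice" by simp
        show "(\<integral>\<^sup>+x. (ennreal (norm (f (x + \<nu>))))\<^sup>2 * indicator (cball \<mu> ?\<rho>) (x + \<nu>) * indicator unit_cube x \<partial>lborel) \<le>
          cell_sq f \<nu> * indicator ((\<lambda>\<kappa>. \<kappa> + \<mu>) ` \<Lambda>) \<nu>"
        proof (cases "\<nu> - \<mu> \<in> \<Lambda>")
          case True
          then have "\<nu> \<in> (\<lambda>\<kappa>. \<kappa> + \<mu>) ` \<Lambda>" by (intro image_eqI[of _ _ "\<nu> - \<mu>"]) auto
          then show ?thesis unfolding cell_sq_def by (simp, intro nn_integral_mono) (auto simp: indicator_def)
        next
          case False
          have "x + \<nu> \<notin> cball \<mu> ?\<rho>" if "x \<in> unit_cube" for x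
          proof
            assume "x + \<nu> \<in> cball \<mu> ?\<rho>"
            then have "norm (x + \<nu> - \<mu>) \<le> ?\<rho>" by (simp add: dist_norm norm_minus_commute)
            then have "norm (\<nu> - \<mu>) \<le> ?\<rho> + ?D"
              using norm_triangle_ineq4[of "x + \<nu> - \<mu>" x] norm_unit_cube_le[OF that] by (simp add: algebra_simps)
            then show False using False int_lattice_diff[OF \<nu> \<mu>] by (simp add: \<Lambda>_def)
          qed
          then have "(\<integral>\<^sup>+x. (ennreal (norm (f (x + \<nu>))))\<^sup>2 * indicator (cball \<mu> ?\<rho>) (x + \<nu>) * indicator unit_cube x \<partial>lborel) = (\<integral>\<^sup>+x. 0 \<partial>(lborel :: 'a measure))"
            by (intro nn_integral_cong) (auto simp: indicator_def)
          then show ?thesis by simp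
        qed
      qed
      also have "\<dots> = (\<Sum>\<nu>\<in>(\<lambda>\<kappa>. \<kappa> + \<mu>) ` \<Lambda>. cell_sq f \<nu>)"
        using fin \<mu> by (subst nn_integral_count_space'[of "(\<lambda>\<kappa>. \<kappa> + \<mu>) ` \<Lambda>"]) (auto simp: \<Lambda>_def intro: int_lattice_add)
      also have "\<dots> = (\<Sum>\<kappa>\<in>\<Lambda>. cell_sq f (\<kappa> + \<mu>))" by (subst sum.reindex) (auto simp: inj_on_def)
      finally show ?thesis .
    qed
    have "lq_norm int_lattice q (\<lambda>\<mu>. epowr (a \<mu>) (1/2)) \<le> ennreal (real (card \<Lambda>) powr (1 / e)) * N"
    proof (cases "q = \<top>")
      case True
      then have e2: "e = 2" by (simp add: e_def min_def)
      have "epowr (a \<mu>) (1/2) \<le> ennreal (real (card \<Lambda>) powr (1 / e)) * N" if \<mu>: "\<mu> \<in> int_lattice" for \<mu>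
      proof -
        have "cell_sq f (\<kappa> + \<mu>) \<le> N\<^sup>2" if "\<kappa> \<in> \<Lambda>" for \<kappa>
        proof -
          have "\<kappa> + \<mu> \<in> int_lattice" using that \<mu> by (auto simp: \<Lambda>_def intro: int_lattice_add)
          then have "epowr (cell_sq f (\<kappa> + \<mu>)) (1/2) \<le> N" unfolding N_def amalgam_norm_2_eq by (rule le_lq_norm[OF L q])
          then have "(epowr (cell_sq f (\<kappa> + \<mu>)) (1/2))\<^sup>2 \<le> N\<^sup>2" by (rule power_mono) simp
          then show ?thesis by (simp add: epowr_half_power2)
        qed
        then have "(\<Sum>\<kappa>\<in>\<Lambda>. cell_sq f (\<kappa> + \<mu>)) \<le> (\<Sum>\<kappa>\<in>\<Lambda>. N\<^sup>2)" by (rule sum_mono)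
        with a_le[OF \<mu>] have "a \<mu> \<le> ennreal (real (card \<Lambda>)) * N\<^sup>2" by (simp add: ennreal_of_nat_eq_real_of_nat)
        from epowr_mono[OF this, of "1/2"] show ?thesis
          by (simp add: epowr_mult epowr_power2_half epowr_ennreal e2)
      qed
      then show ?thesis using True by (auto simp: lq_norm_top[OF L] intro!: SUP_least)
    next
      case False
      define p where "p = enn2real q"
      have p: "0 < p" "q = ennreal p" using q False by (auto simp: p_def enn2real_positive_iff less_top)
      have ep: "e = min 2 p"
      proof -
        have "min 2 q = ennreal (min 2 p)"
        proof (cases "2 \<le> p")
          case True
          then have "ennreal 2 \<le> ennreal p" by (rule ennreal_leI)
          then show ?thesis unfolding p(2) using True by (simp add: min_def)
        next
          case False
          then have "\<not> ennreal 2 \<le> ennreal p" using p(1) by (simp del: ennreal_numeral)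
          then show ?thesis unfolding p(2) using False by (simp add: min_def)
        qed
        then show ?thesis using p by (simp add: e_def)
      qed
      define s where "s = p / 2"
      have s: "0 < s" using p by (simp add: s_def)
      \<comment> \<open>The exponent \<open>max s 1 - 1\<close> joins two regimes: Jensen's
        inequality for s \<ge> 1, and subadditivity with factor 1 for s \<le> 1.\<close>
      have sum_le: "epowr (\<Sum>\<kappa>\<in>\<Lambda>. g \<kappa>) s \<le> ennreal (real (card \<Lambda>) powr (max s 1 - 1)) * (\<Sum>\<kappa>\<in>\<Lambda>. epowr (g \<kappa>) s)" for g :: "'a \<Rightarrow> ennreal"
      proof (cases "1 \<le> s")
        case True
        then show ?thesis using epowr_sum_le_card[OF fin True, of g] by (simp add: max_def)
      next
        case False
        then show ?thesis using epowr_sum_le[OF fin s, of g] card0 by (simp add: max_def)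
      qed
      have "(\<integral>\<^sup>+\<mu>. epowr (epowr (a \<mu>) (1/2)) p \<partial>count_space int_lattice) \<le>
          (\<integral>\<^sup>+\<mu>. ennreal (real (card \<Lambda>) powr (max s 1 - 1)) * (\<Sum>\<kappa>\<in>\<Lambda>. epowr (cell_sq f (\<kappa> + \<mu>)) s) \<partial>count_space int_lattice)"
      proof (rule nn_integral_mono)
        fix \<mu> assume "\<mu> \<in> space (count_space (int_lattice :: 'a set))"
        then have \<mu>: "\<mu> \<in> int_lattice" by simp
        have "epowr (epowr (a \<mu>) (1/2)) p = epowr (a \<mu>) s" by (simp add: epowr_epowr s_def)
        also have "\<dots> \<le> epowr (\<Sum>\<kappa>\<in>\<Lambda>. cell_sq f (\<kappa> + \<mu>)) s" using s by (intro epowr_mono a_le \<mu>) auto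
        also note sum_le
        finally show "epowr (epowr (a \<mu>) (1/2)) p \<le> ennreal (real (card \<Lambda>) powr (max s 1 - 1)) * (\<Sum>\<kappa>\<in>\<Lambda>. epowr (cell_sq f (\<kappa> + \<mu>)) s)" .
      qed
      also have "\<dots> = ennreal (real (card \<Lambda>) powr (max s 1 - 1)) * (\<Sum>\<kappa>\<in>\<Lambda>. \<integral>\<^sup>+\<mu>. epowr (cell_sq f (\<kappa> + \<mu>)) s \<partial>count_space int_lattice)"
        by (simp add: nn_integral_cmult nn_integral_sum)
      also have "(\<Sum>\<kappa>\<in>\<Lambda>. \<integral>\<^sup>+\<mu>. epowr (cell_sq f (\<kappa> + \<mu>)) s \<partial>count_space int_lattice) = (\<Sum>\<kappa>\<in>\<Lambda>. epowr N p)"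
      proof (rule sum.cong[OF refl])
        fix \<kappa> assume "\<kappa> \<in> \<Lambda>"
        then have "(\<integral>\<^sup>+\<mu>. epowr (cell_sq f (\<kappa> + \<mu>)) s \<partial>count_space int_lattice) = (\<integral>\<^sup>+\<mu>. epowr (cell_sq f \<mu>) s \<partial>count_space int_lattice)"
          by (intro nn_integral_int_lattice_shift[where g="\<lambda>\<mu>. epowr (cell_sq f \<mu>) s"]) (simp add: \<Lambda>_def)
        also have "\<dots> = epowr N p"
          unfolding N_def amalgam_norm_2_eq p_def epowr_lq_norm[OF L q False] epowr_epowr s_def by simp
        finally show "(\<integral>\<^sup>+\<mu>. epowr (cell_sq f (\<kappa> + \<mu>)) s \<partial>count_space int_lattice) = epowr N p" .
      qed
      also have "ennreal (real (card \<Lambda>) powr (max s 1 - 1)) * (\<Sum>\<kappa>\<in>\<Lambda>. epowr N p) = ennreal (real (card \<Lambda>) powr max s 1) * epowr N p"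
      proof -
        have "real (card \<Lambda>) powr (max s 1 - 1) * real (card \<Lambda>) = real (card \<Lambda>) powr max s 1"
          using card0 by (simp add: powr_diff)
        then have "ennreal (real (card \<Lambda>) powr (max s 1 - 1)) * ennreal (real (card \<Lambda>)) = ennreal (real (card \<Lambda>) powr max s 1)"
          by (simp add: ennreal_mult[symmetric])
        then show ?thesis by (simp add: ennreal_of_nat_eq_real_of_nat mult.assoc[symmetric])
      qed
      also have "\<dots> = epowr (ennreal (real (card \<Lambda>) powr (1 / e)) * N) p"
      proof -
        \<comment> \<open>Here the minimum of 2 and \<open>q\<close> arises: max (q/2) 1 divided by
          \<open>q\<close> is the reciprocal of min 2 q.\<close>
        have "1 / e * p = max s 1" using p by (simp add: ep s_def min_def max_def)
        then show ?thesis by (simp add: epowr_mult epowr_ennreal powr_powr)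
      qed
      finally show ?thesis unfolding lq_norm_le_iff[OF L q False] p_def .
    qed
    also have "\<dots> \<le> ennreal (C * 2 powr (?D / e * real k)) * N"
    proof (intro mult_right_mono ennreal_leI)
      have "real (card \<Lambda>) powr (1 / e) \<le> ((c0 * 2 ^ k) ^ DIM('a)) powr (1 / e)"
        using card e by (intro powr_mono2) auto
      also have "\<dots> = C * (2 ^ (k * DIM('a))) powr (1 / e)"
        using c0 by (simp add: C_def power_mult_distrib powr_mult power_mult)
      also have "(2 ^ (k * DIM('a))) powr (1 / e) = 2 powr (?D / e * real k)"
        by (simp add: powr_realpow[symmetric] powr_powr mult.commute)
      finally show "real (card \<Lambda>) powr (1 / e) \<le> C * 2 powr (?D / e * real k)" .
    qed simp
    finally show ?thesis by (simp add: a_def N_def)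
  qed
  show ?thesis unfolding e_def[symmetric] using C main by blast
qed

section \<open>The operator on Borel representatives and its pairing with a function on a
  cell\<close>

lemma borel_measurable_lebesgue_cong_AE:
  fixes g g' :: "'a::euclidean_space \<Rightarrow> complex"
  assumes g': "g' \<in> borel_measurable borel" and ae: "AE x in lborel. g x = g' x"
  shows "g \<in> borel_measurable lebesgue"
proof (rule measurableI)
  fix A :: "complex set" assume A: "A \<in> sets borel"
  obtain N where N: "N \<in> null_sets lborel" "{x. g x \<noteq> g' x} \<subseteq> N"
    using ae by (auto elim!: AE_E simp: null_sets_def)
  have "g' -` A \<in> sets lebesgue" using measurable_sets[OF measurable_completion[of g' lborel borel], of A] g' A by simp
  moreover have "{x. g x \<noteq> g' x} \<in> null_sets lebesgue"
    using N null_sets_completion_subset null_sets_completionI by blast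
  then have n: "B \<in> sets lebesgue" if "B \<subseteq> {x. g x \<noteq> g' x}" for B
    using null_sets_completion_subset[OF that] by (auto simp: null_sets_def)
  moreover have "g -` A \<inter> space lebesgue = (g' -` A - (g' -` A \<inter> {x. g x \<noteq> g' x})) \<union> (g -` A \<inter> {x. g x \<noteq> g' x})"
    by auto
  ultimately show "g -` A \<inter> space lebesgue \<in> sets lebesgue"
    by (metis (no_types, lifting) inf_le2 sets.Diff sets.Un)
qed simp

text \<open>Almost every section of a null set of phase space is null. Hence for almost every
  \<open>x\<close> the integral over the frequencies does not see the change of
  representative.\<close>

lemma T_op_borel_version:
  fixes f :: "'N::finite \<Rightarrow> real^'n \<Rightarrow> complex" and \<sigma> \<sigma>' :: "(real^'n) \<times> (real^'n^'N) \<Rightarrow> complex"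
  assumes [measurable]: "\<sigma>' \<in> borel_measurable borel" and bdd: "\<And>z. norm (\<sigma>' z) \<le> M"
    and ae: "AE z in lborel. \<sigma> z = \<sigma>' z"
    and Fm: "\<And>j. fourier (f j) \<in> borel_measurable borel" and Fi: "\<And>j. integrable lborel (fourier (f j))"
  shows "T_op \<sigma>' f \<in> borel_measurable borel"
    and "\<exists>B. \<forall>x. norm (T_op \<sigma>' f x) \<le> B"
    and "AE x in lborel. T_op \<sigma> f x = T_op \<sigma>' f x"
proof -
  note Fm[measurable]
  let ?c = "1 / complex_of_real ((2 * pi) ^ (CARD('N) * CARD('n)))"
  let ?P = "\<lambda>\<xi>::real^'n^'N. \<Prod>j\<in>UNIV. fourier (f j) (\<xi> $ j)"
  have P: "integrable lborel ?P" by (rule integrable_vec_prod) (rule Fi)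
  have T: "T_op \<sigma>' f x = ?c * (\<integral>\<xi>. cis (x \<bullet> (\<Sum>j\<in>UNIV. \<xi> $ j)) * \<sigma>' (x, \<xi>) * ?P \<xi> \<partial>lborel)" for x
    unfolding T_op_def by (subst integral_completion) auto
  show "T_op \<sigma>' f \<in> borel_measurable borel"
    unfolding T[abs_def] by measurable
  have "norm (T_op \<sigma>' f x) \<le> norm ?c * (M * (\<integral>\<xi>. norm (?P \<xi>) \<partial>lborel))" for x
  proof -
    have "norm (\<integral>\<xi>. cis (x \<bullet> (\<Sum>j\<in>UNIV. \<xi> $ j)) * \<sigma>' (x, \<xi>) * ?P \<xi> \<partial>lborel) \<le>
        (\<integral>\<xi>. norm (cis (x \<bullet> (\<Sum>j\<in>UNIV. \<xi> $ j)) * \<sigma>' (x, \<xi>) * ?P \<xi>) \<partial>lborel)"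
      by (rule integral_norm_bound)
    also have "\<dots> \<le> (\<integral>\<xi>. M * norm (?P \<xi>) \<partial>lborel)"
    proof (rule integral_mono)
      show "integrable lborel (\<lambda>\<xi>. norm (cis (x \<bullet> (\<Sum>j\<in>UNIV. \<xi> $ j)) * \<sigma>' (x, \<xi>) * ?P \<xi>))"
        by (intro integrable_norm integrable_bounded_mult[OF _ _ P, of _ M]) (auto simp: norm_mult bdd)
      show "integrable lborel (\<lambda>\<xi>. M * norm (?P \<xi>))" using P by (intro integrable_mult_right integrable_norm)
    qed (auto simp: norm_mult intro!: mult_right_mono bdd)
    finally show ?thesis unfolding T norm_mult by (intro mult_left_mono) auto
  qed
  then show "\<exists>B. \<forall>x. norm (T_op \<sigma>' f x) \<le> B" by blast
  have "AE z in lborel \<Otimes>\<^sub>M lborel. \<sigma> z = \<sigma>' z" unfolding lborel_prod by (rule ae)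
  then have "AE x in lborel. AE \<xi> in lborel. \<sigma> (x, \<xi>) = \<sigma>' (x, \<xi>)" by (rule lborel_pair.AE_pair)
  then show "AE x in lborel. T_op \<sigma> f x = T_op \<sigma>' f x"
  proof eventually_elim
    case (elim x)
    have ae': "AE \<xi> in lborel. cis (x \<bullet> (\<Sum>j\<in>UNIV. \<xi> $ j)) * \<sigma> (x, \<xi>) * ?P \<xi> = cis (x \<bullet> (\<Sum>j\<in>UNIV. \<xi> $ j)) * \<sigma>' (x, \<xi>) * ?P \<xi>"
      using elim by eventually_elim simp
    have b: "(\<lambda>\<xi>. cis (x \<bullet> (\<Sum>j\<in>UNIV. \<xi> $ j)) * \<sigma>' (x, \<xi>) * ?P \<xi>) \<in> borel_measurable borel" by measurable
    have "(\<integral>\<xi>. cis (x \<bullet> (\<Sum>j\<in>UNIV. \<xi> $ j)) * \<sigma> (x, \<xi>) * ?P \<xi> \<partial>lebesgue) = (\<integral>\<xi>. cis (x \<bullet> (\<Sum>j\<in>UNIV. \<xi> $ j)) * \<sigma>' (x, \<xi>) * ?P \<xi> \<partial>lebesgue)"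
      using ae' b by (intro integral_cong_AE borel_measurable_lebesgue_cong_AE[OF b ae'])
        (auto simp: AE_completion_iff intro: measurable_completion)
    then show ?case unfolding T_op_def by simp
  qed
qed

lemma T_op_pairing:
  fixes f :: "'N::finite \<Rightarrow> real^'n \<Rightarrow> complex" and \<sigma> :: "(real^'n) \<times> (real^'n^'N) \<Rightarrow> complex"
  assumes [measurable]: "\<sigma> \<in> borel_measurable borel" and bdd: "\<And>z. norm (\<sigma> z) \<le> M"
    and Fi: "\<And>j. integrable lborel (fourier (f j))" and h: "integrable lborel h"
  shows "(\<integral>x. h x * T_op \<sigma> f x \<partial>lborel) =
    1 / of_real ((2 * pi) ^ (CARD('N) * CARD('n))) * (\<integral>z. \<sigma> z * test_fun h (\<lambda>j. fourier (f j)) z \<partial>lborel)"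
proof -
  have [measurable]: "fourier (f j) \<in> borel_measurable borel" for j using Fi[of j] by auto
  let ?c = "1 / complex_of_real ((2 * pi) ^ (CARD('N) * CARD('n)))"
  let ?P = "\<lambda>\<xi>::real^'n^'N. \<Prod>j\<in>UNIV. fourier (f j) (\<xi> $ j)"
  let ?G = "test_fun h (\<lambda>j. fourier (f j))"
  have T: "T_op \<sigma> f x = ?c * (\<integral>\<xi>. cis (x \<bullet> (\<Sum>j\<in>UNIV. \<xi> $ j)) * \<sigma> (x, \<xi>) * ?P \<xi> \<partial>lborel)" for x
    unfolding T_op_def by (subst integral_completion) auto
  have "integrable lborel (\<lambda>z. \<sigma> z * ?G z)"
    by (rule integrable_bounded_mult[OF _ bdd test_fun_integrable[OF h Fi]]) measurable
  then have int: "integrable (lborel \<Otimes>\<^sub>M lborel) (\<lambda>z. \<sigma> z * ?G z)" by (simp add: lborel_prod)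
  have "(\<integral>z. \<sigma> z * ?G z \<partial>lborel) = (\<integral>x. (\<integral>\<xi>. \<sigma> (x, \<xi>) * ?G (x, \<xi>) \<partial>lborel) \<partial>lborel)"
    using lborel_pair.integral_fst'[OF int] by (simp add: lborel_prod)
  also have "\<dots> = (\<integral>x. h x * (\<integral>\<xi>. cis (x \<bullet> (\<Sum>j\<in>UNIV. \<xi> $ j)) * \<sigma> (x, \<xi>) * ?P \<xi> \<partial>lborel) \<partial>lborel)"
    unfolding integral_mult_right_zero[symmetric] by (simp add: test_fun_def mult_ac)
  finally have "?c * (\<integral>z. \<sigma> z * ?G z \<partial>lborel) = (\<integral>x. ?c * (h x * (\<integral>\<xi>. cis (x \<bullet> (\<Sum>j\<in>UNIV. \<xi> $ j)) * \<sigma> (x, \<xi>) * ?P \<xi> \<partial>lborel)) \<partial>lborel)"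
    by (simp only: integral_mult_right_zero)
  also have "\<dots> = (\<integral>x. h x * T_op \<sigma> f x \<partial>lborel)"
    unfolding T by (simp only: mult_ac)
  finally show ?thesis by simp
qed

text \<open>Duality with an explicit extremizer. For \<open>h\<close> the conjugate of the output
  cut to the cell, the pairing is the square of the local norm \<open>e\<close>, while each piece of
  the symbol contributes a term that is linear in \<open>e\<close>; dividing by \<open>e\<close>
  leaves the bound.\<close>

lemma T_op_cell_bound:
  fixes W :: "real^'n^'N \<Rightarrow> real" and \<phi> :: "real^'n \<Rightarrow> complex"
  assumes \<phi>: "lp_cutoff \<phi>" and WM: "W \<in> class_M" and WB: "W \<in> class_B"
  shows "\<exists>C>0. \<forall>\<sigma> M f \<mu>. \<sigma> \<in> borel_measurable borel \<longrightarrow> (\<forall>z. norm (\<sigma> z) \<le> M) \<longrightarrow> (\<forall>j. f j \<in> schwartz) \<longrightarrow>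
    epowr (cell_sq (T_op \<sigma> f) \<mu>) (1/2) \<le>
    (\<integral>\<^sup>+(k0, k). (ennreal (C * sqrt ((2 ^ Suc k0) ^ CARD('n))) *
        L2ul_norm (\<lambda>(x, \<xi>). of_real (inverse (W \<xi>)) * conv (piece_kernel \<phi> k0 k) \<sigma> (x, \<xi>))) *
        (\<Prod>j\<in>UNIV. epowr (\<integral>\<^sup>+x. (ennreal (norm (f j x)))\<^sup>2 *
          indicator (cball \<mu> (2 * 2 ^ Suc (k j) + real CARD('n))) x \<partial>lborel) (1/2)) \<partial>count_space UNIV)"
proof -
  obtain C where C: "C > 0" and loc: "\<And>k0 k \<mu> h M (u :: (real^'n) \<times> (real^'n^'N) \<Rightarrow> complex) Mu f. h \<in> borel_measurable borel \<Longrightarrow> (\<forall>x. norm (h x) \<le> M) \<Longrightarrow>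
     (\<forall>x. x - \<mu> \<notin> unit_cube \<longrightarrow> h x = 0) \<Longrightarrow> u \<in> borel_measurable borel \<Longrightarrow> (\<forall>z. norm (u z) \<le> Mu) \<Longrightarrow>
     (\<forall>z. conv (dil_kernel \<phi> k0 k) u z = u z) \<Longrightarrow>
     (\<forall>j. integrable lborel (f j)) \<Longrightarrow> (\<forall>j. integrable lborel (fourier (f j))) \<Longrightarrow>
     ennreal (norm (\<integral>z. u z * test_fun h (\<lambda>j. fourier (f j)) z \<partial>lborel))
      \<le> ennreal (C * sqrt ((2 ^ k0) ^ CARD('n))) * L2ul_norm (\<lambda>(x, \<xi>). of_real (inverse (W \<xi>)) * u (x, \<xi>)) *
        epowr (\<integral>\<^sup>+x. (ennreal (norm (h x)))\<^sup>2 \<partial>lborel) (1/2) *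
        (\<Prod>j\<in>UNIV. epowr (\<integral>\<^sup>+x. (ennreal (norm (f j x)))\<^sup>2 * indicator (cball \<mu> (2 * 2 ^ k j + real CARD('n))) x \<partial>lborel) (1/2))"
    using test_fun_pairing_estimate[OF \<phi> WM WB] by blast
  \<comment> \<open>The normalization of the operator, which enters when the pairing is written as
    an integral over phase space.\<close>
  define c1 where "c1 = 1 / (2 * pi) ^ (CARD('N) * CARD('n))"
  have c1: "c1 > 0" by (simp add: c1_def)
  have main: "epowr (cell_sq (T_op \<sigma> f) \<mu>) (1/2) \<le>
    (\<integral>\<^sup>+(k0, k). (ennreal ((c1 * C) * sqrt ((2 ^ Suc k0) ^ CARD('n))) *
        L2ul_norm (\<lambda>(x, \<xi>). of_real (inverse (W \<xi>)) * conv (piece_kernel \<phi> k0 k) \<sigma> (x, \<xi>))) *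
        (\<Prod>j\<in>UNIV. epowr (\<integral>\<^sup>+x. (ennreal (norm (f j x)))\<^sup>2 *
          indicator (cball \<mu> (2 * 2 ^ Suc (k j) + real CARD('n))) x \<partial>lborel) (1/2)) \<partial>count_space UNIV)"
    if \<sigma> [measurable]: "\<sigma> \<in> borel_measurable borel" and bdd: "\<And>z. norm (\<sigma> z) \<le> M" and f: "\<And>j. f j \<in> schwartz"
    for \<sigma> :: "(real^'n) \<times> (real^'n^'N) \<Rightarrow> complex" and M f \<mu>
  proof -
    have fi: "integrable lborel (f j)" for j by (rule schwartz_integrable[OF f])
    have Fi: "integrable lborel (fourier (f j))" for j by (rule fourier_schwartz_integrable[OF f])
    have Fm: "fourier (f j) \<in> borel_measurable borel" for j using Fi[of j] by auto
    note T = T_op_borel_version[where f = f and \<sigma> = \<sigma> and \<sigma>' = \<sigma>, OF \<sigma> bdd AE_I2[OF refl] Fm Fi]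
    have Tm [measurable]: "T_op \<sigma> f \<in> borel_measurable borel" by (rule T(1))
    obtain B where B: "\<And>x. norm (T_op \<sigma> f x) \<le> B" using T(2) by blast
    define h where "h x = cnj (T_op \<sigma> f x) * indicator unit_cube (x - \<mu>)" for x
    have hm [measurable]: "h \<in> borel_measurable borel" unfolding h_def by measurable
    have hb: "norm (h x) \<le> B" for x
      using B[of x] order_trans[OF norm_ge_zero B] by (auto simp: h_def norm_mult indicator_def)
    have hs: "h x = 0" if "x - \<mu> \<notin> unit_cube" for x using that by (simp add: h_def)
    have hi: "integrable lborel h" by (rule integrable_if_supported_on_cell[OF hm hb hs])
    define H where "H = (\<integral>x. (norm (h x))\<^sup>2 \<partial>lborel)"
    have h2: "integrable lborel (\<lambda>x. (norm (h x))\<^sup>2)"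
      by (rule integrable_if_supported_on_cell[where M="B\<^sup>2" and \<mu>=\<mu>]) (auto simp: hs intro!: power_mono hb)
    have H0: "0 \<le> H" by (simp add: H_def)
    have HH: "(\<integral>\<^sup>+x. (ennreal (norm (h x)))\<^sup>2 \<partial>lborel) = ennreal H"
      unfolding H_def by (simp add: ennreal_power nn_integral_eq_integral[OF h2])
    have cell: "cell_sq (T_op \<sigma> f) \<mu> = ennreal H"
    proof -
      have "cell_sq (T_op \<sigma> f) \<mu> = (\<integral>\<^sup>+x. (ennreal (norm (h (x + \<mu>))))\<^sup>2 \<partial>lborel)"
        unfolding cell_sq_def by (intro nn_integral_cong) (auto simp: h_def indicator_def)
      also have "\<dots> = (\<integral>\<^sup>+x. (ennreal (norm (h x)))\<^sup>2 \<partial>lborel)"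
        by (rule nn_integral_lborel_shift) measurable
      finally show ?thesis by (simp add: HH)
    qed
    let ?G = "test_fun h (\<lambda>j. fourier (f j))"
    have G: "integrable lborel ?G" by (rule test_fun_integrable[OF hi Fi])
    have "complex_of_real H = (\<integral>x. h x * T_op \<sigma> f x \<partial>lborel)"
    proof -
      have "h x * T_op \<sigma> f x = complex_of_real ((norm (h x))\<^sup>2)" for x
        unfolding complex_norm_square by (auto simp: h_def indicator_def)
      then show ?thesis by (simp only: H_def integral_complex_of_real)
    qed
    also have "\<dots> = complex_of_real c1 * (\<integral>z. \<sigma> z * ?G z \<partial>lborel)"
      unfolding T_op_pairing[OF \<sigma> bdd Fi hi] by (simp add: c1_def)
    finally have Heq: "complex_of_real H = complex_of_real c1 * (\<integral>z. \<sigma> z * ?G z \<partial>lborel)" .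
    \<comment> \<open>Finite because the output is bounded for Schwartz \<open>f\<close>; finiteness
      is what makes the later cancellation legitimate.\<close>
    define e where "e = epowr (ennreal H) (1/2)"
    have e: "e * e = ennreal H" using epowr_half_power2[of "ennreal H"] by (simp add: e_def power2_eq_square)
    have efin: "e < \<top>" unfolding e_def using H0 by (simp add: epowr_ennreal)
    define t where "t = (\<lambda>(k0, k :: 'N \<Rightarrow> nat). (ennreal (C * sqrt ((2 ^ Suc k0) ^ CARD('n))) *
        L2ul_norm (\<lambda>(x, \<xi>). of_real (inverse (W \<xi>)) * conv (piece_kernel \<phi> k0 k) \<sigma> (x, \<xi>))) *
        (\<Prod>j\<in>UNIV. epowr (\<integral>\<^sup>+x. (ennreal (norm (f j x)))\<^sup>2 *
          indicator (cball \<mu> (2 * 2 ^ Suc (k j) + real CARD('n))) x \<partial>lborel) (1/2)))"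
    have [measurable]: "piece_kernel \<phi> k0 k \<in> borel_measurable borel" for k0 and k :: "'N \<Rightarrow> nat"
      using borel_measurable_integrable[OF piece_kernel_integrable[OF \<phi>]] by simp
    have piece: "ennreal (norm (\<integral>z. conv (piece_kernel \<phi> k0 k) \<sigma> z * ?G z \<partial>lborel)) \<le> t (k0, k) * e" for k0 k
    proof -
      have "ennreal (norm (\<integral>z. conv (piece_kernel \<phi> k0 k) \<sigma> z * ?G z \<partial>lborel)) \<le>
        ennreal (C * sqrt ((2 ^ Suc k0) ^ CARD('n))) * L2ul_norm (\<lambda>(x, \<xi>). of_real (inverse (W \<xi>)) * conv (piece_kernel \<phi> k0 k) \<sigma> (x, \<xi>)) *
        epowr (\<integral>\<^sup>+x. (ennreal (norm (h x)))\<^sup>2 \<partial>lborel) (1/2) *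
        (\<Prod>j\<in>UNIV. epowr (\<integral>\<^sup>+x. (ennreal (norm (f j x)))\<^sup>2 * indicator (cball \<mu> (2 * 2 ^ Suc (k j) + real CARD('n))) x \<partial>lborel) (1/2))"
      proof (rule loc[where M=B and Mu="(\<integral>x. norm (piece_kernel \<phi> k0 k x) \<partial>lborel) * M"])
        show "\<forall>z. norm (conv (piece_kernel \<phi> k0 k) \<sigma> z) \<le> (\<integral>x. norm (piece_kernel \<phi> k0 k x) \<partial>lborel) * M"
          by (intro allI conv_bounded[OF piece_kernel_integrable[OF \<phi>] \<sigma> bdd])
        show "\<forall>z. conv (dil_kernel \<phi> (Suc k0) (\<lambda>j. Suc (k j))) (conv (piece_kernel \<phi> k0 k) \<sigma>) z = conv (piece_kernel \<phi> k0 k) \<sigma> z"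
          by (intro allI conv_piece_kernel_reproducing[OF \<phi> \<sigma> bdd])
        show "\<forall>x. norm (h x) \<le> B" using hb by blast
        show "\<forall>x. x - \<mu> \<notin> unit_cube \<longrightarrow> h x = 0" using hs by blast
        show "\<forall>j. integrable lborel (f j)" "\<forall>j. integrable lborel (fourier (f j))" using fi Fi by blast+
      qed measurable
      then show ?thesis unfolding HH e_def[symmetric] by (simp add: t_def mult_ac)
    qed
    define I where "I k0 k = (\<integral>z. conv (piece_kernel \<phi> k0 k) \<sigma> z * ?G z \<partial>lborel)" for k0 k
    have lim: "(\<lambda>K. \<Sum>k0\<le>K. \<Sum>k\<in>PiE UNIV (\<lambda>_. {..K}). I k0 k) \<longlonglongrightarrow> (\<integral>z. \<sigma> z * ?G z \<partial>lborel)"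
      unfolding I_def by (rule tendsto_sum_pieces[OF \<phi> \<sigma> bdd G])
    \<comment> \<open>The bound by the full sum holds for each partial sum over a box of indices and
      therefore for the weak limit.\<close>
    have "ennreal (norm (\<integral>z. \<sigma> z * ?G z \<partial>lborel)) \<le> (\<integral>\<^sup>+p. t p \<partial>count_space UNIV) * e"
    proof (rule LIMSEQ_le_const2[OF tendsto_ennrealI[OF tendsto_norm[OF lim]]], intro exI allI impI)
      fix K :: nat
      let ?S = "{..K} \<times> PiE (UNIV :: 'N set) (\<lambda>_. {..K})"
      have fin: "finite ?S" by (intro finite_cartesian_product finite_PiE) auto
      have "norm (\<Sum>k0\<le>K. \<Sum>k\<in>PiE UNIV (\<lambda>_. {..K}). I k0 k) = norm (\<Sum>p\<in>?S. I (fst p) (snd p))"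
        by (simp add: sum.cartesian_product case_prod_unfold)
      also have "ennreal \<dots> \<le> ennreal (\<Sum>p\<in>?S. norm (I (fst p) (snd p)))"
        by (intro ennreal_leI norm_sum)
      also have "\<dots> = (\<Sum>p\<in>?S. ennreal (norm (I (fst p) (snd p))))" by (simp add: sum_ennreal)
      also have "\<dots> \<le> (\<Sum>p\<in>?S. t p * e)"
        using piece by (intro sum_mono) (auto simp: I_def)
      also have "\<dots> = (\<Sum>p\<in>?S. t p) * e" by (simp add: sum_distrib_right)
      also have "\<dots> \<le> (\<integral>\<^sup>+p. t p \<partial>count_space UNIV) * e"
        by (intro mult_right_mono nn_integral_count_space_ge_sum fin) auto
      finally show "ennreal (norm (\<Sum>k0\<le>K. \<Sum>k\<in>PiE UNIV (\<lambda>_. {..K}). I k0 k)) \<le> (\<integral>\<^sup>+p. t p \<partial>count_space UNIV) * e" .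
    qed
    then have "ennreal c1 * ennreal (norm (\<integral>z. \<sigma> z * ?G z \<partial>lborel)) \<le> ennreal c1 * ((\<integral>\<^sup>+p. t p \<partial>count_space UNIV) * e)"
      by (rule mult_left_mono) simp
    moreover have "ennreal c1 * ennreal (norm (\<integral>z. \<sigma> z * ?G z \<partial>lborel)) = ennreal H"
    proof -
      have "norm (complex_of_real H) = c1 * norm (\<integral>z. \<sigma> z * ?G z \<partial>lborel)"
        unfolding Heq norm_mult using c1 by simp
      then show ?thesis using H0 c1 by (simp add: ennreal_mult[symmetric])
    qed
    ultimately have "ennreal H \<le> ennreal c1 * ((\<integral>\<^sup>+p. t p \<partial>count_space UNIV) * e)" by (rule subst[rotated])
    then have ee: "e * e \<le> e * (ennreal c1 * (\<integral>\<^sup>+p. t p \<partial>count_space UNIV))" unfolding e by (simp only: mult_ac)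
    have "e \<le> ennreal c1 * (\<integral>\<^sup>+p. t p \<partial>count_space UNIV)"
    proof (cases "e = 0")
      case True
      show ?thesis unfolding True by (rule zero_le)
    next
      case False
      show ?thesis using ee unfolding ennreal_mult_le_mult_iff[OF False less_imp_neq[OF efin]] .
    qed
    also have "\<dots> = (\<integral>\<^sup>+p. ennreal c1 * t p \<partial>count_space UNIV)" by (rule nn_integral_cmult[symmetric]) simp
    also have "\<dots> = (\<integral>\<^sup>+(k0, k). (ennreal ((c1 * C) * sqrt ((2 ^ Suc k0) ^ CARD('n))) *
        L2ul_norm (\<lambda>(x, \<xi>). of_real (inverse (W \<xi>)) * conv (piece_kernel \<phi> k0 k) \<sigma> (x, \<xi>))) *
        (\<Prod>j\<in>UNIV. epowr (\<integral>\<^sup>+x. (ennreal (norm (f j x)))\<^sup>2 *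
          indicator (cball \<mu> (2 * 2 ^ Suc (k j) + real CARD('n))) x \<partial>lborel) (1/2)) \<partial>count_space UNIV)"
    proof (rule nn_integral_cong, clarify)
      fix k0 :: nat and k :: "'N \<Rightarrow> nat"
      have "ennreal ((c1 * C) * sqrt ((2 ^ Suc k0) ^ CARD('n))) = ennreal c1 * ennreal (C * sqrt ((2 ^ Suc k0) ^ CARD('n)))"
        using c1 C by (simp add: ennreal_mult[symmetric] mult.assoc)
      then show "ennreal c1 * t (k0, k) = (ennreal ((c1 * C) * sqrt ((2 ^ Suc k0) ^ CARD('n))) *
        L2ul_norm (\<lambda>(x, \<xi>). of_real (inverse (W \<xi>)) * conv (piece_kernel \<phi> k0 k) \<sigma> (x, \<xi>))) *
        (\<Prod>j\<in>UNIV. epowr (\<integral>\<^sup>+x. (ennreal (norm (f j x)))\<^sup>2 *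
          indicator (cball \<mu> (2 * 2 ^ Suc (k j) + real CARD('n))) x \<partial>lborel) (1/2))"
        unfolding t_def prod.case by (simp only: mult.assoc)
    qed
    finally show ?thesis unfolding cell e_def[symmetric] .
  qed
  show ?thesis
    by (intro exI[of _ "c1 * C"] conjI mult_pos_pos c1 C allI impI, rule main; blast)
qed

section \<open>Summation over the pieces of the symbol and the cells\<close>

theorem theorem5p3:
  fixes W :: "real^'n^'N \<Rightarrow> real"
    and q :: "'N \<Rightarrow> ennreal" and r :: ennreal
    and s0 :: real and s :: "'N \<Rightarrow> real"
    and \<phi> :: "real^'n \<Rightarrow> complex"
    and \<sigma> :: "(real^'n) \<times> (real^'n^'N) \<Rightarrow> complex"
  assumes "W \<in> class_M" and "W \<in> class_B"
    and "\<And>j. 0 < q j" and "0 < r"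
    and "(\<Sum>j\<in>UNIV. 1 / q j) = 1 / r"
    and "s0 = real CARD('n) / 2"
    and "\<And>j. s j = real CARD('n) / enn2real (min 2 (q j))"
    and "lp_cutoff \<phi>"
    and "\<sigma> \<in> symbol_class \<phi> W s0 s (min 1 r)"
  shows "bounded_on_amalgams (T_op \<sigma>) (\<lambda>_. 2) q 2 r"
proof -
  note q = assms(3) and r = assms(4) and qr = assms(5) and \<phi> = assms(8)
  note L = countable_int_lattice
  have \<sigma>: "\<sigma> \<in> L_infty" and symfin: "symbol_norm \<phi> W s0 s (min 1 r) \<sigma> < \<top>"
    using assms(9) by (auto simp: symbol_class_def)
  obtain \<sigma>' M where \<sigma>'m: "\<sigma>' \<in> borel_measurable borel" and \<sigma>'b: "\<And>z. norm (\<sigma>' z) \<le> M"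
    and ae: "AE z in lborel. \<sigma> z = \<sigma>' z" using L_infty_borel_version[OF \<sigma>] by blast
  obtain C where C: "C > 0" and cell: "\<And>\<sigma> M f \<mu>. \<sigma> \<in> borel_measurable borel \<Longrightarrow> (\<forall>z. norm (\<sigma> z) \<le> M) \<Longrightarrow> (\<forall>j. f j \<in> schwartz) \<Longrightarrow>
    epowr (cell_sq (T_op \<sigma> f) \<mu>) (1/2) \<le>
    (\<integral>\<^sup>+(k0, k). (ennreal (C * sqrt ((2 ^ Suc k0) ^ CARD('n))) *
        L2ul_norm (\<lambda>(x, \<xi>). of_real (inverse (W \<xi>)) * conv (piece_kernel \<phi> k0 k) \<sigma> (x, \<xi>))) *
        (\<Prod>j\<in>UNIV. epowr (\<integral>\<^sup>+x. (ennreal (norm (f j x)))\<^sup>2 *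
          indicator (cball \<mu> (2 * 2 ^ Suc (k j) + real CARD('n))) x \<partial>lborel) (1/2)) \<partial>count_space UNIV)"
    using T_op_cell_bound[OF \<phi> assms(1,2)] by blast
  have "\<forall>j. \<exists>B>0. \<forall>f k. f \<in> borel_measurable borel \<longrightarrow>
     lq_norm int_lattice (q j) (\<lambda>\<mu>::real^'n. epowr (\<integral>\<^sup>+x. (ennreal (norm (f x)))\<^sup>2 *
        indicator (cball \<mu> (2 * 2 ^ Suc k + real DIM(real^'n))) x \<partial>lborel) (1/2)) \<le>
     ennreal (B * 2 powr (real DIM(real^'n) / enn2real (min 2 (q j)) * real k)) * amalgam_norm 2 (q j) f"
    using lq_norm_ball_average[OF q] by blast
  from choice[OF this] obtain B where Bp: "\<forall>j. 0 < B j \<and> (\<forall>f k. f \<in> borel_measurable borel \<longrightarrow>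
     lq_norm int_lattice (q j) (\<lambda>\<mu>::real^'n. epowr (\<integral>\<^sup>+x. (ennreal (norm (f x)))\<^sup>2 *
        indicator (cball \<mu> (2 * 2 ^ Suc k + real DIM(real^'n))) x \<partial>lborel) (1/2)) \<le>
     ennreal (B j * 2 powr (real DIM(real^'n) / enn2real (min 2 (q j)) * real k)) * amalgam_norm 2 (q j) f)"
    by (elim exE)
  then have B: "B j > 0" and ball: "f \<in> borel_measurable borel \<Longrightarrow>
     lq_norm int_lattice (q j) (\<lambda>\<mu>::real^'n. epowr (\<integral>\<^sup>+x. (ennreal (norm (f x)))\<^sup>2 *
        indicator (cball \<mu> (2 * 2 ^ Suc k + real DIM(real^'n))) x \<partial>lborel) (1/2)) \<le>
     ennreal (B j * 2 powr (real DIM(real^'n) / enn2real (min 2 (q j)) * real k)) * amalgam_norm 2 (q j) f" for j f k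
    by blast+
  define E where "E = C * sqrt (2 ^ CARD('n)) * (\<Prod>j\<in>UNIV. B j)"
  have E: "0 \<le> E" unfolding E_def using C B by (intro mult_nonneg_nonneg prod_nonneg) (auto intro: less_imp_le)
  define U where "U = (\<lambda>(k0, k). L2ul_norm (\<lambda>(x, \<xi>). of_real (inverse (W \<xi>)) * conv (piece_kernel \<phi> k0 k) \<sigma>' (x, \<xi>)))"
  define w where "w = (\<lambda>(k0, k :: 'N \<Rightarrow> nat). 2 powr (s0 * real k0 + (\<Sum>j\<in>UNIV. s j * real (k j))))"
  \<comment> \<open>The symbol norm is built from the chosen functions in \<open>Delta\<close>, the
    estimates from convolutions. They agree almost everywhere, and the uniformly local norm cannot
    tell them apart.\<close>
  have UD: "L2ul_norm (\<lambda>(x, \<xi>). of_real (inverse (W \<xi>)) * Delta \<phi> k0 k \<sigma> (x, \<xi>)) = U (k0, k)" for k0 k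
  proof -
    have "AE z in lborel. Delta \<phi> k0 k \<sigma> z = conv (piece_kernel \<phi> k0 k) \<sigma>' z"
      using Delta_AE_eq_conv[OF \<phi> \<sigma> \<sigma>'m \<sigma>'b ae, of k0 k] by (simp add: Delta_def tensor_def)
    then have "AE z in lborel. (\<lambda>(x, \<xi>). of_real (inverse (W \<xi>)) * Delta \<phi> k0 k \<sigma> (x, \<xi>)) z =
        (\<lambda>(x, \<xi>). of_real (inverse (W \<xi>)) * conv (piece_kernel \<phi> k0 k) \<sigma>' (x, \<xi>)) z"
      by eventually_elim (simp add: case_prod_unfold)
    then show ?thesis unfolding U_def prod.case by (rule L2ul_norm_cong_AE)
  qed
  have sym: "lq_norm UNIV (min 1 r) (\<lambda>p. ennreal (w p) * U p) = symbol_norm \<phi> W s0 s (min 1 r) \<sigma>"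
    unfolding symbol_norm_def
  proof (rule arg_cong[where f = "lq_norm UNIV (min 1 r)"], rule ext, clarify)
    fix k0 :: nat and k :: "'N \<Rightarrow> nat"
    show "ennreal (w (k0, k)) * U (k0, k) = ennreal (2 powr (s0 * real k0 + (\<Sum>j\<in>UNIV. s j * real (k j)))) *
        L2ul_norm (\<lambda>(x, \<xi>). of_real (inverse (W \<xi>)) * Delta \<phi> k0 k \<sigma> (x, \<xi>))"
      unfolding UD w_def prod.case ..
  qed
  have K: "countable (UNIV :: (nat \<times> ('N \<Rightarrow> nat)) set)" by (rule countableI_type)
  have min_pos: "0 < min 1 r" using r by (simp add: min_def)
  show ?thesis
    unfolding bounded_on_amalgams_def
  \<comment> \<open>The bound depends on the symbol through its norm and not on \<open>f\<close>.
    Passing through \<open>enn2real\<close> loses nothing, since the symbol norm is finite.\<close>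
  proof (intro exI[of _ "enn2real (ennreal E * symbol_norm \<phi> W s0 s (min 1 r) \<sigma>)"] allI impI)
    fix f :: "'N \<Rightarrow> real^'n \<Rightarrow> complex"
    assume f: "\<forall>j. f j \<in> schwartz \<inter> amalgam 2 (q j)"
    then have fs: "f j \<in> schwartz" and ffin: "amalgam_norm 2 (q j) (f j) < \<top>" for j by (auto simp: amalgam_def)
    have fm: "f j \<in> borel_measurable borel" for j by (rule schwartz_borel[OF fs])
    have Fi: "integrable lborel (fourier (f j))" for j by (rule fourier_schwartz_integrable[OF fs])
    have Fm: "fourier (f j) \<in> borel_measurable borel" for j using Fi[of j] by auto
    note T = T_op_borel_version[where f = f, OF \<sigma>'m \<sigma>'b ae Fm Fi]
    define a where "a j i \<mu> = epowr (\<integral>\<^sup>+x. (ennreal (norm (f j x)))\<^sup>2 *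
          indicator (cball \<mu> (2 * 2 ^ Suc i + real CARD('n))) x \<partial>lborel) (1/2)" for j i and \<mu> :: "real^'n"
    define c where "c = (\<lambda>(k0, k). ennreal (C * sqrt ((2 ^ Suc k0) ^ CARD('n))) * U (k0, k))"
    define Nf where "Nf = (\<Prod>j\<in>UNIV. amalgam_norm 2 (q j) (f j))"
    have Nfin: "Nf < \<top>" unfolding Nf_def using ffin by (simp add: ennreal_prod_eq_top less_top[symmetric])
    \<comment> \<open>The exponents \<open>s j = n / min 2 (q j)\<close> are precisely the cost of
      the ball averages.\<close>
    have aq: "lq_norm int_lattice (q j) (a j i) \<le> ennreal (B j * 2 powr (s j * real i)) * amalgam_norm 2 (q j) (f j)" for j i
      using ball[OF fm[of j], of j i] by (simp add: a_def[abs_def] assms(7))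
    have aqfin: "lq_norm int_lattice (q j) (a j i) < \<top>" for j i
      using ffin[of j] by (intro le_less_trans[OF aq]) (simp add: ennreal_mult_less_top)
    have "amalgam_norm 2 r (T_op \<sigma> f) = lq_norm int_lattice r (\<lambda>\<mu>. epowr (cell_sq (T_op \<sigma>' f) \<mu>) (1/2))"
      using cell_sq_cong_AE[OF T(3)] by (simp add: amalgam_norm_2_eq)
    also have "\<dots> \<le> lq_norm int_lattice r (\<lambda>\<mu>. \<integral>\<^sup>+p. c p * (\<Prod>j\<in>UNIV. a j (snd p j) \<mu>) \<partial>count_space UNIV)"
    proof (rule lq_norm_mono[OF L r])
      fix \<mu> :: "real^'n"
      show "epowr (cell_sq (T_op \<sigma>' f) \<mu>) (1/2) \<le> (\<integral>\<^sup>+p. c p * (\<Prod>j\<in>UNIV. a j (snd p j) \<mu>) \<partial>count_space UNIV)"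
        using cell[OF \<sigma>'m, of M f \<mu>] \<sigma>'b fs by (simp add: c_def a_def U_def case_prod_unfold)
    qed
    also have "\<dots> \<le> lq_norm UNIV (min 1 r) (\<lambda>p. lq_norm int_lattice r (\<lambda>\<mu>. c p * (\<Prod>j\<in>UNIV. a j (snd p j) \<mu>)))"
      by (rule lq_norm_triangle[OF L K r])
    also have "\<dots> \<le> lq_norm UNIV (min 1 r) (\<lambda>p. (ennreal E * Nf) * (ennreal (w p) * U p))"
    proof (rule lq_norm_mono[OF K min_pos])
      fix p :: "nat \<times> ('N \<Rightarrow> nat)"
      obtain k0 k where p: "p = (k0, k)" by (cases p)
      have "lq_norm int_lattice r (\<lambda>\<mu>. c p * (\<Prod>j\<in>UNIV. a j (snd p j) \<mu>)) = c p * lq_norm int_lattice r (\<lambda>\<mu>. \<Prod>j\<in>UNIV. a j (k j) \<mu>)"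
        unfolding p snd_conv by (rule lq_norm_cmult[OF L r])
      also have "\<dots> \<le> c p * (\<Prod>j\<in>UNIV. lq_norm int_lattice (q j) (a j (k j)))"
        by (intro mult_left_mono lq_norm_holder[OF L q r qr aqfin]) simp
      also have "\<dots> \<le> c p * (\<Prod>j\<in>UNIV. ennreal (B j * 2 powr (s j * real (k j))) * amalgam_norm 2 (q j) (f j))"
        by (intro mult_left_mono prod_mono_ennreal aq) simp
      also have "\<dots> = (ennreal E * Nf) * (ennreal (w p) * U p)"
      proof -
        have Bw: "0 \<le> B j * 2 powr (s j * real (k j))" for j using B[of j] by simp
        \<comment> \<open>Here \<open>s0 = n / 2\<close> enters: the root of the volume factor at
          scale \<open>k0\<close> is \<open>2 powr (s0 * real k0)\<close>, and the passage to the
          scale \<open>Suc k0\<close> of the reproducing kernel costs the constant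
          \<open>sqrt (2 ^ n)\<close> contained in \<open>E\<close>.\<close>
        have "sqrt ((2 ^ Suc k0) ^ CARD('n)) = sqrt (2 ^ CARD('n)) * 2 powr (s0 * real k0)"
        proof -
          have "(2 ^ Suc k0) ^ CARD('n) = 2 ^ CARD('n) * (2::real) ^ (k0 * CARD('n))"
            by (simp add: power_mult_distrib power_mult)
          then have "sqrt ((2 ^ Suc k0) ^ CARD('n)) = sqrt (2 ^ CARD('n)) * sqrt (2 ^ (k0 * CARD('n)))"
            by (simp only: real_sqrt_mult)
          also have "sqrt (2 ^ (k0 * CARD('n))) = (2 powr real (k0 * CARD('n))) powr (1/2)"
            by (simp only: powr_half_sqrt powr_realpow zero_less_numeral zero_le_power zero_le_numeral)
          also have "\<dots> = 2 powr (s0 * real k0)"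
            unfolding powr_powr assms(6) by (simp add: mult.commute)
          finally show ?thesis .
        qed
        moreover have "(\<Prod>j\<in>UNIV. B j * 2 powr (s j * real (k j))) = (\<Prod>j\<in>UNIV. B j) * 2 powr (\<Sum>j\<in>UNIV. s j * real (k j))"
          by (simp add: prod.distrib powr_sum)
        ultimately have "C * sqrt ((2 ^ Suc k0) ^ CARD('n)) * (\<Prod>j\<in>UNIV. B j * 2 powr (s j * real (k j))) = E * w p"
          unfolding E_def w_def p prod.case powr_add by (simp only: mult_ac)
        then have eq: "ennreal (C * sqrt ((2 ^ Suc k0) ^ CARD('n))) * (\<Prod>j\<in>UNIV. ennreal (B j * 2 powr (s j * real (k j)))) = ennreal E * ennreal (w p)"
          using C E Bw by (simp add: prod_ennreal ennreal_mult[symmetric] prod_nonneg w_def case_prod_unfold)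
        have "c p * (\<Prod>j\<in>UNIV. ennreal (B j * 2 powr (s j * real (k j))) * amalgam_norm 2 (q j) (f j)) =
            (ennreal (C * sqrt ((2 ^ Suc k0) ^ CARD('n))) * (\<Prod>j\<in>UNIV. ennreal (B j * 2 powr (s j * real (k j))))) * (Nf * U p)"
          unfolding prod.distrib Nf_def c_def p prod.case by (simp only: mult_ac)
        also have "\<dots> = (ennreal E * Nf) * (ennreal (w p) * U p)"
          unfolding eq by (simp only: mult_ac)
        finally show ?thesis .
      qed
      finally show "lq_norm int_lattice r (\<lambda>\<mu>. c p * (\<Prod>j\<in>UNIV. a j (snd p j) \<mu>)) \<le> (ennreal E * Nf) * (ennreal (w p) * U p)" .
    qed
    also have "\<dots> = (ennreal E * Nf) * symbol_norm \<phi> W s0 s (min 1 r) \<sigma>"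
      unfolding sym[symmetric] by (rule lq_norm_cmult[OF K min_pos])
    also have "\<dots> = ennreal (enn2real (ennreal E * symbol_norm \<phi> W s0 s (min 1 r) \<sigma>)) * Nf"
    proof -
      have "ennreal E * symbol_norm \<phi> W s0 s (min 1 r) \<sigma> < \<top>" using symfin by (simp add: ennreal_mult_less_top)
      then show ?thesis by (simp add: mult_ac)
    qed
    finally have bound: "amalgam_norm 2 r (T_op \<sigma> f) \<le> ennreal (enn2real (ennreal E * symbol_norm \<phi> W s0 s (min 1 r) \<sigma>)) * Nf" .
    also have "\<dots> < \<top>" using Nfin by (simp add: ennreal_mult_less_top)
    finally have fin: "amalgam_norm 2 r (T_op \<sigma> f) < \<top>" .
    have meas: "T_op \<sigma> f \<in> borel_measurable lebesgue"
      by (rule borel_measurable_lebesgue_cong_AE[OF T(1) T(3)])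
    show "T_op \<sigma> f \<in> amalgam 2 r \<and> amalgam_norm 2 r (T_op \<sigma> f) \<le>
        ennreal (enn2real (ennreal E * symbol_norm \<phi> W s0 s (min 1 r) \<sigma>)) * (\<Prod>j\<in>UNIV. amalgam_norm 2 (q j) (f j))"
      using fin meas bound by (simp add: amalgam_def Nf_def)
  qed
qed

end
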